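(* Let $k$ be a commutative ring and $A$ a unital associative $k$-algebra. The $\mathscr{D}_{\mathbf{Mod}}$-algebra structure $\nu$ on $\widetilde{\mathcal F}\otimes_{\mathrm{Aut}\Delta S_+}B^{sym_+}_*A=\widetilde{\mathcal F}\langle A\rangle$ induces a $\mathscr{D}_{\mathbf{Mod}}$-algebra structure on $CA_*=\widetilde{\mathcal F}\otimes_{\Delta S_+}B^{sym_+}_*A$; that is, with $Q:\widetilde{\mathcal F}\langle A\rangle\to CA_*$ the quotient map, there are structure maps $\nu:\mathscr{D}_{\mathbf{Mod}}(n)\otimes_{\Sigma_n}(CA_* )^{\otimes n}\to CA_*$ making $CA_*$ a $\mathscr{D}_{\mathbf{Mod}}$-algebra and satisfying $\nu\circ(\mathrm{id}\otimes Q^{\otimes n})=Q\circ\nu$ for all $n\ge0$. Consequently $CA_*$ is an $E_\infty$ algebra in the category of simplicial $k$-modules.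
   Context: **The category $\Delta S_+$.** For $n\ge 0$ let $[n]=\{0,1,\dots,n\}$. The category $\Delta S$ has objects $[n]$, $n\geq 0$; a morphism $[n]\to[m]$ is a pair $(\phi,\gamma)$ with $\phi:[n]\to[m]$ a non-decreasing map and $\gamma$ a permutation of $[n]$ (elements of $\Sigma_{n+1}$ are regarded as permutations of $[n]$). For $\psi:[n]\to[m]$ non-decreasing and $\gamma$ a permutation of $[m]$, let $\psi^\gamma:[n]\to[m]$ be the unique non-decreasing map with $|(\psi^\gamma)^{-1}(i)|=|\psi^{-1}(\gamma(i))|$ for all $i$, and let $\gamma^\psi$ be the permutation of $[n]$ restricting to the order-preserving bijections $(\psi^\gamma)^{-1}(i)\to\psi^{-1}(\gamma(i))$. Composition is $(\phi,\gamma)\circ(\psi,\delta)=(\phi\psi^\gamma,\delta\gamma^\psi)$ (permutations compose as functions, right factor first). $\Delta S_+$ is $\Delta S$ with an initial object $[-1]$ added (and no morphisms $[n]\to[-1]$ for $n\ge0$). It has a strictly associative product $\odot$ with unit $[-1]$: $[n]\odot[m]=[n+m+1]$, and on morphisms $\odot$ is juxtaposition (side by side). $\mathrm{Aut}\Delta S_+$ is the subcategory with the same objects and only the automorphisms. **Symmetric bar construction.** $B^{sym_+}_*A:\Delta S_+\to k\text{-}\mathbf{Mod}$ sends $[n]$ to $A^{\otimes(n+1)}$ ($A^{\otimes 0}=k$); $(\mathrm{id},\gamma)$ acts by $a_0\otimes\cdots\otimes a_n\mapsto a_{\gamma(0)}\otimes\cdots\otimes a_{\gamma(n)}$; a non-decreasing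 $\phi:[n]\to[m]$ acts by $a_0\otimes\cdots\otimes a_n\mapsto b_0\otimes\cdots\otimes b_m$, where $b_i$ is the product of the $a_j$ with $\phi(j)=i$ in increasing order of $j$ (empty product $=1$); $[-1]\to[n]$ sends $1$ to $1^{\otimes(n+1)}$. Write $\langle f,V\rangle$ for the value of $f$ on $V$. **The simplicial modules.** $\mathcal{F}(m)=[m-1]\setminus\Delta S_+$ is the under-category (objects: morphisms $f$ of $\Delta S_+$ with source $[m-1]$; morphisms $f\to f'$: $g$ with $gf=f'$), and $\widetilde{\mathcal F}(m)=k[N\mathcal F(m)]$ ($N$ = nerve), contravariant in $[m-1]\in\Delta S_+$ by precomposition. $\Sigma_m$ acts on the right of $\mathcal F(m)$ by $f\bullet\sigma=f\circ(\mathrm{id},\sigma^{-1})$. $CA_*$ is $\bigoplus_{n\ge0}\widetilde{\mathcal F}(n)\otimes_kA^{\otimes n}$ modulo the relations $xf\otimes V=x\otimes\langle f,V\rangle$ for all morphisms $f$ of $\Delta S_+$; imposing the relations only for automorphisms $f$ gives $\widetilde{\mathcal F}\otimes_{\mathrm{Aut}\Delta S_+}B^{sym_+}_*A=\bigoplus_{n\ge0}\widetilde{\mathcal F}(n)\otimes_{\Sigma_n}A^{\otimes n}=\widetilde{\mathcal F}\langle A\rangle$, and $Q$ is the evident quotient map. **Operad and structure map.** $\mathscr{D}_{\mathbf{Mod}}$ is the operad in simplicial $k$-modules with $\mathscr{D}_{\mathbf{Mod}}(m)=k[N E\Sigma_m]$, where $E\Sigma_m$ is the category with object set $\Sigma_m$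 and exactly one morphism between any two objects; $\Sigma_m$ acts by right multiplication, and the operad composition is induced by $(\sigma,\tau_1,\dots,\tau_m)\mapsto\sigma_{\mathbf k}\cdot(\tau_1\oplus\cdots\oplus\tau_m)$ for $\tau_i\in\Sigma_{k_i}$, where $\sigma_{\mathbf k}=\sigma_{k_1,\dots,k_m}$ permutes blocks of sizes $k_1,\dots,k_m$, moving block $i$ to block position $\sigma(i)$, and $\tau_1\oplus\cdots\oplus\tau_m$ permutes within blocks. It is an $E_\infty$ operad (each component has a free symmetric group action and is weakly equivalent to the unit object); an $E_\infty$ algebra is an algebra over an $E_\infty$ operad in the same category. Functors $\mu:E\Sigma_m\times\prod_{s=1}^m\mathcal F(j_s)\to\mathcal F(j_1+\dots+j_m)$ are defined on objects $f_i:[j_i-1]\to[p_i-1]$ by $\mu(\sigma,f_1,\dots,f_m)=(\mathrm{id},\sigma_{\mathbf p}^{-1})\circ(f_1\odot\cdots\odot f_m)$, and send the morphism given by $\sigma\to\tau$ and $g_i:[p_i-1]\to[q_i-1]$ to $(\mathrm{id},\tau_{\mathbf q}^{-1})\circ(g_1\odot\cdots\odot g_m)\circ(\mathrm{id},\sigma_{\mathbf p})$. The $\mathscr{D}_{\mathbf{Mod}}$-algebra structure $\nu:\mathscr{D}_{\mathbf{Mod}}(n)\otimes_{\Sigma_n}\widetilde{\mathcal F}\langle A\rangle^{\otimes n}\to\widetilde{\mathcal F}\langle A\rangle$ is $\nu(d\otimes(x_1\otimes V_1)\otimes\cdots\otimes(x_n\otimes V_n))=\mu_*(d\otimes x_1\otimes\cdots\otimes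 x_n)\otimes(V_1\otimes\cdots\otimes V_n)$, where $\mu_*$ is the degreewise linear map induced by $\mu$ on nerves. *)

theory Defs
  imports "HOL-Algebra.Module" "HOL-Algebra.AbelCoset" "HOL-Combinatorics.Permutations"
begin

section \<open>Modules over a commutative ring\<close>

text \<open>
  Modules are the records of HOL-Algebra.  In the constructions below (free modules, quotients,
  tensor products, direct sums) the multiplicative fields of the record play no role and are left
  undefined; in a k-algebra they carry the ring structure.
\<close>

locale assoc_algebra = module R A + ring A for R (structure) and A (structure) +
  assumes smult_mult_left:
      "\<lbrakk>a \<in> carrier R; x \<in> carrier A; y \<in> carrier A\<rbrakk> \<Longrightarrow>
        (a \<odot>\<^bsub>A\<^esub> x) \<otimes>\<^bsub>A\<^esub> y = a \<odot>\<^bsub>A\<^esub> (x \<otimes>\<^bsub>A\<^esub> y)"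
    and smult_mult_right:
      "\<lbrakk>a \<in> carrier R; x \<in> carrier A; y \<in> carrier A\<rbrakk> \<Longrightarrow>
        x \<otimes>\<^bsub>A\<^esub> (a \<odot>\<^bsub>A\<^esub> y) = a \<odot>\<^bsub>A\<^esub> (x \<otimes>\<^bsub>A\<^esub> y)"

definition mod_hom ::
  "('k, 'r) ring_scheme \<Rightarrow> ('k, 'x, 'm) module_scheme \<Rightarrow> ('k, 'y, 'n) module_scheme \<Rightarrow> ('x \<Rightarrow> 'y) set"
  where "mod_hom R M N = {h \<in> carrier M \<rightarrow> carrier N.
    (\<forall>x\<in>carrier M. \<forall>y\<in>carrier M. h (x \<oplus>\<^bsub>M\<^esub> y) = h x \<oplus>\<^bsub>N\<^esub> h y) \<and>
    (\<forall>a\<in>carrier R. \<forall>x\<in>carrier M. h (a \<odot>\<^bsub>M\<^esub> x) = a \<odot>\<^bsub>N\<^esub> h x)}"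

text \<open>The linear map on M that sends \<open>g i\<close> to \<open>\<phi> i\<close> for all i in I; only meaningful when it exists
  and the \<open>g i\<close> generate M.\<close>

definition linear_from ::
  "('k, 'r) ring_scheme \<Rightarrow> ('k, 'x, 'm) module_scheme \<Rightarrow> ('k, 'y, 'n) module_scheme \<Rightarrow>
    'i set \<Rightarrow> ('i \<Rightarrow> 'x) \<Rightarrow> ('i \<Rightarrow> 'y) \<Rightarrow> 'x \<Rightarrow> 'y"
  where "linear_from R M N I g \<phi> =
    (THE h. h \<in> mod_hom R M N \<and> h \<in> extensional (carrier M) \<and> (\<forall>i\<in>I. h (g i) = \<phi> i))"

definition base_module :: "('k, 'r) ring_scheme \<Rightarrow> ('k, 'k) module"
  where "base_module R = \<lparr>carrier = carrier R, monoid.mult = monoid.mult R, one = \<one>\<^bsub>R\<^esub>,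
    zero = \<zero>\<^bsub>R\<^esub>, add = add R, smult = monoid.mult R\<rparr>"

definition span :: "('k, 'r) ring_scheme \<Rightarrow> ('k, 'x, 'm) module_scheme \<Rightarrow> 'x set \<Rightarrow> 'x set"
  where "span R M S = \<Inter>{N. submodule N R M \<and> S \<subseteq> N}"

text \<open>\<open>quot_map M N f\<close> is the map induced by f into M/N, from a quotient whose elements are cosets.\<close>

definition quot_map :: "('k, 'y, 'n) module_scheme \<Rightarrow> 'y set \<Rightarrow> ('x \<Rightarrow> 'y) \<Rightarrow> 'x set \<Rightarrow> 'y set"
  where "quot_map M N f C = (\<Union>x\<in>C. N +>\<^bsub>M\<^esub> f x)"

definition quot_module :: "('k, 'x, 'm) module_scheme \<Rightarrow> 'x set \<Rightarrow> ('k, 'x set) module"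
  where "quot_module M N = \<lparr>carrier = a_rcosets\<^bsub>M\<^esub> N, monoid.mult = undefined, one = undefined,
    zero = N, add = set_add M, smult = (\<lambda>a. quot_map M N (\<lambda>x. a \<odot>\<^bsub>M\<^esub> x))\<rparr>"

definition free_module :: "('k, 'r) ring_scheme \<Rightarrow> 'b set \<Rightarrow> ('k, 'b \<Rightarrow> 'k) module"
  where "free_module R X = \<lparr>
    carrier = {c. (\<forall>x. c x \<in> carrier R) \<and> (\<forall>x. x \<notin> X \<longrightarrow> c x = \<zero>\<^bsub>R\<^esub>) \<and> finite {x. c x \<noteq> \<zero>\<^bsub>R\<^esub>}},
    monoid.mult = undefined, one = undefined,
    zero = (\<lambda>_. \<zero>\<^bsub>R\<^esub>),
    add = (\<lambda>c d x. c x \<oplus>\<^bsub>R\<^esub> d x),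
    smult = (\<lambda>a c x. a \<otimes>\<^bsub>R\<^esub> c x)\<rparr>"

definition basis_vec :: "('k, 'r) ring_scheme \<Rightarrow> 'b \<Rightarrow> 'b \<Rightarrow> 'k"
  where "basis_vec R x = (\<lambda>y. if y = x then \<one>\<^bsub>R\<^esub> else \<zero>\<^bsub>R\<^esub>)"

definition free_map :: "('k, 'r) ring_scheme \<Rightarrow> ('b \<Rightarrow> 'c) \<Rightarrow> ('b \<Rightarrow> 'k) \<Rightarrow> 'c \<Rightarrow> 'k"
  where "free_map R f c = (\<lambda>y. finsum R c {x. c x \<noteq> \<zero>\<^bsub>R\<^esub> \<and> f x = y})"

text \<open>The multilinear extension of \<open>F : X \<times> Y\<^sub>1 \<times> \<dots> \<times> Y\<^sub>n \<rightarrow> Z\<close> to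
  \<open>k[X] \<times> k[Y\<^sub>1] \<times> \<dots> \<times> k[Y\<^sub>n] \<rightarrow> k[Z]\<close>.\<close>

definition multilinear_ext ::
  "('k, 'r) ring_scheme \<Rightarrow> ('b \<Rightarrow> 'c list \<Rightarrow> 'e) \<Rightarrow> ('b \<Rightarrow> 'k) \<Rightarrow> ('c \<Rightarrow> 'k) list \<Rightarrow> 'e \<Rightarrow> 'k"
  where "multilinear_ext R F d cs = (\<lambda>z. finsum R
    (\<lambda>(x, ys). d x \<otimes>\<^bsub>R\<^esub> foldr (monoid.mult R) (map2 (\<lambda>c y. c y) cs ys) \<one>\<^bsub>R\<^esub>)
    {(x, ys). d x \<noteq> \<zero>\<^bsub>R\<^esub> \<and> list_all2 (\<lambda>c y. c y \<noteq> \<zero>\<^bsub>R\<^esub>) cs ys \<and> F x ys = z})"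

definition dsum :: "(nat \<Rightarrow> ('k, 'x) module) \<Rightarrow> ('k, nat \<Rightarrow> 'x) module"
  where "dsum M = \<lparr>
    carrier = {z. (\<forall>n. z n \<in> carrier (M n)) \<and> finite {n. z n \<noteq> \<zero>\<^bsub>M n\<^esub>}},
    monoid.mult = undefined, one = undefined,
    zero = (\<lambda>n. \<zero>\<^bsub>M n\<^esub>),
    add = (\<lambda>z w n. z n \<oplus>\<^bsub>M n\<^esub> w n),
    smult = (\<lambda>a z n. a \<odot>\<^bsub>M n\<^esub> z n)\<rparr>"

definition dsum_inj :: "(nat \<Rightarrow> ('k, 'x) module) \<Rightarrow> nat \<Rightarrow> 'x \<Rightarrow> nat \<Rightarrow> 'x"
  where "dsum_inj M n x = (\<lambda>i. if i = n then x else \<zero>\<^bsub>M i\<^esub>)"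


subsection \<open>Tensor products\<close>

definition tensor_rel ::
  "('k, 'r) ring_scheme \<Rightarrow> ('k, 'x) module \<Rightarrow> ('k, 'y) module \<Rightarrow> ('x \<times> 'y \<Rightarrow> 'k) set"
  where "tensor_rel R M N =
    (let F = free_module R (carrier M \<times> carrier N); \<delta> = (\<lambda>x y. basis_vec R (x, y)) in
     span R F
      ({\<delta> (x \<oplus>\<^bsub>M\<^esub> x') y \<ominus>\<^bsub>F\<^esub> (\<delta> x y \<oplus>\<^bsub>F\<^esub> \<delta> x' y) | x x' y.
          x \<in> carrier M \<and> x' \<in> carrier M \<and> y \<in> carrier N} \<union>
       {\<delta> x (y \<oplus>\<^bsub>N\<^esub> y') \<ominus>\<^bsub>F\<^esub> (\<delta> x y \<oplus>\<^bsub>F\<^esub> \<delta> x y') | x y y'.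
          x \<in> carrier M \<and> y \<in> carrier N \<and> y' \<in> carrier N} \<union>
       {\<delta> (a \<odot>\<^bsub>M\<^esub> x) y \<ominus>\<^bsub>F\<^esub> a \<odot>\<^bsub>F\<^esub> \<delta> x y | a x y.
          a \<in> carrier R \<and> x \<in> carrier M \<and> y \<in> carrier N} \<union>
       {\<delta> x (a \<odot>\<^bsub>N\<^esub> y) \<ominus>\<^bsub>F\<^esub> a \<odot>\<^bsub>F\<^esub> \<delta> x y | a x y.
          a \<in> carrier R \<and> x \<in> carrier M \<and> y \<in> carrier N}))"

definition tensor ::
  "('k, 'r) ring_scheme \<Rightarrow> ('k, 'x) module \<Rightarrow> ('k, 'y) module \<Rightarrow> ('k, ('x \<times> 'y \<Rightarrow> 'k) set) module"
  where "tensor R M N = quot_module (free_module R (carrier M \<times> carrier N)) (tensor_rel R M N)"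

definition pure ::
  "('k, 'r) ring_scheme \<Rightarrow> ('k, 'x) module \<Rightarrow> ('k, 'y) module \<Rightarrow> 'x \<Rightarrow> 'y \<Rightarrow> ('x \<times> 'y \<Rightarrow> 'k) set"
  where "pure R M N x y =
    tensor_rel R M N +>\<^bsub>free_module R (carrier M \<times> carrier N)\<^esub> basis_vec R (x, y)"

text \<open>\<open>tensor_map R M' N' f g\<close> is \<open>f \<otimes> g\<close> with values in \<open>M' \<otimes> N'\<close>.\<close>

definition tensor_map ::
  "('k, 'r) ring_scheme \<Rightarrow> ('k, 'x') module \<Rightarrow> ('k, 'y') module \<Rightarrow> ('x \<Rightarrow> 'x') \<Rightarrow> ('y \<Rightarrow> 'y') \<Rightarrow>
    ('x \<times> 'y \<Rightarrow> 'k) set \<Rightarrow> ('x' \<times> 'y' \<Rightarrow> 'k) set"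
  where "tensor_map R M' N' f g =
    quot_map (free_module R (carrier M' \<times> carrier N')) (tensor_rel R M' N')
      (free_map R (map_prod f g))"

text \<open>The tensor product \<open>M\<^sub>1 \<otimes> \<dots> \<otimes> M\<^sub>n\<close> of a list of modules; it is free on the empty list for n = 0.\<close>

definition tuples :: "('k, 'x) module list \<Rightarrow> 'x list set"
  where "tuples Ms = {xs. list_all2 (\<lambda>x M. x \<in> carrier M) xs Ms}"

definition tensors_rel :: "('k, 'r) ring_scheme \<Rightarrow> ('k, 'x) module list \<Rightarrow> ('x list \<Rightarrow> 'k) set"
  where "tensors_rel R Ms =
    (let F = free_module R (tuples Ms); \<delta> = basis_vec R in
     span R F
      ({\<delta> (xs[i := x \<oplus>\<^bsub>Ms ! i\<^esub> y]) \<ominus>\<^bsub>F\<^esub> (\<delta> (xs[i := x]) \<oplus>\<^bsub>F\<^esub> \<delta> (xs[i := y])) | xs i x y.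
          xs \<in> tuples Ms \<and> i < length Ms \<and> x \<in> carrier (Ms ! i) \<and> y \<in> carrier (Ms ! i)} \<union>
       {\<delta> (xs[i := a \<odot>\<^bsub>Ms ! i\<^esub> x]) \<ominus>\<^bsub>F\<^esub> a \<odot>\<^bsub>F\<^esub> \<delta> (xs[i := x]) | xs i a x.
          xs \<in> tuples Ms \<and> i < length Ms \<and> a \<in> carrier R \<and> x \<in> carrier (Ms ! i)}))"

definition tensors ::
  "('k, 'r) ring_scheme \<Rightarrow> ('k, 'x) module list \<Rightarrow> ('k, ('x list \<Rightarrow> 'k) set) module"
  where "tensors R Ms = quot_module (free_module R (tuples Ms)) (tensors_rel R Ms)"

definition pures ::
  "('k, 'r) ring_scheme \<Rightarrow> ('k, 'x) module list \<Rightarrow> 'x list \<Rightarrow> ('x list \<Rightarrow> 'k) set"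
  where "pures R Ms xs = tensors_rel R Ms +>\<^bsub>free_module R (tuples Ms)\<^esub> basis_vec R xs"

text \<open>The linear map into the tensor product of Ms' that sends \<open>x\<^sub>1 \<otimes> \<dots> \<otimes> x\<^sub>n\<close> to the pure tensor of the
  list \<open>f [x\<^sub>1, \<dots>, x\<^sub>n]\<close>.\<close>

definition tensors_map ::
  "('k, 'r) ring_scheme \<Rightarrow> ('k, 'y) module list \<Rightarrow> ('x list \<Rightarrow> 'y list) \<Rightarrow>
    ('x list \<Rightarrow> 'k) set \<Rightarrow> ('y list \<Rightarrow> 'k) set"
  where "tensors_map R Ms' f =
    quot_map (free_module R (tuples Ms')) (tensors_rel R Ms') (free_map R f)"


section \<open>Simplicial modules\<close>

text \<open>\<open>monotone_maps q p\<close> is the set of morphisms \<open>[q] \<rightarrow> [p]\<close> of the simplex category.  A simplicial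
  module X has levels \<open>lev X p\<close> and, for \<open>\<theta> : [q] \<rightarrow> [p]\<close>, the operator
  \<open>sop X q p \<theta> : lev X p \<rightarrow> lev X q\<close>.\<close>

definition monotone_maps :: "nat \<Rightarrow> nat \<Rightarrow> (nat \<Rightarrow> nat) set"
  where "monotone_maps q p = {\<theta> \<in> {..q} \<rightarrow>\<^sub>E {..p}. mono_on {..q} \<theta>}"

record ('k, 'x) smod =
  lev :: "nat \<Rightarrow> ('k, 'x) module"
  sop :: "nat \<Rightarrow> nat \<Rightarrow> (nat \<Rightarrow> nat) \<Rightarrow> 'x \<Rightarrow> 'x"

locale simplicial_module = cring R for R (structure) and X :: "('k, 'x) smod" +
  assumes lev_module: "module R (lev X p)"
    and sop_hom: "\<theta> \<in> monotone_maps q p \<Longrightarrow> sop X q p \<theta> \<in> mod_hom R (lev X p) (lev X q)"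
    and sop_id: "x \<in> carrier (lev X p) \<Longrightarrow> sop X p p (restrict id {..p}) x = x"
    and sop_comp: "\<lbrakk>\<theta> \<in> monotone_maps q p; \<eta> \<in> monotone_maps r q; x \<in> carrier (lev X p)\<rbrakk> \<Longrightarrow>
      sop X r p (compose {..r} \<theta> \<eta>) x = sop X r q \<eta> (sop X q p \<theta> x)"

definition simplicial_map ::
  "('k, 'r) ring_scheme \<Rightarrow> ('k, 'x) smod \<Rightarrow> ('k, 'y) smod \<Rightarrow> (nat \<Rightarrow> 'x \<Rightarrow> 'y) \<Rightarrow> bool"
  where "simplicial_map R X Y f \<longleftrightarrow>
    (\<forall>p. f p \<in> mod_hom R (lev X p) (lev Y p)) \<and>
    (\<forall>p q. \<forall>\<theta>\<in>monotone_maps q p. \<forall>x\<in>carrier (lev X p).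
        f q (sop X q p \<theta> x) = sop Y q p \<theta> (f p x))"

definition const_smod :: "('k, 'r) ring_scheme \<Rightarrow> ('k, 'k) smod"
  where "const_smod R = \<lparr>lev = (\<lambda>p. base_module R), sop = (\<lambda>q p \<theta> x. x)\<rparr>"

definition stensor ::
  "('k, 'r) ring_scheme \<Rightarrow> ('k, 'x) smod \<Rightarrow> ('k, 'y) smod \<Rightarrow> ('k, ('x \<times> 'y \<Rightarrow> 'k) set) smod"
  where "stensor R X Y = \<lparr>
    lev = (\<lambda>p. tensor R (lev X p) (lev Y p)),
    sop = (\<lambda>q p \<theta>. tensor_map R (lev X q) (lev Y q) (sop X q p \<theta>) (sop Y q p \<theta>))\<rparr>"

definition stensors ::
  "('k, 'r) ring_scheme \<Rightarrow> ('k, 'x) smod list \<Rightarrow> ('k, ('x list \<Rightarrow> 'k) set) smod"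
  where "stensors R Xs = \<lparr>
    lev = (\<lambda>p. tensors R (map (\<lambda>X. lev X p) Xs)),
    sop = (\<lambda>q p \<theta>. tensors_map R (map (\<lambda>X. lev X q) Xs) (map2 (\<lambda>X. sop X q p \<theta>) Xs))\<rparr>"


subsection \<open>Homotopy groups and weak equivalences\<close>

definition face :: "('k, 'x) smod \<Rightarrow> nat \<Rightarrow> nat \<Rightarrow> 'x \<Rightarrow> 'x"
  where "face X n i = sop X n (Suc n) (restrict (\<lambda>j. if j < i then j else Suc j) {..n})"

text \<open>The n-th homotopy group of (the simplicial set underlying) a simplicial module, based at 0:
  n-simplices all of whose faces vanish, modulo the last faces of the (n+1)-simplices all of whose
  other faces vanish.\<close>

definition spheres :: "('k, 'x) smod \<Rightarrow> nat \<Rightarrow> 'x set"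
  where "spheres X n = {x \<in> carrier (lev X n). \<forall>m. n = Suc m \<longrightarrow> (\<forall>i\<le>n. face X m i x = \<zero>\<^bsub>lev X m\<^esub>)}"

definition boundaries :: "('k, 'x) smod \<Rightarrow> nat \<Rightarrow> 'x set"
  where "boundaries X n = {face X n (Suc n) y | y.
    y \<in> carrier (lev X (Suc n)) \<and> (\<forall>i\<le>n. face X n i y = \<zero>\<^bsub>lev X n\<^esub>)}"

definition homotopy_group :: "('k, 'x) smod \<Rightarrow> nat \<Rightarrow> 'x set set"
  where "homotopy_group X n = (\<lambda>x. boundaries X n +>\<^bsub>lev X n\<^esub> x) ` spheres X n"

definition weak_equivalence ::
  "('k, 'r) ring_scheme \<Rightarrow> ('k, 'x) smod \<Rightarrow> ('k, 'y) smod \<Rightarrow> (nat \<Rightarrow> 'x \<Rightarrow> 'y) \<Rightarrow> bool"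
  where "weak_equivalence R X Y f \<longleftrightarrow> simplicial_map R X Y f \<and>
    (\<forall>n. bij_betw (quot_map (lev Y n) (boundaries Y n) (f n)) (homotopy_group X n) (homotopy_group Y n))"

text \<open>In simplicial modules a zigzag of weak equivalences between X and Y can always be replaced by a
  span \<open>X \<leftarrow> Z \<rightarrow> Y\<close>.  Here Z ranges over the simplicial modules on the type of X.\<close>

definition weakly_equivalent :: "('k, 'r) ring_scheme \<Rightarrow> ('k, 'x) smod \<Rightarrow> ('k, 'y) smod \<Rightarrow> bool"
  where "weakly_equivalent R X Y \<longleftrightarrow> (\<exists>(Z :: ('k, 'x) smod) f g.
    simplicial_module R Z \<and> weak_equivalence R Z X f \<and> weak_equivalence R Z Y g)"


subsection \<open>Nerves\<close>

record ('o, 'a) category =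
  Obj :: "'o set"
  Hom :: "'o \<Rightarrow> 'o \<Rightarrow> 'a set"
  Ide :: "'o \<Rightarrow> 'a"
  Cmp :: "'a \<Rightarrow> 'a \<Rightarrow> 'a"  \<comment> \<open>\<open>Cmp C g f\<close> is g after f\<close>

text \<open>A p-simplex of the nerve is a functor from the poset \<open>{0, \<dots>, p}\<close>, given by the images
  \<open>s (i, j)\<close> of the arrows \<open>i \<le> j\<close>.  In the categories used below, the objects \<open>c i\<close> are determined by
  the identities \<open>s (i, i)\<close>.\<close>

definition arrows_upto :: "nat \<Rightarrow> (nat \<times> nat) set"
  where "arrows_upto p = {(i, j). i \<le> j \<and> j \<le> p}"

definition nerve :: "('o, 'a) category \<Rightarrow> nat \<Rightarrow> (nat \<times> nat \<Rightarrow> 'a) set"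
  where "nerve C p = {s \<in> extensional (arrows_upto p). \<exists>c.
    (\<forall>i\<le>p. c i \<in> Obj C \<and> s (i, i) = Ide C (c i)) \<and>
    (\<forall>i j. i \<le> j \<and> j \<le> p \<longrightarrow> s (i, j) \<in> Hom C (c i) (c j)) \<and>
    (\<forall>i j l. i \<le> j \<and> j \<le> l \<and> l \<le> p \<longrightarrow> s (i, l) = Cmp C (s (j, l)) (s (i, j)))}"

definition nerve_op :: "nat \<Rightarrow> (nat \<Rightarrow> nat) \<Rightarrow> (nat \<times> nat \<Rightarrow> 'a) \<Rightarrow> nat \<times> nat \<Rightarrow> 'a"
  where "nerve_op q \<theta> s = restrict (\<lambda>(i, j). s (\<theta> i, \<theta> j)) (arrows_upto q)"

definition nerve_map :: "nat \<Rightarrow> ('a \<Rightarrow> 'b) \<Rightarrow> (nat \<times> nat \<Rightarrow> 'a) \<Rightarrow> nat \<times> nat \<Rightarrow> 'b"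
  where "nerve_map p F s = restrict (F \<circ> s) (arrows_upto p)"

text \<open>The map on p-simplices of nerves induced by a functor out of \<open>C \<times> D\<^sub>1 \<times> \<dots> \<times> D\<^sub>n\<close>.\<close>

definition nerve_map_prod ::
  "nat \<Rightarrow> ('a \<Rightarrow> 'b list \<Rightarrow> 'c) \<Rightarrow> (nat \<times> nat \<Rightarrow> 'a) \<Rightarrow> (nat \<times> nat \<Rightarrow> 'b) list \<Rightarrow> nat \<times> nat \<Rightarrow> 'c"
  where "nerve_map_prod p F s ts =
    restrict (\<lambda>ij. F (s ij) (map (\<lambda>t. t ij) ts)) (arrows_upto p)"

definition nerve_smod ::
  "('k, 'r) ring_scheme \<Rightarrow> ('o, 'a) category \<Rightarrow> ('k, (nat \<times> nat \<Rightarrow> 'a) \<Rightarrow> 'k) smod"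
  where "nerve_smod R C = \<lparr>
    lev = (\<lambda>p. free_module R (nerve C p)),
    sop = (\<lambda>q p \<theta>. free_map R (nerve_op q \<theta>))\<rparr>"


section \<open>Operads in simplicial modules\<close>

subsection \<open>Block permutations\<close>

text \<open>Permutations of an n-element set are functions permuting \<open>{..<n}\<close>.  \<open>block_perm \<sigma> ks\<close> is
  \<open>\<sigma>\<^bsub>k\<^sub>1,\<dots>,k\<^sub>m\<^esub>\<close>, and \<open>perm_sums ks \<tau>s\<close> is \<open>\<tau>\<^sub>1 \<oplus> \<dots> \<oplus> \<tau>\<^sub>m\<close>.\<close>

definition block_of :: "nat list \<Rightarrow> nat \<Rightarrow> nat"
  where "block_of ks x = (LEAST i. x < sum_list (take (Suc i) ks))"

definition block_perm :: "(nat \<Rightarrow> nat) \<Rightarrow> nat list \<Rightarrow> nat \<Rightarrow> nat"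
  where "block_perm \<sigma> ks x =
    (if x < sum_list ks
     then let i = block_of ks x in
       (\<Sum>l | l < length ks \<and> \<sigma> l < \<sigma> i. ks ! l) + (x - sum_list (take i ks))
     else x)"

definition perm_sum :: "nat \<Rightarrow> (nat \<Rightarrow> nat) \<Rightarrow> (nat \<Rightarrow> nat) \<Rightarrow> nat \<Rightarrow> nat"
  where "perm_sum k \<sigma> \<tau> x = (if x < k then \<sigma> x else k + \<tau> (x - k))"

definition perm_sums :: "nat list \<Rightarrow> (nat \<Rightarrow> nat) list \<Rightarrow> nat \<Rightarrow> nat"
  where "perm_sums ks \<tau>s = foldr (\<lambda>(k, \<tau>). perm_sum k \<tau>) (zip ks \<tau>s) id"

text \<open>The left action of permutations on lists: the i-th entry is moved to position \<open>\<sigma> i\<close>.\<close>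

definition move :: "(nat \<Rightarrow> nat) \<Rightarrow> 'x list \<Rightarrow> 'x list"
  where "move \<sigma> xs = permute_list (inv_into UNIV \<sigma>) xs"


subsection \<open>Operads\<close>

text \<open>\<open>oact P m p \<sigma>\<close> is the right action of \<open>\<sigma>\<close> on level p of \<open>P(m)\<close>.  The composition
  \<open>P(m) \<otimes> (P(k\<^sub>1) \<otimes> \<dots> \<otimes> P(k\<^sub>m)) \<rightarrow> P(k\<^sub>1 + \<dots> + k\<^sub>m)\<close> is \<open>ocomp P ks\<close>, where m is the length of ks.\<close>

record ('k, 'x) operad =
  arity :: "nat \<Rightarrow> ('k, 'x) smod"
  oact :: "nat \<Rightarrow> nat \<Rightarrow> (nat \<Rightarrow> nat) \<Rightarrow> 'x \<Rightarrow> 'x"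
  ocomp :: "nat list \<Rightarrow> nat \<Rightarrow> ('x \<times> ('x list \<Rightarrow> 'k) set \<Rightarrow> 'k) set \<Rightarrow> 'x"
  ounit :: "nat \<Rightarrow> 'k \<Rightarrow> 'x"

definition comp_dom ::
  "('k, 'r) ring_scheme \<Rightarrow> (nat \<Rightarrow> ('k, 'x) smod) \<Rightarrow> nat list \<Rightarrow>
    ('k, ('x \<times> ('x list \<Rightarrow> 'k) set \<Rightarrow> 'k) set) smod"
  where "comp_dom R P ks = stensor R (P (length ks)) (stensors R (map P ks))"

definition comp_pure ::
  "('k, 'r) ring_scheme \<Rightarrow> (nat \<Rightarrow> ('k, 'x) smod) \<Rightarrow> nat list \<Rightarrow> nat \<Rightarrow>
    'x \<Rightarrow> 'x list \<Rightarrow> ('x \<times> ('x list \<Rightarrow> 'k) set \<Rightarrow> 'k) set"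
  where "comp_pure R P ks p d es =
    pure R (lev (P (length ks)) p) (lev (stensors R (map P ks)) p)
      d (pures R (map (\<lambda>k. lev (P k) p) ks) es)"

definition compose_at ::
  "('k, 'r) ring_scheme \<Rightarrow> ('k, 'x) operad \<Rightarrow> nat list \<Rightarrow> nat \<Rightarrow> 'x \<Rightarrow> 'x list \<Rightarrow> 'x"
  where "compose_at R P ks p d es = ocomp P ks p (comp_pure R (arity P) ks p d es)"

locale operad = cring R for R (structure) and P :: "('k, 'x) operad" +
  assumes arity_smod: "simplicial_module R (arity P m)"
    and act_map: "\<sigma> permutes {..<m} \<Longrightarrow> simplicial_map R (arity P m) (arity P m) (\<lambda>p. oact P m p \<sigma>)"
    and act_id: "x \<in> carrier (lev (arity P m) p) \<Longrightarrow> oact P m p id x = x"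
    and act_comp: "\<lbrakk>\<sigma> permutes {..<m}; \<tau> permutes {..<m}; x \<in> carrier (lev (arity P m) p)\<rbrakk> \<Longrightarrow>
      oact P m p \<tau> (oact P m p \<sigma> x) = oact P m p (\<sigma> \<circ> \<tau>) x"
    and comp_map: "simplicial_map R (comp_dom R (arity P) ks) (arity P (sum_list ks)) (ocomp P ks)"
    and unit_map: "simplicial_map R (const_smod R) (arity P 1) (ounit P)"
    and unit_left: "e \<in> carrier (lev (arity P k) p) \<Longrightarrow>
      compose_at R P [k] p (ounit P p \<one>) [e] = e"
    and unit_right: "d \<in> carrier (lev (arity P m) p) \<Longrightarrow>
      compose_at R P (replicate m 1) p d (replicate m (ounit P p \<one>)) = d"
    and assoc: "\<lbrakk>d \<in> carrier (lev (arity P (length ks)) p);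
        es \<in> tuples (map (\<lambda>k. lev (arity P k) p) ks);
        map length jss = ks;
        list_all2 (\<lambda>js fs. fs \<in> tuples (map (\<lambda>j. lev (arity P j) p) js)) jss fss\<rbrakk> \<Longrightarrow>
      compose_at R P (concat jss) p (compose_at R P ks p d es) (concat fss) =
      compose_at R P (map sum_list jss) p d
        (map (\<lambda>i. compose_at R P (jss ! i) p (es ! i) (fss ! i)) [0..<length ks])"
    and equivariant_outer: "\<lbrakk>\<sigma> permutes {..<length ks};
        d \<in> carrier (lev (arity P (length ks)) p);
        es \<in> tuples (map (\<lambda>k. lev (arity P k) p) ks)\<rbrakk> \<Longrightarrow>
      compose_at R P ks p (oact P (length ks) p \<sigma> d) es =
      oact P (sum_list ks) p (block_perm \<sigma> ks) (compose_at R P (move \<sigma> ks) p d (move \<sigma> es))"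
    and equivariant_inner: "\<lbrakk>list_all2 (\<lambda>\<tau> k. \<tau> permutes {..<k}) \<tau>s ks;
        d \<in> carrier (lev (arity P (length ks)) p);
        es \<in> tuples (map (\<lambda>k. lev (arity P k) p) ks)\<rbrakk> \<Longrightarrow>
      compose_at R P ks p d (map (\<lambda>i. oact P (ks ! i) p (\<tau>s ! i) (es ! i)) [0..<length ks]) =
      oact P (sum_list ks) p (perm_sums ks \<tau>s) (compose_at R P ks p d es)"


subsection \<open>Algebras over an operad\<close>

text \<open>\<open>alg_dom R P n X\<close> is \<open>P(n) \<otimes>\<^bsub>\<Sigma>\<^sub>n\<^esub> X\<^sup>\<otimes>\<^sup>n\<close>: the quotient of \<open>P(n) \<otimes> X\<^sup>\<otimes>\<^sup>n\<close> by
  \<open>d\<sigma> \<otimes> w = d \<otimes> \<sigma>w\<close>.\<close>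

definition sym_rel ::
  "('k, 'r) ring_scheme \<Rightarrow> ('k, 'd) operad \<Rightarrow> nat \<Rightarrow> ('k, 'x) smod \<Rightarrow> nat \<Rightarrow>
    ('d \<times> ('x list \<Rightarrow> 'k) set \<Rightarrow> 'k) set set"
  where "sym_rel R P n X p =
    (let D = lev (arity P n) p; Ms = replicate n (lev X p);
         T = tensor R D (tensors R Ms); t = pure R D (tensors R Ms) in
     span R T {t (oact P n p \<sigma> d) w \<ominus>\<^bsub>T\<^esub> t d (tensors_map R Ms (move \<sigma>) w) | \<sigma> d w.
       \<sigma> permutes {..<n} \<and> d \<in> carrier D \<and> w \<in> carrier (tensors R Ms)})"

definition alg_dom ::
  "('k, 'r) ring_scheme \<Rightarrow> ('k, 'd) operad \<Rightarrow> nat \<Rightarrow> ('k, 'x) smod \<Rightarrow>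
    ('k, ('d \<times> ('x list \<Rightarrow> 'k) set \<Rightarrow> 'k) set set) smod"
  where "alg_dom R P n X =
    (let T = stensor R (arity P n) (stensors R (replicate n X)) in \<lparr>
     lev = (\<lambda>p. quot_module (lev T p) (sym_rel R P n X p)),
     sop = (\<lambda>q p \<theta>. quot_map (lev T q) (sym_rel R P n X q) (sop T q p \<theta>))\<rparr>)"

definition alg_pure ::
  "('k, 'r) ring_scheme \<Rightarrow> ('k, 'd) operad \<Rightarrow> nat \<Rightarrow> ('k, 'x) smod \<Rightarrow> nat \<Rightarrow>
    'd \<Rightarrow> 'x list \<Rightarrow> ('d \<times> ('x list \<Rightarrow> 'k) set \<Rightarrow> 'k) set set"
  where "alg_pure R P n X p d xs =
    (let D = lev (arity P n) p; Ms = replicate n (lev X p); T = tensor R D (tensors R Ms) in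
     sym_rel R P n X p +>\<^bsub>T\<^esub> pure R D (tensors R Ms) d (pures R Ms xs))"

text \<open>\<open>alg_dom_map R P n Y p f\<close> is \<open>id \<otimes> f\<^sup>\<otimes>\<^sup>n : P(n) \<otimes>\<^bsub>\<Sigma>\<^sub>n\<^esub> X\<^sup>\<otimes>\<^sup>n \<rightarrow> P(n) \<otimes>\<^bsub>\<Sigma>\<^sub>n\<^esub> Y\<^sup>\<otimes>\<^sup>n\<close> in degree p.\<close>

definition alg_dom_map ::
  "('k, 'r) ring_scheme \<Rightarrow> ('k, 'd) operad \<Rightarrow> nat \<Rightarrow> ('k, 'y) smod \<Rightarrow> nat \<Rightarrow> ('x \<Rightarrow> 'y) \<Rightarrow>
    ('d \<times> ('x list \<Rightarrow> 'k) set \<Rightarrow> 'k) set set \<Rightarrow> ('d \<times> ('y list \<Rightarrow> 'k) set \<Rightarrow> 'k) set set"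
  where "alg_dom_map R P n Y p f =
    (let D = lev (arity P n) p; Ms = replicate n (lev Y p) in
     quot_map (tensor R D (tensors R Ms)) (sym_rel R P n Y p)
       (tensor_map R D (tensors R Ms) id (tensors_map R Ms (map f))))"

locale operad_algebra = operad R P + simplicial_module R X
  for R (structure) and P :: "('k, 'd) operad" and X :: "('k, 'x) smod" +
  fixes \<nu> :: "nat \<Rightarrow> nat \<Rightarrow> ('d \<times> ('x list \<Rightarrow> 'k) set \<Rightarrow> 'k) set set \<Rightarrow> 'x"
  assumes structure_map: "simplicial_map R (alg_dom R P n X) X (\<nu> n)"
    and alg_unit: "x \<in> carrier (lev X p) \<Longrightarrow> \<nu> 1 p (alg_pure R P 1 X p (ounit P p \<one>) [x]) = x"
    and alg_assoc: "\<lbrakk>d \<in> carrier (lev (arity P (length ks)) p);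
        es \<in> tuples (map (\<lambda>k. lev (arity P k) p) ks);
        list_all2 (\<lambda>k xs. xs \<in> tuples (replicate k (lev X p))) ks xss\<rbrakk> \<Longrightarrow>
      \<nu> (sum_list ks) p (alg_pure R P (sum_list ks) X p (compose_at R P ks p d es) (concat xss)) =
      \<nu> (length ks) p (alg_pure R P (length ks) X p d
        (map (\<lambda>i. \<nu> (ks ! i) p (alg_pure R P (ks ! i) X p (es ! i) (xss ! i))) [0..<length ks]))"


subsection \<open>E-infinity operads and algebras\<close>

text \<open>The action on \<open>P(m)\<close> is free when each level is a free \<open>k[\<Sigma>\<^sub>m]\<close>-module: it has a subset S such that
  the \<open>s\<sigma>\<close>, for s in S and \<open>\<sigma>\<close> in \<open>\<Sigma>\<^sub>m\<close>, form a k-basis.\<close>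

definition free_action :: "('k, 'r) ring_scheme \<Rightarrow> ('k, 'x) operad \<Rightarrow> nat \<Rightarrow> bool"
  where "free_action R P m \<longleftrightarrow> (\<forall>p. \<exists>S \<subseteq> carrier (lev (arity P m) p).
    bij_betw
      (\<lambda>c. finsum (lev (arity P m) p)
        (\<lambda>(s, \<sigma>). c (s, \<sigma>) \<odot>\<^bsub>lev (arity P m) p\<^esub> oact P m p \<sigma> s) {z. c z \<noteq> \<zero>\<^bsub>R\<^esub>})
      (carrier (free_module R (S \<times> {\<sigma>. \<sigma> permutes {..<m}})))
      (carrier (lev (arity P m) p)))"

definition E_infinity_operad :: "('k, 'r) ring_scheme \<Rightarrow> ('k, 'x) operad \<Rightarrow> bool"
  where "E_infinity_operad R P \<longleftrightarrow> operad R P \<and>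
    (\<forall>m. free_action R P m \<and> weakly_equivalent R (arity P m) (const_smod R))"

text \<open>The first argument fixes the type that carries the operad.\<close>

definition E_infinity_algebra :: "'d itself \<Rightarrow> ('k, 'r) ring_scheme \<Rightarrow> ('k, 'x) smod \<Rightarrow> bool"
  where "E_infinity_algebra _ R X \<longleftrightarrow>
    (\<exists>(P :: ('k, 'd) operad) \<nu>. E_infinity_operad R P \<and> operad_algebra R P X \<nu>)"


section \<open>The category \<open>\<Delta>S\<^sub>+\<close>\<close>

text \<open>The object \<open>[n-1]\<close> is represented by the natural number n, in particular the initial object
  \<open>[-1]\<close> by 0, and its elements by \<open>{..<n}\<close>.  A morphism is a monotone map together with a permutation
  of the source; for source 0 there is exactly one such pair, and for target 0 none unless the source
  is 0, so the initial object needs no separate treatment.\<close>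

record ds_mor =
  dsrc :: nat
  dtgt :: nat
  dmap :: "nat \<Rightarrow> nat"
  dperm :: "nat \<Rightarrow> nat"

definition ds_maps :: "nat \<Rightarrow> nat \<Rightarrow> (nat \<Rightarrow> nat) set"
  where "ds_maps p q = {\<phi> \<in> {..<p} \<rightarrow>\<^sub>E {..<q}. mono_on {..<p} \<phi>}"

definition ds_hom :: "nat \<Rightarrow> nat \<Rightarrow> ds_mor set"
  where "ds_hom p q = {f. dsrc f = p \<and> dtgt f = q \<and> dmap f \<in> ds_maps p q \<and> dperm f permutes {..<p}}"

definition ds_perm :: "nat \<Rightarrow> (nat \<Rightarrow> nat) \<Rightarrow> ds_mor"
  where "ds_perm p \<gamma> = \<lparr>dsrc = p, dtgt = p, dmap = restrict id {..<p}, dperm = \<gamma>\<rparr>"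

definition ds_id :: "nat \<Rightarrow> ds_mor"
  where "ds_id p = ds_perm p id"

text \<open>For \<open>\<psi>\<close> from p to q and \<open>\<gamma>\<close> in \<open>\<Sigma>\<^sub>q\<close>: the map \<open>\<psi>\<^sup>\<gamma>\<close> and the permutation \<open>\<gamma>\<^sup>\<psi>\<close>.\<close>

definition twist_map :: "nat \<Rightarrow> nat \<Rightarrow> (nat \<Rightarrow> nat) \<Rightarrow> (nat \<Rightarrow> nat) \<Rightarrow> nat \<Rightarrow> nat"
  where "twist_map p q \<psi> \<gamma> = (THE \<chi>. \<chi> \<in> ds_maps p q \<and>
    (\<forall>i<q. card {j. j < p \<and> \<chi> j = i} = card {j. j < p \<and> \<psi> j = \<gamma> i}))"

definition twist_perm :: "nat \<Rightarrow> nat \<Rightarrow> (nat \<Rightarrow> nat) \<Rightarrow> (nat \<Rightarrow> nat) \<Rightarrow> nat \<Rightarrow> nat"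
  where "twist_perm p q \<psi> \<gamma> = (THE \<pi>. \<pi> permutes {..<p} \<and>
    (\<forall>i<q. let B = {j. j < p \<and> twist_map p q \<psi> \<gamma> j = i} in
       bij_betw \<pi> B {j. j < p \<and> \<psi> j = \<gamma> i} \<and> mono_on B \<pi>))"

definition ds_comp :: "ds_mor \<Rightarrow> ds_mor \<Rightarrow> ds_mor"  (infixl \<open>\<bullet>\<close> 70)
  where "f \<bullet> g = \<lparr>dsrc = dsrc g, dtgt = dtgt f,
    dmap = compose {..<dsrc g} (dmap f) (twist_map (dsrc g) (dtgt g) (dmap g) (dperm f)),
    dperm = dperm g \<circ> twist_perm (dsrc g) (dtgt g) (dmap g) (dperm f)\<rparr>"

definition ds_mors :: "ds_mor set"
  where "ds_mors = (\<Union>p q. ds_hom p q)"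

definition ds_auts :: "ds_mor set"
  where "ds_auts = (\<Union>p. {f \<in> ds_hom p p. \<exists>g\<in>ds_hom p p. g \<bullet> f = ds_id p \<and> f \<bullet> g = ds_id p})"

definition ds_juxt :: "ds_mor \<Rightarrow> ds_mor \<Rightarrow> ds_mor"
  where "ds_juxt f g = \<lparr>dsrc = dsrc f + dsrc g, dtgt = dtgt f + dtgt g,
    dmap = restrict (\<lambda>x. if x < dsrc f then dmap f x else dtgt f + dmap g (x - dsrc f))
      {..<dsrc f + dsrc g},
    dperm = perm_sum (dsrc f) (dperm f) (dperm g)\<rparr>"

definition ds_juxts :: "ds_mor list \<Rightarrow> ds_mor"
  where "ds_juxts fs = foldr ds_juxt fs (ds_id 0)"


subsection \<open>The symmetric bar construction\<close>

definition bar :: "('k, 'r) ring_scheme \<Rightarrow> ('k, 'a) module \<Rightarrow> nat \<Rightarrow> ('k, ('a list \<Rightarrow> 'k) set) module"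
  where "bar R A n = tensors R (replicate n A)"

definition bar_list :: "('k, 'a) module \<Rightarrow> ds_mor \<Rightarrow> 'a list \<Rightarrow> 'a list"
  where "bar_list A f as =
    (let bs = permute_list (dperm f) as in
     map (\<lambda>i. foldr (monoid.mult A) (map (nth bs) (filter (\<lambda>j. dmap f j = i) [0..<dsrc f])) \<one>\<^bsub>A\<^esub>)
       [0..<dtgt f])"

definition bar_map ::
  "('k, 'r) ring_scheme \<Rightarrow> ('k, 'a) module \<Rightarrow> ds_mor \<Rightarrow> ('a list \<Rightarrow> 'k) set \<Rightarrow> ('a list \<Rightarrow> 'k) set"
  where "bar_map R A f = tensors_map R (replicate (dtgt f) A) (bar_list A f)"


subsection \<open>The under-categories\<close>

text \<open>An arrow \<open>f \<rightarrow> g f\<close> of the under-category is represented by the pair \<open>(f, g)\<close>.\<close>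

definition under :: "nat \<Rightarrow> (ds_mor, ds_mor \<times> ds_mor) category"
  where "under m = \<lparr>
    Obj = (\<Union>p. ds_hom m p),
    Hom = (\<lambda>f f'. {(f, g) | g. g \<in> ds_hom (dtgt f) (dtgt f') \<and> g \<bullet> f = f'}),
    Ide = (\<lambda>f. (f, ds_id (dtgt f))),
    Cmp = (\<lambda>v u. (fst u, snd v \<bullet> snd u))\<rparr>"

type_synonym under_simplex = "nat \<times> nat \<Rightarrow> ds_mor \<times> ds_mor"

definition Ftilde :: "('k, 'r) ring_scheme \<Rightarrow> nat \<Rightarrow> ('k, under_simplex \<Rightarrow> 'k) smod"
  where "Ftilde R m = nerve_smod R (under m)"

text \<open>The contravariant action \<open>x \<mapsto> xf\<close> of a morphism f, in degree p.\<close>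

definition precomp ::
  "('k, 'r) ring_scheme \<Rightarrow> nat \<Rightarrow> ds_mor \<Rightarrow> (under_simplex \<Rightarrow> 'k) \<Rightarrow> under_simplex \<Rightarrow> 'k"
  where "precomp R p f = free_map R (nerve_map p (map_prod (\<lambda>h. h \<bullet> f) id))"


subsection \<open>Coends over \<open>\<Delta>S\<^sub>+\<close> and its subcategory of automorphisms\<close>

type_synonym ('k, 'a) summand = "((under_simplex \<Rightarrow> 'k) \<times> ('a list \<Rightarrow> 'k) set \<Rightarrow> 'k) set"

definition coend_summand ::
  "('k, 'r) ring_scheme \<Rightarrow> ('k, 'a) module \<Rightarrow> nat \<Rightarrow> nat \<Rightarrow> ('k, ('k, 'a) summand) module"
  where "coend_summand R A p n = tensor R (lev (Ftilde R n) p) (bar R A n)"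

text \<open>\<open>x \<otimes> V\<close> in summand n, as an element of the direct sum.\<close>

definition coend_pre ::
  "('k, 'r) ring_scheme \<Rightarrow> ('k, 'a) module \<Rightarrow> nat \<Rightarrow> nat \<Rightarrow> (under_simplex \<Rightarrow> 'k) \<Rightarrow>
    ('a list \<Rightarrow> 'k) set \<Rightarrow> nat \<Rightarrow> ('k, 'a) summand"
  where "coend_pre R A p n x V =
    dsum_inj (coend_summand R A p) n (pure R (lev (Ftilde R n) p) (bar R A n) x V)"

text \<open>The relations \<open>xf \<otimes> V = x \<otimes> \<langle>f, V\<rangle>\<close> for all f in a set S of morphisms.\<close>

definition coend_rel ::
  "('k, 'r) ring_scheme \<Rightarrow> ('k, 'a) module \<Rightarrow> ds_mor set \<Rightarrow> nat \<Rightarrow> (nat \<Rightarrow> ('k, 'a) summand) set"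
  where "coend_rel R A S p =
    span R (dsum (coend_summand R A p))
      {coend_pre R A p (dsrc f) (precomp R p f x) V
          \<ominus>\<^bsub>dsum (coend_summand R A p)\<^esub> coend_pre R A p (dtgt f) x (bar_map R A f V) | f x V.
        f \<in> S \<and> x \<in> carrier (lev (Ftilde R (dtgt f)) p) \<and> V \<in> carrier (bar R A (dsrc f))}"

definition coend ::
  "('k, 'r) ring_scheme \<Rightarrow> ('k, 'a) module \<Rightarrow> ds_mor set \<Rightarrow> ('k, (nat \<Rightarrow> ('k, 'a) summand) set) smod"
  where "coend R A S = \<lparr>
    lev = (\<lambda>p. quot_module (dsum (coend_summand R A p)) (coend_rel R A S p)),
    sop = (\<lambda>q p \<theta>. quot_map (dsum (coend_summand R A q)) (coend_rel R A S q)
      (\<lambda>z n. tensor_map R (lev (Ftilde R n) q) (bar R A n) (sop (Ftilde R n) q p \<theta>) id (z n)))\<rparr>"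

definition CA :: "('k, 'r) ring_scheme \<Rightarrow> ('k, 'a) module \<Rightarrow> ('k, (nat \<Rightarrow> ('k, 'a) summand) set) smod"
  where "CA R A = coend R A ds_mors"

definition FA :: "('k, 'r) ring_scheme \<Rightarrow> ('k, 'a) module \<Rightarrow> ('k, (nat \<Rightarrow> ('k, 'a) summand) set) smod"
  where "FA R A = coend R A ds_auts"

definition FA_class ::
  "('k, 'r) ring_scheme \<Rightarrow> ('k, 'a) module \<Rightarrow> nat \<Rightarrow> nat \<Rightarrow> (under_simplex \<Rightarrow> 'k) \<Rightarrow>
    ('a list \<Rightarrow> 'k) set \<Rightarrow> (nat \<Rightarrow> ('k, 'a) summand) set"
  where "FA_class R A p n x V =
    coend_rel R A ds_auts p +>\<^bsub>dsum (coend_summand R A p)\<^esub> coend_pre R A p n x V"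

text \<open>The quotient map from FA to CA in degree p.\<close>

definition Q_map ::
  "('k, 'r) ring_scheme \<Rightarrow> ('k, 'a) module \<Rightarrow> nat \<Rightarrow>
    (nat \<Rightarrow> ('k, 'a) summand) set \<Rightarrow> (nat \<Rightarrow> ('k, 'a) summand) set"
  where "Q_map R A p = quot_map (dsum (coend_summand R A p)) (coend_rel R A ds_mors p) id"


section \<open>The operad of the categories \<open>E\<Sigma>\<^sub>m\<close> and its action\<close>

text \<open>The unique arrow from \<open>\<sigma>\<close> to \<open>\<tau>\<close> is represented by \<open>(\<sigma>, \<tau>)\<close>.\<close>

definition ESigma :: "nat \<Rightarrow> (nat \<Rightarrow> nat, (nat \<Rightarrow> nat) \<times> (nat \<Rightarrow> nat)) category"
  where "ESigma m = \<lparr>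
    Obj = {\<sigma>. \<sigma> permutes {..<m}},
    Hom = (\<lambda>\<sigma> \<tau>. {(\<sigma>, \<tau>)}),
    Ide = (\<lambda>\<sigma>. (\<sigma>, \<sigma>)),
    Cmp = (\<lambda>v u. (fst u, snd v))\<rparr>"

type_synonym perm_simplex = "nat \<times> nat \<Rightarrow> (nat \<Rightarrow> nat) \<times> (nat \<Rightarrow> nat)"

definition perm_comp :: "nat list \<Rightarrow> (nat \<Rightarrow> nat) \<Rightarrow> (nat \<Rightarrow> nat) list \<Rightarrow> nat \<Rightarrow> nat"
  where "perm_comp ks \<sigma> \<tau>s = block_perm \<sigma> ks \<circ> perm_sums ks \<tau>s"

definition perm_comp_arr ::
  "nat list \<Rightarrow> (nat \<Rightarrow> nat) \<times> (nat \<Rightarrow> nat) \<Rightarrow> ((nat \<Rightarrow> nat) \<times> (nat \<Rightarrow> nat)) list \<Rightarrow>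
    (nat \<Rightarrow> nat) \<times> (nat \<Rightarrow> nat)"
  where "perm_comp_arr ks u vs =
    (perm_comp ks (fst u) (map fst vs), perm_comp ks (snd u) (map snd vs))"

definition DMod :: "('k, 'r) ring_scheme \<Rightarrow> ('k, perm_simplex \<Rightarrow> 'k) operad"
  where "DMod R =
    (let D = (\<lambda>m. nerve_smod R (ESigma m)) in \<lparr>
     arity = D,
     oact = (\<lambda>m p \<rho>. free_map R (nerve_map p (\<lambda>(\<sigma>, \<tau>). (\<sigma> \<circ> \<rho>, \<tau> \<circ> \<rho>)))),
     ocomp = (\<lambda>ks p. linear_from R (lev (comp_dom R D ks) p) (lev (D (sum_list ks)) p)
       {(d, es). d \<in> carrier (lev (D (length ks)) p) \<and> es \<in> tuples (map (\<lambda>k. lev (D k) p) ks)}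
       (\<lambda>(d, es). comp_pure R D ks p d es)
       (\<lambda>(d, es). multilinear_ext R (nerve_map_prod p (perm_comp_arr ks)) d es)),
     ounit = (\<lambda>p a x. if x = restrict (\<lambda>_. (id, id)) (arrows_upto p) then a else \<zero>\<^bsub>R\<^esub>)\<rparr>)"

text \<open>The functors \<open>\<mu>\<close> on objects and on arrows.\<close>

definition mu_obj :: "(nat \<Rightarrow> nat) \<Rightarrow> ds_mor list \<Rightarrow> ds_mor"
  where "mu_obj \<sigma> fs =
    (let ps = map dtgt fs in ds_perm (sum_list ps) (inv_into UNIV (block_perm \<sigma> ps)) \<bullet> ds_juxts fs)"

definition mu_arr :: "(nat \<Rightarrow> nat) \<times> (nat \<Rightarrow> nat) \<Rightarrow> (ds_mor \<times> ds_mor) list \<Rightarrow> ds_mor \<times> ds_mor"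
  where "mu_arr u vs =
    (let fs = map fst vs; gs = map snd vs; ps = map dsrc gs; qs = map dtgt gs in
     (mu_obj (fst u) fs,
      ds_perm (sum_list qs) (inv_into UNIV (block_perm (snd u) qs)) \<bullet> ds_juxts gs
        \<bullet> ds_perm (sum_list ps) (block_perm (fst u) ps)))"

definition mu_star ::
  "('k, 'r) ring_scheme \<Rightarrow> nat \<Rightarrow> (perm_simplex \<Rightarrow> 'k) \<Rightarrow> (under_simplex \<Rightarrow> 'k) list \<Rightarrow>
    under_simplex \<Rightarrow> 'k"
  where "mu_star R p = multilinear_ext R (nerve_map_prod p mu_arr)"

text \<open>The structure map \<open>\<nu>\<close> on FA is the linear map determined by its values on the elements
  \<open>d \<otimes> (x\<^sub>1 \<otimes> V\<^sub>1) \<otimes> \<dots> \<otimes> (x\<^sub>n \<otimes> V\<^sub>n)\<close>.  Such an element is indexed by d and a list of triples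
  \<open>(j\<^sub>i, x\<^sub>i, vs\<^sub>i)\<close>, where \<open>V\<^sub>i\<close> is the pure tensor of the list \<open>vs\<^sub>i\<close> of length \<open>j\<^sub>i\<close>.\<close>

definition nu_index ::
  "('k, 'r) ring_scheme \<Rightarrow> ('k, 'a) module \<Rightarrow> nat \<Rightarrow> nat \<Rightarrow>
    ((perm_simplex \<Rightarrow> 'k) \<times> (nat \<times> (under_simplex \<Rightarrow> 'k) \<times> 'a list) list) set"
  where "nu_index R A n p = {(d, ys). d \<in> carrier (lev (arity (DMod R) n) p) \<and> length ys = n \<and>
    (\<forall>(j, x, vs)\<in>set ys. x \<in> carrier (lev (Ftilde R j) p) \<and> vs \<in> tuples (replicate j A))}"

definition nu_gen ::
  "('k, 'r) ring_scheme \<Rightarrow> ('k, 'a) module \<Rightarrow> nat \<Rightarrow> nat \<Rightarrow>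
    (perm_simplex \<Rightarrow> 'k) \<times> (nat \<times> (under_simplex \<Rightarrow> 'k) \<times> 'a list) list \<Rightarrow>
    ((perm_simplex \<Rightarrow> 'k) \<times> ((nat \<Rightarrow> ('k, 'a) summand) set list \<Rightarrow> 'k) set \<Rightarrow> 'k) set set"
  where "nu_gen R A n p = (\<lambda>(d, ys). alg_pure R (DMod R) n (FA R A) p d
    (map (\<lambda>(j, x, vs). FA_class R A p j x (pures R (replicate j A) vs)) ys))"

definition nu_value ::
  "('k, 'r) ring_scheme \<Rightarrow> ('k, 'a) module \<Rightarrow> nat \<Rightarrow>
    (perm_simplex \<Rightarrow> 'k) \<times> (nat \<times> (under_simplex \<Rightarrow> 'k) \<times> 'a list) list \<Rightarrow>
    (nat \<Rightarrow> ('k, 'a) summand) set"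
  where "nu_value R A p = (\<lambda>(d, ys).
    let j = sum_list (map fst ys) in
    FA_class R A p j (mu_star R p d (map (fst \<circ> snd) ys))
      (pures R (replicate j A) (concat (map (snd \<circ> snd) ys))))"

definition nu ::
  "('k, 'r) ring_scheme \<Rightarrow> ('k, 'a) module \<Rightarrow> nat \<Rightarrow> nat \<Rightarrow>
    ((perm_simplex \<Rightarrow> 'k) \<times> ((nat \<Rightarrow> ('k, 'a) summand) set list \<Rightarrow> 'k) set \<Rightarrow> 'k) set set \<Rightarrow>
    (nat \<Rightarrow> ('k, 'a) summand) set"
  where "nu R A n p = linear_from R (lev (alg_dom R (DMod R) n (FA R A)) p) (lev (FA R A) p)
    (nu_index R A n p) (nu_gen R A n p) (nu_value R A p)"

end

theory Submission
  imports Defs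
begin

text \<open>The operad acts on CA because \<open>\<mu>\<close> is natural in its second arguments: precomposing each \<open>f\<^sub>i\<close> with a
morphism \<open>g\<^sub>i\<close> precomposes \<open>\<mu>(\<sigma>, f\<^sub>1, \<dots>, f\<^sub>n)\<close> with the juxtaposition of the \<open>g\<^sub>i\<close>, and the bar construction
takes juxtapositions to tensor products, so \<open>\<nu>\<close> respects the coend relations in each tensor factor separately.
This works for every class of morphisms that contains the permutations and is closed under juxtaposition; the
automorphisms give FA, all morphisms give CA. Equations between morphisms of \<open>\<Delta>S\<^sub>+\<close> are checked on their action
on lists, which is faithful and turns the twisted composition into substitution of lists, and equations between
multilinear maps on generators. The operad is E-infinity since \<open>E\<Sigma>\<^sub>m\<close> is contractible and \<open>\<Sigma>\<^sub>m\<close> acts freely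
on its nerve.\<close>

text \<open>The operadic composition and \<open>nu\<close> are given by definite descriptions
  through \<open>linear_from\<close>, with values prescribed on pure elements. Such elements satisfy
  many relations, so the obstacle is existence: a linear map with these values has to be exhibited
  before anything can be computed. The maps come from the universal properties of free modules,
  tensor products, direct sums and quotients. In the coend the generators are classes of a simplex
  tensored with a list of algebra elements (\<open>cell\<close>). They are not independent, as
  \<open>A\<close> need not be free over the ground ring, so a map in several arguments cannot be
  defined outright by its values on cells. Instead, extendability is a predicate
  (\<open>extends_to\<close>) in one slot at a time, and \<open>multilin_extend\<close> combines the
  slots. A coend relation by \<open>f\<close> in one slot becomes a relation for the whole product
  once \<open>f\<close> is juxtaposed with identities; this is where the closure of the class of
  morphisms under juxtaposition enters, while the block permutations in it make the product
  symmetric.\<close>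

abbreviation "esimps n \<equiv> nerve (ESigma n)"
abbreviation "usimps n \<equiv> nerve (under n)"
abbreviation "perms \<equiv> list_all2 (%\<tau> k. \<tau> permutes {..<k})"
abbreviation "esimplices p \<equiv> list_all2 (%t k. t \<in> esimps k p)"
abbreviation "usimplices p \<equiv> list_all2 (%t j. t \<in> usimps j p)"
abbreviation "list_tuples \<equiv> list_all2 (%xs Ms. xs \<in> tuples Ms)"
abbreviation "id_simplex p \<equiv> restrict (%_. (id, id)) (arrows_upto p)"
abbreviation "mu_simplex p \<equiv> nerve_map_prod p mu_arr"
abbreviation "comp_simplex p ks \<equiv> nerve_map_prod p (perm_comp_arr ks)"

section \<open>Linear algebra by generators\<close>

text \<open>Spanning is phrased through submodules instead of linear combinations: it then passes to
  images by taking preimages of submodules, and finite sums are confined to free modules and direct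
  sums.\<close>

definition generates :: "('k, 'r) ring_scheme => ('k, 'x) module => 'x set => bool"
 where "generates R M G \<longleftrightarrow>
  G <= carrier M \<and> (\<forall>N. submodule N R M --> G <= N --> carrier M <= N)"

context cring
begin

abbreviation "mhom \<equiv> mod_hom R"
abbreviation "free \<equiv> free_module R"
abbreviation "bv \<equiv> basis_vec R"
abbreviation "mext \<equiv> multilinear_ext R"

section \<open>Linear maps and submodules\<close>

lemma mod_homI:
 assumes "!!x. x \<in> carrier M ==> h x \<in> carrier N"
  and "!!x y. [|x \<in> carrier M; y \<in> carrier M|] ==> h (x \<oplus>\<^bsub>M\<^esub> y) = h x \<oplus>\<^bsub>N\<^esub> h y"
  and "!!a x. [|a \<in> carrier R; x \<in> carrier M|] ==> h (a \<odot>\<^bsub>M\<^esub> x) = a \<odot>\<^bsub>N\<^esub> h x"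
 shows "h \<in> mhom M N"
 using assms by (auto simp: mod_hom_def)

lemma hom_closed: "[|h \<in> mhom M N; x \<in> carrier M|] ==> h x \<in> carrier N"
 by (auto simp: mod_hom_def)

lemma mod_hom_add: "[|h \<in> mhom M N; x \<in> carrier M; y \<in> carrier M|] ==>
  h (x \<oplus>\<^bsub>M\<^esub> y) = h x \<oplus>\<^bsub>N\<^esub> h y"
 by (auto simp: mod_hom_def)

lemma mod_hom_smult: "[|h \<in> mhom M N; a \<in> carrier R; x \<in> carrier M|] ==>
  h (a \<odot>\<^bsub>M\<^esub> x) = a \<odot>\<^bsub>N\<^esub> h x"
 by (auto simp: mod_hom_def)

lemma mod_hom_id: "id \<in> mhom M M" "(%x. x) \<in> mhom M M"
 by (auto simp: mod_hom_def)

lemma hom_compose: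
 "[|h \<in> mhom M N; g \<in> mhom N P|] ==> (%x. g (h x)) \<in> mhom M P"
 by (auto simp: mod_hom_def Pi_def)

lemma mod_hom_cong:
 assumes "module R M" "h \<in> mhom M N" "!!x. x \<in> carrier M ==> h' x = h x"
 shows "h' \<in> mhom M N"
proof -
 interpret M: module R M by fact
 show ?thesis using assms(2,3) by (auto simp: mod_hom_def Pi_def)
qed

text \<open>Negatives become scalar multiples, so that linear maps and submodules need no separate
  treatment of inverses.\<close>

lemma module_minus_eq:
 assumes "module R M" "x \<in> carrier M"
 shows "\<ominus>\<^bsub>M\<^esub> x = (\<ominus> \<one>) \<odot>\<^bsub>M\<^esub> x"
proof -
 interpret M: module R M by fact
 show ?thesis using assms(2) by (simp add: M.smult_l_minus)
qed

lemma mod_hom_zero: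
 assumes "module R M" "module R N" "h \<in> mhom M N"
 shows "h \<zero>\<^bsub>M\<^esub> = \<zero>\<^bsub>N\<^esub>"
proof -
 interpret M: module R M by fact
 interpret N: module R N by fact
 have "h (\<zero> \<odot>\<^bsub>M\<^esub> \<zero>\<^bsub>M\<^esub>) = \<zero> \<odot>\<^bsub>N\<^esub> h \<zero>\<^bsub>M\<^esub>"
  by (rule mod_hom_smult[OF assms(3)]) simp_all
 then show ?thesis using hom_closed[OF assms(3)] by simp
qed

lemma mod_hom_uminus:
 assumes "module R M" "module R N" "h \<in> mhom M N" "x \<in> carrier M"
 shows "h (\<ominus>\<^bsub>M\<^esub> x) = \<ominus>\<^bsub>N\<^esub> h x"
 using assms by (simp add: module_minus_eq hom_closed mod_hom_smult)

lemma mod_hom_minus: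
 assumes "module R M" "module R N" "h \<in> mhom M N" "x \<in> carrier M" "y \<in> carrier M"
 shows "h (x \<ominus>\<^bsub>M\<^esub> y) = h x \<ominus>\<^bsub>N\<^esub> h y"
proof -
 interpret M: module R M by fact
 show ?thesis using assms by (simp add: a_minus_def mod_hom_add mod_hom_uminus)
qed

lemma mod_hom_plus:
 assumes "module R N" "h \<in> mhom M N" "g \<in> mhom M N"
 shows "(%x. h x \<oplus>\<^bsub>N\<^esub> g x) \<in> mhom M N"
proof -
 interpret N: module R N by fact
 show ?thesis by (rule mod_homI)
   (simp_all add: hom_closed[OF assms(2)] hom_closed[OF assms(3)] mod_hom_add[OF assms(2)]
    mod_hom_add[OF assms(3)] mod_hom_smult[OF assms(2)] mod_hom_smult[OF assms(3)]
    N.add.m_ac N.smult_r_distr)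
qed

lemma mod_hom_scale:
 assumes "module R N" "h \<in> mhom M N" "a \<in> carrier R"
 shows "(%x. a \<odot>\<^bsub>N\<^esub> h x) \<in> mhom M N"
proof -
 interpret N: module R N by fact
 show ?thesis by (rule mod_homI)
   (simp_all add: hom_closed[OF assms(2)] mod_hom_add[OF assms(2)] mod_hom_smult[OF assms(2)]
    assms(3) N.smult_r_distr N.smult_assoc1[symmetric] m_comm)
qed

lemma mod_hom_const_zero:
 assumes "module R N"
 shows "(%x. \<zero>\<^bsub>N\<^esub>) \<in> mhom M N"
proof -
 interpret N: module R N by fact
 show ?thesis by (rule mod_homI) auto
qed

lemma submodule_iff:
 assumes "module R M"
 shows "submodule H R M \<longleftrightarrow> H <= carrier M \<and> \<zero>\<^bsub>M\<^esub> \<in> H \<and>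
  (\<forall>x\<in>H. \<forall>y\<in>H. x \<oplus>\<^bsub>M\<^esub> y \<in> H) \<and> (\<forall>a\<in>carrier R. \<forall>x\<in>H. a \<odot>\<^bsub>M\<^esub> x \<in> H)"
proof -
 interpret M: module R M by fact
 show ?thesis
 proof
  assume s: "submodule H R M"
  from M.submoduleE[OF s] obtain x where "x \<in> H" by auto
  with M.submoduleE[OF s] have "\<zero>\<^bsub>M\<^esub> \<in> H"
   by (metis M.add.r_inv subsetD)
  with M.submoduleE[OF s] show "H <= carrier M \<and> \<zero>\<^bsub>M\<^esub> \<in> H \<and>
   (\<forall>x\<in>H. \<forall>y\<in>H. x \<oplus>\<^bsub>M\<^esub> y \<in> H) \<and> (\<forall>a\<in>carrier R. \<forall>x\<in>H. a \<odot>\<^bsub>M\<^esub> x \<in> H)" by blast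
 next
  assume s: "H <= carrier M \<and> \<zero>\<^bsub>M\<^esub> \<in> H \<and>
   (\<forall>x\<in>H. \<forall>y\<in>H. x \<oplus>\<^bsub>M\<^esub> y \<in> H) \<and> (\<forall>a\<in>carrier R. \<forall>x\<in>H. a \<odot>\<^bsub>M\<^esub> x \<in> H)"
  show "submodule H R M" by (rule M.submoduleI) (use s in "auto simp: module_minus_eq[OF assms] subset_iff")
 qed
qed

lemma submoduleI':
 assumes "module R M" "H <= carrier M" "\<zero>\<^bsub>M\<^esub> \<in> H"
  "!!x y. [|x \<in> H; y \<in> H|] ==> x \<oplus>\<^bsub>M\<^esub> y \<in> H"
  "!!a x. [|a \<in> carrier R; x \<in> H|] ==> a \<odot>\<^bsub>M\<^esub> x \<in> H"
 shows "submodule H R M"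
 using assms by (simp add: submodule_iff)

lemma submoduleD:
 assumes "module R M" "submodule H R M"
 shows "H <= carrier M" "\<zero>\<^bsub>M\<^esub> \<in> H" "!!x y. [|x \<in> H; y \<in> H|] ==> x \<oplus>\<^bsub>M\<^esub> y \<in> H"
  "!!a x. [|a \<in> carrier R; x \<in> H|] ==> a \<odot>\<^bsub>M\<^esub> x \<in> H"
 using assms by (simp_all add: submodule_iff)

lemma submodule_equalizer:
 assumes "module R M" "module R N" "h \<in> mhom M N" "g \<in> mhom M N"
 shows "submodule {x \<in> carrier M. h x = g x} R M"
proof -
 interpret M: module R M by fact
 show ?thesis by (rule submoduleI'[OF assms(1)])
   (auto simp: mod_hom_add[OF assms(3)] mod_hom_add[OF assms(4)] mod_hom_smult[OF assms(3)]
    mod_hom_smult[OF assms(4)] mod_hom_zero[OF assms(1-3)] mod_hom_zero[OF assms(1,2,4)])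
qed

lemma submodule_preimage:
 assumes "module R M" "module R N" "h \<in> mhom M N" "submodule H R N"
 shows "submodule {x \<in> carrier M. h x \<in> H} R M"
proof -
 interpret M: module R M by fact
 show ?thesis by (rule submoduleI'[OF assms(1)])
   (use submoduleD[OF assms(2,4)] in "auto simp: mod_hom_add[OF assms(3)] mod_hom_smult[OF assms(3)]
    mod_hom_zero[OF assms(1-3)]")
qed

section \<open>Generating sets and spans\<close>

lemma generatesD: "[|generates R M G; submodule N R M; G <= N|] ==> carrier M <= N"
 by (auto simp: generates_def)

lemma generates_subset: "generates R M G ==> G <= carrier M"
 by (auto simp: generates_def)

text \<open>The equalizer of two linear maps is a submodule. Nearly every later identity between
  linear maps is reduced to generators in this way.\<close>

lemma mod_hom_eqI:
 assumes "generates R M G" "module R M" "module R N" "h \<in> mhom M N" "g \<in> mhom M N"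
  and "!!x. x \<in> G ==> h x = g x" and "x \<in> carrier M"
 shows "h x = g x"
 using generatesD[OF assms(1) submodule_equalizer[OF assms(2-5)]] assms(6,7) generates_subset[OF assms(1)]
 by blast

text \<open>The preimage of a submodule that contains the image of \<open>G\<close> is a submodule
  that contains \<open>G\<close>, hence all of \<open>M\<close>.\<close>

lemma generates_surj:
 assumes "generates R M G" "module R M" "module R N" "h \<in> mhom M N"
  and "carrier N = h ` carrier M"
 shows "generates R N (h ` G)"
 unfolding generates_def
proof (intro conjI allI impI)
 show "h ` G <= carrier N" using generates_subset[OF assms(1)] assms(5) by auto
next
 fix H assume H: "submodule H R N" "h ` G <= H"
 have "carrier M <= {x \<in> carrier M. h x \<in> H}"
  by (rule generatesD[OF assms(1) submodule_preimage[OF assms(2-4) H(1)]])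
   (use H generates_subset[OF assms(1)] in auto)
 then show "carrier N <= H" using assms(5) by auto
qed

lemma span_least: "[|submodule N R M; S <= N|] ==> span R M S <= N"
 by (auto simp: span_def)

lemma span_superset: "S <= span R M S"
 by (auto simp: span_def)

lemma span_submodule:
 assumes "module R M" "S <= carrier M"
 shows "submodule (span R M S) R M"
proof -
 interpret M: module R M by fact
 show ?thesis by (rule submoduleI'[OF assms(1)])
   (use assms(2) M.carrier_is_submodule in
    \<open>auto simp: span_def submodule_iff[OF assms(1)] subset_iff\<close>)
qed

lemma span_map_subset:
 assumes "module R M" "module R N" "h \<in> mhom M N" "submodule H R N" "S <= carrier M"
  and "!!x. x \<in> S ==> h x \<in> H"
 shows "h ` span R M S <= H"
 using span_least[OF submodule_preimage[OF assms(1-4)], of S] assms(5,6) by auto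

lemma span_kernel:
 assumes "module R M" "module R N" "h \<in> mhom M N" "S <= carrier M"
  and "!!x. x \<in> S ==> h x = \<zero>\<^bsub>N\<^esub>" and "x \<in> span R M S"
 shows "h x = \<zero>\<^bsub>N\<^esub>"
 using span_least[OF submodule_equalizer[OF assms(1-3) mod_hom_const_zero[OF assms(2)]], of S] assms(4-6)
 by auto

lemma module_minus_eq_zero:
 assumes "module R M" "x \<in> carrier M" "y \<in> carrier M"
 shows "x \<ominus>\<^bsub>M\<^esub> y = \<zero>\<^bsub>M\<^esub> \<longleftrightarrow> x = y"
proof -
 interpret M: module R M by fact
 show ?thesis
 proof
  assume "x \<ominus>\<^bsub>M\<^esub> y = \<zero>\<^bsub>M\<^esub>"
  moreover have "(x \<ominus>\<^bsub>M\<^esub> y) \<oplus>\<^bsub>M\<^esub> y = x"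
   using assms(2,3) by (simp add: a_minus_def M.add.m_assoc M.l_neg)
  ultimately show "x = y" using assms(3) by simp
 qed (use assms(2,3) in "simp add: a_minus_def M.r_neg")
qed

text \<open>The definite description is usable only with existence and uniqueness. The witness
  \<open>h\<close> gives existence, the generators give uniqueness on \<open>carrier M\<close>, and
  extensionality fixes the values outside, which is why the solution is a restriction of
  \<open>h\<close>.\<close>

lemma linear_from_props:
 assumes "module R M" "module R N" "generates R M (g ` I)" "h \<in> mhom M N"
  and "!!i. i \<in> I ==> h (g i) = \<phi> i"
 shows "linear_from R M N I g \<phi> \<in> mhom M N"
  and "i \<in> I ==> linear_from R M N I g \<phi> (g i) = \<phi> i"
  and "x \<in> carrier M ==> linear_from R M N I g \<phi> x = h x"
proof -
 let ?P = "%h. h \<in> mhom M N \<and> h \<in> extensional (carrier M) \<and> (\<forall>i\<in>I. h (g i) = \<phi> i)"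
 have "?P (restrict h (carrier M))"
 proof (intro conjI ballI)
  show "restrict h (carrier M) \<in> mhom M N" by (rule mod_hom_cong[OF assms(1,4)]) simp
  show "restrict h (carrier M) (g i) = \<phi> i" if "i \<in> I" for i
   using that assms(5) generates_subset[OF assms(3)] by auto
 qed simp
 moreover have "h' = restrict h (carrier M)" if h': "?P h'" for h'
 proof (rule extensionalityI[of _ "carrier M"])
  show "h' x = restrict h (carrier M) x" if x: "x \<in> carrier M" for x
  proof -
   have "h' x = h x" by (rule mod_hom_eqI[OF assms(3,1,2) _ assms(4) _ x]) (use h' assms(5) in auto)
   then show ?thesis using x by simp
  qed
 qed (use h' in auto)
 ultimately have eq: "linear_from R M N I g \<phi> = restrict h (carrier M)"
  unfolding linear_from_def by (rule the_equality)
 show "linear_from R M N I g \<phi> \<in> mhom M N" unfolding eq by (rule mod_hom_cong[OF assms(1,4)]) simp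
 show "x \<in> carrier M ==> linear_from R M N I g \<phi> x = h x" by (simp add: eq)
 show "i \<in> I ==> linear_from R M N I g \<phi> (g i) = \<phi> i"
  using assms(5) generates_subset[OF assms(3)] by (auto simp: eq)
qed


subsection \<open>Quotients\<close>

lemma submodule_abelian_subgroup:
 assumes "module R M" "submodule N R M"
 shows "abelian_subgroup N M"
proof -
 interpret M: module R M by fact
 show ?thesis
  using assms(2) by (intro abelian_subgroupI3 additive_subgroupI) (auto simp: submodule_def M.abelian_group_axioms)
qed

lemma coset_eq_iff:
 assumes "module R M" "submodule N R M" "x \<in> carrier M" "y \<in> carrier M"
 shows "N +>\<^bsub>M\<^esub> x = N +>\<^bsub>M\<^esub> y \<longleftrightarrow> x \<ominus>\<^bsub>M\<^esub> y \<in> N"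
proof -
 interpret M: module R M by fact
 interpret N: abelian_subgroup N M by (rule submodule_abelian_subgroup[OF assms(1,2)])
 have "x \<ominus>\<^bsub>M\<^esub> y \<in> N \<longleftrightarrow> x \<in> N +>\<^bsub>M\<^esub> y"
  using N.a_rcos_module[OF assms(4,3)] by (simp add: a_minus_def)
 also have "... \<longleftrightarrow> N +>\<^bsub>M\<^esub> x = N +>\<^bsub>M\<^esub> y"
  using N.a_repr_independence'[of x y] N.a_rcos_self[OF assms(3)] assms(4) by auto
 finally show ?thesis by simp
qed

lemma coset_self:
 assumes "module R M" "submodule N R M" "x \<in> carrier M"
 shows "x \<in> N +>\<^bsub>M\<^esub> x"
 using abelian_subgroup.a_rcos_self[OF submodule_abelian_subgroup[OF assms(1,2)] assms(3)] .

lemma coset_subset: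
 assumes "module R M" "submodule N R M" "x \<in> carrier M" "z \<in> N +>\<^bsub>M\<^esub> x"
 shows "z \<in> carrier M" "N +>\<^bsub>M\<^esub> z = N +>\<^bsub>M\<^esub> x"
proof -
 interpret M: module R M by fact
 interpret N: abelian_subgroup N M by (rule submodule_abelian_subgroup[OF assms(1,2)])
 show "z \<in> carrier M" using M.a_r_coset_subset_G[OF N.a_subset assms(3)] assms(4) by auto
 show "N +>\<^bsub>M\<^esub> z = N +>\<^bsub>M\<^esub> x" using N.a_repr_independence'[OF assms(4,3)] by simp
qed

text \<open>\<open>quot_map\<close> is a union over all representatives of a coset; it collapses to
  a single coset because \<open>f\<close> sends differences of representatives into
  \<open>N'\<close>.\<close>

lemma quot_map_coset:
 assumes "module R M" "submodule N R M" "module R M'" "submodule N' R M'"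
  and "f \<in> mhom M M'" "f ` N <= N'" "x \<in> carrier M"
 shows "quot_map M' N' f (N +>\<^bsub>M\<^esub> x) = N' +>\<^bsub>M'\<^esub> f x"
proof -
 have "N' +>\<^bsub>M'\<^esub> f z = N' +>\<^bsub>M'\<^esub> f x" if z: "z \<in> N +>\<^bsub>M\<^esub> x" for z
 proof -
  note zc = coset_subset[OF assms(1,2,7) z]
  have "z \<ominus>\<^bsub>M\<^esub> x \<in> N" using zc(2) coset_eq_iff[OF assms(1,2) zc(1) assms(7)] by simp
  then have "f z \<ominus>\<^bsub>M'\<^esub> f x \<in> N'"
   using mod_hom_minus[OF assms(1,3,5) zc(1) assms(7)] assms(6) by (metis image_subset_iff)
  then show ?thesis using coset_eq_iff[OF assms(3,4)] hom_closed[OF assms(5)] zc(1) assms(7) by simp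
 qed
 then have "quot_map M' N' f (N +>\<^bsub>M\<^esub> x) = (\<Union>z\<in>N +>\<^bsub>M\<^esub> x. N' +>\<^bsub>M'\<^esub> f x)"
  unfolding quot_map_def by (rule SUP_cong[OF refl])
 also have "... = N' +>\<^bsub>M'\<^esub> f x" using coset_self[OF assms(1,2,7)] by (subst UN_constant) auto
 finally show ?thesis .
qed

lemma quot_simps:
 assumes "module R M" "submodule N R M"
 shows quot_carrier: "carrier (quot_module M N) = (%x. N +>\<^bsub>M\<^esub> x) ` carrier M"
  and quot_zero: "\<zero>\<^bsub>quot_module M N\<^esub> = N +>\<^bsub>M\<^esub> \<zero>\<^bsub>M\<^esub>"
  and quot_add: "[|x \<in> carrier M; y \<in> carrier M|] ==>
   (N +>\<^bsub>M\<^esub> x) \<oplus>\<^bsub>quot_module M N\<^esub> (N +>\<^bsub>M\<^esub> y) = N +>\<^bsub>M\<^esub> (x \<oplus>\<^bsub>M\<^esub> y)"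
  and quot_smult: "[|a \<in> carrier R; x \<in> carrier M|] ==>
   a \<odot>\<^bsub>quot_module M N\<^esub> (N +>\<^bsub>M\<^esub> x) = N +>\<^bsub>M\<^esub> (a \<odot>\<^bsub>M\<^esub> x)"
proof -
 interpret M: module R M by fact
 interpret N: abelian_subgroup N M by (rule submodule_abelian_subgroup[OF assms(1,2)])
 show "carrier (quot_module M N) = (%x. N +>\<^bsub>M\<^esub> x) ` carrier M"
  by (auto simp: quot_module_def A_RCOSETS_def' )
 show "\<zero>\<^bsub>quot_module M N\<^esub> = N +>\<^bsub>M\<^esub> \<zero>\<^bsub>M\<^esub>"
  using M.a_coset_add_zero[OF N.a_subset] by (simp add: quot_module_def)
 show "[|x \<in> carrier M; y \<in> carrier M|] ==>
   (N +>\<^bsub>M\<^esub> x) \<oplus>\<^bsub>quot_module M N\<^esub> (N +>\<^bsub>M\<^esub> y) = N +>\<^bsub>M\<^esub> (x \<oplus>\<^bsub>M\<^esub> y)"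
  using N.a_rcos_sum by (simp add: quot_module_def)
 show "a \<odot>\<^bsub>quot_module M N\<^esub> (N +>\<^bsub>M\<^esub> x) = N +>\<^bsub>M\<^esub> (a \<odot>\<^bsub>M\<^esub> x)"
  if "a \<in> carrier R" "x \<in> carrier M"
 proof -
  have "(%x. a \<odot>\<^bsub>M\<^esub> x) ` N <= N" using submoduleD(4)[OF assms that(1)] by blast
  then have "quot_map M N (%x. a \<odot>\<^bsub>M\<^esub> x) (N +>\<^bsub>M\<^esub> x) = N +>\<^bsub>M\<^esub> (a \<odot>\<^bsub>M\<^esub> x)"
   by (rule quot_map_coset[OF assms assms mod_hom_scale[OF assms(1) mod_hom_id(2) that(1)] _ that(2)])
  then show ?thesis by (simp add: quot_module_def)
 qed
qed

lemma quot_module_module: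
 assumes "module R M" "submodule N R M"
 shows "module R (quot_module M N)"
proof -
 interpret M: module R M by fact
 note q = quot_simps[OF assms]
 show ?thesis
 proof (rule moduleI)
  show "abelian_group (quot_module M N)"
  proof (rule abelian_groupI)
   show "\<exists>y\<in>carrier (quot_module M N). y \<oplus>\<^bsub>quot_module M N\<^esub> x = \<zero>\<^bsub>quot_module M N\<^esub>"
    if "x \<in> carrier (quot_module M N)" for x
   proof -
    obtain z where "z \<in> carrier M" "x = N +>\<^bsub>M\<^esub> z" using \<open>x \<in> _\<close> q(1) by auto
    then show ?thesis
     by (intro bexI[of _ "N +>\<^bsub>M\<^esub> (\<ominus>\<^bsub>M\<^esub> z)"]) (auto simp: q M.l_neg)
   qed
  qed (auto simp: q M.add.m_ac)
 qed (auto simp: q cring_axioms M.smult_l_distr M.smult_r_distr M.smult_assoc1)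
qed

lemma quot_proj_hom:
 assumes "module R M" "submodule N R M"
 shows "(%x. N +>\<^bsub>M\<^esub> x) \<in> mhom M (quot_module M N)"
 by (rule mod_homI) (auto simp: quot_simps[OF assms])

lemma quot_generates:
 assumes "module R M" "submodule N R M" "generates R M G"
 shows "generates R (quot_module M N) ((%x. N +>\<^bsub>M\<^esub> x) ` G)"
 by (rule generates_surj[OF assms(3,1) quot_module_module[OF assms(1,2)] quot_proj_hom[OF assms(1,2)]])
  (simp add: quot_simps[OF assms(1,2)])

lemma quot_map_hom:
 assumes "module R M" "submodule N R M" "module R M'" "submodule N' R M'"
  and "f \<in> mhom M M'" "f ` N <= N'"
 shows "quot_map M' N' f \<in> mhom (quot_module M N) (quot_module M' N')"
proof -
 interpret M: module R M by fact
 show ?thesis by (rule mod_homI)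
  (auto simp: quot_simps[OF assms(1,2)] quot_simps[OF assms(3,4)] quot_map_coset[OF assms]
   hom_closed[OF assms(5)] mod_hom_add[OF assms(5)] mod_hom_smult[OF assms(5)])
qed

lemma coset_eq_zero_iff:
 assumes "module R M" "submodule N R M" "x \<in> carrier M"
 shows "N +>\<^bsub>M\<^esub> x = \<zero>\<^bsub>quot_module M N\<^esub> \<longleftrightarrow> x \<in> N"
proof -
 interpret M: module R M by fact
 have "x \<ominus>\<^bsub>M\<^esub> \<zero>\<^bsub>M\<^esub> = x"
  using module_minus_eq[OF assms(1) M.zero_closed] assms(3) by (simp add: a_minus_def)
 then show ?thesis using coset_eq_iff[OF assms(1-3) M.zero_closed] by (simp only: quot_zero[OF assms(1,2)])
qed

lemma quot_lift:
 assumes "module R M" "submodule N R M" "module R P" "h \<in> mhom M P"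
  and "!!x. x \<in> N ==> h x = \<zero>\<^bsub>P\<^esub>"
 shows "\<exists>h' \<in> mhom (quot_module M N) P. \<forall>x\<in>carrier M. h' (N +>\<^bsub>M\<^esub> x) = h x"
proof -
 interpret M: module R M by fact
 \<comment> \<open>The lift evaluates \<open>h\<close> at a chosen representative; the choice is
   harmless because \<open>h\<close> vanishes on \<open>N\<close>.\<close>
 define h' where "h' C = h (SOME x. x \<in> C)" for C
 have val: "h' (N +>\<^bsub>M\<^esub> x) = h x" if x: "x \<in> carrier M" for x
 proof -
  define z where "z = (SOME z. z \<in> N +>\<^bsub>M\<^esub> x)"
  have z: "z \<in> N +>\<^bsub>M\<^esub> x" unfolding z_def by (rule someI, rule coset_self[OF assms(1,2) x])
  note zc = coset_subset[OF assms(1,2) x z]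
  have "z \<ominus>\<^bsub>M\<^esub> x \<in> N" using zc(2) coset_eq_iff[OF assms(1,2) zc(1) x] by simp
  then have "h z \<ominus>\<^bsub>P\<^esub> h x = \<zero>\<^bsub>P\<^esub>"
   using mod_hom_minus[OF assms(1,3,4) zc(1) x] assms(5) by metis
  then have "h z = h x" using module_minus_eq_zero[OF assms(3)] hom_closed[OF assms(4)] zc(1) x by simp
  then show ?thesis by (simp add: h'_def z_def)
 qed
 have "h' \<in> mhom (quot_module M N) P"
  by (rule mod_homI) (auto simp: quot_simps[OF assms(1,2)] val hom_closed[OF assms(4)]
   mod_hom_add[OF assms(4)] mod_hom_smult[OF assms(4)])
 with val show ?thesis by blast
qed

text \<open>The relation modules of tensor products, coinvariants and coends are all spans, so an
  induced map needs to be tested on the defining relations only.\<close>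

lemma quot_map_span_hom:
 assumes "module R M" "S <= carrier M" "module R M'" "submodule N' R M'" "f \<in> mhom M M'"
  and "!!x. x \<in> S ==> f x \<in> N'"
 shows "quot_map M' N' f \<in> mhom (quot_module M (span R M S)) (quot_module M' N')"
  and "x \<in> carrier M ==> quot_map M' N' f (span R M S +>\<^bsub>M\<^esub> x) = N' +>\<^bsub>M'\<^esub> f x"
proof -
 note sp = span_submodule[OF assms(1,2)] span_map_subset[OF assms(1,3,5,4,2,6)]
 show "quot_map M' N' f \<in> mhom (quot_module M (span R M S)) (quot_module M' N')"
  by (rule quot_map_hom[OF assms(1) sp(1) assms(3-5) sp(2)])
 show "x \<in> carrier M ==> quot_map M' N' f (span R M S +>\<^bsub>M\<^esub> x) = N' +>\<^bsub>M'\<^esub> f x"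
  by (rule quot_map_coset[OF assms(1) sp(1) assms(3-5) sp(2)])
qed

end

context cring
begin

subsection \<open>Direct sums\<close>

lemma dsum_simps:
 "carrier (dsum M) = {z. (\<forall>n. z n \<in> carrier (M n)) \<and> finite {n. z n ~= \<zero>\<^bsub>M n\<^esub>}}"
 "\<zero>\<^bsub>dsum M\<^esub> = (%n. \<zero>\<^bsub>M n\<^esub>)"
 "z \<oplus>\<^bsub>dsum M\<^esub> w = (%n. z n \<oplus>\<^bsub>M n\<^esub> w n)"
 "a \<odot>\<^bsub>dsum M\<^esub> z = (%n. a \<odot>\<^bsub>M n\<^esub> z n)"
 by (simp_all add: dsum_def)

lemma dsum_module:
 assumes M: "!!n. module R (M n)"
 shows "module R (dsum M)"
proof -
 note ab = module.axioms(2)[OF M]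
 note mon = abelian_group.axioms(1)[OF ab]
 show ?thesis
 proof (rule moduleI)
  show "abelian_group (dsum M)"
  proof (rule abelian_groupI)
   fix x y assume x: "x \<in> carrier (dsum M)" and y: "y \<in> carrier (dsum M)"
   have "{n. x n \<oplus>\<^bsub>M n\<^esub> y n ~= \<zero>\<^bsub>M n\<^esub>} <= {n. x n ~= \<zero>\<^bsub>M n\<^esub>} \<union> {n. y n ~= \<zero>\<^bsub>M n\<^esub>}"
    using abelian_monoid.l_zero[OF mon] abelian_monoid.zero_closed[OF mon] by auto
   with x y show "x \<oplus>\<^bsub>dsum M\<^esub> y \<in> carrier (dsum M)"
    by (auto simp: dsum_simps abelian_monoid.a_closed[OF mon] intro: finite_subset)
  next
   fix x assume x: "x \<in> carrier (dsum M)"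
   have "\<ominus>\<^bsub>M n\<^esub> \<zero>\<^bsub>M n\<^esub> = \<zero>\<^bsub>M n\<^esub>" for n
    by (metis abelian_group.r_neg[OF ab] abelian_group.a_inv_closed[OF ab]
     abelian_monoid.l_zero[OF mon] abelian_monoid.zero_closed[OF mon])
   then have "{n. \<ominus>\<^bsub>M n\<^esub> x n ~= \<zero>\<^bsub>M n\<^esub>} <= {n. x n ~= \<zero>\<^bsub>M n\<^esub>}"
    by auto
   with x show "\<exists>y\<in>carrier (dsum M). y \<oplus>\<^bsub>dsum M\<^esub> x = \<zero>\<^bsub>dsum M\<^esub>"
    by (intro bexI[of _ "%n. \<ominus>\<^bsub>M n\<^esub> x n"])
     (auto simp: dsum_simps abelian_group.l_neg[OF ab] abelian_group.a_inv_closed[OF ab] intro: finite_subset)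
  qed (auto simp: dsum_simps abelian_monoid.zero_closed[OF mon] abelian_monoid.l_zero[OF mon]
    abelian_monoid.a_assoc[OF mon] intro!: ext abelian_monoid.a_comm[OF mon])
 next
  fix a x assume a: "a \<in> carrier R" and x: "x \<in> carrier (dsum M)"
  have "{n. a \<odot>\<^bsub>M n\<^esub> x n ~= \<zero>\<^bsub>M n\<^esub>} <= {n. x n ~= \<zero>\<^bsub>M n\<^esub>}"
   using module.smult_r_null[OF M a] by auto
  with a x show "a \<odot>\<^bsub>dsum M\<^esub> x \<in> carrier (dsum M)"
   by (auto simp: dsum_simps module.smult_closed[OF M] intro: finite_subset)
 qed (auto simp: dsum_simps cring_axioms module.smult_l_distr[OF M] module.smult_r_distr[OF M]
   module.smult_assoc1[OF M] module.smult_one[OF M])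
qed

lemma dsum_inj_hom:
 assumes M: "!!n. module R (M n)"
 shows "dsum_inj M n \<in> mhom (M n) (dsum M)"
proof -
 note ab = module.axioms(2)[OF M]
 note mon = abelian_group.axioms(1)[OF ab]
 have "finite {i. (if i = n then x else \<zero>\<^bsub>M i\<^esub>) ~= \<zero>\<^bsub>M i\<^esub>}" for x
  by (rule finite_subset[of _ "{n}"]) auto
 then show ?thesis by (intro mod_homI) (auto simp: dsum_inj_def dsum_simps abelian_monoid.zero_closed[OF mon]
   abelian_monoid.l_zero[OF mon] module.smult_r_null[OF M])
qed

lemma dsum_generates:
 assumes M: "!!n. module R (M n)" and G: "!!n. generates R (M n) (G n)"
 shows "generates R (dsum M) (\<Union>n. dsum_inj M n ` G n)"
 unfolding generates_def
proof (intro conjI allI impI)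
 show "(\<Union>n. dsum_inj M n ` G n) <= carrier (dsum M)"
  using generates_subset[OF G] hom_closed[OF dsum_inj_hom[of M, OF M]] by blast
next
 note ab = module.axioms(2)[OF M]
 note mon = abelian_group.axioms(1)[OF ab]
 fix N assume N: "submodule N R (dsum M)" and sub: "(\<Union>n. dsum_inj M n ` G n) <= N"
 note ND = submoduleD[OF dsum_module[OF M] N]
 have inj: "dsum_inj M n x \<in> N" if "x \<in> carrier (M n)" for n x
  using generatesD[OF G submodule_preimage[OF M dsum_module[OF M] dsum_inj_hom[OF M] N]]
   sub that generates_subset[OF G] by blast
 \<comment> \<open>The induction is over a finite set containing the support rather than the support
   itself, which avoids asking whether the component split off is zero.\<close>
 have "z \<in> N" if "finite F" "\<forall>n. z n \<in> carrier (M n)" "{n. z n ~= \<zero>\<^bsub>M n\<^esub>} <= F" for z F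
  using that
 proof (induction F arbitrary: z rule: finite_induct)
  case empty
  then have "z = \<zero>\<^bsub>dsum M\<^esub>" by (auto simp: dsum_simps)
  then show ?case using ND(2) by simp
 next
  case (insert m F)
  define w where "w = (%n. if n = m then \<zero>\<^bsub>M n\<^esub> else z n)"
  have "w \<in> N" by (rule insert.IH) (use insert.prems in "auto simp: w_def abelian_monoid.zero_closed[OF mon]")
  moreover have "dsum_inj M m (z m) \<in> N" using insert.prems by (intro inj) auto
  moreover have "z = dsum_inj M m (z m) \<oplus>\<^bsub>dsum M\<^esub> w"
   using insert.prems by (auto simp: dsum_simps w_def dsum_inj_def abelian_monoid.l_zero[OF mon]
    abelian_monoid.r_zero[OF mon])
  ultimately show ?case using ND(3) by metis
 qed
 then show "carrier (dsum M) <= N" by (auto simp: dsum_simps)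
qed

lemma dsum_lift:
 assumes M: "!!n. module R (M n)" and P: "module R P" and f: "!!n. f n \<in> mhom (M n) P"
 shows "\<exists>h \<in> mhom (dsum M) P. \<forall>n. \<forall>x\<in>carrier (M n). h (dsum_inj M n x) = f n x"
proof -
 interpret P: module R P by fact
 note ab = module.axioms(2)[OF M]
 note mon = abelian_group.axioms(1)[OF ab]
 define h where "h z = finsum P (%n. f n (z n)) {n. z n ~= \<zero>\<^bsub>M n\<^esub>}" for z
 \<comment> \<open>The supports of two elements and of their sum differ; a common finite superset
   allows a termwise comparison of the sums.\<close>
 have hF: "h z = finsum P (%n. f n (z n)) F"
  if "z \<in> carrier (dsum M)" "finite F" "{n. z n ~= \<zero>\<^bsub>M n\<^esub>} <= F" for z F
  unfolding h_def
  by (rule P.add.finprod_mono_neutral_cong_left[OF that(2,3)])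
   (use that in "auto simp: dsum_simps mod_hom_zero[OF M P f] hom_closed[OF f]")
 have "h \<in> mhom (dsum M) P"
 proof (rule mod_homI)
  fix x assume x: "x \<in> carrier (dsum M)"
  then show "h x \<in> carrier P" unfolding h_def
   by (intro P.finsum_closed) (auto simp: dsum_simps hom_closed[OF f])
 next
  fix x y assume x: "x \<in> carrier (dsum M)" and y: "y \<in> carrier (dsum M)"
  define F where "F = {n. x n ~= \<zero>\<^bsub>M n\<^esub>} \<union> {n. y n ~= \<zero>\<^bsub>M n\<^esub>}"
  have F: "finite F" using x y by (auto simp: F_def dsum_simps)
  interpret D: module R "dsum M" by (rule dsum_module[OF M])
  have "{n. (x \<oplus>\<^bsub>dsum M\<^esub> y) n ~= \<zero>\<^bsub>M n\<^esub>} <= F"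
   by (auto simp: F_def dsum_simps(3) abelian_monoid.l_zero[OF mon] abelian_monoid.zero_closed[OF mon])
  then have "h (x \<oplus>\<^bsub>dsum M\<^esub> y) = finsum P (%n. f n ((x \<oplus>\<^bsub>dsum M\<^esub> y) n)) F"
   by (rule hF[OF D.M.a_closed[OF x y] F])
  also have "... = finsum P (%n. f n (x n) \<oplus>\<^bsub>P\<^esub> f n (y n)) F"
   by (rule P.finsum_cong') (use x y in "auto simp: dsum_simps mod_hom_add[OF f] hom_closed[OF f]")
  also have "... = finsum P (%n. f n (x n)) F \<oplus>\<^bsub>P\<^esub> finsum P (%n. f n (y n)) F"
   by (rule P.finsum_addf) (use x y in "auto simp: dsum_simps hom_closed[OF f]")
  also have "... = h x \<oplus>\<^bsub>P\<^esub> h y" using hF[OF x F] hF[OF y F] by (simp add: F_def)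
  finally show "h (x \<oplus>\<^bsub>dsum M\<^esub> y) = h x \<oplus>\<^bsub>P\<^esub> h y" .
 next
  fix a x assume a: "a \<in> carrier R" and x: "x \<in> carrier (dsum M)"
  define F where "F = {n. x n ~= \<zero>\<^bsub>M n\<^esub>}"
  have F: "finite F" using x by (auto simp: F_def dsum_simps)
  interpret D: module R "dsum M" by (rule dsum_module[OF M])
  have "{n. (a \<odot>\<^bsub>dsum M\<^esub> x) n ~= \<zero>\<^bsub>M n\<^esub>} <= F"
   using a by (auto simp: F_def dsum_simps(4) module.smult_r_null[OF M])
  then have "h (a \<odot>\<^bsub>dsum M\<^esub> x) = finsum P (%n. f n ((a \<odot>\<^bsub>dsum M\<^esub> x) n)) F"
   by (rule hF[OF D.smult_closed[OF a x] F])
  also have "... = finsum P (%n. a \<odot>\<^bsub>P\<^esub> f n (x n)) F"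
   by (rule P.finsum_cong') (use a x in "auto simp: dsum_simps mod_hom_smult[OF f] hom_closed[OF f]")
  also have "... = a \<odot>\<^bsub>P\<^esub> finsum P (%n. f n (x n)) F"
   by (rule P.finsum_smult_ldistr[symmetric]) (use a x F in "auto simp: dsum_simps hom_closed[OF f]")
  also have "... = a \<odot>\<^bsub>P\<^esub> h x" using hF[OF x F] by (simp add: F_def)
  finally show "h (a \<odot>\<^bsub>dsum M\<^esub> x) = a \<odot>\<^bsub>P\<^esub> h x" .
 qed
 moreover have "h (dsum_inj M n x) = f n x" if x: "x \<in> carrier (M n)" for n x
 proof -
  have "h (dsum_inj M n x) = finsum P (%i. f i (dsum_inj M n x i)) {n}"
   by (rule hF) (use x hom_closed[OF dsum_inj_hom[OF M]] in "auto simp: dsum_inj_def")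
  also have "... = f n x" using x by (simp add: dsum_inj_def hom_closed[OF f])
  finally show ?thesis .
 qed
 ultimately show ?thesis by blast
qed


subsection \<open>Free modules and multilinear extension\<close>

lemma free_simps:
 "carrier (free X) =
  {c. (\<forall>x. c x \<in> carrier R) \<and> (\<forall>x. x \<notin> X --> c x = \<zero>) \<and> finite {x. c x ~= \<zero>}}"
 "\<zero>\<^bsub>free X\<^esub> = (%_. \<zero>)"
 "c \<oplus>\<^bsub>free X\<^esub> d = (%x. c x \<oplus> d x)"
 "a \<odot>\<^bsub>free X\<^esub> c = (%x. a \<otimes> c x)"
 by (simp_all add: free_module_def)

lemma free_mod: "module R (free X)"
proof (rule moduleI)
 show "abelian_group (free X)"
 proof (rule abelian_groupI)
  fix x y assume x: "x \<in> carrier (free X)" and y: "y \<in> carrier (free X)"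
  have "{n. x n \<oplus> y n ~= \<zero>} <= {n. x n ~= \<zero>} \<union> {n. y n ~= \<zero>}" by auto
  with x y show "x \<oplus>\<^bsub>free X\<^esub> y \<in> carrier (free X)"
   by (auto simp: free_simps intro: finite_subset)
 next
  fix x assume x: "x \<in> carrier (free X)"
  have "{n. \<ominus> x n ~= \<zero>} <= {n. x n ~= \<zero>}" by auto
  with x show "\<exists>y\<in>carrier (free X). y \<oplus>\<^bsub>free X\<^esub> x = \<zero>\<^bsub>free X\<^esub>"
   by (intro bexI[of _ "%n. \<ominus> x n"]) (auto simp: free_simps l_neg intro: finite_subset)
 qed (auto simp: free_simps a_assoc intro!: ext a_comm)
next
 fix a x assume a: "a \<in> carrier R" and x: "x \<in> carrier (free X)"
 have "{n. a \<otimes> x n ~= \<zero>} <= {n. x n ~= \<zero>}" using a by auto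
 with a x show "a \<odot>\<^bsub>free X\<^esub> x \<in> carrier (free X)"
  by (auto simp: free_simps intro: finite_subset)
qed (auto simp: free_simps cring_axioms l_distr r_distr m_assoc)

lemma basis_vec_closed: "x \<in> X ==> bv x \<in> carrier (free X)"
 using finite_subset[of "{y. bv x y ~= \<zero>}" "{x}"] by (auto simp: free_simps basis_vec_def)

lemma free_generates: "generates R (free X) (bv ` X)"
 unfolding generates_def
proof (intro conjI allI impI)
 show "bv ` X <= carrier (free X)" by (auto simp: basis_vec_closed)
next
 fix N assume N: "submodule N R (free X)" and sub: "bv ` X <= N"
 note ND = submoduleD[OF free_mod N]
 have "c \<in> N" if "finite F" "c \<in> carrier (free X)" "{x. c x ~= \<zero>} <= F" for c F using that
 proof (induction F arbitrary: c rule: finite_induct)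
  case empty
  then have "c = \<zero>\<^bsub>free X\<^esub>" by (auto simp: free_simps)
  then show ?case using ND(2) by simp
 next
  case (insert m F)
  define w where "w = (%n. if n = m then \<zero> else c n)"
  have cR: "c n \<in> carrier R" for n using insert.prems(1) by (simp add: free_simps)
  have "finite {x. c x ~= \<zero>}" using insert.prems(1) by (simp add: free_simps)
  then have "finite {x. w x ~= \<zero>}" by (rule rev_finite_subset) (auto simp: w_def)
  then have "w \<in> carrier (free X)" "{x. w x ~= \<zero>} <= F"
   using insert.prems by (auto simp: w_def free_simps)
  then have w: "w \<in> N" by (rule insert.IH)
  show ?case
  proof (cases "m \<in> X")
   case True
   have "c m \<odot>\<^bsub>free X\<^esub> bv m \<in> N" using sub True cR by (intro ND(4)) auto
   moreover have "c = (c m \<odot>\<^bsub>free X\<^esub> bv m) \<oplus>\<^bsub>free X\<^esub> w"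
    using cR by (auto simp: free_simps w_def basis_vec_def)
   ultimately show ?thesis using ND(3) w by metis
  next
   case False
   then have "w = c" using insert.prems(1) by (auto simp: w_def free_simps)
   then show ?thesis using w by simp
  qed
 qed
 then show "carrier (free X) <= N" by (auto simp: free_simps)
qed

text \<open>The extension is kept in its explicit form as a finite sum, because the definition of
  \<open>free_action\<close> speaks of exactly this map.\<close>

lemma free_sum_props:
 assumes P: "module R P" and \<phi>: "!!x. x \<in> X ==> \<phi> x \<in> carrier P"
 shows free_sum_hom: "(%c. finsum P (%x. c x \<odot>\<^bsub>P\<^esub> \<phi> x) {x. c x ~= \<zero>}) \<in> mhom (free X) P"
  and free_sum_basis: "x \<in> X ==>
   finsum P (%y. bv x y \<odot>\<^bsub>P\<^esub> \<phi> y) {y. bv x y ~= \<zero>} = \<phi> x"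
proof -
 interpret P: module R P by fact
 let ?F = "free X"
 interpret F: module R ?F by (rule free_mod)
 define h where "h c = finsum P (%x. c x \<odot>\<^bsub>P\<^esub> \<phi> x) {x. c x ~= \<zero>}" for c
 have cl: "c x \<odot>\<^bsub>P\<^esub> \<phi> x \<in> carrier P" if "c \<in> carrier ?F" "x \<in> X" for c x
  using that \<phi> by (auto simp: free_simps)
 have hF: "h c = finsum P (%x. c x \<odot>\<^bsub>P\<^esub> \<phi> x) S"
  if "c \<in> carrier ?F" "finite S" "{x. c x ~= \<zero>} <= S" "S <= X" for c S
  unfolding h_def
  by (rule P.add.finprod_mono_neutral_cong_left[OF that(2,3)])
   (use that cl[OF that(1)] \<phi> in "auto simp: subset_iff")
 have supp: "{x. c x ~= \<zero>} <= X" "finite {x. c x ~= \<zero>}" "!!x. c x \<in> carrier R" if "c \<in> carrier ?F" for c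
  using that by (auto simp: free_simps)
 have "h \<in> mhom ?F P"
 proof (rule mod_homI)
  fix x assume x: "x \<in> carrier ?F"
  then show "h x \<in> carrier P" unfolding h_def by (intro P.finsum_closed) (use supp(1) cl in blast)
 next
  fix x y assume x: "x \<in> carrier ?F" and y: "y \<in> carrier ?F"
  define S where "S = {n. x n ~= \<zero>} \<union> {n. y n ~= \<zero>}"
  have S: "finite S" "S <= X" using supp[OF x] supp[OF y] by (auto simp: S_def)
  have "{n. (x \<oplus>\<^bsub>?F\<^esub> y) n ~= \<zero>} <= S" by (auto simp: S_def free_simps(3))
  then have "h (x \<oplus>\<^bsub>?F\<^esub> y) = finsum P (%n. (x \<oplus>\<^bsub>?F\<^esub> y) n \<odot>\<^bsub>P\<^esub> \<phi> n) S"
   using hF[OF F.M.a_closed[OF x y] S(1) _ S(2)] by blast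
  also have "... = finsum P (%n. x n \<odot>\<^bsub>P\<^esub> \<phi> n \<oplus>\<^bsub>P\<^esub> y n \<odot>\<^bsub>P\<^esub> \<phi> n) S"
   by (rule P.finsum_cong')
    (use S cl[OF x] cl[OF y] supp(3)[OF x] supp(3)[OF y] \<phi> in
     \<open>auto simp: free_simps(3) subset_iff P.smult_l_distr\<close>)
  also have "... = finsum P (%n. x n \<odot>\<^bsub>P\<^esub> \<phi> n) S \<oplus>\<^bsub>P\<^esub> finsum P (%n. y n \<odot>\<^bsub>P\<^esub> \<phi> n) S"
   by (rule P.finsum_addf) (use S cl[OF x] cl[OF y] in auto)
  also have "... = h x \<oplus>\<^bsub>P\<^esub> h y"
   using hF[OF x S(1) _ S(2)] hF[OF y S(1) _ S(2)] by (simp add: S_def)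
  finally show "h (x \<oplus>\<^bsub>?F\<^esub> y) = h x \<oplus>\<^bsub>P\<^esub> h y" .
 next
  fix a x assume a: "a \<in> carrier R" and x: "x \<in> carrier ?F"
  define S where "S = {n. x n ~= \<zero>}"
  have S: "finite S" "S <= X" using supp[OF x] by (auto simp: S_def)
  have "{n. (a \<odot>\<^bsub>?F\<^esub> x) n ~= \<zero>} <= S" using a by (auto simp: S_def free_simps(4))
  then have "h (a \<odot>\<^bsub>?F\<^esub> x) = finsum P (%n. (a \<odot>\<^bsub>?F\<^esub> x) n \<odot>\<^bsub>P\<^esub> \<phi> n) S"
   using hF[OF F.smult_closed[OF a x] S(1) _ S(2)] by blast
  also have "... = finsum P (%n. a \<odot>\<^bsub>P\<^esub> (x n \<odot>\<^bsub>P\<^esub> \<phi> n)) S"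
   by (rule P.finsum_cong')
    (use S a cl[OF x] supp(3)[OF x] \<phi> in "auto simp: free_simps(4) subset_iff P.smult_assoc1")
  also have "... = a \<odot>\<^bsub>P\<^esub> finsum P (%n. x n \<odot>\<^bsub>P\<^esub> \<phi> n) S"
   by (rule P.finsum_smult_ldistr[symmetric]) (use a S cl[OF x] in auto)
  also have "... = a \<odot>\<^bsub>P\<^esub> h x" using hF[OF x S(1) _ S(2)] by (simp add: S_def)
  finally show "h (a \<odot>\<^bsub>?F\<^esub> x) = a \<odot>\<^bsub>P\<^esub> h x" .
 qed
 then show "(%c. finsum P (%x. c x \<odot>\<^bsub>P\<^esub> \<phi> x) {x. c x ~= \<zero>}) \<in> mhom ?F P"
  by (simp add: h_def[abs_def])
 show "finsum P (%y. bv x y \<odot>\<^bsub>P\<^esub> \<phi> y) {y. bv x y ~= \<zero>} = \<phi> x" if x: "x \<in> X"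
 proof -
  have "h (bv x) = finsum P (%i. bv x i \<odot>\<^bsub>P\<^esub> \<phi> i) {x}"
   by (rule hF[OF basis_vec_closed[OF x]]) (use x in "auto simp: basis_vec_def")
  also have "... = \<phi> x" using x \<phi> by (simp add: basis_vec_def)
  finally show ?thesis unfolding h_def .
 qed
qed

lemma free_lift:
 assumes P: "module R P" and \<phi>: "!!x. x \<in> X ==> \<phi> x \<in> carrier P"
 shows "\<exists>h \<in> mhom (free X) P. \<forall>x\<in>X. h (bv x) = \<phi> x"
 by (rule bexI[OF _ free_sum_hom[of P X \<phi>]]) (use free_sum_basis[of P X \<phi>] assms in auto)

end

section \<open>Multilinear extension to free modules\<close>

context cring
begin

text \<open>The scalar with which the basis tuple \<open>ys\<close> enters the multilinear extension
  at \<open>cs\<close>. The underlying \<open>zip\<close> truncates, so equality of lengths has to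
  be carried along.\<close>

definition weight :: "('y => 'a) list => 'y list => 'a"
 where "weight cs ys = foldr (\<otimes>) (map2 (%c y. c y) cs ys) \<one>"

lemma weight_simps [simp]:
 "weight [] ys = \<one>" "weight (c # cs) (y # ys) = c y \<otimes> weight cs ys"
 by (simp_all add: weight_def)

lemma weight_closed:
 "\<forall>c\<in>set cs. \<forall>y. c y \<in> carrier R ==> weight cs ys \<in> carrier R"
proof (induction cs arbitrary: ys)
 case (Cons c cs)
 then show ?case by (cases ys) (auto simp: weight_def)
qed simp

text \<open>Putting the constant function one into slot \<open>i\<close> isolates the factor that
  comes from this slot; linearity in the slot is then distributivity in the ring.\<close>

lemma weight_update:
 assumes "length ys = length cs" "i < length cs" "\<forall>c\<in>set cs. \<forall>y. c y \<in> carrier R"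
  "\<forall>y. c y \<in> carrier R"
 shows "weight (cs[i := c]) ys = c (ys ! i) \<otimes> weight (cs[i := %_. \<one>]) ys"
 using assms
proof (induction cs arbitrary: i ys)
 case (Cons d cs)
 then obtain y ys' where ys: "ys = y # ys'" by (cases ys) auto
 have cl: "weight cs ys' \<in> carrier R" using Cons.prems by (intro weight_closed) auto
 show ?case
 proof (cases i)
  case 0 then show ?thesis using Cons.prems cl by (simp add: ys)
 next
  case (Suc j)
  have "weight (cs[j := %_. \<one>]) ys' \<in> carrier R"
   using Cons.prems set_update_subset_insert[of cs j "%_. \<one>"] by (intro weight_closed) auto
  then show ?thesis using Cons Suc by (simp add: ys m_lcomm)
 qed
qed simp

text \<open>Tuples outside the supports contribute nothing, so a sum over the supports may be taken
  over a larger finite set.\<close>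

lemma weight_zero:
 assumes "length ys = length cs" "\<not> list_all2 (%c y. c y ~= \<zero>) cs ys" "\<forall>c\<in>set cs. \<forall>y. c y \<in> carrier R"
 shows "weight cs ys = \<zero>"
 using assms
proof (induction cs arbitrary: ys)
 case (Cons d cs)
 then obtain y ys' where ys: "ys = y # ys'" by (cases ys) auto
 have cl: "weight cs ys' \<in> carrier R" using Cons.prems by (intro weight_closed) auto
 show ?case using Cons cl by (cases "d y = \<zero>") (auto simp: ys)
qed simp

lemma weight_basis:
 "length ys = length zs ==> weight (map (bv) zs) ys = (if ys = zs then \<one> else \<zero>)"
proof (induction zs arbitrary: ys)
 case (Cons z zs)
 then obtain y ys' where ys: "ys = y # ys'" by (cases ys) auto
 show ?case using Cons by (auto simp: ys basis_vec_def)
qed simp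

lemma finite_list_all2:
 assumes "\<forall>c\<in>set cs. finite {y. P c y}"
 shows "finite {ys. list_all2 P cs ys}"
 using assms
proof (induction cs)
 case (Cons c cs)
 have "{ys. list_all2 P (c # cs) ys} <= (%(y, ys). y # ys) ` ({y. P c y} \<times> {ys. list_all2 P cs ys})"
  by (auto simp: list_all2_Cons1)
 then show ?case using Cons by (auto intro: finite_subset)
next
 case Nil
 have "{ys. list_all2 P [] ys} = {[]}" by auto
 then show ?case by simp
qed

definition mext_term :: "('x => 'a) => ('y => 'a) list => 'x \<times> 'y list => 'a"
 where "mext_term d cs = (%(x, ys). d x \<otimes> weight cs ys)"

text \<open>The definition sums over the exact supports, which change when arguments are added or
  scaled. With arbitrary finite supersets \<open>A\<close> and \<open>L\<close>, the sums for
  different arguments can share one index set.\<close>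

lemma multilinear_ext_eq:
 assumes "finite A" "{x. d x ~= \<zero>} <= A"
  and "finite L" "{ys. list_all2 (%c y. c y ~= \<zero>) cs ys} <= L" "\<forall>ys\<in>L. length ys = length cs"
  and "\<forall>x. d x \<in> carrier R" "\<forall>c\<in>set cs. \<forall>y. c y \<in> carrier R"
 shows "mext F d cs z =
  finsum R (mext_term d cs) {p \<in> A \<times> L. F (fst p) (snd p) = z}"
proof -
 have "mext F d cs z = finsum R (mext_term d cs)
  {(x, ys). d x ~= \<zero> \<and> list_all2 (%c y. c y ~= \<zero>) cs ys \<and> F x ys = z}"
  by (simp add: multilinear_ext_def mext_term_def weight_def)
 also have "... = finsum R (mext_term d cs) {p \<in> A \<times> L. F (fst p) (snd p) = z}"
 proof (rule add.finprod_mono_neutral_cong_left)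
  fix p assume p: "p \<in> {p \<in> A \<times> L. F (fst p) (snd p) = z} -
   {(x, ys). d x ~= \<zero> \<and> list_all2 (%c y. c y ~= \<zero>) cs ys \<and> F x ys = z}"
  then show "mext_term d cs p = \<zero>"
   using assms(5-7) weight_zero[of "snd p" cs] weight_closed[of cs "snd p"]
   by (cases "d (fst p) = \<zero>"; cases "list_all2 (%c y. c y ~= \<zero>) cs (snd p)")
    (auto simp: mext_term_def)
 qed (use assms in "auto simp: mext_term_def weight_closed")
 finally show ?thesis .
qed

lemma free_supp:
 assumes "c \<in> carrier (free X)"
 shows "\<forall>x. c x \<in> carrier R" "finite {x. c x ~= \<zero>}" "{x. c x ~= \<zero>} <= X"
 using assms by (auto simp: free_simps)

lemma tuples_iff: "xs \<in> tuples Ms \<longleftrightarrow> length xs = length Ms \<and> (\<forall>i<length Ms. xs ! i \<in> carrier (Ms ! i))"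
 by (auto simp: tuples_def list_all2_conv_all_nth)

lemma tuples_free_set:
 assumes "cs \<in> tuples (map (free) Ys)"
 shows "\<forall>c\<in>set cs. \<forall>y. c y \<in> carrier R" "\<forall>c\<in>set cs. finite {y. c y ~= \<zero>}" "length cs = length Ys"
 using assms by (fastforce simp: tuples_iff in_set_conv_nth free_simps)+

lemma mext_term_closed:
 "[|\<forall>x. d x \<in> carrier R; \<forall>c\<in>set cs. \<forall>y. c y \<in> carrier R|] ==> mext_term d cs p \<in> carrier R"
 by (auto simp: mext_term_def weight_closed split: prod.splits)

lemma multilinear_ext_closed:
 assumes d: "d \<in> carrier (free X)" and cs: "cs \<in> tuples (map (free) Ys)"
  and F: "!!x ys. [|x \<in> X; list_all2 (\<in>) ys Ys|] ==> F x ys \<in> Z"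
 shows "mext F d cs \<in> carrier (free Z)"
proof -
 note ds = free_supp[OF d] and css = tuples_free_set[OF cs]
 let ?A = "{x. d x ~= \<zero>}" and ?L = "{ys. list_all2 (%c y. c y ~= \<zero>) cs ys}"
 have L: "finite ?L" using finite_list_all2[OF css(2)] .
 have lys: "list_all2 (\<in>) ys Ys" if "ys \<in> ?L" for ys
  using that cs by (fastforce simp: list_all2_conv_all_nth tuples_iff free_simps)
 have eq: "mext F d cs z =
  finsum R (mext_term d cs) {p \<in> ?A \<times> ?L. F (fst p) (snd p) = z}" for z
  by (rule multilinear_ext_eq) (use ds css L in "auto dest: list_all2_lengthD")
 have z: "z \<in> (%p. F (fst p) (snd p)) ` (?A \<times> ?L)" if "mext F d cs z ~= \<zero>" for z
 proof (rule ccontr)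
  assume "z \<notin> (%p. F (fst p) (snd p)) ` (?A \<times> ?L)"
  then have e: "{p \<in> ?A \<times> ?L. F (fst p) (snd p) = z} = {}" by blast
  show False using that unfolding eq e by simp
 qed
 show ?thesis unfolding free_simps
 proof (intro CollectI conjI allI impI)
  show "mext F d cs z \<in> carrier R" for z
   unfolding eq by (rule finsum_closed) (use ds css in "auto simp: mext_term_closed")
  show "mext F d cs z = \<zero>" if "z \<notin> Z" for z
  proof (rule ccontr)
   assume "mext F d cs z ~= \<zero>"
   from z[OF this] obtain x ys where "z = F x ys" "x \<in> ?A" "ys \<in> ?L" by auto
   then show False using F[of x ys] lys ds(3) that by auto
  qed
  show "finite {z. mext F d cs z ~= \<zero>}"
   by (rule finite_subset[of _ "(%p. F (fst p) (snd p)) ` (?A \<times> ?L)"]) (use z ds L in auto)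
 qed
qed

lemma multilinear_ext_basis:
 "mext F (bv x) (map (bv) ys) = bv (F x ys)"
proof
 fix z
 have L: "list_all2 (%c y. c y ~= \<zero>) (map (bv) ys) ys' ==> ys' = ys" for ys'
  by (auto simp: list_all2_conv_all_nth basis_vec_def split: if_splits intro: nth_equalityI)
 have "mext F (bv x) (map (bv) ys) z =
  finsum R (mext_term (bv x) (map (bv) ys)) {p \<in> {x} \<times> {ys}. F (fst p) (snd p) = z}"
  by (rule multilinear_ext_eq) (auto simp: L basis_vec_def split: if_splits)
 also have "{p \<in> {x} \<times> {ys}. F (fst p) (snd p) = z} = (if F x ys = z then {(x, ys)} else {})"
  by auto
 also have "finsum R (mext_term (bv x) (map (bv) ys)) ... = bv (F x ys) z"
  by (auto simp: mext_term_def weight_basis basis_vec_def)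
 finally show "mext F (bv x) (map (bv) ys) z = bv (F x ys) z" .
qed

lemma multilinear_ext_hom_left:
 assumes cs: "cs \<in> tuples (map (free) Ys)"
  and F: "!!x ys. [|x \<in> X; list_all2 (\<in>) ys Ys|] ==> F x ys \<in> Z"
 shows "(%d. mext F d cs) \<in> mhom (free X) (free Z)"
proof -
 note css = tuples_free_set[OF cs]
 let ?L = "{ys. list_all2 (%c y. c y ~= \<zero>) cs ys}"
 have L: "finite ?L" using finite_list_all2[OF css(2)] .
 interpret X: module R "free X" by (rule free_mod)
 have eq: "mext F d cs z = finsum R (mext_term d cs) {p \<in> A \<times> ?L. F (fst p) (snd p) = z}"
  if "d \<in> carrier (free X)" "finite A" "{x. d x ~= \<zero>} <= A" for d z A
  by (rule multilinear_ext_eq[OF that(2,3) L]) (use free_supp[OF that(1)] css in "auto dest: list_all2_lengthD")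
 show ?thesis
 proof (rule mod_homI)
  show "d \<in> carrier (free X) ==> mext F d cs \<in> carrier (free Z)" for d
   by (rule multilinear_ext_closed[OF _ cs F])
 next
  fix d e assume d: "d \<in> carrier (free X)" and e: "e \<in> carrier (free X)"
  let ?A = "{x. d x ~= \<zero>} \<union> {x. e x ~= \<zero>}"
  note ds = free_supp[OF d] and es = free_supp[OF e]
  have A: "finite ?A" using ds es by simp
  have t: "mext_term (d \<oplus>\<^bsub>free X\<^esub> e) cs p = mext_term d cs p \<oplus> mext_term e cs p" for p
   using ds es css by (auto simp: mext_term_def free_simps l_distr weight_closed split: prod.splits)
  have "{x. (d \<oplus>\<^bsub>free X\<^esub> e) x ~= \<zero>} <= ?A" by (auto simp: free_simps)
  note eqs = eq[OF X.M.a_closed[OF d e] A this] eq[OF d A] eq[OF e A]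
  show "mext F (d \<oplus>\<^bsub>free X\<^esub> e) cs =
   mext F d cs \<oplus>\<^bsub>free Z\<^esub> mext F e cs"
   unfolding free_simps(3)[where X=Z]
   by (rule ext, subst eqs(1), subst eqs(2), simp, subst eqs(3), simp, unfold t, rule finsum_addf)
    (use ds es css in "auto simp: mext_term_closed")
 next
  fix a d assume a: "a \<in> carrier R" and d: "d \<in> carrier (free X)"
  note ds = free_supp[OF d]
  let ?A = "{x. d x ~= \<zero>}"
  have t: "mext_term (a \<odot>\<^bsub>free X\<^esub> d) cs p = a \<otimes> mext_term d cs p" for p
   using ds css a by (auto simp: mext_term_def free_simps m_assoc weight_closed split: prod.splits)
  have "{x. (a \<odot>\<^bsub>free X\<^esub> d) x ~= \<zero>} <= ?A" using a by (auto simp: free_simps)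
  note eqs = eq[OF X.smult_closed[OF a d] ds(2) this] eq[OF d ds(2) subset_refl]
  show "mext F (a \<odot>\<^bsub>free X\<^esub> d) cs = a \<odot>\<^bsub>free Z\<^esub> mext F d cs"
   unfolding free_simps(4)[where X=Z]
   by (rule ext, subst eqs(1), subst eqs(2), unfold t, rule finsum_rdistr[symmetric])
    (use ds css a L in "auto simp: mext_term_closed")
 qed
qed

lemma multilinear_ext_hom_slot:
 assumes d: "d \<in> carrier (free X)" and cs: "cs \<in> tuples (map (free) Ys)"
  and i: "i < length Ys"
  and F: "!!x ys. [|x \<in> X; list_all2 (\<in>) ys Ys|] ==> F x ys \<in> Z"
 shows "(%c. mext F d (cs[i := c])) \<in> mhom (free (Ys ! i)) (free Z)"
proof -
 let ?Y = "free (Ys ! i)"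
 interpret Y: module R ?Y by (rule free_mod)
 have up: "cs[i := c] \<in> tuples (map (free) Ys)" if "c \<in> carrier ?Y" for c
  using cs i that by (auto simp: tuples_iff nth_list_update)
 let ?L = "%c. {ys. list_all2 (%c y. c y ~= \<zero>) (cs[i := c]) ys}"
 have L: "finite (?L c)" if "c \<in> carrier ?Y" for c
  using finite_list_all2[of "cs[i := c]" "%c y. c y ~= \<zero>"] tuples_free_set(2)[OF up[OF that]] by simp
 have len: "length ys = length cs" if "ys \<in> ?L c" for c ys using that by (auto dest: list_all2_lengthD)
 note ds = free_supp[OF d]
 let ?A = "{x. d x ~= \<zero>}"
 have eq: "mext F d (cs[i := c]) z =
   finsum R (mext_term d (cs[i := c])) {p \<in> ?A \<times> K. F (fst p) (snd p) = z}"
  if "c \<in> carrier ?Y" "finite K" "?L c <= K" "\<forall>ys\<in>K. length ys = length cs" for c z K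
  by (rule multilinear_ext_eq[OF ds(2) subset_refl that(2,3)])
   (use that(4) ds tuples_free_set[OF up[OF that(1)]] in simp_all)
 have tc: "mext_term d (cs[i := c]) p \<in> carrier R" if "c \<in> carrier ?Y" for c p
  by (rule mext_term_closed) (use ds tuples_free_set[OF up[OF that(1)]] in simp_all)
 have wu: "weight (cs[i := c]) ys = c (ys ! i) \<otimes> weight (cs[i := %_. \<one>]) ys"
  "weight (cs[i := %_. \<one>]) ys \<in> carrier R"
  if "c \<in> carrier ?Y" "length ys = length cs" for c ys
 proof -
  show "weight (cs[i := c]) ys = c (ys ! i) \<otimes> weight (cs[i := %_. \<one>]) ys"
   by (rule weight_update) (use that i tuples_free_set[OF cs] free_supp[OF that(1)] in auto)
  show "weight (cs[i := %_. \<one>]) ys \<in> carrier R" by (rule weight_closed)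
    (use tuples_free_set[OF cs] set_update_subset_insert[of cs i "%_. \<one>"] in auto)
 qed
 show ?thesis
 proof (rule mod_homI)
  show "c \<in> carrier ?Y ==> mext F d (cs[i := c]) \<in> carrier (free Z)" for c
   by (rule multilinear_ext_closed[OF d up F])
 next
  fix c e assume c: "c \<in> carrier ?Y" and e: "e \<in> carrier ?Y"
  note ce = Y.M.a_closed[OF c e]
  \<comment> \<open>One index set that serves all three sums.\<close>
  let ?K = "?L c \<union> ?L e \<union> ?L (c \<oplus>\<^bsub>?Y\<^esub> e)"
  have K: "finite ?K" "\<forall>ys\<in>?K. length ys = length cs" using L c e ce len by blast+
  have t: "mext_term d (cs[i := c \<oplus>\<^bsub>?Y\<^esub> e]) p = mext_term d (cs[i := c]) p \<oplus> mext_term d (cs[i := e]) p"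
   if "length (snd p) = length cs" for p
   using that ds free_supp[OF c] free_supp[OF e] wu(2)[OF c]
   by (cases p) (simp add: mext_term_def wu(1)[OF ce] wu(1)[OF c] wu(1)[OF e], simp add: free_simps l_distr r_distr)
  note eqs = eq[OF ce K(1) _ K(2)] eq[OF c K(1) _ K(2)] eq[OF e K(1) _ K(2)]
  have "mext F d (cs[i := c \<oplus>\<^bsub>?Y\<^esub> e]) z =
   mext F d (cs[i := c]) z \<oplus> mext F d (cs[i := e]) z" for z
  proof -
   let ?S = "{p \<in> ?A \<times> ?K. F (fst p) (snd p) = z}"
   have "mext F d (cs[i := c \<oplus>\<^bsub>?Y\<^esub> e]) z = finsum R (mext_term d (cs[i := c \<oplus>\<^bsub>?Y\<^esub> e])) ?S"
    by (rule eqs(1)) auto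
   also have "... = finsum R (%p. mext_term d (cs[i := c]) p \<oplus> mext_term d (cs[i := e]) p) ?S"
    by (rule finsum_cong') (use K(2) t tc c e in auto)
   also have "... = finsum R (mext_term d (cs[i := c])) ?S \<oplus> finsum R (mext_term d (cs[i := e])) ?S"
    by (rule finsum_addf) (use tc c e in auto)
   also have "finsum R (mext_term d (cs[i := c])) ?S = mext F d (cs[i := c]) z"
    by (rule eqs(2)[symmetric]) auto
   also have "finsum R (mext_term d (cs[i := e])) ?S = mext F d (cs[i := e]) z"
    by (rule eqs(3)[symmetric]) auto
   finally show ?thesis .
  qed
  then show "mext F d (cs[i := c \<oplus>\<^bsub>?Y\<^esub> e]) =
   mext F d (cs[i := c]) \<oplus>\<^bsub>free Z\<^esub> mext F d (cs[i := e])"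
   by (auto simp: free_simps(3)[where X=Z])
 next
  fix a c assume a: "a \<in> carrier R" and c: "c \<in> carrier ?Y"
  note ac = Y.smult_closed[OF a c]
  let ?K = "?L c \<union> ?L (a \<odot>\<^bsub>?Y\<^esub> c)"
  have K: "finite ?K" "\<forall>ys\<in>?K. length ys = length cs" using L c ac len by blast+
  have t: "mext_term d (cs[i := a \<odot>\<^bsub>?Y\<^esub> c]) p = a \<otimes> mext_term d (cs[i := c]) p"
   if "length (snd p) = length cs" for p
   using that ds free_supp[OF c] a wu(2)[OF c]
   by (cases p) (simp add: mext_term_def wu(1)[OF ac] wu(1)[OF c], simp add: free_simps m_assoc m_lcomm)
  note eqs = eq[OF ac K(1) _ K(2)] eq[OF c K(1) _ K(2)]
  have "mext F d (cs[i := a \<odot>\<^bsub>?Y\<^esub> c]) z = a \<otimes> mext F d (cs[i := c]) z" for z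
  proof -
   let ?S = "{p \<in> ?A \<times> ?K. F (fst p) (snd p) = z}"
   have "mext F d (cs[i := a \<odot>\<^bsub>?Y\<^esub> c]) z = finsum R (mext_term d (cs[i := a \<odot>\<^bsub>?Y\<^esub> c])) ?S"
    by (rule eqs(1)) auto
   also have "... = finsum R (%p. a \<otimes> mext_term d (cs[i := c]) p) ?S"
    by (rule finsum_cong') (use K(2) t tc c a in auto)
   also have "... = a \<otimes> finsum R (mext_term d (cs[i := c])) ?S"
    by (rule finsum_rdistr[symmetric]) (use tc c a ds K(1) in auto)
   also have "finsum R (mext_term d (cs[i := c])) ?S = mext F d (cs[i := c]) z"
    by (rule eqs(2)[symmetric]) auto
   finally show ?thesis .
  qed
  then show "mext F d (cs[i := a \<odot>\<^bsub>?Y\<^esub> c]) = a \<odot>\<^bsub>free Z\<^esub> mext F d (cs[i := c])"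
   by (auto simp: free_simps(4)[where X=Z])
 qed
qed

text \<open>A map between free modules is a multilinear extension with no further slots, so its
  linearity is a special case; \<open>unit\<close> only types the empty list.\<close>

lemma free_map_multilinear_ext:
 assumes "c \<in> carrier (free X)"
 shows "free_map R f c = mext (%x _. f x) c ([] :: (unit => 'a) list)"
proof
 fix z
 note cs = free_supp[OF assms]
 have "mext (%x _. f x) c ([] :: (unit => 'a) list) z =
   finsum R (mext_term c ([] :: (unit => 'a) list)) {p \<in> {x. c x ~= \<zero>} \<times> {[]}. f (fst p) = z}"
  by (rule multilinear_ext_eq) (use cs in auto)
 also have "{p \<in> {x. c x ~= \<zero>} \<times> {[]}. f (fst p) = z} = (%x. (x, [])) ` {x. c x ~= \<zero> \<and> f x = z}"
  by auto
 also have "finsum R (mext_term c ([] :: (unit => 'a) list)) ... = finsum R c {x. c x ~= \<zero> \<and> f x = z}"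
  by (subst finsum_reindex) (use cs in "auto simp: inj_on_def mext_term_def intro!: finsum_cong'")
 finally show "free_map R f c z = mext (%x _. f x) c ([] :: (unit => 'a) list) z" by (simp add: free_map_def)
qed

lemma free_map_hom:
 assumes "!!x. x \<in> X ==> f x \<in> Y"
 shows "free_map R f \<in> mhom (free X) (free Y)"
proof (rule mod_hom_cong[OF free_mod])
 show "(%d. mext (%x _. f x) d ([] :: (unit => 'a) list)) \<in> mhom (free X) (free Y)"
  by (rule multilinear_ext_hom_left[where Ys="[]"]) (use assms in "auto simp: tuples_def")
qed (rule free_map_multilinear_ext)

lemma free_map_basis: "free_map R f (bv x) = bv (f x)"
 using free_map_multilinear_ext[OF basis_vec_closed, of x UNIV f]
  multilinear_ext_basis[of "%x _. f x" x "[] :: unit list"] by simp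

end

subsection \<open>Tensor products\<close>

text \<open>The defining relations are separated from their span, since maps out of the tensor
  product are tested on them.\<close>

definition tensor_gens ::
 "('k, 'r) ring_scheme => ('k, 'x) module => ('k, 'y) module => ('x \<times> 'y => 'k) set"
 where "tensor_gens R M N =
  (let F = free_module R (carrier M \<times> carrier N); \<delta> = (%x y. basis_vec R (x, y)) in
   {\<delta> (x \<oplus>\<^bsub>M\<^esub> x') y \<ominus>\<^bsub>F\<^esub> (\<delta> x y \<oplus>\<^bsub>F\<^esub> \<delta> x' y) | x x' y.
     x \<in> carrier M \<and> x' \<in> carrier M \<and> y \<in> carrier N} \<union>
   {\<delta> x (y \<oplus>\<^bsub>N\<^esub> y') \<ominus>\<^bsub>F\<^esub> (\<delta> x y \<oplus>\<^bsub>F\<^esub> \<delta> x y') | x y y'.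
     x \<in> carrier M \<and> y \<in> carrier N \<and> y' \<in> carrier N} \<union>
   {\<delta> (a \<odot>\<^bsub>M\<^esub> x) y \<ominus>\<^bsub>F\<^esub> a \<odot>\<^bsub>F\<^esub> \<delta> x y | a x y.
     a \<in> carrier R \<and> x \<in> carrier M \<and> y \<in> carrier N} \<union>
   {\<delta> x (a \<odot>\<^bsub>N\<^esub> y) \<ominus>\<^bsub>F\<^esub> a \<odot>\<^bsub>F\<^esub> \<delta> x y | a x y.
     a \<in> carrier R \<and> x \<in> carrier M \<and> y \<in> carrier N})"

lemma tensor_rel_span:
 "tensor_rel R M N = span R (free_module R (carrier M \<times> carrier N)) (tensor_gens R M N)"
 by (simp add: tensor_rel_def tensor_gens_def Let_def)

definition tensors_gens :: "('k, 'r) ring_scheme => ('k, 'x) module list => ('x list => 'k) set"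
 where "tensors_gens R Ms =
  (let F = free_module R (tuples Ms); \<delta> = basis_vec R in
   {\<delta> (xs[i := x \<oplus>\<^bsub>Ms ! i\<^esub> y]) \<ominus>\<^bsub>F\<^esub> (\<delta> (xs[i := x]) \<oplus>\<^bsub>F\<^esub> \<delta> (xs[i := y])) | xs i x y.
     xs \<in> tuples Ms \<and> i < length Ms \<and> x \<in> carrier (Ms ! i) \<and> y \<in> carrier (Ms ! i)} \<union>
   {\<delta> (xs[i := a \<odot>\<^bsub>Ms ! i\<^esub> x]) \<ominus>\<^bsub>F\<^esub> a \<odot>\<^bsub>F\<^esub> \<delta> (xs[i := x]) | xs i a x.
     xs \<in> tuples Ms \<and> i < length Ms \<and> a \<in> carrier R \<and> x \<in> carrier (Ms ! i)})"

lemma tensors_rel_span: "tensors_rel R Ms = span R (free_module R (tuples Ms)) (tensors_gens R Ms)"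
 by (simp add: tensors_rel_def tensors_gens_def Let_def)

text \<open>Linearity is demanded in each argument with the other one confined to its carrier;
  outside the carriers \<open>b\<close> is arbitrary.\<close>

definition bilin ::
 "('k, 'r) ring_scheme => ('k, 'x) module => ('k, 'y) module => ('k, 'z) module =>
  ('x => 'y => 'z) => bool"
 where "bilin R M N P b \<longleftrightarrow>
  (\<forall>x\<in>carrier M. b x \<in> mod_hom R N P) \<and> (\<forall>y\<in>carrier N. (%x. b x y) \<in> mod_hom R M P)"

definition multilin ::
 "('k, 'r) ring_scheme => ('k, 'x) module list => ('k, 'z) module => ('x list => 'z) => bool"
 where "multilin R Ms P f \<longleftrightarrow> (\<forall>xs\<in>tuples Ms. f xs \<in> carrier P \<and>
  (\<forall>i<length Ms. (%x. f (xs[i := x])) \<in> mod_hom R (Ms ! i) P))"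

text \<open>Entries of a list are replaced one at a time by elements of \<open>G i\<close>. When
  \<open>P\<close> is an equation of multilinear maps or membership in a submodule, linearity in
  slot \<open>i\<close> supplies \<open>step\<close>, since it lets arbitrary entries be reached
  from generators.\<close>

lemma slot_induct:
 fixes A G :: "nat => 'x set"
 assumes G: "!!i. i < n ==> G i <= A i"
  and step: "!!xs i. [|length xs = n; \<forall>j<n. xs ! j \<in> A j; i < n; !!x. x \<in> G i ==> P (xs[i := x])|] ==> P xs"
  and base: "!!xs. [|length xs = n; \<forall>j<n. xs ! j \<in> G j|] ==> P xs"
  and xs: "length xs = n" "\<forall>j<n. xs ! j \<in> A j"
 shows "P xs"
proof -
 \<comment> \<open>\<open>k\<close> counts the leading slots that are still arbitrary; the slots
   from \<open>k\<close> on already lie in \<open>G\<close>.\<close>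
 have "P xs" if "k <= n" "length xs = n" "\<forall>j<n. xs ! j \<in> A j" "\<forall>j<n. k <= j --> xs ! j \<in> G j" for k xs
  using that
 proof (induction k arbitrary: xs)
  case 0 then show ?case by (intro base) auto
 next
  case (Suc k)
  show ?case
  proof (rule step)
   show "P (xs[k := x])" if "x \<in> G k" for x
   proof (rule Suc.IH)
    show "\<forall>j<n. xs[k := x] ! j \<in> A j" using Suc.prems G[of k] that by (auto simp: nth_list_update)
    show "\<forall>j<n. k <= j --> xs[k := x] ! j \<in> G j"
     using Suc.prems that by (auto simp: nth_list_update Suc_le_eq)
   qed (use Suc.prems in auto)
  qed (use Suc.prems in auto)
 qed
 from this[of n xs] show ?thesis using xs by auto
qed

lemma tuples_update: "[|xs \<in> tuples Ms; x \<in> carrier (Ms ! i)|] ==> xs[i := x] \<in> tuples Ms"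
 by (cases "i < length xs") (auto simp: tuples_def list_all2_conv_all_nth nth_list_update)

lemma multilin_closed: "[|multilin R Ms P f; xs \<in> tuples Ms|] ==> f xs \<in> carrier P"
 by (simp add: multilin_def)

lemma multilin_slot:
 "[|multilin R Ms P f; xs \<in> tuples Ms; i < length Ms|] ==> (%x. f (xs[i := x])) \<in> mod_hom R (Ms ! i) P"
 by (simp add: multilin_def)

section \<open>Universal properties and generators of tensor products\<close>

context cring
begin

lemma tensor_gens_subset:
 assumes "module R M" "module R N"
 shows "tensor_gens R M N <= carrier (free (carrier M \<times> carrier N))"
proof -
 interpret M: module R M by fact
 interpret N: module R N by fact
 interpret F: module R "free (carrier M \<times> carrier N)" by (rule free_mod)
 show ?thesis
  by (auto simp: tensor_gens_def Let_def basis_vec_closed intro!: F.M.minus_closed F.M.a_closed F.smult_closed)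
qed

lemma tensors_gens_subset:
 assumes "\<forall>M\<in>set Ms. module R M"
 shows "tensors_gens R Ms <= carrier (free (tuples Ms))"
proof -
 interpret F: module R "free (tuples Ms)" by (rule free_mod)
 have M: "module R (Ms ! i)" if "i < length Ms" for i using assms that by simp
 note ab = abelian_group.axioms(1)[OF module.axioms(2)[OF M]]
 show ?thesis
  by (auto simp: tensors_gens_def Let_def intro!: F.M.minus_closed F.M.a_closed F.smult_closed basis_vec_closed
   tuples_update abelian_monoid.a_closed[OF ab] module.smult_closed[OF M])
qed

text \<open>Serves two purposes: maps out of a tensor product, and, with a quotient as
  \<open>P\<close>, maps between tensor products.\<close>

lemma tensor_gens_kernel:
 assumes "module R M" "module R N" "module R P"
  and h: "h \<in> mhom (free (carrier M \<times> carrier N)) P"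
  and b: "bilin R M N P (%x y. h (bv (x, y)))"
  and z: "z \<in> tensor_gens R M N"
 shows "h z = \<zero>\<^bsub>P\<^esub>"
proof -
 interpret M: module R M by fact
 interpret N: module R N by fact
 interpret P: module R P by fact
 let ?F = "free (carrier M \<times> carrier N)"
 interpret F: module R ?F by (rule free_mod)
 have b1: "h (bv (x \<oplus>\<^bsub>M\<^esub> x', y)) = h (bv (x, y)) \<oplus>\<^bsub>P\<^esub> h (bv (x', y))"
  "h (bv (a \<odot>\<^bsub>M\<^esub> x, y)) = a \<odot>\<^bsub>P\<^esub> h (bv (x, y))"
  if "x \<in> carrier M" "x' \<in> carrier M" "y \<in> carrier N" "a \<in> carrier R" for a x x' y
  using b that mod_hom_add[of "%x. h (bv (x, y))" M P] mod_hom_smult[of "%x. h (bv (x, y))" M P]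
  by (simp_all add: bilin_def)
 have b2: "h (bv (x, y \<oplus>\<^bsub>N\<^esub> y')) = h (bv (x, y)) \<oplus>\<^bsub>P\<^esub> h (bv (x, y'))"
  "h (bv (x, a \<odot>\<^bsub>N\<^esub> y)) = a \<odot>\<^bsub>P\<^esub> h (bv (x, y))"
  if "x \<in> carrier M" "y \<in> carrier N" "y' \<in> carrier N" "a \<in> carrier R" for a x y y'
  using b that mod_hom_add[of "%y. h (bv (x, y))" N P] mod_hom_smult[of "%y. h (bv (x, y))" N P]
  by (simp_all add: bilin_def)
 have cl: "bv (x, y) \<in> carrier ?F" if "x \<in> carrier M" "y \<in> carrier N" for x y
  using that by (simp add: basis_vec_closed)
 have hm: "h (u \<ominus>\<^bsub>?F\<^esub> v) = \<zero>\<^bsub>P\<^esub>" if "u \<in> carrier ?F" "v \<in> carrier ?F" "h u = h v" for u v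
  using mod_hom_minus[OF free_mod assms(3) h that(1,2)] that
   module_minus_eq_zero[OF assms(3)] hom_closed[OF h] by simp
 show ?thesis using z unfolding tensor_gens_def Let_def
  by (auto intro!: hm simp: cl mod_hom_add[OF h] mod_hom_smult[OF h]
   b1(1)[OF _ _ _ zero_closed] b1(2) b2(1)[OF _ _ _ zero_closed] b2(2))
qed

lemma tensors_gens_kernel:
 assumes "\<forall>M\<in>set Ms. module R M" "module R P"
  and h: "h \<in> mhom (free (tuples Ms)) P"
  and b: "multilin R Ms P (%xs. h (bv xs))"
  and z: "z \<in> tensors_gens R Ms"
 shows "h z = \<zero>\<^bsub>P\<^esub>"
proof -
 interpret P: module R P by fact
 let ?F = "free (tuples Ms)"
 interpret F: module R ?F by (rule free_mod)
 have M: "module R (Ms ! i)" if "i < length Ms" for i using assms that by simp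
 note ab = abelian_group.axioms(1)[OF module.axioms(2)[OF M]]
 have b1: "h (bv (xs[i := x \<oplus>\<^bsub>Ms ! i\<^esub> y])) =
   h (bv (xs[i := x])) \<oplus>\<^bsub>P\<^esub> h (bv (xs[i := y]))"
  "h (bv (xs[i := a \<odot>\<^bsub>Ms ! i\<^esub> x])) = a \<odot>\<^bsub>P\<^esub> h (bv (xs[i := x]))"
  if "xs \<in> tuples Ms" "i < length Ms" "x \<in> carrier (Ms ! i)" "y \<in> carrier (Ms ! i)" "a \<in> carrier R" for a xs i x y
  using mod_hom_add[OF multilin_slot[OF b that(1,2)] that(3,4)]
   mod_hom_smult[OF multilin_slot[OF b that(1,2)] that(5,3)] by simp_all
 have cl: "bv (xs[i := x]) \<in> carrier ?F" if "xs \<in> tuples Ms" "i < length Ms" "x \<in> carrier (Ms ! i)" for xs i x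
  using that by (intro basis_vec_closed tuples_update)
 have hm: "h (u \<ominus>\<^bsub>?F\<^esub> v) = \<zero>\<^bsub>P\<^esub>" if "u \<in> carrier ?F" "v \<in> carrier ?F" "h u = h v" for u v
  using mod_hom_minus[OF free_mod assms(2) h that(1,2)] that
   module_minus_eq_zero[OF assms(2)] hom_closed[OF h] by simp
 show ?thesis using z unfolding tensors_gens_def Let_def
  by (auto intro!: hm simp: cl mod_hom_add[OF h] mod_hom_smult[OF h] b1(1)[OF _ _ _ _ zero_closed] b1(2)
   abelian_monoid.a_closed[OF ab] module.smult_closed[OF M])
qed

lemma tensor_rel_submodule:
 assumes "module R M" "module R N"
 shows "submodule (tensor_rel R M N) R (free (carrier M \<times> carrier N))"
 unfolding tensor_rel_span by (rule span_submodule[OF free_mod tensor_gens_subset[OF assms]])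

lemma tensors_rel_submodule:
 assumes "\<forall>M\<in>set Ms. module R M"
 shows "submodule (tensors_rel R Ms) R (free (tuples Ms))"
 unfolding tensors_rel_span by (rule span_submodule[OF free_mod tensors_gens_subset[OF assms]])

lemma tensor_module: "[|module R M; module R N|] ==> module R (tensor R M N)"
 unfolding tensor_def by (intro quot_module_module free_mod tensor_rel_submodule)

lemma tensors_module: "\<forall>M\<in>set Ms. module R M ==> module R (tensors R Ms)"
 unfolding tensors_def by (intro quot_module_module free_mod tensors_rel_submodule)

lemma pure_bilin:
 assumes "module R M" "module R N"
 shows "bilin R M N (tensor R M N) (pure R M N)"
proof -
 interpret M: module R M by fact
 interpret N: module R N by fact
 let ?F = "free (carrier M \<times> carrier N)"
 let ?T = "tensor R M N" and ?\<pi> = "%z. tensor_rel R M N +>\<^bsub>?F\<^esub> z"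
 interpret F: module R ?F by (rule free_mod)
 note sub = tensor_rel_submodule[OF assms]
 have h: "?\<pi> \<in> mhom ?F ?T" using quot_proj_hom[OF free_mod sub] by (simp add: tensor_def)
 have cl: "bv (x, y) \<in> carrier ?F" if "x \<in> carrier M" "y \<in> carrier N" for x y
  using that by (simp add: basis_vec_closed)
 have eqI: "?\<pi> u = ?\<pi> v" if "u \<ominus>\<^bsub>?F\<^esub> v \<in> tensor_gens R M N" "u \<in> carrier ?F" "v \<in> carrier ?F" for u v
 proof -
  have "u \<ominus>\<^bsub>?F\<^esub> v \<in> tensor_rel R M N"
   unfolding tensor_rel_span by (rule subsetD[OF span_superset that(1)])
  then show ?thesis by (simp only: coset_eq_iff[OF free_mod sub that(2,3)])
 qed
 have closed: "pure R M N x y \<in> carrier ?T" if "x \<in> carrier M" "y \<in> carrier N" for x y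
  unfolding pure_def by (rule hom_closed[OF h cl[OF that]])
 have 1: "pure R M N (x \<oplus>\<^bsub>M\<^esub> x') y = pure R M N x y \<oplus>\<^bsub>?T\<^esub> pure R M N x' y"
  if "x \<in> carrier M" "x' \<in> carrier M" "y \<in> carrier N" for x x' y
  unfolding pure_def mod_hom_add[OF h cl[OF that(1,3)] cl[OF that(2,3)], symmetric]
  by (rule eqI, unfold tensor_gens_def Let_def,
    rule UnI1, rule UnI1, rule UnI1, rule CollectI, intro exI conjI, rule refl)
   (use that cl in auto)
 have 2: "pure R M N x (y \<oplus>\<^bsub>N\<^esub> y') = pure R M N x y \<oplus>\<^bsub>?T\<^esub> pure R M N x y'"
  if "x \<in> carrier M" "y \<in> carrier N" "y' \<in> carrier N" for x y y'
  unfolding pure_def mod_hom_add[OF h cl[OF that(1,2)] cl[OF that(1,3)], symmetric]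
  by (rule eqI, unfold tensor_gens_def Let_def,
    rule UnI1, rule UnI1, rule UnI2, rule CollectI, intro exI conjI, rule refl)
   (use that cl in auto)
 have 3: "pure R M N (a \<odot>\<^bsub>M\<^esub> x) y = a \<odot>\<^bsub>?T\<^esub> pure R M N x y"
  if "a \<in> carrier R" "x \<in> carrier M" "y \<in> carrier N" for a x y
  unfolding pure_def mod_hom_smult[OF h that(1) cl[OF that(2,3)], symmetric]
  by (rule eqI, unfold tensor_gens_def Let_def,
    rule UnI1, rule UnI2, rule CollectI, intro exI conjI, rule refl)
   (use that cl in auto)
 have 4: "pure R M N x (a \<odot>\<^bsub>N\<^esub> y) = a \<odot>\<^bsub>?T\<^esub> pure R M N x y"
  if "a \<in> carrier R" "x \<in> carrier M" "y \<in> carrier N" for a x y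
  unfolding pure_def mod_hom_smult[OF h that(1) cl[OF that(2,3)], symmetric]
  by (rule eqI, unfold tensor_gens_def Let_def,
    rule UnI2, rule CollectI, intro exI conjI, rule refl)
   (use that cl in auto)
 show ?thesis unfolding bilin_def by (intro conjI ballI mod_homI closed 1 2 3 4)
qed

lemma pures_multilin:
 assumes Ms: "\<forall>M\<in>set Ms. module R M"
 shows "multilin R Ms (tensors R Ms) (pures R Ms)"
proof -
 let ?F = "free (tuples Ms)"
 let ?T = "tensors R Ms" and ?\<pi> = "%z. tensors_rel R Ms +>\<^bsub>?F\<^esub> z"
 interpret F: module R ?F by (rule free_mod)
 note sub = tensors_rel_submodule[OF Ms]
 have h: "?\<pi> \<in> mhom ?F ?T" using quot_proj_hom[OF free_mod sub] by (simp add: tensors_def)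
 have eqI: "?\<pi> u = ?\<pi> v" if "u \<ominus>\<^bsub>?F\<^esub> v \<in> tensors_gens R Ms" "u \<in> carrier ?F" "v \<in> carrier ?F" for u v
 proof -
  have "u \<ominus>\<^bsub>?F\<^esub> v \<in> tensors_rel R Ms"
   unfolding tensors_rel_span by (rule subsetD[OF span_superset that(1)])
  then show ?thesis by (simp only: coset_eq_iff[OF free_mod sub that(2,3)])
 qed
 have closed: "pures R Ms xs \<in> carrier ?T" if "xs \<in> tuples Ms" for xs
  unfolding pures_def by (rule hom_closed[OF h basis_vec_closed[OF that]])
 show ?thesis unfolding multilin_def
 proof (intro ballI conjI allI impI)
  fix xs i assume xs: "xs \<in> tuples Ms" and i: "i < length Ms"
  interpret M: module R "Ms ! i" using Ms i by simp
  have cl: "bv (xs[i := x]) \<in> carrier ?F" if "x \<in> carrier (Ms ! i)" for x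
   using that xs by (intro basis_vec_closed tuples_update)
  have 1: "pures R Ms (xs[i := x \<oplus>\<^bsub>Ms ! i\<^esub> y]) = pures R Ms (xs[i := x]) \<oplus>\<^bsub>?T\<^esub> pures R Ms (xs[i := y])"
   if "x \<in> carrier (Ms ! i)" "y \<in> carrier (Ms ! i)" for x y
   unfolding pures_def mod_hom_add[OF h cl[OF that(1)] cl[OF that(2)], symmetric]
   by (rule eqI, unfold tensors_gens_def Let_def,
     rule UnI1, rule CollectI, intro exI conjI, rule refl)
    (use that cl xs i in auto)
  have 2: "pures R Ms (xs[i := a \<odot>\<^bsub>Ms ! i\<^esub> x]) = a \<odot>\<^bsub>?T\<^esub> pures R Ms (xs[i := x])"
   if "a \<in> carrier R" "x \<in> carrier (Ms ! i)" for a x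
   unfolding pures_def mod_hom_smult[OF h that(1) cl[OF that(2)], symmetric]
   by (rule eqI, unfold tensors_gens_def Let_def,
     rule UnI2, rule CollectI, intro exI conjI, rule refl)
    (use that cl xs i in auto)
  show "(%x. pures R Ms (xs[i := x])) \<in> mhom (Ms ! i) ?T"
   by (intro mod_homI closed tuples_update[OF xs] 1 2)
 qed (rule closed)
qed

lemma tensor_lift:
 assumes "module R M" "module R N" "module R P" and b: "bilin R M N P b"
 shows "\<exists>h \<in> mhom (tensor R M N) P. \<forall>x\<in>carrier M. \<forall>y\<in>carrier N. h (pure R M N x y) = b x y"
proof -
 let ?F = "free (carrier M \<times> carrier N)"
 have bc: "b x y \<in> carrier P" if "x \<in> carrier M" "y \<in> carrier N" for x y
  using b that by (auto simp: bilin_def hom_closed)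
 then obtain h where h: "h \<in> mhom ?F P" "\<forall>p\<in>carrier M \<times> carrier N. h (bv p) = case_prod b p"
  using free_lift[OF assms(3), of "carrier M \<times> carrier N" "case_prod b"] by auto
 have "bilin R M N P (%x y. h (bv (x, y)))" unfolding bilin_def
 proof (intro conjI ballI)
  show "(%y. h (bv (x, y))) \<in> mhom N P" if "x \<in> carrier M" for x
   by (rule mod_hom_cong[OF assms(2), of "b x"]) (use b h(2) that in "auto simp: bilin_def")
  show "(%x. h (bv (x, y))) \<in> mhom M P" if "y \<in> carrier N" for y
   by (rule mod_hom_cong[OF assms(1), of "%x. b x y"]) (use b h(2) that in "auto simp: bilin_def")
 qed
 note K = tensor_gens_kernel[OF assms(1-3) h(1) this]
 have "h x = \<zero>\<^bsub>P\<^esub>" if "x \<in> tensor_rel R M N" for x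
  by (rule span_kernel[OF free_mod assms(3) h(1) tensor_gens_subset[OF assms(1,2)] K
    that[unfolded tensor_rel_span]])
 from quot_lift[OF free_mod tensor_rel_submodule[OF assms(1,2)] assms(3) h(1) this]
 obtain h' where h': "h' \<in> mhom (tensor R M N) P"
  "!!x. x \<in> carrier ?F ==> h' (tensor_rel R M N +>\<^bsub>?F\<^esub> x) = h x"
  unfolding tensor_def by blast
 show ?thesis
 proof (intro bexI[OF _ h'(1)] ballI)
  show "h' (pure R M N x y) = b x y" if "x \<in> carrier M" "y \<in> carrier N" for x y
   using h'(2)[OF basis_vec_closed] h(2) that by (simp add: pure_def)
 qed
qed

lemma tensors_lift:
 assumes Ms: "\<forall>M\<in>set Ms. module R M" and P: "module R P" and b: "multilin R Ms P b"
 shows "\<exists>h \<in> mhom (tensors R Ms) P. \<forall>xs\<in>tuples Ms. h (pures R Ms xs) = b xs"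
proof -
 let ?F = "free (tuples Ms)"
 obtain h where h: "h \<in> mhom ?F P" "\<forall>xs\<in>tuples Ms. h (bv xs) = b xs"
  using free_lift[OF P, of "tuples Ms" b] multilin_closed[OF b] by blast
 have "multilin R Ms P (%xs. h (bv xs))" unfolding multilin_def
 proof (intro ballI conjI allI impI)
  fix xs i assume xs: "xs \<in> tuples Ms" and i: "i < length Ms"
  show "(%x. h (bv (xs[i := x]))) \<in> mhom (Ms ! i) P" by (rule mod_hom_cong[OF _ multilin_slot[OF b xs i]])
    (use Ms i h(2) tuples_update[OF xs] in auto)
 qed (use h(2) multilin_closed[OF b] in auto)
 note K = tensors_gens_kernel[OF Ms P h(1) this]
 have "h x = \<zero>\<^bsub>P\<^esub>" if "x \<in> tensors_rel R Ms" for x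
  by (rule span_kernel[OF free_mod P h(1) tensors_gens_subset[OF Ms] K
    that[unfolded tensors_rel_span]])
 from quot_lift[OF free_mod tensors_rel_submodule[OF Ms] P h(1) this]
 obtain h' where h': "h' \<in> mhom (tensors R Ms) P"
  "!!x. x \<in> carrier ?F ==> h' (tensors_rel R Ms +>\<^bsub>?F\<^esub> x) = h x"
  unfolding tensors_def by blast
 show ?thesis
 proof (intro bexI[OF _ h'(1)] ballI)
  show "h' (pures R Ms xs) = b xs" if "xs \<in> tuples Ms" for xs
   using h'(2)[OF basis_vec_closed] h(2) that by (simp add: pures_def)
 qed
qed

lemma tensor_generates_pure:
 assumes "module R M" "module R N"
 shows "generates R (tensor R M N) {pure R M N x y | x y. x \<in> carrier M \<and> y \<in> carrier N}"
proof -
 have "{pure R M N x y | x y. x \<in> carrier M \<and> y \<in> carrier N} =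
  (%x. tensor_rel R M N +>\<^bsub>free (carrier M \<times> carrier N)\<^esub> x) ` (bv ` (carrier M \<times> carrier N))"
  unfolding pure_def by blast
 then show ?thesis
  using quot_generates[OF free_mod tensor_rel_submodule[OF assms] free_generates] by (simp add: tensor_def)
qed

text \<open>For a submodule \<open>K\<close> that contains the small set of pure tensors, preimages
  of \<open>K\<close> under \<open>pure\<close> with one argument fixed release the second argument
  from \<open>H\<close> and after that the first one from \<open>G\<close>.\<close>

lemma tensor_generates:
 assumes "module R M" "module R N" "generates R M G" "generates R N H"
 shows "generates R (tensor R M N) {pure R M N x y | x y. x \<in> G \<and> y \<in> H}"
 unfolding generates_def
proof (intro conjI allI impI)
 note b = pure_bilin[OF assms(1,2), unfolded bilin_def] and T = tensor_module[OF assms(1,2)]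
 note sub = generates_subset[OF assms(3)] generates_subset[OF assms(4)]
 show "{pure R M N x y | x y. x \<in> G \<and> y \<in> H} <= carrier (tensor R M N)"
  using sub generates_subset[OF tensor_generates_pure[OF assms(1,2)]] by blast
 fix K assume K: "submodule K R (tensor R M N)" "{pure R M N x y | x y. x \<in> G \<and> y \<in> H} <= K"
 have 1: "pure R M N x y \<in> K" if "x \<in> G" "y \<in> carrier N" for x y
  using generatesD[OF assms(4) submodule_preimage[OF assms(2) T _ K(1), of "pure R M N x"]] b K(2) that sub
  by blast
 have 2: "pure R M N x y \<in> K" if "x \<in> carrier M" "y \<in> carrier N" for x y
  using generatesD[OF assms(3) submodule_preimage[OF assms(1) T _ K(1), of "%x. pure R M N x y"]] b 1 that sub
  by blast
 show "carrier (tensor R M N) <= K"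
  by (rule generatesD[OF tensor_generates_pure[OF assms(1,2)] K(1)]) (use 2 in blast)
qed

lemma tensors_generates_pures:
 assumes "\<forall>M\<in>set Ms. module R M"
 shows "generates R (tensors R Ms) (pures R Ms ` tuples Ms)"
proof -
 have "pures R Ms ` tuples Ms =
  (%x. tensors_rel R Ms +>\<^bsub>free (tuples Ms)\<^esub> x) ` (bv ` tuples Ms)"
  unfolding pures_def by blast
 then show ?thesis
  using quot_generates[OF free_mod tensors_rel_submodule[OF assms] free_generates] by (simp add: tensors_def)
qed

lemma tensors_generates:
 assumes Ms: "\<forall>M\<in>set Ms. module R M" and G: "!!i. i < length Ms ==> generates R (Ms ! i) (G i)"
 shows "generates R (tensors R Ms) (pures R Ms ` {xs. length xs = length Ms \<and> (\<forall>i<length Ms. xs ! i \<in> G i)})"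
 unfolding generates_def
proof (intro conjI allI impI)
 note b = pures_multilin[OF Ms] and T = tensors_module[OF Ms]
 have GM: "i < length Ms ==> G i <= carrier (Ms ! i)" for i using generates_subset[OF G] .
 then have "{xs. length xs = length Ms \<and> (\<forall>i<length Ms. xs ! i \<in> G i)} <= tuples Ms"
  by (fastforce simp: tuples_iff)
 then show "pures R Ms ` {xs. length xs = length Ms \<and> (\<forall>i<length Ms. xs ! i \<in> G i)} <= carrier (tensors R Ms)"
  using multilin_closed[OF b] by blast
 fix K assume K: "submodule K R (tensors R Ms)"
  "pures R Ms ` {xs. length xs = length Ms \<and> (\<forall>i<length Ms. xs ! i \<in> G i)} <= K"
 have "pures R Ms xs \<in> K" if "length xs = length Ms" "\<forall>j<length Ms. xs ! j \<in> carrier (Ms ! j)" for xs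
  using GM _ _ that
 proof (rule slot_induct)
  fix xs i
  assume xs: "length xs = length Ms" "\<forall>j<length Ms. xs ! j \<in> carrier (Ms ! j)" and i: "i < length Ms"
   and IH: "!!x. x \<in> G i ==> pures R Ms (xs[i := x]) \<in> K"
  have t: "xs \<in> tuples Ms" using xs by (simp add: tuples_iff)
  have Mi: "module R (Ms ! i)" using Ms i by simp
  have "carrier (Ms ! i) <= {x \<in> carrier (Ms ! i). pures R Ms (xs[i := x]) \<in> K}"
   by (rule generatesD[OF G[OF i] submodule_preimage[OF Mi T multilin_slot[OF b t i] K(1)]])
    (use IH GM[OF i] in auto)
  then have "pures R Ms (xs[i := xs ! i]) \<in> K" using xs i by blast
  then show "pures R Ms xs \<in> K" by simp
 qed (use K(2) in auto)
 then show "carrier (tensors R Ms) <= K"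
  by (intro generatesD[OF tensors_generates_pures[OF Ms] K(1)]) (auto simp: tuples_iff)
qed

lemma multilin_eqI:
 assumes Ms: "\<forall>M\<in>set Ms. module R M" and P: "module R P"
  and G: "!!i. i < length Ms ==> generates R (Ms ! i) (G i)"
  and f: "multilin R Ms P f" and g: "multilin R Ms P g"
  and eq: "!!xs. [|length xs = length Ms; \<forall>i<length Ms. xs ! i \<in> G i|] ==> f xs = g xs"
  and xs: "xs \<in> tuples Ms"
 shows "f xs = g xs"
proof -
 have GM: "i < length Ms ==> G i <= carrier (Ms ! i)" for i using generates_subset[OF G] .
 show ?thesis using GM _ eq xs[unfolded tuples_iff, THEN conjunct1] xs[unfolded tuples_iff, THEN conjunct2]
 proof (rule slot_induct)
  fix xs i
  assume xs: "length xs = length Ms" "\<forall>j<length Ms. xs ! j \<in> carrier (Ms ! j)" and i: "i < length Ms"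
   and IH: "!!x. x \<in> G i ==> f (xs[i := x]) = g (xs[i := x])"
  have t: "xs \<in> tuples Ms" using xs by (simp add: tuples_iff)
  have Mi: "module R (Ms ! i)" using Ms i by simp
  have "f (xs[i := xs ! i]) = g (xs[i := xs ! i])"
   by (rule mod_hom_eqI[OF G[OF i] Mi P multilin_slot[OF f t i] multilin_slot[OF g t i] IH])
    (use xs i in auto)
  then show "f xs = g xs" by simp
 qed
qed

text \<open>\<open>tensor_map\<close> is induced from a map of free modules, which has to send
  relations to relations. This needs no calculation with the relations: composed with the projection
  to the target it is bilinear on basis pairs, and hence kills them.\<close>

lemma tensor_map_props:
 assumes "module R M" "module R N" "module R M'" "module R N'"
  and f: "f \<in> mhom M M'" and g: "g \<in> mhom N N'"
 shows tensor_map_hom: "tensor_map R M' N' f g \<in> mhom (tensor R M N) (tensor R M' N')"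
  and tensor_map_pure: "[|x \<in> carrier M; y \<in> carrier N|] ==>
   tensor_map R M' N' f g (pure R M N x y) = pure R M' N' (f x) (g y)"
proof -
 let ?F = "free (carrier M \<times> carrier N)" and ?F' = "free (carrier M' \<times> carrier N')"
 have m: "free_map R (map_prod f g) \<in> mhom ?F ?F'"
  by (rule free_map_hom) (use hom_closed[OF f] hom_closed[OF g] in auto)
 note sub = tensor_rel_submodule[OF assms(3,4)]
 let ?h = "%z. tensor_rel R M' N' +>\<^bsub>?F'\<^esub> free_map R (map_prod f g) z"
 have h: "?h \<in> mhom ?F (tensor R M' N')"
  using hom_compose[OF m quot_proj_hom[OF free_mod sub]] by (simp add: tensor_def)
 have hb: "?h (bv (x, y)) = pure R M' N' (f x) (g y)" for x y by (simp add: free_map_basis pure_def)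
 note pb = pure_bilin[OF assms(3,4), unfolded bilin_def]
 have "bilin R M N (tensor R M' N') (%x y. pure R M' N' (f x) (g y))" unfolding bilin_def
 proof (intro conjI ballI)
  show "(%y. pure R M' N' (f x) (g y)) \<in> mhom N (tensor R M' N')" if "x \<in> carrier M" for x
   by (rule hom_compose[OF g]) (use pb hom_closed[OF f that] in auto)
  show "(%x. pure R M' N' (f x) (g y)) \<in> mhom M (tensor R M' N')" if "y \<in> carrier N" for y
   by (rule hom_compose[OF f, of "%x. pure R M' N' x (g y)"]) (use pb hom_closed[OF g that] in auto)
 qed
 then have b: "bilin R M N (tensor R M' N') (%x y. ?h (bv (x, y)))" unfolding hb .
 have K: "free_map R (map_prod f g) z \<in> tensor_rel R M' N'" if z: "z \<in> tensor_gens R M N" for z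
  using tensor_gens_kernel[OF assms(1,2) tensor_module[OF assms(3,4)] h b z]
   coset_eq_zero_iff[OF free_mod sub, of "free_map R (map_prod f g) z"]
   hom_closed[OF m] tensor_gens_subset[OF assms(1,2)] z by (auto simp: tensor_def)
 note q = quot_map_span_hom[OF free_mod tensor_gens_subset[OF assms(1,2)] free_mod sub m]
 show "tensor_map R M' N' f g \<in> mhom (tensor R M N) (tensor R M' N')"
  unfolding tensor_map_def tensor_def tensor_rel_span[of R M N] by (rule q(1)[OF K])
 show "tensor_map R M' N' f g (pure R M N x y) = pure R M' N' (f x) (g y)"
  if "x \<in> carrier M" "y \<in> carrier N"
  unfolding tensor_map_def pure_def[of R M N] tensor_rel_span[of R M N] hb[symmetric]
  by (rule q(2)[OF K basis_vec_closed]) (use that in auto)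
qed

text \<open>The list map \<open>f\<close> may change the length of its argument. Only multilinearity
  of the resulting pure tensor is required, which covers permutations as well as the multiplication
  of entries in the bar construction.\<close>

lemma tensors_map_props:
 assumes Ms: "\<forall>M\<in>set Ms. module R M" and Ns: "\<forall>N\<in>set Ns. module R N"
  and f: "!!xs. xs \<in> tuples Ms ==> f xs \<in> tuples Ns"
  and b: "multilin R Ms (tensors R Ns) (%xs. pures R Ns (f xs))"
 shows tensors_map_hom: "tensors_map R Ns f \<in> mhom (tensors R Ms) (tensors R Ns)"
  and tensors_map_pures: "xs \<in> tuples Ms ==> tensors_map R Ns f (pures R Ms xs) = pures R Ns (f xs)"
proof -
 let ?F = "free (tuples Ms)" and ?F' = "free (tuples Ns)"
 have m: "free_map R f \<in> mhom ?F ?F'" by (rule free_map_hom) (rule f)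
 note sub = tensors_rel_submodule[OF Ns]
 let ?h = "%z. tensors_rel R Ns +>\<^bsub>?F'\<^esub> free_map R f z"
 have h: "?h \<in> mhom ?F (tensors R Ns)"
  using hom_compose[OF m quot_proj_hom[OF free_mod sub]] by (simp add: tensors_def)
 have hb: "?h (bv xs) = pures R Ns (f xs)" for xs by (simp add: free_map_basis pures_def)
 have b': "multilin R Ms (tensors R Ns) (%xs. ?h (bv xs))" using b unfolding hb .
 have K: "free_map R f z \<in> tensors_rel R Ns" if z: "z \<in> tensors_gens R Ms" for z
  using tensors_gens_kernel[OF Ms tensors_module[OF Ns] h b' z]
   coset_eq_zero_iff[OF free_mod sub, of "free_map R f z"]
   hom_closed[OF m] tensors_gens_subset[OF Ms] z by (auto simp: tensors_def)
 note q = quot_map_span_hom[OF free_mod tensors_gens_subset[OF Ms] free_mod sub m]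
 show "tensors_map R Ns f \<in> mhom (tensors R Ms) (tensors R Ns)"
  unfolding tensors_map_def tensors_def tensors_rel_span[of R Ms] by (rule q(1)[OF K])
 show "tensors_map R Ns f (pures R Ms xs) = pures R Ns (f xs)"
  if "xs \<in> tuples Ms"
  unfolding tensors_map_def pures_def[of R Ms] tensors_rel_span[of R Ms] hb[symmetric]
  by (rule q(2)[OF K basis_vec_closed]) (use that in auto)
qed

end

subsection \<open>Multilinear maps\<close>

text \<open>The shape of an operation applied to its inputs: linear in the operation
  \<open>d\<close> and multilinear in the inputs, which live in modules of another type.\<close>

definition bimulti ::
 "('k, 'r) ring_scheme => ('k, 'd) module => ('k, 'x) module list => ('k, 'z) module =>
  ('d => 'x list => 'z) => bool"
 where "bimulti R D Ms P \<Phi> \<longleftrightarrow> (\<forall>d\<in>carrier D. multilin R Ms P (\<Phi> d)) \<and>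
  (\<forall>xs\<in>tuples Ms. (%d. \<Phi> d xs) \<in> mod_hom R D P)"

text \<open>Expresses that \<open>\<psi>\<close> respects all relations between the elements
  \<open>e x\<close>. As a predicate of \<open>\<psi>\<close> it is closed under linear
  combinations, so the parameters for which it holds can be shown to form a submodule.\<close>

definition extends_to ::
 "('k, 'r) ring_scheme => ('k, 'x) module => ('k, 'z) module => 'i set => ('i => 'x) => ('i => 'z) => bool"
 where "extends_to R M P X e \<psi> \<longleftrightarrow> (\<exists>h\<in>mod_hom R M P. \<forall>x\<in>X. h (e x) = \<psi> x)"

text \<open>Each slot feeds linearly into one slot of the result and leaves the others alone, where
  \<open>k\<close> and \<open>g\<close> may depend on the remaining entries. Precomposition with
  such a map preserves multilinearity; permutations, concatenations, entrywise maps and the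
  multiplications of the bar construction are all of this kind.\<close>

definition slotlin ::
 "('k, 'r) ring_scheme => ('k, 'x) module list => ('k, 'y) module list => ('x list => 'y list) => bool"
 where "slotlin R Ms Ns f \<longleftrightarrow> (\<forall>xs\<in>tuples Ms. f xs \<in> tuples Ns \<and>
  (\<forall>i<length Ms. \<exists>k<length Ns. \<exists>g\<in>mod_hom R (Ms ! i) (Ns ! k).
   \<forall>x\<in>carrier (Ms ! i). f (xs[i := x]) = (f xs)[k := g x]))"

lemma bimultiD:
 assumes "bimulti R D Ms P \<Phi>"
 shows "d \<in> carrier D ==> multilin R Ms P (\<Phi> d)" "xs \<in> tuples Ms ==> (%d. \<Phi> d xs) \<in> mod_hom R D P"
 using assms by (auto simp: bimulti_def)

lemma tuples_Cons: "x # xs \<in> tuples (M # Ms) \<longleftrightarrow> x \<in> carrier M \<and> xs \<in> tuples Ms"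
 by (simp add: tuples_def)

lemma tuples_replicate: "xs \<in> tuples (replicate n M) \<longleftrightarrow> length xs = n \<and> set xs <= carrier M"
 by (auto simp: tuples_def list_all2_conv_all_nth in_set_conv_nth subset_iff)

context cring
begin

lemma multilin_compose:
 assumes "multilin R Ms P f" "h \<in> mhom P Q"
 shows "multilin R Ms Q (%xs. h (f xs))"
 unfolding multilin_def
 by (intro ballI conjI allI impI hom_closed[OF assms(2)] multilin_closed[OF assms(1)]
   hom_compose[OF multilin_slot[OF assms(1)] assms(2)])

lemma multilin_slotlin:
 assumes Ms: "\<forall>M\<in>set Ms. module R M" and f: "multilin R Ns P f" and g: "slotlin R Ms Ns g"
 shows "multilin R Ms P (%xs. f (g xs))"
 unfolding multilin_def
proof (intro ballI conjI allI impI)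
 fix xs assume xs: "xs \<in> tuples Ms"
 show "f (g xs) \<in> carrier P" using multilin_closed[OF f] g xs by (simp add: slotlin_def)
 fix i assume i: "i < length Ms"
 obtain k h where k: "k < length Ns" "h \<in> mhom (Ms ! i) (Ns ! k)"
  "\<forall>x\<in>carrier (Ms ! i). g (xs[i := x]) = (g xs)[k := h x]"
  using g xs i unfolding slotlin_def by blast
 have "g xs \<in> tuples Ns" using g xs by (simp add: slotlin_def)
 then have "(%x. f ((g xs)[k := h x])) \<in> mhom (Ms ! i) P"
  using hom_compose[OF k(2) multilin_slot[OF f _ k(1)]] by simp
 then show "(%x. f (g (xs[i := x]))) \<in> mhom (Ms ! i) P"
  by (rule mod_hom_cong[rotated]) (use Ms i k(3) in auto)
qed

lemma bimulti_compose:
 assumes "bimulti R D Ms P \<Phi>" "h \<in> mhom P Q"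
 shows "bimulti R D Ms Q (%d xs. h (\<Phi> d xs))"
 unfolding bimulti_def
 by (intro conjI ballI multilin_compose[OF bimultiD(1)[OF assms(1)] assms(2)]
   hom_compose[OF bimultiD(2)[OF assms(1)] assms(2)])

lemma bimulti_pure:
 assumes "module R D" "\<forall>M\<in>set Ms. module R M"
 shows "bimulti R D Ms (tensor R D (tensors R Ms)) (%d xs. pure R D (tensors R Ms) d (pures R Ms xs))"
proof -
 note b = pure_bilin[OF assms(1) tensors_module[OF assms(2)], unfolded bilin_def]
 note m = pures_multilin[OF assms(2)]
 show ?thesis unfolding bimulti_def
  by (intro conjI ballI multilin_compose[OF m] b[THEN conjunct1, rule_format]
    b[THEN conjunct2, rule_format] multilin_closed[OF m])
qed

lemma bimulti_eqI:
 assumes D: "module R D" and Ms: "\<forall>M\<in>set Ms. module R M" and P: "module R P"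
  and G: "generates R D G" and H: "!!i. i < length Ms ==> generates R (Ms ! i) (H i)"
  and f: "bimulti R D Ms P f" and g: "bimulti R D Ms P g"
  and eq: "!!d xs. [|d \<in> G; length xs = length Ms; \<forall>i<length Ms. xs ! i \<in> H i|] ==> f d xs = g d xs"
  and d: "d \<in> carrier D" and xs: "xs \<in> tuples Ms"
 shows "f d xs = g d xs"
proof -
 have "f d xs = g d xs" if "d \<in> G" for d
 proof -
  have "d \<in> carrier D" using that generates_subset[OF G] by auto
  then show ?thesis by (intro multilin_eqI[OF Ms P H bimultiD(1)[OF f] bimultiD(1)[OF g] eq[OF that] xs])
 qed
 then show ?thesis by (rule mod_hom_eqI[OF G D P bimultiD(2)[OF f xs] bimultiD(2)[OF g xs] _ d])
qed

text \<open>For each \<open>d\<close> the list argument is lifted to the tensor product. The lifts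
  are chosen independently, but they agree with \<open>f\<close> on pure tensors, which generate,
  and this forces linearity in \<open>d\<close>.\<close>

lemma tensor_tensors_lift:
 assumes D: "module R D" and Ms: "\<forall>M\<in>set Ms. module R M" and P: "module R P"
  and f: "bimulti R D Ms P f"
 shows "\<exists>h \<in> mhom (tensor R D (tensors R Ms)) P. \<forall>d\<in>carrier D. \<forall>xs\<in>tuples Ms.
  h (pure R D (tensors R Ms) d (pures R Ms xs)) = f d xs"
proof -
 let ?T = "tensors R Ms"
 have "\<forall>d\<in>carrier D. \<exists>h. h \<in> mhom ?T P \<and> (\<forall>xs\<in>tuples Ms. h (pures R Ms xs) = f d xs)"
  using tensors_lift[OF Ms P] bimultiD(1)[OF f] by blast
 then obtain h where h: "!!d. d \<in> carrier D ==> h d \<in> mhom ?T P"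
  "!!d xs. [|d \<in> carrier D; xs \<in> tuples Ms|] ==> h d (pures R Ms xs) = f d xs"
  by metis
 interpret D: module R D by fact
 interpret P: module R P by fact
 note T = tensors_module[OF Ms]
 have "(%d. h d w) \<in> mhom D P" if w: "w \<in> carrier ?T" for w
 proof (rule mod_homI)
  show "h d w \<in> carrier P" if "d \<in> carrier D" for d using hom_closed[OF h(1)[OF that] w] .
  show "h (d \<oplus>\<^bsub>D\<^esub> e) w = h d w \<oplus>\<^bsub>P\<^esub> h e w" if de: "d \<in> carrier D" "e \<in> carrier D" for d e
  proof (rule mod_hom_eqI[OF tensors_generates_pures[OF Ms] T P _ _ _ w])
   show "h (d \<oplus>\<^bsub>D\<^esub> e) \<in> mhom ?T P" using de by (intro h) simp
   show "(%w. h d w \<oplus>\<^bsub>P\<^esub> h e w) \<in> mhom ?T P" using de by (intro mod_hom_plus P h)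
  qed (use h(2) de mod_hom_add[OF bimultiD(2)[OF f]] in auto)
  show "h (a \<odot>\<^bsub>D\<^esub> d) w = a \<odot>\<^bsub>P\<^esub> h d w" if ad: "a \<in> carrier R" "d \<in> carrier D" for a d
  proof (rule mod_hom_eqI[OF tensors_generates_pures[OF Ms] T P _ _ _ w])
   show "h (a \<odot>\<^bsub>D\<^esub> d) \<in> mhom ?T P" using ad by (intro h) simp
   show "(%w. a \<odot>\<^bsub>P\<^esub> h d w) \<in> mhom ?T P" using ad by (intro mod_hom_scale P h)
  qed (use h(2) ad mod_hom_smult[OF bimultiD(2)[OF f]] in auto)
 qed
 then have "bilin R D ?T P h" using h(1) by (simp add: bilin_def)
 from tensor_lift[OF D T P this] obtain g where g: "g \<in> mhom (tensor R D ?T) P"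
  "!!d w. [|d \<in> carrier D; w \<in> carrier ?T|] ==> g (pure R D ?T d w) = h d w"
  by blast
 show ?thesis by (intro bexI[OF _ g(1)] ballI) (simp add: g(2) h(2) multilin_closed[OF pures_multilin[OF Ms]])
qed

lemma tensor_tensors_generates:
 assumes D: "module R D" and Ms: "\<forall>M\<in>set Ms. module R M" and G: "generates R D G"
  and H: "!!i. i < length Ms ==> generates R (Ms ! i) (H i)"
 shows "generates R (tensor R D (tensors R Ms))
  {pure R D (tensors R Ms) d (pures R Ms xs) | d xs.
   d \<in> G \<and> length xs = length Ms \<and> (\<forall>i<length Ms. xs ! i \<in> H i)}"
proof -
 let ?S = "{xs. length xs = length Ms \<and> (\<forall>i<length Ms. xs ! i \<in> H i)}"
 have "{pure R D (tensors R Ms) d (pures R Ms xs) | d xs.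
   d \<in> G \<and> length xs = length Ms \<and> (\<forall>i<length Ms. xs ! i \<in> H i)} =
  {pure R D (tensors R Ms) d w | d w. d \<in> G \<and> w \<in> pures R Ms ` ?S}"
  by auto
 then show ?thesis using tensor_generates[OF D tensors_module[OF Ms] G tensors_generates[OF Ms H]] by simp
qed

lemma extends_to_lincomb:
 assumes "module R P"
 shows "extends_to R M P X e (%_. \<zero>\<^bsub>P\<^esub>)"
  and "[|extends_to R M P X e \<psi>; extends_to R M P X e \<chi>|] ==> extends_to R M P X e (%x. \<psi> x \<oplus>\<^bsub>P\<^esub> \<chi> x)"
  and "[|extends_to R M P X e \<psi>; a \<in> carrier R|] ==> extends_to R M P X e (%x. a \<odot>\<^bsub>P\<^esub> \<psi> x)"
proof -
 show "extends_to R M P X e (%_. \<zero>\<^bsub>P\<^esub>)"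
  unfolding extends_to_def by (rule bexI[OF _ mod_hom_const_zero[OF assms]]) simp
 show "extends_to R M P X e (%x. \<psi> x \<oplus>\<^bsub>P\<^esub> \<chi> x)"
  if "extends_to R M P X e \<psi>" "extends_to R M P X e \<chi>"
 proof -
  obtain h h' where "h \<in> mhom M P" "\<forall>x\<in>X. h (e x) = \<psi> x" "h' \<in> mhom M P" "\<forall>x\<in>X. h' (e x) = \<chi> x"
   using \<open>extends_to R M P X e \<psi>\<close> \<open>extends_to R M P X e \<chi>\<close> by (auto simp: extends_to_def)
  then show ?thesis unfolding extends_to_def by (intro bexI[OF _ mod_hom_plus[OF assms, of h M h']]) simp_all
 qed
 show "extends_to R M P X e (%x. a \<odot>\<^bsub>P\<^esub> \<psi> x)" if ex: "extends_to R M P X e \<psi>" and a: "a \<in> carrier R"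
 proof -
  obtain h where "h \<in> mhom M P" "\<forall>x\<in>X. h (e x) = \<psi> x"
   using ex by (auto simp: extends_to_def)
  then show ?thesis
   unfolding extends_to_def by (intro bexI[OF _ mod_hom_scale[OF assms, of h M a]]) (use a in auto)
 qed
qed

lemma extends_to_cong:
 "[|extends_to R M P X e \<psi>; !!x. x \<in> X ==> \<chi> x = \<psi> x|] ==> extends_to R M P X e \<chi>"
 by (auto simp: extends_to_def)

text \<open>For fixed \<open>cs\<close> an extension in \<open>d\<close> is determined by its values
  on the generators \<open>e x\<close>; uniqueness carries the multilinearity in \<open>cs\<close>
  from these generators to all of \<open>D\<close>.\<close>

lemma bimulti_extend:
 assumes D: "module R D" and P: "module R P" and Ms: "\<forall>M\<in>set Ms. module R M"
  and gen: "generates R D (e ` X)"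
  and F: "!!x. x \<in> X ==> multilin R Ms P (F x)"
  and ext: "!!cs. cs \<in> tuples Ms ==> extends_to R D P X e (%x. F x cs)"
 shows "\<exists>\<Phi>. bimulti R D Ms P \<Phi> \<and> (\<forall>x\<in>X. \<forall>cs\<in>tuples Ms. \<Phi> (e x) cs = F x cs)"
proof -
 have "\<forall>cs\<in>tuples Ms. \<exists>h. h \<in> mhom D P \<and> (\<forall>x\<in>X. h (e x) = F x cs)"
  using ext by (auto simp: extends_to_def)
 then obtain H where H: "!!cs. cs \<in> tuples Ms ==> H cs \<in> mhom D P"
  "!!cs x. [|cs \<in> tuples Ms; x \<in> X|] ==> H cs (e x) = F x cs"
  by metis
 have "multilin R Ms P (%cs. H cs d)" if d: "d \<in> carrier D" for d unfolding multilin_def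
 proof (intro ballI conjI allI impI)
  fix cs assume cs: "cs \<in> tuples Ms"
  show "H cs d \<in> carrier P" by (rule hom_closed[OF H(1)[OF cs] d])
  fix i assume i: "i < length Ms"
  interpret M: module R "Ms ! i" using Ms i by simp
  note up = tuples_update[OF cs]
  show "(%x. H (cs[i := x]) d) \<in> mhom (Ms ! i) P"
  proof (rule mod_homI)
   show "H (cs[i := x]) d \<in> carrier P" if "x \<in> carrier (Ms ! i)" for x
    by (rule hom_closed[OF H(1)[OF up[OF that]] d])
   show "H (cs[i := x \<oplus>\<^bsub>Ms ! i\<^esub> y]) d = H (cs[i := x]) d \<oplus>\<^bsub>P\<^esub> H (cs[i := y]) d"
    if xy: "x \<in> carrier (Ms ! i)" "y \<in> carrier (Ms ! i)" for x y
   proof (rule mod_hom_eqI[OF gen D P _ _ _ d])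
    show "H (cs[i := x \<oplus>\<^bsub>Ms ! i\<^esub> y]) \<in> mhom D P" using xy by (intro H up) simp
    show "(%d. H (cs[i := x]) d \<oplus>\<^bsub>P\<^esub> H (cs[i := y]) d) \<in> mhom D P"
     using xy by (intro mod_hom_plus P H up)
   qed (use H(2) up xy mod_hom_add[OF multilin_slot[OF F cs i]] in auto)
   show "H (cs[i := a \<odot>\<^bsub>Ms ! i\<^esub> x]) d = a \<odot>\<^bsub>P\<^esub> H (cs[i := x]) d"
    if ax: "a \<in> carrier R" "x \<in> carrier (Ms ! i)" for a x
   proof (rule mod_hom_eqI[OF gen D P _ _ _ d])
    show "H (cs[i := a \<odot>\<^bsub>Ms ! i\<^esub> x]) \<in> mhom D P" using ax by (intro H up) simp
    show "(%d. a \<odot>\<^bsub>P\<^esub> H (cs[i := x]) d) \<in> mhom D P"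
     using ax by (intro mod_hom_scale P H up)
   qed (use H(2) up ax mod_hom_smult[OF multilin_slot[OF F cs i]] in auto)
  qed
 qed
 then have "bimulti R D Ms P (%d cs. H cs d)" using H(1) by (simp add: bimulti_def)
 then show ?thesis using H(2) by blast
qed

text \<open>A function of n generators that extends linearly in each slot separately extends to a multilinear
 map: the first slot is extended last, so the function being extended is generalized.\<close>

lemma multilin_extend:
 assumes C: "module R C" and P: "module R P" and gen: "generates R C (e ` X)"
  and closed: "!!ys. [|length ys = n; set ys <= X|] ==> \<phi> ys \<in> carrier P"
  and ext: "!!ys i. [|length ys = n; i < n; \<forall>j<n. j ~= i --> ys ! j \<in> X|] ==>
   extends_to R C P X e (%x. \<phi> (ys[i := x]))"
 shows "\<exists>f. multilin R (replicate n C) P f \<and> (\<forall>ys. length ys = n --> set ys <= X --> f (map e ys) = \<phi> ys)"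
 using closed ext
proof (induction n arbitrary: \<phi>)
 case 0
 have "multilin R (replicate 0 C) P (%_. \<phi> [])" using 0(1)[of "[]"] by (simp add: multilin_def)
 then show ?case by auto
next
 case (Suc n)
 let ?Ms = "replicate n C"
 have Ms: "\<forall>M\<in>set ?Ms. module R M" using C by simp
 have "\<forall>x\<in>X. \<exists>f. multilin R ?Ms P f \<and>
  (\<forall>ys. length ys = n --> set ys <= X --> f (map e ys) = \<phi> (x # ys))"
 proof
  fix x assume x: "x \<in> X"
  show "\<exists>f. multilin R ?Ms P f \<and>
   (\<forall>ys. length ys = n --> set ys <= X --> f (map e ys) = \<phi> (x # ys))"
  proof (rule Suc.IH)
   show "\<phi> (x # ys) \<in> carrier P" if "length ys = n" "set ys <= X" for ys
    by (rule Suc.prems(1)) (use that x in auto)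
   show "extends_to R C P X e (%y. \<phi> (x # ys[i := y]))"
    if "length ys = n" "i < n" "\<forall>j<n. j ~= i --> ys ! j \<in> X" for ys i
    using Suc.prems(2)[of "x # ys" "Suc i"] that x by (auto simp: nth_Cons split: nat.splits)
  qed
 qed
 then obtain F where F: "!!x. x \<in> X ==> multilin R ?Ms P (F x)"
  "!!x ys. [|x \<in> X; length ys = n; set ys <= X|] ==> F x (map e ys) = \<phi> (x # ys)"
  by metis
 have eX: "e ` X <= carrier C" using generates_subset[OF gen] .
 \<comment> \<open>\<open>ext\<close> speaks about generators in the other slots, while here the
   tail \<open>cs\<close> is arbitrary. The entries in a given slot for which an extension exists
   form a submodule, so one slot of the tail after the other can be freed.\<close>
 have E: "extends_to R C P X e (%x. F x cs)" if cs: "length cs = n" "\<forall>j<n. cs ! j \<in> carrier C" for cs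
  using eX _ _ cs
 proof (rule slot_induct[where G="%_. e ` X"])
  fix cs i
  assume cs: "length cs = n" "\<forall>j<n. cs ! j \<in> carrier C" and i: "i < n"
   and IH: "!!x. x \<in> e ` X ==> extends_to R C P X e (%y. F y (cs[i := x]))"
  have t: "cs \<in> tuples ?Ms" using cs by (simp add: tuples_iff)
  have sl: "(%x. F y (cs[i := x])) \<in> mhom C P" if "y \<in> X" for y
   using multilin_slot[OF F(1)[OF that] t, of i] i by simp
  interpret C: module R C by fact
  note lc = extends_to_lincomb[OF P, of C X e]
  have "submodule {c \<in> carrier C. extends_to R C P X e (%y. F y (cs[i := c]))} R C"
  proof (rule submoduleI'[OF C])
   show "\<zero>\<^bsub>C\<^esub> \<in> {c \<in> carrier C. extends_to R C P X e (%y. F y (cs[i := c]))}"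
    using extends_to_cong[OF lc(1)] mod_hom_zero[OF C P sl] by simp
  next
   fix x y assume xy: "x \<in> {c \<in> carrier C. extends_to R C P X e (%y. F y (cs[i := c]))}"
    "y \<in> {c \<in> carrier C. extends_to R C P X e (%y. F y (cs[i := c]))}"
   have "extends_to R C P X e (%z. F z (cs[i := x \<oplus>\<^bsub>C\<^esub> y]))"
    by (rule extends_to_cong[OF lc(2)[of "%z. F z (cs[i := x])" "%z. F z (cs[i := y])"]])
     (use xy mod_hom_add[OF sl] in auto)
   then show "x \<oplus>\<^bsub>C\<^esub> y \<in> {c \<in> carrier C. extends_to R C P X e (%y. F y (cs[i := c]))}"
    using xy by simp
  next
   fix a x assume ax: "a \<in> carrier R" "x \<in> {c \<in> carrier C. extends_to R C P X e (%y. F y (cs[i := c]))}"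
   have "extends_to R C P X e (%z. F z (cs[i := a \<odot>\<^bsub>C\<^esub> x]))"
    by (rule extends_to_cong[OF lc(3)[of "%z. F z (cs[i := x])" a]])
     (use ax mod_hom_smult[OF sl] in auto)
   then show "a \<odot>\<^bsub>C\<^esub> x \<in> {c \<in> carrier C. extends_to R C P X e (%y. F y (cs[i := c]))}"
    using ax by simp
  qed auto
  from generatesD[OF gen this] have "cs ! i \<in> {c \<in> carrier C. extends_to R C P X e (%y. F y (cs[i := c]))}"
   using eX IH cs i by blast
  then show "extends_to R C P X e (%y. F y cs)" by simp
 next
  fix cs assume cs: "length cs = n" "\<forall>j<n. cs ! j \<in> e ` X"
  then have "\<forall>j<n. \<exists>y. y \<in> X \<and> cs ! j = e y" by auto
  then obtain y where y: "!!j. j < n ==> y j \<in> X \<and> cs ! j = e (y j)" by metis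
  let ?ys = "map y [0..<n]"
  have ys: "cs = map e ?ys" "set ?ys <= X" "length ?ys = n" using y cs by (auto intro!: nth_equalityI)
  \<comment> \<open>The entry at position 0 is overwritten, and \<open>ext\<close> puts no condition
    on the slot that varies, so \<open>undefined\<close> may stand there.\<close>
  have "extends_to R C P X e (%x. \<phi> ((undefined # ?ys)[0 := x]))"
   by (rule Suc.prems(2)) (use y in "auto simp: nth_Cons split: nat.splits")
  then show "extends_to R C P X e (%x. F x cs)"
   by (rule extends_to_cong, unfold ys(1)) (use F(2)[OF _ ys(3) ys(2)] in simp)
 qed
 have "extends_to R C P X e (%x. F x cs)" if "cs \<in> tuples ?Ms" for cs
  using E that by (simp add: tuples_iff)
 from bimulti_extend[OF C P Ms gen F(1) this]
 obtain \<Phi> where \<Phi>: "bimulti R C ?Ms P \<Phi>" "!!x cs. [|x \<in> X; cs \<in> tuples ?Ms|] ==> \<Phi> (e x) cs = F x cs"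
  by blast
 have "multilin R (replicate (Suc n) C) P (%xs. \<Phi> (hd xs) (tl xs))" unfolding multilin_def
 proof (intro ballI conjI allI impI)
  fix xs assume "xs \<in> tuples (replicate (Suc n) C)"
  then obtain c cs where xs: "xs = c # cs" "c \<in> carrier C" "cs \<in> tuples ?Ms"
   by (cases xs) (auto simp: tuples_Cons tuples_def)
  show "\<Phi> (hd xs) (tl xs) \<in> carrier P" using multilin_closed[OF bimultiD(1)[OF \<Phi>(1)]] xs by simp
  fix i assume i: "i < length (replicate (Suc n) C)"
  show "(%x. \<Phi> (hd (xs[i := x])) (tl (xs[i := x]))) \<in> mhom (replicate (Suc n) C ! i) P"
  proof (cases i)
   case 0 then show ?thesis using bimultiD(2)[OF \<Phi>(1) xs(3)] xs(1) by simp
  next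
   case (Suc j)
   then show ?thesis using multilin_slot[OF bimultiD(1)[OF \<Phi>(1) xs(2)] xs(3), of j] xs(1) i by simp
  qed
 qed
 moreover have "\<Phi> (hd (map e ys)) (tl (map e ys)) = \<phi> ys" if ys: "length ys = Suc n" "set ys <= X" for ys
 proof -
  obtain y zs where yz: "ys = y # zs" "length zs = n" "y \<in> X" "set zs <= X" using ys by (cases ys) auto
  moreover have "map e zs \<in> tuples ?Ms" using yz eX by (auto simp: tuples_replicate)
  ultimately show ?thesis using \<Phi>(2) F(2) by simp
 qed
 ultimately show ?case by blast
qed

end

section \<open>Block permutations\<close>

lemma permutes_inv_compose:
 assumes "\<sigma> permutes S" "\<tau> permutes S"
 shows "inv_into UNIV (\<sigma> o \<tau>) = inv_into UNIV \<tau> o inv_into UNIV \<sigma>"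
 using o_inv_distrib[OF permutes_bij[OF assms(1)] permutes_bij[OF assms(2)]] .

lemma length_move [simp]: "length (move \<sigma> xs) = length xs"
 by (simp add: move_def)

lemma move_Nil [simp]: "move \<sigma> [] = []"
 by (simp add: move_def)

lemma move_id [simp]: "move id xs = xs"
 by (simp add: move_def)

text \<open>\<open>permute_list\<close> is a right action; the inverse in \<open>move\<close> turns
  it into a left action.\<close>

lemma move_compose:
 assumes "\<sigma> permutes {..<length xs}" "\<tau> permutes {..<length xs}"
 shows "move (\<sigma> o \<tau>) xs = move \<sigma> (move \<tau> xs)"
 unfolding move_def permutes_inv_compose[OF assms]
 by (rule permute_list_compose) (rule permutes_inv[OF assms(1)])

lemma move_map:
 assumes "\<sigma> permutes {..<length xs}"
 shows "move \<sigma> (map f xs) = map f (move \<sigma> xs)"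
 unfolding move_def by (rule permute_list_map[OF permutes_inv[OF assms]])

lemma set_move: "\<sigma> permutes {..<length xs} ==> set (move \<sigma> xs) = set xs"
 unfolding move_def by (rule set_permute_list[OF permutes_inv])

lemma move_map2:
 assumes "\<sigma> permutes {..<length xs}" "length xs = length ys"
 shows "move \<sigma> (map2 f xs ys) = map2 f (move \<sigma> xs) (move \<sigma> ys)"
proof -
 have "move \<sigma> (zip xs ys) = zip (move \<sigma> xs) (move \<sigma> ys)"
  unfolding move_def by (rule permute_list_zip[OF permutes_inv[OF assms(1)]]) (use assms in auto)
 moreover have "move \<sigma> (map2 f xs ys) = map (case_prod f) (move \<sigma> (zip xs ys))"
  by (rule move_map) (use assms in simp)
 ultimately show ?thesis by simp
qed

lemma nth_move:
 assumes "\<sigma> permutes {..<length xs}" "i < length xs"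
 shows "move \<sigma> xs ! (\<sigma> i) = xs ! i"
 using permutes_in_image[OF assms(1), of i] assms(2) permutes_inverses(2)[OF assms(1)]
 by (simp add: move_def permute_list_nth[OF permutes_inv[OF assms(1)]])

text \<open>Describes the moved list by where each entry goes, which avoids computing inverse
  permutations.\<close>

lemma move_unique:
 assumes "\<sigma> permutes {..<length xs}" "length ys = length xs"
  and "!!i. i < length xs ==> ys ! (\<sigma> i) = xs ! i"
 shows "move \<sigma> xs = ys"
proof (rule nth_equalityI)
 fix j assume "j < length (move \<sigma> xs)"
 then have j: "j < length xs" by simp
 then obtain i where i: "j = \<sigma> i" "i < length xs"
  using permutes_in_image[OF permutes_inv[OF assms(1)], of j] permutes_inverses(1)[OF assms(1), of j]
  by (metis lessThan_iff)
 then show "move \<sigma> xs ! j = ys ! j" using nth_move[OF assms(1) i(2)] assms(3) by simp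
qed (use assms in simp)

text \<open>The entries of \<open>[0..<n]\<close> are distinct, so the position at which
  \<open>i\<close> ends up determines the value of the permutation at \<open>i\<close>.\<close>

lemma move_inject:
 assumes "\<sigma> permutes {..<n}" "\<tau> permutes {..<n}" "move \<sigma> [0..<n] = move \<tau> [0..<n]"
 shows "\<sigma> = \<tau>"
proof
 fix i
 have len: "length [0..<n] = n" by simp
 show "\<sigma> i = \<tau> i"
 proof (cases "i < n")
  case True
  have s: "\<sigma> i < n" "\<tau> i < n"
   using True permutes_in_image[OF assms(1), of i] permutes_in_image[OF assms(2), of i] by auto
  have "move \<tau> [0..<n] ! (\<tau> i) = i" "move \<sigma> [0..<n] ! (\<sigma> i) = i"
   using nth_move[of \<tau> "[0..<n]" i] nth_move[of \<sigma> "[0..<n]" i] assms True by simp_all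
  moreover have "distinct (move \<tau> [0..<n])" using assms permutes_inv[OF assms(2)] by (simp add: move_def)
  ultimately show ?thesis using s assms(3) by (metis length_move len nth_eq_iff_index_eq)
 next
  case False
  then show ?thesis using permutes_not_in[OF assms(1), of i] permutes_not_in[OF assms(2), of i] by auto
 qed
qed

lemma split_concat: "length xs = sum_list ks ==> \<exists>xss. map length xss = ks \<and> concat xss = xs"
proof (induction ks arbitrary: xs)
 case (Cons k ks)
 then obtain xss where "map length xss = ks" "concat xss = drop k xs" by (metis add_diff_cancel_left' length_drop sum_list.Cons)
 then show ?case using Cons.prems by (intro exI[of _ "take k xs # xss"]) simp
qed simp

text \<open>Identities of block permutations are tested on concatenations, where both sides merely
  rearrange inner lists. This replaces arithmetic with positions.\<close>

lemma perm_eq_by_concat: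
 assumes "\<sigma> permutes {..<sum_list ks}" "\<tau> permutes {..<sum_list ks}"
  and "!!xss :: nat list list. map length xss = ks ==> move \<sigma> (concat xss) = move \<tau> (concat xss)"
 shows "\<sigma> = \<tau>"
 using split_concat[of "[0..<sum_list ks]" ks] assms move_inject[OF assms(1,2)] by force

section \<open>Positions within blocks\<close>

definition offset :: "nat list => nat => nat"
 where "offset ks i = sum_list (take i ks)"

lemma offset_Suc: "i < length ks ==> offset ks (Suc i) = offset ks i + ks ! i"
 by (simp add: offset_def take_Suc_conv_app_nth)

lemma offset_mono: "i <= j ==> offset ks i <= offset ks j"
 by (metis offset_def le_add1 le_Suc_ex sum_list_append take_add)

lemma offset_less: "[|i < length ks; x < ks ! i|] ==> offset ks i + x < sum_list ks"
 using offset_mono[of "Suc i" "length ks" ks] offset_Suc[of i ks] by (simp add: offset_def)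

lemma block_of_offset:
 assumes "i < length ks" "x < ks ! i"
 shows "block_of ks (offset ks i + x) = i"
 unfolding block_of_def
proof (rule Least_equality)
 show "offset ks i + x < sum_list (take (Suc i) ks)" using assms offset_Suc[of i ks] by (simp add: offset_def)
 fix j assume "offset ks i + x < sum_list (take (Suc j) ks)"
 then have "offset ks i + x < offset ks (Suc j)" by (simp add: offset_def)
 then show "i <= j" using offset_mono[of "Suc j" i ks] by (metis le_add1 le_trans not_less not_less_eq_eq)
qed

lemma offset_cases:
 assumes "y < sum_list ks"
 obtains i x where "i < length ks" "x < ks ! i" "y = offset ks i + x"
proof -
 have "\<exists>i<length ks. \<exists>x<ks ! i. y = offset ks i + x" using assms
 proof (induction ks rule: rev_induct)
  case (snoc k ks)
  show ?case
  proof (cases "y < sum_list ks")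
   case True
   then obtain i x where "i < length ks" "x < ks ! i" "y = offset ks i + x" using snoc.IH by auto
   then show ?thesis by (intro exI[of _ i] conjI exI[of _ x]) (auto simp: offset_def nth_append)
  next
   case False
   then show ?thesis using snoc.prems
    by (intro exI[of _ "length ks"] conjI exI[of _ "y - sum_list ks"]) (auto simp: offset_def)
  qed
 qed simp
 then show thesis using that by blast
qed

lemma nth_concat_offset:
 "[|i < length xss; x < length (xss ! i)|] ==> concat xss ! (offset (map length xss) i + x) = xss ! i ! x"
proof (induction xss arbitrary: i)
 case (Cons xs xss)
 then show ?case by (cases i) (auto simp: offset_def nth_append)
qed simp

text \<open>\<open>block_perm\<close> adds up the sizes of the blocks placed earlier by
  \<open>\<sigma>\<close>; this identifies the sum as the start of block \<open>\<sigma> i\<close>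
  in the rearranged list of sizes.\<close>

lemma offset_move:
 assumes "\<sigma> permutes {..<length ks}" "i < length ks"
 shows "offset (move \<sigma> ks) (\<sigma> i) = (\<Sum>l | l < length ks \<and> \<sigma> l < \<sigma> i. ks ! l)"
proof -
 have s: "\<sigma> i < length ks" using permutes_in_image[OF assms(1), of i] assms(2) by simp
 have "offset (move \<sigma> ks) (\<sigma> i) = (\<Sum>j<\<sigma> i. move \<sigma> ks ! j)"
  using s by (simp add: offset_def sum_list_sum_nth atLeast0LessThan)
 also have "... = (\<Sum>l | l < length ks \<and> \<sigma> l < \<sigma> i. move \<sigma> ks ! \<sigma> l)"
 proof (rule sum.reindex_cong[of \<sigma>])
  show "inj_on \<sigma> {l. l < length ks \<and> \<sigma> l < \<sigma> i}" using permutes_inj[OF assms(1)] by (rule inj_on_subset) simp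
  show "{..<\<sigma> i} = \<sigma> ` {l. l < length ks \<and> \<sigma> l < \<sigma> i}"
  proof (intro equalityI subsetI)
   fix j assume j: "j \<in> {..<\<sigma> i}"
   then have "inv_into UNIV \<sigma> j < length ks"
    using s permutes_in_image[OF permutes_inv[OF assms(1)], of j] by simp
   then show "j \<in> \<sigma> ` {l. l < length ks \<and> \<sigma> l < \<sigma> i}"
    using j permutes_inverses(1)[OF assms(1), of j] by (intro image_eqI[of _ _ "inv_into UNIV \<sigma> j"]) auto
  qed auto
 qed simp
 also have "... = (\<Sum>l | l < length ks \<and> \<sigma> l < \<sigma> i. ks ! l)"
  by (rule sum.cong) (auto simp: nth_move[OF assms(1)])
 finally show ?thesis .
qed

lemma block_perm_offset:
 assumes "\<sigma> permutes {..<length ks}" "i < length ks" "x < ks ! i"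
 shows "block_perm \<sigma> ks (offset ks i + x) = offset (move \<sigma> ks) (\<sigma> i) + x"
 using offset_less[OF assms(2,3)] block_of_offset[OF assms(2,3)] offset_move[OF assms(1,2)]
 by (simp add: block_perm_def offset_def Let_def)

lemma sum_list_move: "\<sigma> permutes {..<length ks} ==> sum_list (move \<sigma> (ks :: nat list)) = sum_list ks"
 unfolding move_def by (metis mset_permute_list permutes_inv sum_mset_sum_list)

lemma inj_endo_permutes:
 fixes f :: "nat => nat"
 assumes "inj_on f {..<n}" "!!x. x < n ==> f x < n" "!!x. \<not> x < n ==> f x = x"
 shows "f permutes {..<n}"
proof (rule bij_imp_permutes)
 have "f ` {..<n} = {..<n}" by (rule endo_inj_surj) (use assms in auto)
 then show "bij_betw f {..<n} {..<n}" using assms(1) by (simp add: bij_betw_def)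
qed (use assms(3) in auto)

lemma block_perm_permutes:
 assumes \<sigma>: "\<sigma> permutes {..<length ks}"
 shows "block_perm \<sigma> ks permutes {..<sum_list ks}"
proof -
 have \<sigma>i: "\<sigma> i < length ks" if "i < length ks" for i
  using permutes_in_image[OF \<sigma>, of i] that by simp
 have lt: "block_perm \<sigma> ks y < sum_list ks" if y: "y < sum_list ks" for y
 proof -
  obtain i x where ix: "i < length ks" "x < ks ! i" "y = offset ks i + x" by (rule offset_cases[OF y])
  then show ?thesis
   using block_perm_offset[OF \<sigma> ix(1,2)] offset_less[of "\<sigma> i" "move \<sigma> ks" x] \<sigma>i nth_move[OF \<sigma> ix(1)]
    sum_list_move[OF \<sigma>] by simp
 qed
 have "inj_on (block_perm \<sigma> ks) {..<sum_list ks}"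
 proof (rule inj_onI)
  fix y y' assume y: "y \<in> {..<sum_list ks}" and y': "y' \<in> {..<sum_list ks}"
   and eq: "block_perm \<sigma> ks y = block_perm \<sigma> ks y'"
  obtain i x where ix: "i < length ks" "x < ks ! i" "y = offset ks i + x" using y by (auto elim: offset_cases)
  obtain i' x' where ix': "i' < length ks" "x' < ks ! i'" "y' = offset ks i' + x'"
   using y' by (auto elim: offset_cases)
  have e: "offset (move \<sigma> ks) (\<sigma> i) + x = offset (move \<sigma> ks) (\<sigma> i') + x'"
   using eq block_perm_offset[OF \<sigma> ix(1,2)] block_perm_offset[OF \<sigma> ix'(1,2)] ix ix' by simp
  have "\<sigma> i = \<sigma> i'"
   using block_of_offset[of "\<sigma> i" "move \<sigma> ks" x] block_of_offset[of "\<sigma> i'" "move \<sigma> ks" x']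
    \<sigma>i ix ix' nth_move[OF \<sigma>] e by simp
  then have "i = i'" using permutes_inj[OF \<sigma>] by (simp add: inj_eq)
  then show "y = y'" using e ix ix' by simp
 qed
 then show ?thesis by (rule inj_endo_permutes) (simp_all add: lt, simp add: block_perm_def)
qed

text \<open>The form in which block permutations are mostly used from here on: they permute the
  inner lists of a concatenation.\<close>

lemma move_block_perm:
 assumes \<sigma>: "\<sigma> permutes {..<length xss}"
 shows "move (block_perm \<sigma> (map length xss)) (concat xss) = concat (move \<sigma> xss)"
proof (rule move_unique)
 let ?ks = "map length xss"
 have \<sigma>': "\<sigma> permutes {..<length ?ks}" using \<sigma> by simp
 have len: "length (concat xss) = sum_list ?ks" by (simp add: length_concat)
 show "block_perm \<sigma> ?ks permutes {..<length (concat xss)}"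
  unfolding len by (rule block_perm_permutes[OF \<sigma>'])
 have mm: "map length (move \<sigma> xss) = move \<sigma> ?ks" using move_map[OF \<sigma>, of length] by simp
 show "length (concat (move \<sigma> xss)) = length (concat xss)"
  unfolding length_concat mm using sum_list_move[OF \<sigma>'] by simp
 fix y assume "y < length (concat xss)"
 then obtain i x where ix: "i < length ?ks" "x < ?ks ! i" "y = offset ?ks i + x"
  unfolding len by (rule offset_cases)
 have \<sigma>i: "\<sigma> i < length xss" using permutes_in_image[OF \<sigma>, of i] ix(1) by simp
 have "concat (move \<sigma> xss) ! (offset (map length (move \<sigma> xss)) (\<sigma> i) + x) = move \<sigma> xss ! \<sigma> i ! x"
  by (rule nth_concat_offset) (use \<sigma>i ix nth_move[OF \<sigma>, of i] in auto)
 also have "... = concat xss ! y" using nth_concat_offset[of i xss x] ix nth_move[OF \<sigma>, of i] by simp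
 finally show "concat (move \<sigma> xss) ! block_perm \<sigma> ?ks y = concat xss ! y"
  using block_perm_offset[OF \<sigma>' ix(1,2)] ix(3) mm by simp
qed

section \<open>Juxtaposed permutations\<close>

lemma perm_sum_permutes:
 assumes "\<sigma> permutes {..<k}" "\<tau> permutes {..<l}"
 shows "perm_sum k \<sigma> \<tau> permutes {..<k + l}"
proof -
 have s: "x < k ==> \<sigma> x < k" "x < l ==> \<tau> x < l" for x
  using permutes_in_image[OF assms(1), of x] permutes_in_image[OF assms(2), of x] by auto
 have "inj_on (perm_sum k \<sigma> \<tau>) {..<k + l}"
 proof (rule inj_onI)
  fix x y assume "perm_sum k \<sigma> \<tau> x = perm_sum k \<sigma> \<tau> y"
  then show "x = y" using s(1)[of x] s(1)[of y] inj_eq[OF permutes_inj[OF assms(1)], of x y]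
    inj_eq[OF permutes_inj[OF assms(2)], of "x - k" "y - k"]
   by (auto simp: perm_sum_def split: if_splits)
 qed
 moreover have "perm_sum k \<sigma> \<tau> x < k + l" if "x < k + l" for x
  using s(1)[of x] s(2)[of "x - k"] that by (auto simp: perm_sum_def)
 moreover have "perm_sum k \<sigma> \<tau> x = x" if "\<not> x < k + l" for x
  using that permutes_not_in[OF assms(2), of "x - k"] by (auto simp: perm_sum_def)
 ultimately show ?thesis by (rule inj_endo_permutes)
qed

lemma move_perm_sum:
 assumes "\<sigma> permutes {..<length xs}" "\<tau> permutes {..<length ys}"
 shows "move (perm_sum (length xs) \<sigma> \<tau>) (xs @ ys) = move \<sigma> xs @ move \<tau> ys"
proof (rule move_unique)
 show "perm_sum (length xs) \<sigma> \<tau> permutes {..<length (xs @ ys)}"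
  using perm_sum_permutes[OF assms] by simp
 fix i assume i: "i < length (xs @ ys)"
 show "(move \<sigma> xs @ move \<tau> ys) ! perm_sum (length xs) \<sigma> \<tau> i = (xs @ ys) ! i"
  using i permutes_in_image[OF assms(1), of i] nth_move[OF assms(1), of i] nth_move[OF assms(2), of "i - length xs"]
  by (auto simp: perm_sum_def nth_append)
qed simp

lemma perm_sums_simps [simp]:
 "perm_sums [] \<tau>s = id" "perm_sums (k # ks) (\<tau> # \<tau>s) = perm_sum k \<tau> (perm_sums ks \<tau>s)"
 by (simp_all add: perm_sums_def)

lemma perm_sums_permutes:
 "perms \<tau>s ks ==> perm_sums ks \<tau>s permutes {..<sum_list ks}"
 by (induction rule: list_all2_induct) (auto intro: perm_sum_permutes permutes_id)

lemma move_perm_sums: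
 "list_all2 (%\<tau> xs. \<tau> permutes {..<length xs}) \<tau>s xss ==>
  move (perm_sums (map length xss) \<tau>s) (concat xss) = concat (map2 move \<tau>s xss)"
proof (induction rule: list_all2_induct)
 case (Cons \<tau> \<tau>s xs xss)
 have "perm_sums (map length xss) \<tau>s permutes {..<length (concat xss)}"
  using perm_sums_permutes[of \<tau>s "map length xss"] Cons.hyps
  by (simp add: list_all2_map2 length_concat)
 then show ?case using Cons move_perm_sum[of \<tau> xs] by simp
qed simp

section \<open>Identities between block permutations\<close>

lemma concat_concat_map: "concat (map concat xsss) = concat (concat xsss)"
 by (induction xsss) simp_all

lemma block_perm_id: "block_perm id ks = id"
proof (rule perm_eq_by_concat[of _ ks])
 show "block_perm id ks permutes {..<sum_list ks}" by (rule block_perm_permutes) (rule permutes_id)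
 show "move (block_perm id ks) (concat xss) = move id (concat xss)" if "map length xss = ks" for xss :: "nat list list"
  using move_block_perm[of id xss] that permutes_id by auto
qed (rule permutes_id)

text \<open>\<open>\<sigma>\<close> meets the blocks in the order in which \<open>\<tau>\<close> has
  left them, whence the sizes \<open>move \<tau> ks\<close>.\<close>

lemma block_perm_compose:
 assumes \<sigma>: "\<sigma> permutes {..<length ks}" and \<tau>: "\<tau> permutes {..<length ks}"
 shows "block_perm (\<sigma> o \<tau>) ks = block_perm \<sigma> (move \<tau> ks) o block_perm \<tau> ks"
proof (rule perm_eq_by_concat)
 have \<sigma>': "\<sigma> permutes {..<length (move \<tau> ks)}" using \<sigma> by simp
 note p = block_perm_permutes[OF \<sigma>', unfolded sum_list_move[OF \<tau>]] block_perm_permutes[OF \<tau>]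
 show "block_perm (\<sigma> o \<tau>) ks permutes {..<sum_list ks}"
  by (rule block_perm_permutes[OF permutes_compose[OF \<tau> \<sigma>]])
 show "block_perm \<sigma> (move \<tau> ks) o block_perm \<tau> ks permutes {..<sum_list ks}"
  by (rule permutes_compose[OF p(2,1)])
 fix xss :: "nat list list" assume ks: "map length xss = ks"
 have len: "length xss = length ks" "length (concat xss) = sum_list ks" using ks by (auto simp: length_concat)
 have mk: "move \<tau> ks = map length (move \<tau> xss)"
  using move_map[of \<tau> xss length] \<tau> len ks by simp
 have "move (block_perm \<sigma> (move \<tau> ks) o block_perm \<tau> ks) (concat xss) =
  move (block_perm \<sigma> (move \<tau> ks)) (concat (move \<tau> xss))"
  using move_compose[of _ "concat xss"] p len move_block_perm[of \<tau> xss] \<tau> ks by simp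
 also have "... = concat (move \<sigma> (move \<tau> xss))"
  unfolding mk by (rule move_block_perm) (use \<sigma> len in simp)
 also have "... = concat (move (\<sigma> o \<tau>) xss)"
  using move_compose[of \<sigma> xss \<tau>] \<sigma> \<tau> len by simp
 also have "... = move (block_perm (\<sigma> o \<tau>) ks) (concat xss)"
  using move_block_perm[of "\<sigma> o \<tau>" xss] permutes_compose[OF \<tau> \<sigma>] len ks by simp
 finally show "move (block_perm (\<sigma> o \<tau>) ks) (concat xss) =
  move (block_perm \<sigma> (move \<tau> ks) o block_perm \<tau> ks) (concat xss)" by simp
qed

text \<open>Acting inside the blocks before or after moving them comes to the same if each inner
  permutation travels with its block. This exchange law is behind the outer equivariance of the
  operad.\<close>

lemma block_perm_perm_sums:
 assumes \<sigma>: "\<sigma> permutes {..<length ks}" and \<tau>s: "perms \<tau>s ks"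
 shows "block_perm \<sigma> ks o perm_sums ks \<tau>s = perm_sums (move \<sigma> ks) (move \<sigma> \<tau>s) o block_perm \<sigma> ks"
proof (rule perm_eq_by_concat)
 have lt: "length \<tau>s = length ks" using list_all2_lengthD[OF \<tau>s] .
 have \<tau>s': "perms (move \<sigma> \<tau>s) (move \<sigma> ks)" unfolding move_def
  by (rule list_all2_permute_list_iff[THEN iffD2]) (use \<tau>s permutes_inv[OF \<sigma>] lt in simp_all)
 note p = block_perm_permutes[OF \<sigma>] perm_sums_permutes[OF \<tau>s] perm_sums_permutes[OF \<tau>s', unfolded sum_list_move[OF \<sigma>]]
 show "block_perm \<sigma> ks o perm_sums ks \<tau>s permutes {..<sum_list ks}"
  by (rule permutes_compose[OF p(2,1)])
 show "perm_sums (move \<sigma> ks) (move \<sigma> \<tau>s) o block_perm \<sigma> ks permutes {..<sum_list ks}"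
  by (rule permutes_compose[OF p(1,3)])
 fix xss :: "nat list list" assume ks: "map length xss = ks"
 have len: "length xss = length ks" "length (concat xss) = sum_list ks" using ks by (auto simp: length_concat)
 have \<tau>x: "list_all2 (%\<tau> xs. \<tau> permutes {..<length xs}) \<tau>s xss"
  using \<tau>s unfolding ks[symmetric] by (simp only: list_all2_map2)
 have \<tau>m: "list_all2 (%\<tau> xs. \<tau> permutes {..<length xs}) (move \<sigma> \<tau>s) (move \<sigma> xss)"
  using \<tau>s' unfolding ks[symmetric] move_map[OF \<sigma>[folded len(1)], of length] by (simp only: list_all2_map2)
 have ml: "map length (map2 move \<tau>s xss) = ks"
  unfolding ks[symmetric] by (rule nth_equalityI) (use lt len in simp_all)
 have "move (block_perm \<sigma> ks o perm_sums ks \<tau>s) (concat xss) = move (block_perm \<sigma> ks) (concat (map2 move \<tau>s xss))"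
  using move_compose[of _ "concat xss"] p len move_perm_sums[OF \<tau>x] ks by simp
 also have "... = concat (move \<sigma> (map2 move \<tau>s xss))"
  using move_block_perm[of \<sigma> "map2 move \<tau>s xss", unfolded ml] \<sigma> lt len by simp
 also have "... = concat (map2 move (move \<sigma> \<tau>s) (move \<sigma> xss))"
  using move_map2[of \<sigma> \<tau>s xss move] \<sigma> lt len by simp
 also have "... = move (perm_sums (move \<sigma> ks) (move \<sigma> \<tau>s)) (concat (move \<sigma> xss))"
  using move_perm_sums[OF \<tau>m] move_map[of \<sigma> xss length] \<sigma> len ks by simp
 also have "... = move (perm_sums (move \<sigma> ks) (move \<sigma> \<tau>s) o block_perm \<sigma> ks) (concat xss)"
  using move_compose[of _ "concat xss"] p len move_block_perm[of \<sigma> xss] \<sigma> ks by simp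
 finally show "move (block_perm \<sigma> ks o perm_sums ks \<tau>s) (concat xss) =
  move (perm_sums (move \<sigma> ks) (move \<sigma> \<tau>s) o block_perm \<sigma> ks) (concat xss)" .
qed

lemma perm_sums_compose:
 assumes "perms \<tau>s ks" "perms \<rho>s ks"
 shows "perm_sums ks (map2 (o) \<tau>s \<rho>s) = perm_sums ks \<tau>s o perm_sums ks \<rho>s"
 using assms
proof (induction arbitrary: \<rho>s rule: list_all2_induct)
 case (Cons \<tau> \<tau>s k ks)
 then obtain \<rho> \<rho>s' where \<rho>: "\<rho>s = \<rho> # \<rho>s'" "\<rho> permutes {..<k}" "perms \<rho>s' ks"
  by (auto simp: list_all2_Cons2)
 have "\<rho> x < k" if "x < k" for x using permutes_in_image[OF \<rho>(2), of x] that by simp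
 then show ?case using Cons.IH[OF \<rho>(3)] by (auto simp: \<rho>(1) perm_sum_def)
qed simp

lemma sum_list_concat: "sum_list (concat kss) = sum_list (map sum_list kss)"
 by (induction kss) simp_all

lemma block_perm_concat:
 assumes \<sigma>: "\<sigma> permutes {..<length jss}"
 shows "block_perm (block_perm \<sigma> (map length jss)) (concat jss) = block_perm \<sigma> (map sum_list jss)"
proof (rule perm_eq_by_concat)
 let ?ks = "map length jss"
 have \<sigma>': "block_perm \<sigma> ?ks permutes {..<length (concat jss)}"
  using block_perm_permutes[of \<sigma> ?ks] \<sigma> by (simp add: length_concat)
 show "block_perm (block_perm \<sigma> ?ks) (concat jss) permutes {..<sum_list (concat jss)}"
  by (rule block_perm_permutes[OF \<sigma>'])
 show "block_perm \<sigma> (map sum_list jss) permutes {..<sum_list (concat jss)}"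
  using block_perm_permutes[of \<sigma> "map sum_list jss"] \<sigma> by (simp add: sum_list_concat)
 fix xss :: "nat list list" assume xss: "map length xss = concat jss"
 \<comment> \<open>\<open>xss\<close> is itself a concatenation of groups; on the threefold nested
   list both sides permute the outermost level.\<close>
 then obtain xsss where xsss: "map length xsss = ?ks" "concat xsss = xss"
  using split_concat[of xss ?ks] by (metis length_concat length_map)
 have l: "length xsss = length jss" using xsss(1) by (metis length_map)
 have "length (xsss ! i) = length (jss ! i)" if "i < length jss" for i
  using arg_cong[OF xsss(1), of "%l. l ! i"] that l by simp
 moreover have "concat (map (map length) xsss) = concat jss"
  using xss unfolding xsss(2)[symmetric] map_concat .
 ultimately have "map (map length) xsss = jss"
  using l by (intro concat_injective) (auto simp: zip_map1 set_zip)
 then have s: "map length (map concat xsss) = map sum_list jss" by (auto simp: length_concat comp_def)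
 have "move (block_perm (block_perm \<sigma> ?ks) (concat jss)) (concat xss) = concat (move (block_perm \<sigma> ?ks) xss)"
  using move_block_perm[of "block_perm \<sigma> ?ks" xss] \<sigma>' xss by (metis length_map)
 also have "... = concat (concat (move \<sigma> xsss))"
  using move_block_perm[of \<sigma> xsss] \<sigma> xsss l by simp
 also have "... = concat (move \<sigma> (map concat xsss))"
  using move_map[of \<sigma> xsss concat] \<sigma> l by (simp add: concat_concat_map)
 also have "... = move (block_perm \<sigma> (map sum_list jss)) (concat xss)"
  using move_block_perm[of \<sigma> "map concat xsss"] \<sigma> s l xsss(2) by (simp add: concat_concat_map)
 finally show "move (block_perm (block_perm \<sigma> ?ks) (concat jss)) (concat xss) =
  move (block_perm \<sigma> (map sum_list jss)) (concat xss)" .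
qed

section \<open>The category \<open>\<Delta>S\<^sub>+\<close> through its action on lists\<close>

definition fibre :: "(nat => nat) => nat => nat => nat list"
 where "fibre \<phi> p i = filter (%j. \<phi> j = i) [0..<p]"

text \<open>The effect of a morphism on a list: the entries are sorted into ordered groups, without being
 multiplied.  A morphism is determined by it, and composition becomes composition in the list monad.\<close>

definition act :: "ds_mor => 'x list => 'x list list"
 where "act f xs = map (%i. map (%j. xs ! dperm f j) (fibre (dmap f) (dsrc f) i)) [0..<dtgt f]"

lemma set_fibre: "set (fibre \<phi> p i) = {j. j < p \<and> \<phi> j = i}"
 by (auto simp: fibre_def)

lemma length_fibre: "length (fibre \<phi> p i) = card {j. j < p \<and> \<phi> j = i}"
 unfolding set_fibre[symmetric] by (rule distinct_card[symmetric]) (simp add: fibre_def)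

lemma sorted_fibre: "sorted_wrt (<) (fibre \<phi> p i)"
 by (simp add: fibre_def sorted_wrt_filter)

lemma filter_less_Suc:
 "sorted_wrt (%x y. \<phi> x <= \<phi> y) xs ==>
  filter (%j. \<phi> j < Suc k) xs = filter (%j. \<phi> j < k) xs @ filter (%j. \<phi> j = k) xs"
proof (induction xs)
 case (Cons a xs)
 show ?case
 proof (cases "\<phi> a < k")
  case False
  then have "filter (%j. \<phi> j < k) xs = []" using Cons.prems by (auto simp: filter_empty_conv)
  then show ?thesis using Cons False by auto
 qed (use Cons in auto)
qed simp

lemma ds_mapsD:
 assumes "\<phi> \<in> ds_maps p q"
 shows "j < p ==> \<phi> j < q" "[|i <= j; j < p|] ==> \<phi> i <= \<phi> j" "\<phi> \<in> extensional {..<p}"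
 using assms by (auto simp: ds_maps_def PiE_def Pi_def monotone_on_def)

text \<open>Monotonicity enters here: the fibres over 0, 1, 2 and so on are consecutive runs of the
  source.\<close>

lemma concat_fibres:
 assumes "\<phi> \<in> ds_maps p q"
 shows "concat (map (fibre \<phi> p) [0..<q]) = [0..<p]"
proof -
 have s: "sorted_wrt (%x y. \<phi> x <= \<phi> y) [0..<p]"
  using ds_mapsD(2)[OF assms] by (auto simp: sorted_wrt_iff_nth_less)
 have "concat (map (fibre \<phi> p) [0..<k]) = filter (%j. \<phi> j < k) [0..<p]" for k
  by (induction k) (simp_all add: filter_less_Suc[OF s] fibre_def)
 also have "filter (%j. \<phi> j < q) [0..<p] = [0..<p]"
  using ds_mapsD(1)[OF assms] by (simp add: filter_id_conv)
 finally show ?thesis .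
qed

text \<open>The list of values of a monotone map repeats each \<open>i\<close> as often as its fibre
  has elements, so the sizes of the fibres determine the map. This gives uniqueness for
  \<open>twist_map\<close>.\<close>

lemma ds_maps_eqI:
 assumes "\<phi> \<in> ds_maps p q" "\<psi> \<in> ds_maps p q"
  and "!!i. i < q ==> length (fibre \<phi> p i) = length (fibre \<psi> p i)"
 shows "\<phi> = \<psi>"
proof -
 have m: "map \<phi> [0..<p] = concat (map (%i. replicate (length (fibre \<phi> p i)) i) [0..<q])"
  if "\<phi> \<in> ds_maps p q" for \<phi>
 proof -
  have "map \<phi> (fibre \<phi> p i) = replicate (length (fibre \<phi> p i)) i" for i
   by (rule replicate_eqI) (auto simp: set_fibre)
  then have "map \<phi> (concat (map (fibre \<phi> p) [0..<q])) =
    concat (map (%i. replicate (length (fibre \<phi> p i)) i) [0..<q])"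
   by (simp add: map_concat comp_def)
  then show ?thesis unfolding concat_fibres[OF that] .
 qed
 have "map \<phi> [0..<p] = map \<psi> [0..<p]" unfolding m[OF assms(1)] m[OF assms(2)]
  by (intro arg_cong[of _ _ concat] map_cong refl) (use assms(3) in auto)
 then have "\<forall>j<p. \<phi> j = \<psi> j" by simp
 then show ?thesis
  using ds_mapsD(3)[OF assms(1)] ds_mapsD(3)[OF assms(2)] by (intro extensionalityI[of _ "{..<p}"]) auto
qed

section \<open>The twisted maps and the composition\<close>

lemma sorted_less_unique:
 fixes xs ys :: "nat list"
 assumes "sorted_wrt (<) xs" "sorted_wrt (<) ys" "set xs = set ys"
 shows "xs = ys"
 using assms by (simp add: strict_sorted_equal)

text \<open>An order-preserving bijection matches the increasing enumerations. The condition in the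
  definition of \<open>twist_perm\<close> thereby becomes an equation of lists.\<close>

lemma mono_bij_iff:
 fixes xs ys :: "nat list"
 assumes xs: "sorted_wrt (<) xs" and ys: "sorted_wrt (<) ys"
 shows "bij_betw \<pi> (set xs) (set ys) \<and> mono_on (set xs) \<pi> \<longleftrightarrow> map \<pi> xs = ys"
proof
 assume b: "bij_betw \<pi> (set xs) (set ys) \<and> mono_on (set xs) \<pi>"
 have "\<pi> x < \<pi> y" if "x \<in> set xs" "y \<in> set xs" "x < y" for x y
 proof -
  have "\<pi> x <= \<pi> y" by (rule mono_onD[of "set xs"]) (use b that in auto)
  moreover have "\<pi> x ~= \<pi> y"
   using inj_onD[OF bij_betw_imp_inj_on[OF conjunct1[OF b]], of x y] that by auto
  ultimately show ?thesis by simp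
 qed
 then have "sorted_wrt (%x y. \<pi> x < \<pi> y) xs" by (rule sorted_wrt_mono_rel[OF _ xs])
 then have "sorted_wrt (<) (map \<pi> xs)" by (simp add: sorted_wrt_map)
 then show "map \<pi> xs = ys" by (rule sorted_less_unique[OF _ ys]) (use b in "auto simp: bij_betw_def")
next
 assume m: "map \<pi> xs = ys"
 have s: "sorted_wrt (%x y. \<pi> x < \<pi> y) xs" using ys unfolding m[symmetric] by (simp add: sorted_wrt_map)
 have lt: "\<pi> x < \<pi> y" if xy: "x \<in> set xs" "y \<in> set xs" "x < y" for x y
 proof -
  obtain a b where ab: "a < length xs" "b < length xs" "x = xs ! a" "y = xs ! b"
   using xy(1,2) by (auto simp: in_set_conv_nth)
  then have "a < b" using xy(3) sorted_wrt_nth_less[OF xs, of b a] by (cases a b rule: linorder_cases) auto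
  then show ?thesis using sorted_wrt_nth_less[OF s, of a b] ab by simp
 qed
 have "inj_on \<pi> (set xs)" by (rule linorder_inj_onI) (use lt in "auto simp: less_le")
 moreover have "mono_on (set xs) \<pi>" by (rule mono_onI) (use lt in "auto simp: le_less")
 ultimately show "bij_betw \<pi> (set xs) (set ys) \<and> mono_on (set xs) \<pi>"
  using m by (auto simp: bij_betw_def)
qed

text \<open>Permute the list of fibres of \<open>\<psi>\<close> by \<open>\<gamma>\<close>. The
  lengths of the resulting blocks give the monotone map, and the concatenation, read as a function
  of positions, gives the permutation.\<close>

lemma twist_exists:
 assumes \<psi>: "\<psi> \<in> ds_maps p q" and \<gamma>: "\<gamma> permutes {..<q}"
 shows "\<exists>\<chi> \<pi>. \<chi> \<in> ds_maps p q \<and> \<pi> permutes {..<p} \<and> (\<forall>i<q. map \<pi> (fibre \<chi> p i) = fibre \<psi> p (\<gamma> i))"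
proof -
 define L where "L = permute_list \<gamma> (map (fibre \<psi> p) [0..<q])"
 define ks where "ks = map length L"
 have L: "length L = q" "!!i. i < q ==> L ! i = fibre \<psi> p (\<gamma> i)"
  using \<gamma> permutes_in_image[OF \<gamma>] by (auto simp: L_def permute_list_nth)
 have ks: "length ks = q" "!!i. i < q ==> ks ! i = length (L ! i)" using L by (auto simp: ks_def)
 have "mset (concat L) = mset (concat (map (fibre \<psi> p) [0..<q]))"
  using mset_permute_list[of \<gamma> "map (fibre \<psi> p) [0..<q]"] \<gamma> unfolding L_def mset_concat
  by (metis diff_zero length_map length_upt mset_map sum_mset_sum_list)
 then have mL: "mset (concat L) = mset [0..<p]" unfolding concat_fibres[OF \<psi>] .
 have sL: "set (concat L) = {..<p}" using mset_eq_setD[OF mL] by auto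
 have dL: "distinct (concat L)" using mset_eq_imp_distinct_iff[OF mL] by simp
 have lL: "length (concat L) = p" using mset_eq_length[OF mL] by simp
 have sum: "sum_list ks = p" using lL by (simp add: ks_def length_concat)
 define \<chi> where "\<chi> = restrict (block_of ks) {..<p}"
 define \<pi> where "\<pi> j = (if j < p then concat L ! j else j)" for j
 \<comment> \<open>Replaces the least number in \<open>block_of\<close> by the interval of positions
   that block \<open>i\<close> occupies.\<close>
 have blk: "block_of ks j = i \<longleftrightarrow> offset ks i <= j \<and> j < offset ks (Suc i)" if "j < p" "i < q" for i j
 proof -
  have "j < sum_list ks" using that sum by simp
  then obtain i' x where j: "i' < length ks" "x < ks ! i'" "j = offset ks i' + x" by (rule offset_cases)
  have b: "block_of ks j = i'" unfolding j(3) by (rule block_of_offset[OF j(1,2)])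
  have j': "offset ks i' <= j" "j < offset ks (Suc i')" using j offset_Suc[OF j(1)] by auto
  show ?thesis
  proof
   assume "offset ks i <= j \<and> j < offset ks (Suc i)"
   then have "\<not> i' < i" "\<not> i < i'"
    using j' offset_mono[of "Suc i'" i ks] offset_mono[of "Suc i" i' ks] by auto
   then show "block_of ks j = i" using b by simp
  qed (use b j' in auto)
 qed
 have blk_lt: "block_of ks j < q" if j: "j < p" for j
 proof -
  have "j < sum_list ks" using j sum by simp
  then show ?thesis by (rule offset_cases) (use ks block_of_offset in auto)
 qed
 have "\<chi> \<in> ds_maps p q" unfolding ds_maps_def
 proof (intro CollectI conjI)
  show "\<chi> \<in> {..<p} \<rightarrow>\<^sub>E {..<q}" using blk_lt by (auto simp: \<chi>_def)
  show "mono_on {..<p} \<chi>"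
  proof (rule mono_onI)
   fix j j' assume j: "j \<in> {..<p}" "j' \<in> {..<p}" "j <= j'"
   show "\<chi> j <= \<chi> j'"
   proof (rule ccontr)
    assume "\<not> \<chi> j <= \<chi> j'"
    then have "Suc (block_of ks j') <= block_of ks j" using j by (simp add: \<chi>_def)
    then have "offset ks (Suc (block_of ks j')) <= offset ks (block_of ks j)" by (rule offset_mono)
    then show False using blk[of j' "block_of ks j'"] blk[of j "block_of ks j"] blk_lt j by auto
   qed
  qed
 qed
 moreover have "\<pi> permutes {..<p}"
 proof (rule inj_endo_permutes)
  show "inj_on \<pi> {..<p}" using dL lL by (auto simp: inj_on_def \<pi>_def nth_eq_iff_index_eq)
  show "\<pi> x < p" if "x < p" for x using nth_mem[of x "concat L"] sL lL that by (auto simp: \<pi>_def)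
 qed (simp add: \<pi>_def)
 moreover have "map \<pi> (fibre \<chi> p i) = fibre \<psi> p (\<gamma> i)" if i: "i < q" for i
 proof -
  have le: "offset ks (Suc i) <= p" using offset_mono[of "Suc i" "length ks" ks] i ks sum by (simp add: offset_def)
  have "fibre \<chi> p i = [offset ks i..<offset ks (Suc i)]"
  proof (rule sorted_less_unique[OF sorted_fibre])
   show "set (fibre \<chi> p i) = set [offset ks i..<offset ks (Suc i)]"
    unfolding set_fibre using blk[OF _ i] le by (auto simp: \<chi>_def)
  qed simp
  also have "map \<pi> ... = L ! i"
  proof (rule nth_equalityI)
   fix x assume "x < length (map \<pi> [offset ks i..<offset ks (Suc i)])"
   then have x: "x < length (L ! i)" "offset ks i + x < p" using offset_Suc[of i ks] i ks le by auto
   then show "map \<pi> [offset ks i..<offset ks (Suc i)] ! x = L ! i ! x"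
    using nth_concat_offset[of i L x] L(1) i ks offset_Suc[of i ks] by (simp add: \<pi>_def ks_def)
  qed (use i ks offset_Suc[of i ks] in simp)
  finally show ?thesis using L(2)[OF i] by simp
 qed
 ultimately show ?thesis by blast
qed

text \<open>Settles both definite descriptions: the sizes of the fibres determine the map, and the
  equation on fibres determines the permutation at each position. Composition uses only these three
  facts.\<close>

lemma twist_props:
 assumes \<psi>: "\<psi> \<in> ds_maps p q" and \<gamma>: "\<gamma> permutes {..<q}"
 shows twist_map_in: "twist_map p q \<psi> \<gamma> \<in> ds_maps p q"
  and twist_perm_permutes: "twist_perm p q \<psi> \<gamma> permutes {..<p}"
  and twist_fibre: "i < q ==>
   map (twist_perm p q \<psi> \<gamma>) (fibre (twist_map p q \<psi> \<gamma>) p i) = fibre \<psi> p (\<gamma> i)"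
proof -
 from twist_exists[OF assms] obtain \<chi> \<pi> where ex: "\<chi> \<in> ds_maps p q \<and> \<pi> permutes {..<p} \<and>
  (\<forall>i<q. map \<pi> (fibre \<chi> p i) = fibre \<psi> p (\<gamma> i))"
  by (elim exE)
 then have \<chi>: "\<chi> \<in> ds_maps p q" and \<pi>: "\<pi> permutes {..<p}" by simp_all
 have m: "map \<pi> (fibre \<chi> p i) = fibre \<psi> p (\<gamma> i)" if "i < q" for i using ex that by simp
 have len: "length (fibre \<chi> p i) = length (fibre \<psi> p (\<gamma> i))" if "i < q" for i
  using arg_cong[OF m[OF that], of length] by simp
 have tm: "twist_map p q \<psi> \<gamma> = \<chi>" unfolding twist_map_def
 proof (rule the_equality)
  show "\<chi> \<in> ds_maps p q \<and> (\<forall>i<q. card {j. j < p \<and> \<chi> j = i} = card {j. j < p \<and> \<psi> j = \<gamma> i})"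
   using \<chi> len by (simp add: length_fibre)
  show "\<chi>' = \<chi>" if "\<chi>' \<in> ds_maps p q \<and> (\<forall>i<q. card {j. j < p \<and> \<chi>' j = i} = card {j. j < p \<and> \<psi> j = \<gamma> i})" for \<chi>'
   by (rule ds_maps_eqI[of _ p q]) (use that \<chi> len in "simp_all add: length_fibre")
 qed
 have iff: "(let B = {j. j < p \<and> \<chi> j = i} in bij_betw \<pi>' B {j. j < p \<and> \<psi> j = \<gamma> i} \<and> mono_on B \<pi>') \<longleftrightarrow>
   map \<pi>' (fibre \<chi> p i) = fibre \<psi> p (\<gamma> i)" for \<pi>' i
  using mono_bij_iff[OF sorted_fibre sorted_fibre, of \<pi>' \<chi> p i \<psi> p "\<gamma> i"] by (simp add: set_fibre Let_def)
 have tp: "twist_perm p q \<psi> \<gamma> = \<pi>" unfolding twist_perm_def tm iff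
 proof (rule the_equality)
  show "\<pi> permutes {..<p} \<and> (\<forall>i<q. map \<pi> (fibre \<chi> p i) = fibre \<psi> p (\<gamma> i))" using \<pi> m by blast
  fix \<pi>' assume \<pi>': "\<pi>' permutes {..<p} \<and> (\<forall>i<q. map \<pi>' (fibre \<chi> p i) = fibre \<psi> p (\<gamma> i))"
  show "\<pi>' = \<pi>"
  proof
   fix j
   show "\<pi>' j = \<pi> j"
   proof (cases "j < p")
    case True
    then have "\<chi> j < q" "j \<in> set (fibre \<chi> p (\<chi> j))" using ds_mapsD(1)[OF \<chi>] by (auto simp: set_fibre)
    then show ?thesis using \<pi>' m[of "\<chi> j"] map_eq_conv[of \<pi>' "fibre \<chi> p (\<chi> j)" \<pi>] by simp
   next
    case False
    then show ?thesis using permutes_not_in[OF \<pi>, of j] permutes_not_in[OF conjunct1[OF \<pi>'], of j] by simp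
   qed
  qed
 qed
 show "twist_map p q \<psi> \<gamma> \<in> ds_maps p q" "twist_perm p q \<psi> \<gamma> permutes {..<p}"
  "i < q ==> map (twist_perm p q \<psi> \<gamma>) (fibre (twist_map p q \<psi> \<gamma>) p i) = fibre \<psi> p (\<gamma> i)"
  unfolding tm tp using \<chi> \<pi> m by auto
qed

lemma ds_homD:
 assumes "f \<in> ds_hom p q"
 shows "dsrc f = p" "dtgt f = q" "dmap f \<in> ds_maps p q" "dperm f permutes {..<p}"
 using assms by (auto simp: ds_hom_def)

lemma length_act [simp]: "length (act f xs) = dtgt f"
 by (simp add: act_def)

lemma ds_comp_fields [simp]: "dsrc (f \<bullet> g) = dsrc g" "dtgt (f \<bullet> g) = dtgt f"
 by (simp_all add: ds_comp_def)

lemma ds_comp_hom: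
 assumes f: "f \<in> ds_hom q r" and g: "g \<in> ds_hom p q"
 shows "f \<bullet> g \<in> ds_hom p r"
proof -
 note f = ds_homD[OF f] and g = ds_homD[OF g]
 note t = twist_props[OF g(3) f(4)]
 have "compose {..<p} (dmap f) (twist_map p q (dmap g) (dperm f)) \<in> ds_maps p r" unfolding ds_maps_def
 proof (intro CollectI conjI)
  show "compose {..<p} (dmap f) (twist_map p q (dmap g) (dperm f)) \<in> {..<p} \<rightarrow>\<^sub>E {..<r}"
   using ds_mapsD[OF t(1)] ds_mapsD[OF f(3)] by (auto simp: compose_def)
  show "mono_on {..<p} (compose {..<p} (dmap f) (twist_map p q (dmap g) (dperm f)))"
   by (rule mono_onI) (use ds_mapsD[OF t(1)] ds_mapsD[OF f(3)] in "auto simp: compose_def")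
 qed
 then show ?thesis using f g permutes_compose[OF t(2) g(4)] by (simp add: ds_hom_def ds_comp_def)
qed

text \<open>A fibre of the composite is the concatenation of the twisted fibres over a fibre of
  \<open>dmap f\<close>, and \<open>twist_perm\<close> carries each of these to the fibre of
  \<open>dmap g\<close> that \<open>dperm f\<close> selects. So groups of entries are substituted
  for entries, and both twists disappear.\<close>

lemma act_comp:
 assumes f: "f \<in> ds_hom q r" and g: "g \<in> ds_hom p q"
 shows "act (f \<bullet> g) xs = map concat (act f (act g xs))"
proof -
 note f = ds_homD[OF f] and g = ds_homD[OF g]
 let ?\<chi> = "twist_map p q (dmap g) (dperm f)" and ?\<pi> = "twist_perm p q (dmap g) (dperm f)"
 note t = twist_props[OF g(3) f(4)]
 have "fibre (compose {..<p} (dmap f) ?\<chi>) p i = concat (map (fibre ?\<chi> p) (fibre (dmap f) q i))" for i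
 proof -
  have e: "filter (%j. dmap f (?\<chi> j) = i) (fibre ?\<chi> p k) = (if dmap f k = i then fibre ?\<chi> p k else [])" for k
   by (auto simp: filter_empty_conv set_fibre filter_id_conv)
  have e2: "concat (map (%k. if P k then h k else []) ks) = concat (map h (filter P ks))"
   for P and h :: "nat => nat list" and ks
   by (induction ks) auto
  have "fibre (compose {..<p} (dmap f) ?\<chi>) p i = filter (%j. dmap f (?\<chi> j) = i) [0..<p]"
   by (auto simp: fibre_def compose_def intro: filter_cong)
  also have "... = filter (%j. dmap f (?\<chi> j) = i) (concat (map (fibre ?\<chi> p) [0..<q]))"
   by (simp only: concat_fibres[OF t(1)])
  also have "... = concat (map (fibre ?\<chi> p) (fibre (dmap f) q i))"
   by (simp add: filter_concat comp_def e e2 fibre_def[of "dmap f"])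
  finally show ?thesis .
 qed
 then have "act (f \<bullet> g) xs = map (%i. concat (map (%k. map (%j. xs ! dperm g (?\<pi> j)) (fibre ?\<chi> p k))
   (fibre (dmap f) q i))) [0..<r]"
  using f g by (simp add: act_def ds_comp_def map_concat comp_def)
 also have "... = map (%i. concat (map (%k. act g xs ! dperm f k) (fibre (dmap f) q i))) [0..<r]"
 proof (intro map_cong refl arg_cong[of _ _ concat])
  fix i k assume "k \<in> set (fibre (dmap f) q i)"
  then have k: "k < q" by (simp add: set_fibre)
  then have fk: "dperm f k < q" using permutes_in_image[OF f(4), of k] by simp
  have "map (%j. xs ! dperm g (?\<pi> j)) (fibre ?\<chi> p k) = map (%j. xs ! dperm g j) (map ?\<pi> (fibre ?\<chi> p k))"
   by simp
  also have "... = act g xs ! dperm f k" unfolding t(3)[OF k] using fk g by (simp add: act_def)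
  finally show "map (%j. xs ! dperm g (?\<pi> j)) (fibre ?\<chi> p k) = act g xs ! dperm f k" .
 qed
 also have "... = map concat (act f (act g xs))" using f by (simp add: act_def comp_def)
 finally show ?thesis .
qed

section \<open>Faithfulness of the action on lists\<close>

lemma concat_act:
 assumes f: "f \<in> ds_hom p q" and "length xs = p"
 shows "concat (act f xs) = permute_list (dperm f) xs"
proof -
 note f = ds_homD[OF f]
 have "concat (act f xs) = map (%j. xs ! dperm f j) (concat (map (fibre (dmap f) p) [0..<q]))"
  using f by (simp add: act_def map_concat comp_def)
 then show ?thesis unfolding concat_fibres[OF f(3)] permute_list_def using assms(2) by simp
qed

text \<open>Flattening the groups recovers the permutation, and their lengths recover the monotone
  map.\<close>

lemma act_inject:
 assumes f: "f \<in> ds_hom p q" and g: "g \<in> ds_hom p q" and eq: "act f [0..<p] = act g [0..<p]"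
 shows "f = g"
proof -
 note fD = ds_homD[OF f] and gD = ds_homD[OF g]
 have "permute_list (dperm f) [0..<p] = permute_list (dperm g) [0..<p]"
  using concat_act[OF f, of "[0..<p]"] concat_act[OF g, of "[0..<p]"] eq by simp
 then have pl: "map (dperm f) [0..<p] = map (dperm g) [0..<p]"
  using permutes_in_image[OF fD(4)] permutes_in_image[OF gD(4)] by (simp add: permute_list_def)
 have "dperm f = dperm g"
 proof
  fix j show "dperm f j = dperm g j"
   using pl permutes_not_in[OF fD(4), of j] permutes_not_in[OF gD(4), of j] by (cases "j < p") auto
 qed
 moreover have "dmap f = dmap g"
 proof (rule ds_maps_eqI[OF fD(3) gD(3)])
  fix i assume "i < q"
  then show "length (fibre (dmap f) p i) = length (fibre (dmap g) p i)"
   using arg_cong[OF eq, of "%l. length (l ! i)"] fD gD by (simp add: act_def)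
 qed
 ultimately show ?thesis using fD gD by (intro ds_mor.equality) auto
qed

lemma act_inject_concat:
 assumes "f \<in> ds_hom p q" "g \<in> ds_hom p q" "sum_list ks = p"
  and "!!xss :: nat list list. map length xss = ks ==> act f (concat xss) = act g (concat xss)"
 shows "f = g"
 using split_concat[of "[0..<p]" ks] assms act_inject[OF assms(1,2)] by force

lemma act_map:
 assumes f: "f \<in> ds_hom p q" and "length xs = p"
 shows "act f (map h xs) = map (map h) (act f xs)"
 using ds_homD[OF f] permutes_in_image[OF ds_homD(4)[OF f]] assms(2)
 by (auto simp: act_def set_fibre)

lemma ds_mors_iff: "f \<in> ds_mors \<longleftrightarrow> f \<in> ds_hom (dsrc f) (dtgt f)"
 by (auto simp: ds_mors_def ds_hom_def)

lemma ds_hom_iff: "f \<in> ds_hom p q \<longleftrightarrow> f \<in> ds_mors \<and> dsrc f = p \<and> dtgt f = q"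
 by (auto simp: ds_mors_def ds_hom_def)

text \<open>The test lists are cut into blocks of prescribed lengths, as juxtapositions and block
  permutations can be evaluated on those.\<close>

lemma mors_eqI:
 assumes "f \<in> ds_mors" "g \<in> ds_mors" "dsrc f = sum_list ks" "dsrc g = sum_list ks" "dtgt f = dtgt g"
  and "!!xss :: nat list list. map length xss = ks ==> act f (concat xss) = act g (concat xss)"
 shows "f = g"
 using act_inject_concat[of f "sum_list ks" "dtgt f" g ks] assms by (simp add: ds_hom_iff)

lemma mors_eqI':
 assumes "f \<in> ds_mors" "g \<in> ds_mors" "dsrc f = dsrc g" "dtgt f = dtgt g"
  and "!!xs :: nat list. length xs = dsrc g ==> act f xs = act g xs"
 shows "f = g"
 using act_inject[of f "dsrc f" "dtgt f" g] assms by (simp add: ds_hom_iff)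

lemma comp_mors: "[|f \<in> ds_mors; g \<in> ds_mors; dsrc f = dtgt g|] ==> f \<bullet> g \<in> ds_mors"
 using ds_comp_hom[of f "dtgt g" "dtgt f" g "dsrc g"] by (simp add: ds_hom_iff)

lemma act_comp_mors: "[|f \<in> ds_mors; g \<in> ds_mors; dsrc f = dtgt g|] ==>
  act (f \<bullet> g) xs = map concat (act f (act g xs))"
 using act_comp[of f "dtgt g" "dtgt f" g "dsrc g"] by (simp add: ds_hom_iff)

lemma act_map_mors: "[|f \<in> ds_mors; length xs = dsrc f|] ==> act f (map h xs) = map (map h) (act f xs)"
 using act_map[of f "dsrc f" "dtgt f"] by (simp add: ds_hom_iff)

text \<open>This is associativity of \<open>concat\<close>, together with the naturality of
  \<open>act\<close> in the entries of its list.\<close>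

lemma ds_comp_assoc:
 assumes "f \<in> ds_mors" "g \<in> ds_mors" "h \<in> ds_mors" "dsrc f = dtgt g" "dsrc g = dtgt h"
 shows "f \<bullet> g \<bullet> h = f \<bullet> (g \<bullet> h)"
proof (rule mors_eqI')
 fix xs :: "nat list"
 show "act (f \<bullet> g \<bullet> h) xs = act (f \<bullet> (g \<bullet> h)) xs"
  using assms by (simp add: act_comp_mors comp_mors act_map_mors comp_def concat_concat_map)
qed (use assms in "simp_all add: comp_mors")

section \<open>Permutations as morphisms\<close>

lemma ds_perm_simps [simp]: "dsrc (ds_perm n \<gamma>) = n" "dtgt (ds_perm n \<gamma>) = n"
 by (simp_all add: ds_perm_def)

lemma ds_perm_mors: "\<gamma> permutes {..<n} ==> ds_perm n \<gamma> \<in> ds_mors"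
 by (auto simp: ds_mors_iff ds_hom_def ds_maps_def ds_perm_def monotone_on_def)

lemma act_perm:
 assumes "length xs = n"
 shows "act (ds_perm n \<gamma>) xs = map (%x. [x]) (permute_list \<gamma> xs)"
proof -
 have "fibre (restrict id {..<n}) n i = [i]" if "i < n" for i
  by (rule sorted_less_unique[OF sorted_fibre]) (use that in "auto simp: set_fibre")
 then show ?thesis using assms by (simp add: act_def ds_perm_def permute_list_def)
qed

lemma concat_singletons: "concat (map (%x. [x]) xs) = xs"
 by (induction xs) simp_all

lemma act_perm_comp:
 assumes "\<gamma> permutes {..<n}" "g \<in> ds_mors" "dtgt g = n"
 shows "act (ds_perm n \<gamma> \<bullet> g) xs = permute_list \<gamma> (act g xs)"
 using assms by (simp add: act_comp_mors ds_perm_mors act_perm comp_def)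

lemma act_comp_perm:
 assumes "\<gamma> permutes {..<n}" "f \<in> ds_mors" "dsrc f = n" "length xs = n"
 shows "act (f \<bullet> ds_perm n \<gamma>) xs = act f (permute_list \<gamma> xs)"
 using assms by (simp add: act_comp_mors ds_perm_mors act_perm act_map_mors comp_def concat_singletons)

lemma ds_id_simps [simp]: "dsrc (ds_id n) = n" "dtgt (ds_id n) = n"
 by (simp_all add: ds_id_def)

lemma ds_id_mors: "ds_id n \<in> ds_mors"
 unfolding ds_id_def by (rule ds_perm_mors) (rule permutes_id)

lemma comp_id_left: "[|f \<in> ds_mors; dtgt f = n|] ==> ds_id n \<bullet> f = f"
 unfolding ds_id_def by (rule mors_eqI') (simp_all add: act_perm_comp permutes_id comp_mors ds_perm_mors)

lemma comp_id_right: "[|f \<in> ds_mors; dsrc f = n|] ==> f \<bullet> ds_id n = f"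
 unfolding ds_id_def by (rule mors_eqI') (simp_all add: act_comp_perm permutes_id comp_mors ds_perm_mors)

text \<open>The order is reversed because \<open>ds_perm\<close> acts on lists through
  \<open>permute_list\<close>, a right action.\<close>

lemma perm_perm:
 assumes "\<sigma> permutes {..<n}" "\<tau> permutes {..<n}"
 shows "ds_perm n \<sigma> \<bullet> ds_perm n \<tau> = ds_perm n (\<tau> o \<sigma>)"
 by (rule mors_eqI') (use assms in "simp_all add: comp_mors ds_perm_mors permutes_compose act_perm_comp act_perm
  permute_list_map permute_list_compose")

text \<open>The morphism of the inverse permutation. It acts on lists by \<open>move\<close>, so
  composition preserves the order of the permutations; \<open>\<mu>\<close> uses block permutations
  in this form.\<close>

definition ds_move :: "nat => (nat => nat) => ds_mor"
 where "ds_move n \<pi> = ds_perm n (inv_into UNIV \<pi>)"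

lemma ds_move_simps [simp]: "dsrc (ds_move n \<gamma>) = n" "dtgt (ds_move n \<gamma>) = n"
 by (simp_all add: ds_move_def)

lemma ds_move_mors: "\<gamma> permutes {..<n} ==> ds_move n \<gamma> \<in> ds_mors"
 unfolding ds_move_def by (intro ds_perm_mors permutes_inv)

lemma act_move: "length xs = n ==> act (ds_move n \<gamma>) xs = map (%x. [x]) (move \<gamma> xs)"
 by (simp add: ds_move_def act_perm move_def)

lemma act_move_comp:
 assumes "\<gamma> permutes {..<n}" "g \<in> ds_mors" "dtgt g = n"
 shows "act (ds_move n \<gamma> \<bullet> g) xs = move \<gamma> (act g xs)"
 using assms by (simp add: act_perm_comp permutes_inv move_def ds_move_def)

lemma act_comp_move:
 assumes "\<gamma> permutes {..<n}" "f \<in> ds_mors" "dsrc f = n" "length xs = n"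
 shows "act (f \<bullet> ds_move n \<gamma>) xs = act f (move \<gamma> xs)"
 using assms by (simp add: act_comp_perm permutes_inv move_def ds_move_def)

lemma move_move:
 assumes "\<sigma> permutes {..<n}" "\<tau> permutes {..<n}"
 shows "ds_move n \<sigma> \<bullet> ds_move n \<tau> = ds_move n (\<sigma> o \<tau>)"
 using assms by (simp add: ds_move_def perm_perm permutes_inv permutes_inv_compose)

lemma perm_move_cancel:
 assumes "\<sigma> permutes {..<n}"
 shows "ds_perm n \<sigma> \<bullet> ds_move n \<sigma> = ds_id n" "ds_move n \<sigma> \<bullet> ds_perm n \<sigma> = ds_id n"
 using assms by (simp_all add: ds_move_def perm_perm permutes_inv permutes_inv_o ds_id_def)

lemma ds_move_id: "ds_move n id = ds_id n"
 by (simp add: ds_move_def ds_id_def)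


subsection \<open>Juxtaposition\<close>

lemma ds_juxt_simps [simp]: "dsrc (ds_juxt f g) = dsrc f + dsrc g" "dtgt (ds_juxt f g) = dtgt f + dtgt g"
 by (simp_all add: ds_juxt_def)

lemma ds_juxt_mors:
 assumes "f \<in> ds_mors" "g \<in> ds_mors"
 shows "ds_juxt f g \<in> ds_mors"
proof -
 note f = ds_homD[OF assms(1)[unfolded ds_mors_iff]] and g = ds_homD[OF assms(2)[unfolded ds_mors_iff]]
 have l: "dmap (ds_juxt f g) j < dtgt f + dtgt g" if "j < dsrc f + dsrc g" for j
  using that ds_mapsD(1)[OF f(3), of j] ds_mapsD(1)[OF g(3), of "j - dsrc f"] by (auto simp: ds_juxt_def)
 have ext: "dmap (ds_juxt f g) \<in> extensional {..<dsrc f + dsrc g}" by (simp add: ds_juxt_def)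
 have "dmap (ds_juxt f g) i <= dmap (ds_juxt f g) j" if "i <= j" "j < dsrc f + dsrc g" for i j
  using that ds_mapsD(1)[OF f(3), of i] ds_mapsD(2)[OF f(3), of i j] ds_mapsD(2)[OF g(3), of "i - dsrc f" "j - dsrc f"]
  by (auto simp: ds_juxt_def)
 then have "dmap (ds_juxt f g) \<in> ds_maps (dsrc f + dsrc g) (dtgt f + dtgt g)"
  using l ext by (auto simp: ds_maps_def monotone_on_def PiE_def)
 then show ?thesis
  using perm_sum_permutes[OF f(4) g(4)] by (simp add: ds_mors_iff ds_hom_def) (simp add: ds_juxt_def)
qed

text \<open>The fibres over targets of \<open>f\<close> stay as they are, and those over targets of
  \<open>g\<close> are shifted by the source of \<open>f\<close>; the two index lists are split
  accordingly.\<close>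

lemma act_juxt:
 assumes f: "f \<in> ds_mors" and g: "g \<in> ds_mors" and xs: "length xs = dsrc f"
 shows "act (ds_juxt f g) (xs @ ys) = act f xs @ act g ys"
proof -
 note fD = ds_homD[OF f[unfolded ds_mors_iff]] and gD = ds_homD[OF g[unfolded ds_mors_iff]]
 let ?p = "dsrc f" and ?p' = "dsrc g" and ?q = "dtgt f"
 have up: "[0..<?p + ?p'] = [0..<?p] @ map (%j. ?p + j) [0..<?p']"
  by (rule nth_equalityI) (auto simp: nth_append)
 have 1: "fibre (dmap (ds_juxt f g)) (?p + ?p') i = fibre (dmap f) ?p i" if "i < ?q" for i
  unfolding fibre_def up using that
  by (auto simp: filter_empty_conv ds_juxt_def intro!: filter_cong)
 have 2: "fibre (dmap (ds_juxt f g)) (?p + ?p') (?q + i) = map (%j. ?p + j) (fibre (dmap g) ?p' i)" for i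
 proof (rule sorted_less_unique[OF sorted_fibre])
  show "sorted_wrt (<) (map (%j. ?p + j) (fibre (dmap g) ?p' i))"
   using sorted_fibre[of "dmap g" ?p' i] by (simp add: sorted_wrt_map)
  have "j \<in> (%j. ?p + j) ` {j. j < ?p' \<and> dmap g j = i}"
   if "j < ?p + ?p'" "dmap (ds_juxt f g) j = ?q + i" for j
   using that ds_mapsD(1)[OF fD(3), of j]
   by (intro image_eqI[of _ _ "j - ?p"]) (auto simp: ds_juxt_def split: if_splits)
  then show "set (fibre (dmap (ds_juxt f g)) (?p + ?p') (?q + i)) = set (map (%j. ?p + j) (fibre (dmap g) ?p' i))"
   by (auto simp: set_fibre) (auto simp: ds_juxt_def)
 qed
 have uq: "[0..<?q + dtgt g] = [0..<?q] @ map (%j. ?q + j) [0..<dtgt g]"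
  by (rule nth_equalityI) (auto simp: nth_append)
 have d1: "dperm (ds_juxt f g) j = dperm f j" if "j < ?p" for j
  using that by (simp add: ds_juxt_def perm_sum_def)
 have d2: "dperm (ds_juxt f g) (?p + j) = ?p + dperm g j" for j by (simp add: ds_juxt_def perm_sum_def)
 have "map (%j. (xs @ ys) ! dperm (ds_juxt f g) j) (fibre (dmap f) ?p i) = map (%j. xs ! dperm f j) (fibre (dmap f) ?p i)" for i
  by (rule map_cong[OF refl]) (use permutes_in_image[OF fD(4)] xs in "auto simp: set_fibre d1 nth_append")
 moreover have "map (%j. (xs @ ys) ! dperm (ds_juxt f g) j) (map (%j. ?p + j) (fibre (dmap g) ?p' i)) =
   map (%j. ys ! dperm g j) (fibre (dmap g) ?p' i)" for i
  using xs by (simp add: d2 nth_append)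
 ultimately show ?thesis
  unfolding act_def ds_juxt_simps uq map_append map_map comp_def 2 by (simp add: 1 del: map_map)
qed

lemma ds_juxts_simps [simp]: "ds_juxts [] = ds_id 0" "ds_juxts (f # fs) = ds_juxt f (ds_juxts fs)"
 by (simp_all add: ds_juxts_def)

lemma ds_juxts_src_tgt [simp]:
 "dsrc (ds_juxts fs) = sum_list (map dsrc fs)" "dtgt (ds_juxts fs) = sum_list (map dtgt fs)"
 by (induction fs) simp_all

lemma ds_juxts_mors: "set fs <= ds_mors ==> ds_juxts fs \<in> ds_mors"
 by (induction fs) (auto intro: ds_juxt_mors ds_id_mors)

lemma act_juxts:
 assumes "set fs <= ds_mors" "map length xss = map dsrc fs"
 shows "act (ds_juxts fs) (concat xss) = concat (map2 act fs xss)"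
 using assms
proof (induction fs arbitrary: xss)
 case Nil
 then show ?case by (simp add: act_def)
next
 case (Cons f fs)
 then obtain xs xss' where "xss = xs # xss'" by (cases xss) auto
 with Cons show ?case using act_juxt[of f "ds_juxts fs" xs "concat xss'"] ds_juxts_mors[of fs] by auto
qed

text \<open>The interchange law, read off on a concatenation that is cut along the sources of
  \<open>gs\<close>.\<close>

lemma juxts_comp:
 assumes "set fs <= ds_mors" "set gs <= ds_mors" "map dsrc fs = map dtgt gs"
 shows "ds_juxts fs \<bullet> ds_juxts gs = ds_juxts (map2 (\<bullet>) fs gs)"
proof -
 have l: "length fs = length gs" using assms(3) by (rule map_eq_imp_length_eq)
 have e: "dsrc (fs ! i) = dtgt (gs ! i)" if "i < length gs" for i
  using arg_cong[OF assms(3), of "%l. l ! i"] that l by simp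
 have m: "set (map2 (\<bullet>) fs gs) <= ds_mors"
  using assms(1,2) e l by (auto simp: set_zip intro!: comp_mors)
 have s: "map dsrc (map2 (\<bullet>) fs gs) = map dsrc gs" "map dtgt (map2 (\<bullet>) fs gs) = map dtgt fs"
  using l by (auto intro!: nth_equalityI)
 show ?thesis
 proof (rule mors_eqI)
  show "ds_juxts fs \<bullet> ds_juxts gs \<in> ds_mors"
   using assms by (intro comp_mors ds_juxts_mors) simp_all
  show "ds_juxts (map2 (\<bullet>) fs gs) \<in> ds_mors" by (rule ds_juxts_mors[OF m])
  show "dsrc (ds_juxts fs \<bullet> ds_juxts gs) = sum_list (map dsrc gs)" by simp
  show "dsrc (ds_juxts (map2 (\<bullet>) fs gs)) = sum_list (map dsrc gs)" by (simp only: ds_juxts_src_tgt s)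
  show "dtgt (ds_juxts fs \<bullet> ds_juxts gs) = dtgt (ds_juxts (map2 (\<bullet>) fs gs))"
   by (simp only: ds_comp_fields ds_juxts_src_tgt s)
  fix xss :: "nat list list" assume xss: "map length xss = map dsrc gs"
  have lx: "length xss = length gs" using xss by (rule map_eq_imp_length_eq)
  have al: "map length (map2 act gs xss) = map dsrc fs" using lx l e by (auto intro!: nth_equalityI)
  have "act (ds_juxts fs \<bullet> ds_juxts gs) (concat xss) = map concat (act (ds_juxts fs) (concat (map2 act gs xss)))"
   using assms act_juxts[OF assms(2) xss] by (subst act_comp_mors) (simp_all add: ds_juxts_mors)
  also have "... = concat (map (map concat) (map2 act fs (map2 act gs xss)))"
   unfolding act_juxts[OF assms(1) al] by (rule map_concat)
  also have "map (map concat) (map2 act fs (map2 act gs xss)) = map2 act (map2 (\<bullet>) fs gs) xss"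
   using lx l e assms(1,2) by (auto intro!: nth_equalityI simp: act_comp_mors subset_iff)
  also have "concat ... = act (ds_juxts (map2 (\<bullet>) fs gs)) (concat xss)"
   by (rule act_juxts[OF m, symmetric]) (simp only: xss s)
  finally show "act (ds_juxts fs \<bullet> ds_juxts gs) (concat xss) = act (ds_juxts (map2 (\<bullet>) fs gs)) (concat xss)" .
 qed
qed

lemma juxt_assoc:
 assumes "f \<in> ds_mors" "g \<in> ds_mors" "h \<in> ds_mors"
 shows "ds_juxt (ds_juxt f g) h = ds_juxt f (ds_juxt g h)"
proof (rule mors_eqI[where ks="[dsrc f, dsrc g, dsrc h]"])
 fix xss :: "nat list list" assume "map length xss = [dsrc f, dsrc g, dsrc h]"
 then obtain us vs ws where "xss = [us, vs, ws]" "length us = dsrc f" "length vs = dsrc g" "length ws = dsrc h"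
  by auto
 then show "act (ds_juxt (ds_juxt f g) h) (concat xss) = act (ds_juxt f (ds_juxt g h)) (concat xss)"
  using assms act_juxt[of f "ds_juxt g h" us "vs @ ws"] act_juxt[of g h vs ws] act_juxt[of f g us vs]
   act_juxt[of "ds_juxt f g" h "us @ vs" ws] by (simp add: ds_juxt_mors)
qed (use assms in "simp_all add: ds_juxt_mors")

lemma juxt_id0: "f \<in> ds_mors ==> ds_juxt (ds_id 0) f = f" "f \<in> ds_mors ==> ds_juxt f (ds_id 0) = f"
proof -
 assume f: "f \<in> ds_mors"
 show "ds_juxt (ds_id 0) f = f"
 proof (rule mors_eqI')
  show "act (ds_juxt (ds_id 0) f) xs = act f xs" for xs :: "nat list"
   using act_juxt[OF ds_id_mors f, of "[]" 0 xs] by (simp add: act_def)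
 qed (use f in "simp_all add: ds_juxt_mors ds_id_mors")
 show "ds_juxt f (ds_id 0) = f"
 proof (rule mors_eqI')
  show "act (ds_juxt f (ds_id 0)) xs = act f xs" if "length xs = dsrc f" for xs :: "nat list"
   using act_juxt[OF f ds_id_mors that, of 0 "[]"] by (simp add: act_def)
 qed (use f in "simp_all add: ds_juxt_mors ds_id_mors")
qed

lemma juxts_append: "[|set fs <= ds_mors; set gs <= ds_mors|] ==>
  ds_juxts (fs @ gs) = ds_juxt (ds_juxts fs) (ds_juxts gs)"
 by (induction fs) (auto simp: juxt_id0 ds_juxts_mors juxt_assoc)

lemma juxts_concat: "\<Union> (set ` set fss) <= ds_mors ==> ds_juxts (concat fss) = ds_juxts (map ds_juxts fss)"
 by (induction fss) (auto simp: juxts_append ds_juxts_mors UN_subset_iff)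

lemma act_id: "length xs = n ==> act (ds_id n) xs = map (%x. [x]) xs"
 by (simp add: ds_id_def act_perm)

lemma juxts_ids: "ds_juxts (map ds_id ks) = ds_id (sum_list ks)"
proof (rule mors_eqI)
 fix xss :: "nat list list" assume xss: "map length xss = ks"
 have "act (ds_juxts (map ds_id ks)) (concat xss) = concat (map2 act (map ds_id ks) xss)"
  by (rule act_juxts) (auto simp: ds_id_mors xss comp_def)
 also have "map2 act (map ds_id ks) xss = map (map (%x. [x])) xss"
  unfolding xss[symmetric] by (auto intro!: nth_equalityI simp: act_id)
 also have "concat ... = map (%x. [x]) (concat xss)" by (rule map_concat[symmetric])
 also have "... = act (ds_id (sum_list ks)) (concat xss)"
  by (rule act_id[symmetric]) (simp add: length_concat xss)
 finally show "act (ds_juxts (map ds_id ks)) (concat xss) = act (ds_id (sum_list ks)) (concat xss)" .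
qed (use ds_id_mors in "auto intro!: ds_juxts_mors simp: comp_def")

lemma juxts_move:
 assumes "perms \<tau>s ks"
 shows "ds_juxts (map2 ds_move ks \<tau>s) = ds_move (sum_list ks) (perm_sums ks \<tau>s)"
proof (rule mors_eqI)
 have l: "length \<tau>s = length ks" using assms by (rule list_all2_lengthD)
 have p: "\<tau>s ! i permutes {..<ks ! i}" if "i < length ks" for i using assms that by (simp add: list_all2_conv_all_nth)
 have m: "set (map2 ds_move ks \<tau>s) <= ds_mors" using p l by (auto simp: set_zip ds_move_mors)
 have s: "map dsrc (map2 ds_move ks \<tau>s) = ks" "map dtgt (map2 ds_move ks \<tau>s) = ks"
  using l by (auto intro!: nth_equalityI)
 show "ds_juxts (map2 ds_move ks \<tau>s) \<in> ds_mors" by (rule ds_juxts_mors[OF m])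
 show "ds_move (sum_list ks) (perm_sums ks \<tau>s) \<in> ds_mors" by (rule ds_move_mors[OF perm_sums_permutes[OF assms]])
 show "dsrc (ds_juxts (map2 ds_move ks \<tau>s)) = sum_list ks" by (simp only: ds_juxts_src_tgt s)
 show "dtgt (ds_juxts (map2 ds_move ks \<tau>s)) = dtgt (ds_move (sum_list ks) (perm_sums ks \<tau>s))"
  by (simp only: ds_juxts_src_tgt s ds_move_simps)
 fix xss :: "nat list list" assume xss: "map length xss = ks"
 have lx: "length xss = length ks" using xss by auto
 have px: "list_all2 (%\<tau> xs. \<tau> permutes {..<length xs}) \<tau>s xss"
  using assms unfolding xss[symmetric] by (simp only: list_all2_map2)
 have "act (ds_juxts (map2 ds_move ks \<tau>s)) (concat xss) = concat (map2 act (map2 ds_move ks \<tau>s) xss)"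
  by (rule act_juxts[OF m]) (simp only: xss s)
 also have "map2 act (map2 ds_move ks \<tau>s) xss = map (map (%x. [x])) (map2 move \<tau>s xss)"
  unfolding xss[symmetric] using l lx by (auto intro!: nth_equalityI simp: act_move)
 also have "concat ... = map (%x. [x]) (concat (map2 move \<tau>s xss))" by (rule map_concat[symmetric])
 also have "... = act (ds_move (sum_list ks) (perm_sums ks \<tau>s)) (concat xss)"
  using move_perm_sums[OF px] xss by (subst act_move) (auto simp: length_concat)
 finally show "act (ds_juxts (map2 ds_move ks \<tau>s)) (concat xss) =
  act (ds_move (sum_list ks) (perm_sums ks \<tau>s)) (concat xss)" .
qed simp

text \<open>Naturality of the symmetry of juxtaposition: a block permutation passes from the targets
  to the sources, and the morphisms are reordered on the way.\<close>

lemma move_natural: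
 assumes \<sigma>: "\<sigma> permutes {..<length fs}" and fs: "set fs <= ds_mors"
 shows "ds_move (sum_list (map dtgt fs)) (block_perm \<sigma> (map dtgt fs)) \<bullet> ds_juxts fs =
  ds_juxts (move \<sigma> fs) \<bullet> ds_move (sum_list (map dsrc fs)) (block_perm \<sigma> (map dsrc fs))"
proof (rule mors_eqI)
 note p = block_perm_permutes[of \<sigma> "map dtgt fs", simplified, OF \<sigma>] block_perm_permutes[of \<sigma> "map dsrc fs", simplified, OF \<sigma>]
 have m: "set (move \<sigma> fs) <= ds_mors" using set_move[OF \<sigma>] fs by simp
 have s: "map dsrc (move \<sigma> fs) = move \<sigma> (map dsrc fs)" "map dtgt (move \<sigma> fs) = move \<sigma> (map dtgt fs)"
  using move_map[OF \<sigma>, of dsrc] move_map[OF \<sigma>, of dtgt] by simp_all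
 have sum: "sum_list (map dsrc (move \<sigma> fs)) = sum_list (map dsrc fs)" "sum_list (map dtgt (move \<sigma> fs)) = sum_list (map dtgt fs)"
  unfolding s using sum_list_move[of \<sigma> "map dsrc fs"] sum_list_move[of \<sigma> "map dtgt fs"] \<sigma> by simp_all
 show "ds_move (sum_list (map dtgt fs)) (block_perm \<sigma> (map dtgt fs)) \<bullet> ds_juxts fs \<in> ds_mors"
  by (intro comp_mors ds_move_mors p ds_juxts_mors fs) simp
 show "ds_juxts (move \<sigma> fs) \<bullet> ds_move (sum_list (map dsrc fs)) (block_perm \<sigma> (map dsrc fs)) \<in> ds_mors"
  by (intro comp_mors ds_move_mors p ds_juxts_mors m) (simp add: sum)
 show "dsrc (ds_move (sum_list (map dtgt fs)) (block_perm \<sigma> (map dtgt fs)) \<bullet> ds_juxts fs) = sum_list (map dsrc fs)"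
  "dsrc (ds_juxts (move \<sigma> fs) \<bullet> ds_move (sum_list (map dsrc fs)) (block_perm \<sigma> (map dsrc fs))) = sum_list (map dsrc fs)"
  "dtgt (ds_move (sum_list (map dtgt fs)) (block_perm \<sigma> (map dtgt fs)) \<bullet> ds_juxts fs) =
   dtgt (ds_juxts (move \<sigma> fs) \<bullet> ds_move (sum_list (map dsrc fs)) (block_perm \<sigma> (map dsrc fs)))"
  by (simp_all add: sum)
 fix xss :: "nat list list" assume xss: "map length xss = map dsrc fs"
 have lx: "length xss = length fs" using xss by (rule map_eq_imp_length_eq)
 have \<sigma>x: "\<sigma> permutes {..<length xss}" using \<sigma> lx by simp
 have al: "map length (map2 act fs xss) = map dtgt fs" by (rule nth_equalityI) (use lx in simp_all)
 have "act (ds_move (sum_list (map dtgt fs)) (block_perm \<sigma> (map dtgt fs)) \<bullet> ds_juxts fs) (concat xss) =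
  move (block_perm \<sigma> (map dtgt fs)) (concat (map2 act fs xss))"
  by (simp add: act_move_comp[OF p(1) ds_juxts_mors[OF fs]] act_juxts[OF fs xss])
 also have "... = concat (move \<sigma> (map2 act fs xss))"
  unfolding al[symmetric] by (rule move_block_perm) (simp add: \<sigma> lx)
 also have "move \<sigma> (map2 act fs xss) = map2 act (move \<sigma> fs) (move \<sigma> xss)"
  by (rule move_map2[OF \<sigma> lx[symmetric]])
 also have "concat ... = act (ds_juxts (move \<sigma> fs)) (concat (move \<sigma> xss))"
  by (rule act_juxts[OF m, symmetric]) (simp only: s move_map[OF \<sigma>x, of length, symmetric] xss)
 also have "concat (move \<sigma> xss) = move (block_perm \<sigma> (map dsrc fs)) (concat xss)"
  unfolding xss[symmetric] by (rule move_block_perm[OF \<sigma>x, symmetric])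
 also have "act (ds_juxts (move \<sigma> fs)) ... =
   act (ds_juxts (move \<sigma> fs) \<bullet> ds_move (sum_list (map dsrc fs)) (block_perm \<sigma> (map dsrc fs))) (concat xss)"
  by (rule act_comp_move[OF p(2) ds_juxts_mors[OF m], symmetric])
   (simp_all only: ds_juxts_src_tgt sum length_concat xss)
 finally show "act (ds_move (sum_list (map dtgt fs)) (block_perm \<sigma> (map dtgt fs)) \<bullet> ds_juxts fs) (concat xss) =
  act (ds_juxts (move \<sigma> fs) \<bullet> ds_move (sum_list (map dsrc fs)) (block_perm \<sigma> (map dsrc fs))) (concat xss)" .
qed

section \<open>Associativity for composite permutations\<close>

lemma block_perm_append:
 assumes \<sigma>: "\<sigma> permutes {..<length js}" and \<tau>: "\<tau> permutes {..<length js'}"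
 shows "block_perm (perm_sum (length js) \<sigma> \<tau>) (js @ js') = perm_sum (sum_list js) (block_perm \<sigma> js) (block_perm \<tau> js')"
proof (rule perm_eq_by_concat)
 have p: "perm_sum (length js) \<sigma> \<tau> permutes {..<length (js @ js')}" using perm_sum_permutes[OF \<sigma> \<tau>] by simp
 show "block_perm (perm_sum (length js) \<sigma> \<tau>) (js @ js') permutes {..<sum_list (js @ js')}"
  by (rule block_perm_permutes[OF p])
 show "perm_sum (sum_list js) (block_perm \<sigma> js) (block_perm \<tau> js') permutes {..<sum_list (js @ js')}"
  using perm_sum_permutes[OF block_perm_permutes[OF \<sigma>] block_perm_permutes[OF \<tau>]] by simp
 fix xss :: "nat list list" assume xss: "map length xss = js @ js'"
 then obtain us vs where x: "xss = us @ vs" "map length us = js" "map length vs = js'"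
  by (auto simp: map_eq_append_conv)
 have l: "length us = length js" "length vs = length js'" "length (concat us) = sum_list js"
  "length (concat vs) = sum_list js'" using x(2,3) by (auto simp: length_concat)
 have "move (block_perm (perm_sum (length js) \<sigma> \<tau>) (js @ js')) (concat xss) = concat (move (perm_sum (length us) \<sigma> \<tau>) (us @ vs))"
  unfolding xss[symmetric] l[symmetric] x(1)[symmetric] by (rule move_block_perm) (use p x l in simp)
 also have "... = concat (move \<sigma> us) @ concat (move \<tau> vs)"
  using move_perm_sum[of \<sigma> us \<tau> vs] \<sigma> \<tau> l by simp
 also have "... = move (block_perm \<sigma> js) (concat us) @ move (block_perm \<tau> js') (concat vs)"
  using move_block_perm[of \<sigma> us] move_block_perm[of \<tau> vs] \<sigma> \<tau> l x by simp
 also have "... = move (perm_sum (sum_list js) (block_perm \<sigma> js) (block_perm \<tau> js')) (concat us @ concat vs)"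
  using move_perm_sum[of "block_perm \<sigma> js" "concat us" "block_perm \<tau> js'" "concat vs"]
   block_perm_permutes[OF \<sigma>] block_perm_permutes[OF \<tau>] l by simp
 finally show "move (block_perm (perm_sum (length js) \<sigma> \<tau>) (js @ js')) (concat xss) =
  move (perm_sum (sum_list js) (block_perm \<sigma> js) (block_perm \<tau> js')) (concat xss)"
  by (simp add: x)
qed

lemma block_perm_perm_sums_concat:
 "list_all2 (%\<tau> js. \<tau> permutes {..<length js}) \<tau>s jss ==>
  block_perm (perm_sums (map length jss) \<tau>s) (concat jss) = perm_sums (map sum_list jss) (map2 block_perm \<tau>s jss)"
proof (induction rule: list_all2_induct)
 case Nil then show ?case by (auto simp: block_perm_def fun_eq_iff)
next
 case (Cons \<tau> \<tau>s js jss)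
 have "perm_sums (map length jss) \<tau>s permutes {..<length (concat jss)}"
  using perm_sums_permutes[of \<tau>s "map length jss"] Cons.hyps by (simp add: list_all2_map2 length_concat)
 then show ?case using Cons block_perm_append[of \<tau> js "perm_sums (map length jss) \<tau>s" "concat jss"] by simp
qed

lemma perm_comp_permutes:
 assumes "\<sigma> permutes {..<length ks}" "perms \<tau>s ks"
 shows "perm_comp ks \<sigma> \<tau>s permutes {..<sum_list ks}"
 unfolding perm_comp_def
 by (rule permutes_compose[OF perm_sums_permutes[OF assms(2)] block_perm_permutes[OF assms(1)]])

text \<open>The inner permutations reorder the sizes within each group and keep the sum of each
  group. The outer permutation therefore acts as a block permutation on the sums alone.\<close>

lemma block_perm_perm_comp:
 assumes \<sigma>: "\<sigma> permutes {..<length jss}" and \<tau>s: "list_all2 (%\<tau> js. \<tau> permutes {..<length js}) \<tau>s jss"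
 shows "block_perm (perm_comp (map length jss) \<sigma> \<tau>s) (concat jss) =
  block_perm \<sigma> (map sum_list jss) o perm_sums (map sum_list jss) (map2 block_perm \<tau>s jss)"
proof -
 let ?ks = "map length jss" and ?js' = "map2 move \<tau>s jss"
 have lt: "length \<tau>s = length jss" using \<tau>s by (rule list_all2_lengthD)
 have nth: "\<tau>s ! i permutes {..<length (jss ! i)}" if "i < length jss" for i
  using \<tau>s that by (simp add: list_all2_conv_all_nth)
 have \<tau>s': "perms \<tau>s ?ks" using \<tau>s by (simp only: list_all2_map2)
 have js': "map length ?js' = ?ks" "map sum_list ?js' = map sum_list jss" "length ?js' = length jss"
  using lt nth by (auto intro!: nth_equalityI simp: sum_list_move)
 have p1: "perm_sums ?ks \<tau>s permutes {..<length (concat jss)}"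
  using perm_sums_permutes[OF \<tau>s'] by (simp add: length_concat)
 have p2: "block_perm \<sigma> ?ks permutes {..<length (concat jss)}"
  using block_perm_permutes[of \<sigma> ?ks] \<sigma> by (simp add: length_concat)
 have "block_perm (perm_comp ?ks \<sigma> \<tau>s) (concat jss) =
  block_perm (block_perm \<sigma> ?ks) (move (perm_sums ?ks \<tau>s) (concat jss)) o block_perm (perm_sums ?ks \<tau>s) (concat jss)"
  unfolding perm_comp_def by (rule block_perm_compose[OF p2 p1])
 also have "move (perm_sums ?ks \<tau>s) (concat jss) = concat ?js'" by (rule move_perm_sums[OF \<tau>s])
 also have "block_perm (block_perm \<sigma> ?ks) (concat ?js') = block_perm \<sigma> (map sum_list jss)"
  using block_perm_concat[of \<sigma> ?js'] \<sigma> unfolding js' by simp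
 also have "block_perm (perm_sums ?ks \<tau>s) (concat jss) = perm_sums (map sum_list jss) (map2 block_perm \<tau>s jss)"
  by (rule block_perm_perm_sums_concat[OF \<tau>s])
 finally show ?thesis .
qed

lemma perm_sum_assoc: "perm_sum (k + l) (perm_sum k \<sigma> \<tau>) \<rho> = perm_sum k \<sigma> (perm_sum l \<tau> \<rho>)"
 if "\<sigma> permutes {..<k}"
proof
 fix x
 show "perm_sum (k + l) (perm_sum k \<sigma> \<tau>) \<rho> x = perm_sum k \<sigma> (perm_sum l \<tau> \<rho>) x"
  by (auto simp: perm_sum_def)
qed

lemma perm_sums_append:
 "[|perms \<tau>s ks|] ==>
  perm_sums (ks @ ls) (\<tau>s @ \<rho>s) = perm_sum (sum_list ks) (perm_sums ks \<tau>s) (perm_sums ls \<rho>s)"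
proof (induction rule: list_all2_induct)
 case Nil then show ?case by (auto simp: perm_sum_def fun_eq_iff)
next
 case (Cons \<tau> \<tau>s k ks) then show ?case by (simp add: perm_sum_assoc)
qed

lemma perm_sums_concat:
 "list_all2 (%\<rho>s js. perms \<rho>s js) \<rho>ss jss ==>
  perm_sums (concat jss) (concat \<rho>ss) = perm_sums (map sum_list jss) (map2 perm_sums jss \<rho>ss)"
 by (induction rule: list_all2_induct) (simp_all add: perm_sums_append)

text \<open>Both sides are brought to the form of the block permutation of \<open>\<sigma>\<close>
  after a juxtaposition of inner composites; \<open>perm_sums_compose\<close> fuses the two inner
  layers.\<close>

lemma perm_comp_assoc:
 assumes \<sigma>: "\<sigma> permutes {..<length jss}" and \<tau>s: "list_all2 (%\<tau> js. \<tau> permutes {..<length js}) \<tau>s jss"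
  and \<rho>ss: "list_all2 (%\<rho>s js. perms \<rho>s js) \<rho>ss jss"
 shows "perm_comp (concat jss) (perm_comp (map length jss) \<sigma> \<tau>s) (concat \<rho>ss) =
  perm_comp (map sum_list jss) \<sigma> (map (%i. perm_comp (jss ! i) (\<tau>s ! i) (\<rho>ss ! i)) [0..<length jss])"
proof -
 let ?S = "map sum_list jss"
 have l: "length \<tau>s = length jss" "length \<rho>ss = length jss"
  using list_all2_lengthD[OF \<tau>s] list_all2_lengthD[OF \<rho>ss] .
 have nth: "\<tau>s ! i permutes {..<length (jss ! i)}" "perms (\<rho>ss ! i) (jss ! i)"
  if "i < length jss" for i
  using \<tau>s \<rho>ss that by (simp_all add: list_all2_conv_all_nth)
 have b: "perms (map2 block_perm \<tau>s jss) ?S"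
  using l nth by (auto simp: list_all2_conv_all_nth intro: block_perm_permutes)
 have s: "perms (map2 perm_sums jss \<rho>ss) ?S"
  using l nth by (auto simp: list_all2_conv_all_nth[of _ "map2 perm_sums jss \<rho>ss"] intro: perm_sums_permutes)
 have "map2 (o) (map2 block_perm \<tau>s jss) (map2 perm_sums jss \<rho>ss) =
   map (%i. perm_comp (jss ! i) (\<tau>s ! i) (\<rho>ss ! i)) [0..<length jss]"
  using l by (auto intro!: nth_equalityI simp: perm_comp_def)
 from perm_sums_compose[OF b s, unfolded this]
 show ?thesis
  unfolding perm_comp_def[of "concat jss"] block_perm_perm_comp[OF \<sigma> \<tau>s] perm_sums_concat[OF \<rho>ss]
  by (simp add: perm_comp_def[of ?S] comp_assoc)
qed


subsection \<open>The functors \<open>\<mu>\<close>\<close>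

lemma mu_obj_eq: "mu_obj \<sigma> fs =
  ds_move (sum_list (map dtgt fs)) (block_perm \<sigma> (map dtgt fs)) \<bullet> ds_juxts fs"
 by (simp add: mu_obj_def ds_move_def Let_def)

text \<open>The arrow part of \<open>\<mu>\<close>: undo \<open>\<sigma>\<close> at the source,
  juxtapose, permute by \<open>\<tau>\<close> at the target. Written with
  \<open>mu_obj \<tau>\<close>, it inherits the facts about objects.\<close>

definition mu_snd :: "(nat => nat) => (nat => nat) => ds_mor list => ds_mor"
 where "mu_snd \<sigma> \<tau> gs = mu_obj \<tau> gs \<bullet> ds_perm (sum_list (map dsrc gs)) (block_perm \<sigma> (map dsrc gs))"

lemma mu_arr_eq: "mu_arr u vs = (mu_obj (fst u) (map fst vs), mu_snd (fst u) (snd u) (map snd vs))"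
 by (simp add: mu_arr_def mu_snd_def mu_obj_def Let_def)

lemma mu_obj_simps [simp]:
 "dsrc (mu_obj \<sigma> fs) = sum_list (map dsrc fs)" "dtgt (mu_obj \<sigma> fs) = sum_list (map dtgt fs)"
 by (simp_all add: mu_obj_eq)

lemma mu_snd_simps [simp]:
 "dsrc (mu_snd \<sigma> \<tau> fs) = sum_list (map dsrc fs)" "dtgt (mu_snd \<sigma> \<tau> fs) = sum_list (map dtgt fs)"
 by (simp_all add: mu_snd_def)

lemma block_perm_map_permutes:
 "\<sigma> permutes {..<length fs} ==> block_perm \<sigma> (map h fs) permutes {..<sum_list (map h fs)}"
 by (rule block_perm_permutes) simp

lemma mu_obj_mors: "[|set fs <= ds_mors; \<sigma> permutes {..<length fs}|] ==> mu_obj \<sigma> fs \<in> ds_mors"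
 unfolding mu_obj_eq by (intro comp_mors ds_move_mors block_perm_map_permutes ds_juxts_mors) simp_all

lemma mu_snd_mors: "[|set fs <= ds_mors; \<sigma> permutes {..<length fs}; \<tau> permutes {..<length fs}|] ==> mu_snd \<sigma> \<tau> fs \<in> ds_mors"
 unfolding mu_snd_def by (intro comp_mors mu_obj_mors ds_perm_mors block_perm_map_permutes) simp_all

text \<open>The naturality that lets products descend to the coend: precomposition in all arguments
  is precomposition with one juxtaposition.\<close>

lemma mu_obj_comp:
 assumes "set fs <= ds_mors" "set hs <= ds_mors" "map dsrc fs = map dtgt hs" "\<sigma> permutes {..<length fs}"
 shows "mu_obj \<sigma> (map2 (\<bullet>) fs hs) = mu_obj \<sigma> fs \<bullet> ds_juxts hs"
proof -
 have l: "length fs = length hs" using assms(3) by (rule map_eq_imp_length_eq)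
 have t: "map dtgt (map2 (\<bullet>) fs hs) = map dtgt fs" by (rule nth_equalityI) (use l in simp_all)
 show ?thesis unfolding mu_obj_eq t juxts_comp[OF assms(1-3), symmetric] by (rule ds_comp_assoc[symmetric])
   (use assms in "simp_all add: ds_move_mors block_perm_map_permutes ds_juxts_mors")
qed

text \<open>Multiplying by \<open>\<rho>\<close> on the right amounts to reordering the arguments,
  up to a block permutation at the source. \<open>block_perm_compose\<close> splits off this
  permutation at the targets, and \<open>move_natural\<close> brings it to the source.\<close>

lemma mu_obj_equivariant:
 assumes fs: "set fs <= ds_mors" and \<sigma>: "\<sigma> permutes {..<length fs}" and \<rho>: "\<rho> permutes {..<length fs}"
 shows "mu_obj (\<sigma> o \<rho>) fs = mu_obj \<sigma> (move \<rho> fs) \<bullet> ds_move (sum_list (map dsrc fs)) (block_perm \<rho> (map dsrc fs))"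
proof -
 let ?n = "sum_list (map dtgt fs)"
 have m: "set (move \<rho> fs) <= ds_mors" using set_move[OF \<rho>] fs by simp
 have s: "map dtgt (move \<rho> fs) = move \<rho> (map dtgt fs)" "map dsrc (move \<rho> fs) = move \<rho> (map dsrc fs)"
  using move_map[OF \<rho>, of dtgt] move_map[OF \<rho>, of dsrc] by simp_all
 have sum: "sum_list (map dtgt (move \<rho> fs)) = ?n" "sum_list (map dsrc (move \<rho> fs)) = sum_list (map dsrc fs)"
  unfolding s using sum_list_move[of \<rho> "map dtgt fs"] sum_list_move[of \<rho> "map dsrc fs"] \<rho> by simp_all
 have p1: "block_perm \<sigma> (map dtgt (move \<rho> fs)) permutes {..<?n}"
  using block_perm_map_permutes[of \<sigma> "move \<rho> fs" dtgt] \<sigma> sum by simp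
 note p2 = block_perm_map_permutes[OF \<rho>, of dtgt] block_perm_map_permutes[OF \<rho>, of dsrc]
 have "mu_obj (\<sigma> o \<rho>) fs = ds_move ?n (block_perm \<sigma> (map dtgt (move \<rho> fs)) o block_perm \<rho> (map dtgt fs)) \<bullet> ds_juxts fs"
  unfolding mu_obj_eq s using block_perm_compose[of \<sigma> "map dtgt fs" \<rho>] \<sigma> \<rho> by simp
 also have "... = ds_move ?n (block_perm \<sigma> (map dtgt (move \<rho> fs))) \<bullet> ds_move ?n (block_perm \<rho> (map dtgt fs)) \<bullet> ds_juxts fs"
  by (simp only: move_move[OF p1 p2(1)])
 also have "... = ds_move ?n (block_perm \<sigma> (map dtgt (move \<rho> fs))) \<bullet> (ds_move ?n (block_perm \<rho> (map dtgt fs)) \<bullet> ds_juxts fs)"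
  by (rule ds_comp_assoc) (use p1 p2 fs in "simp_all add: ds_move_mors ds_juxts_mors")
 also have "... = ds_move ?n (block_perm \<sigma> (map dtgt (move \<rho> fs))) \<bullet>
   (ds_juxts (move \<rho> fs) \<bullet> ds_move (sum_list (map dsrc fs)) (block_perm \<rho> (map dsrc fs)))"
  unfolding move_natural[OF \<rho> fs] ..
 also have "... = mu_obj \<sigma> (move \<rho> fs) \<bullet> ds_move (sum_list (map dsrc fs)) (block_perm \<rho> (map dsrc fs))"
  unfolding mu_obj_eq sum
  by (rule ds_comp_assoc[symmetric]) (use p1 p2 m in "simp_all only: ds_move_mors ds_juxts_mors ds_juxts_src_tgt ds_move_simps sum")
 finally show ?thesis .
qed

text \<open>For arrows no correction remains: the block permutation \<open>?\<beta>\<close> at the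
  source of \<open>mu_obj\<close> cancels against the factor of the permutation with which
  \<open>mu_snd\<close> begins.\<close>

lemma mu_snd_equivariant:
 assumes gs: "set gs <= ds_mors" and \<sigma>: "\<sigma> permutes {..<length gs}" and \<tau>: "\<tau> permutes {..<length gs}"
  and \<rho>: "\<rho> permutes {..<length gs}"
 shows "mu_snd (\<sigma> o \<rho>) (\<tau> o \<rho>) gs = mu_snd \<sigma> \<tau> (move \<rho> gs)"
proof -
 let ?n = "sum_list (map dsrc gs)" and ?\<beta> = "block_perm \<rho> (map dsrc gs)"
 let ?\<alpha> = "block_perm \<sigma> (map dsrc (move \<rho> gs))"
 have m: "set (move \<rho> gs) <= ds_mors" using set_move[OF \<rho>] gs by simp
 have s: "map dsrc (move \<rho> gs) = move \<rho> (map dsrc gs)" using move_map[OF \<rho>, of dsrc] by simp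
 have sum: "sum_list (map dsrc (move \<rho> gs)) = ?n"
  unfolding s using sum_list_move[of \<rho> "map dsrc gs"] \<rho> by simp
 have p1: "?\<alpha> permutes {..<?n}"
  using block_perm_map_permutes[of \<sigma> "move \<rho> gs" dsrc] \<sigma> sum by simp
 note p2 = block_perm_map_permutes[OF \<rho>, of dsrc]
 have b: "block_perm (\<sigma> o \<rho>) (map dsrc gs) = ?\<alpha> o ?\<beta>"
  unfolding s using block_perm_compose[of \<sigma> "map dsrc gs" \<rho>] \<sigma> \<rho> by simp
 have mo: "mu_obj \<tau> (move \<rho> gs) \<in> ds_mors" by (rule mu_obj_mors[OF m]) (use \<tau> in simp)
 have src: "dsrc (mu_obj \<tau> (move \<rho> gs)) = ?n" by (simp add: sum)
 have "mu_snd (\<sigma> o \<rho>) (\<tau> o \<rho>) gs = mu_obj \<tau> (move \<rho> gs) \<bullet> ds_move ?n ?\<beta> \<bullet> ds_perm ?n (?\<alpha> o ?\<beta>)"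
  unfolding mu_snd_def mu_obj_equivariant[OF gs \<tau> \<rho>] b ..
 also have "... = mu_obj \<tau> (move \<rho> gs) \<bullet> (ds_move ?n ?\<beta> \<bullet> ds_perm ?n (?\<alpha> o ?\<beta>))"
  by (rule ds_comp_assoc) (simp_all add: mo sum ds_move_mors ds_perm_mors p1 p2 permutes_compose)
 also have "ds_move ?n ?\<beta> \<bullet> ds_perm ?n (?\<alpha> o ?\<beta>) = ds_move ?n ?\<beta> \<bullet> (ds_perm ?n ?\<beta> \<bullet> ds_perm ?n ?\<alpha>)"
  by (simp only: perm_perm[OF p2 p1])
 also have "... = ds_move ?n ?\<beta> \<bullet> ds_perm ?n ?\<beta> \<bullet> ds_perm ?n ?\<alpha>"
  by (rule ds_comp_assoc[symmetric]) (simp_all add: ds_move_mors ds_perm_mors p1 p2)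
 also have "... = ds_perm ?n ?\<alpha>"
  unfolding perm_move_cancel(2)[OF p2] by (rule comp_id_left) (simp_all add: ds_perm_mors p1)
 finally show ?thesis unfolding mu_snd_def sum .
qed

text \<open>Deduced from \<open>juxts_move\<close> by cancelling inverse morphisms, which spares the
  computation of the inverse of a juxtaposed permutation.\<close>

lemma juxts_perm:
 assumes "perms \<tau>s ks"
 shows "ds_juxts (map2 ds_perm ks \<tau>s) = ds_perm (sum_list ks) (perm_sums ks \<tau>s)"
proof -
 let ?n = "sum_list ks" and ?\<pi> = "perm_sums ks \<tau>s"
 have l: "length \<tau>s = length ks" using assms by (rule list_all2_lengthD)
 have p: "\<tau>s ! i permutes {..<ks ! i}" if "i < length ks" for i using assms that by (simp add: list_all2_conv_all_nth)
 note \<pi> = perm_sums_permutes[OF assms]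
 have m: "set (map2 ds_perm ks \<tau>s) <= ds_mors" "set (map2 ds_move ks \<tau>s) <= ds_mors"
  using p l by (auto simp: set_zip ds_move_mors ds_perm_mors)
 have s: "map dsrc (map2 ds_perm ks \<tau>s) = ks" "map dtgt (map2 ds_move ks \<tau>s) = ks" "map dsrc (map2 ds_move ks \<tau>s) = ks"
  "map dtgt (map2 ds_perm ks \<tau>s) = ks"
  using l by (auto intro!: nth_equalityI)
 have i: "map2 (\<bullet>) (map2 ds_perm ks \<tau>s) (map2 ds_move ks \<tau>s) = map ds_id ks"
  using l p by (auto intro!: nth_equalityI simp: perm_move_cancel)
 have c: "ds_juxts (map2 ds_perm ks \<tau>s) \<bullet> ds_move ?n ?\<pi> = ds_id ?n"
  unfolding juxts_move[OF assms, symmetric] juxts_comp[OF m trans[OF s(1) s(2)[symmetric]]] i juxts_ids ..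
 have src: "dsrc (ds_juxts (map2 ds_perm ks \<tau>s)) = ?n" by (simp only: ds_juxts_src_tgt s)
 have "ds_juxts (map2 ds_perm ks \<tau>s) = ds_juxts (map2 ds_perm ks \<tau>s) \<bullet> (ds_move ?n ?\<pi> \<bullet> ds_perm ?n ?\<pi>)"
  unfolding perm_move_cancel(2)[OF \<pi>] by (rule comp_id_right[symmetric, OF ds_juxts_mors[OF m(1)] src])
 also have "... = ds_juxts (map2 ds_perm ks \<tau>s) \<bullet> ds_move ?n ?\<pi> \<bullet> ds_perm ?n ?\<pi>"
  by (rule ds_comp_assoc[symmetric]) (simp_all only: ds_juxts_mors m ds_move_mors ds_perm_mors \<pi> src ds_move_simps ds_perm_simps)
 also have "... = ds_perm ?n ?\<pi>" unfolding c by (rule comp_id_left) (simp_all add: ds_perm_mors \<pi>)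
 finally show ?thesis .
qed

text \<open>The juxtaposition of the inner values splits by the interchange law into a juxtaposition
  of block permutations after one of morphisms; the permutations then merge by
  \<open>block_perm_perm_comp\<close>.\<close>

lemma mu_obj_assoc:
 assumes fss: "!!fs. fs \<in> set fss ==> set fs <= ds_mors" and \<sigma>: "\<sigma> permutes {..<length fss}"
  and \<tau>s: "list_all2 (%\<tau> fs. \<tau> permutes {..<length fs}) \<tau>s fss"
 shows "mu_obj (perm_comp (map length fss) \<sigma> \<tau>s) (concat fss) = mu_obj \<sigma> (map2 mu_obj \<tau>s fss)"
proof -
 let ?jss = "map (map dtgt) fss"
 let ?S = "map sum_list ?jss" and ?\<beta>s = "map2 block_perm \<tau>s ?jss"
 have lt: "length \<tau>s = length fss" using \<tau>s by (rule list_all2_lengthD)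
 have nth: "\<tau>s ! i permutes {..<length (fss ! i)}" "set (fss ! i) <= ds_mors" if "i < length fss" for i
  using \<tau>s that fss by (simp_all add: list_all2_conv_all_nth)
 have \<tau>j: "list_all2 (%\<tau> js. \<tau> permutes {..<length js}) \<tau>s ?jss"
  using \<tau>s by (simp add: list_all2_map2)
 have \<sigma>j: "\<sigma> permutes {..<length ?jss}" "\<sigma> permutes {..<length ?S}" using \<sigma> by simp_all
 have \<beta>: "perms ?\<beta>s ?S"
  using lt nth by (auto simp: list_all2_conv_all_nth intro: block_perm_map_permutes)
 note p = block_perm_permutes[OF \<sigma>j(2)] perm_sums_permutes[OF \<beta>]
 let ?n = "sum_list ?S"
 have cm: "set (concat fss) <= ds_mors" using fss by auto
 have tgt: "map dtgt (map2 mu_obj \<tau>s fss) = ?S" using lt by (auto intro!: nth_equalityI)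
 have jm: "set (map ds_juxts fss) <= ds_mors" using fss by (auto intro!: ds_juxts_mors)
 have mm: "set (map2 ds_move ?S ?\<beta>s) <= ds_mors"
  using lt nth by (auto simp: set_zip intro!: ds_move_mors block_perm_map_permutes)
 have "map2 mu_obj \<tau>s fss = map2 (\<bullet>) (map2 ds_move ?S ?\<beta>s) (map ds_juxts fss)"
  using lt by (auto intro!: nth_equalityI simp: mu_obj_eq)
 then have "ds_juxts (map2 mu_obj \<tau>s fss) = ds_juxts (map2 ds_move ?S ?\<beta>s) \<bullet> ds_juxts (map ds_juxts fss)"
  using lt by (subst juxts_comp[OF mm jm]) (auto intro!: nth_equalityI)
 also have "... = ds_move ?n (perm_sums ?S ?\<beta>s) \<bullet> ds_juxts (concat fss)"
  using juxts_concat[of fss] fss juxts_move[OF \<beta>] by (simp add: UN_subset_iff)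
 finally have "mu_obj \<sigma> (map2 mu_obj \<tau>s fss) =
   ds_move ?n (block_perm \<sigma> ?S) \<bullet> (ds_move ?n (perm_sums ?S ?\<beta>s) \<bullet> ds_juxts (concat fss))"
  unfolding mu_obj_eq[of \<sigma>] tgt by simp
 also have "... = ds_move ?n (block_perm \<sigma> ?S) \<bullet> ds_move ?n (perm_sums ?S ?\<beta>s) \<bullet> ds_juxts (concat fss)"
  by (rule ds_comp_assoc[symmetric])
   (use p cm in "simp_all add: ds_move_mors ds_juxts_mors map_concat sum_list_concat comp_def")
 also have "ds_move ?n (block_perm \<sigma> ?S) \<bullet> ds_move ?n (perm_sums ?S ?\<beta>s) =
   ds_move ?n (block_perm \<sigma> ?S o perm_sums ?S ?\<beta>s)"
  by (rule move_move[OF p])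
 also have "block_perm \<sigma> ?S o perm_sums ?S ?\<beta>s = block_perm (perm_comp (map length ?jss) \<sigma> \<tau>s) (concat ?jss)"
  by (rule block_perm_perm_comp[OF \<sigma>j(1) \<tau>j, symmetric])
 finally show ?thesis
  unfolding mu_obj_eq[of "perm_comp _ _ _"] map_concat by (simp add: sum_list_concat comp_def)
qed

lemma mu_snd_assoc:
 assumes gss: "!!gs. gs \<in> set gss ==> set gs <= ds_mors"
  and \<sigma>: "\<sigma> permutes {..<length gss}" and \<tau>: "\<tau> permutes {..<length gss}"
  and \<sigma>s: "list_all2 (%\<tau> gs. \<tau> permutes {..<length gs}) \<sigma>s gss"
  and \<tau>s: "list_all2 (%\<tau> gs. \<tau> permutes {..<length gs}) \<tau>s gss"
 shows "mu_snd (perm_comp (map length gss) \<sigma> \<sigma>s) (perm_comp (map length gss) \<tau> \<tau>s) (concat gss) =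
  mu_snd \<sigma> \<tau> (map (%i. mu_snd (\<sigma>s ! i) (\<tau>s ! i) (gss ! i)) [0..<length gss])"
proof -
 let ?jss = "map (map dsrc) gss"
 let ?S = "map sum_list ?jss" and ?\<beta>s = "map2 block_perm \<sigma>s ?jss"
 let ?gs = "map (%i. mu_snd (\<sigma>s ! i) (\<tau>s ! i) (gss ! i)) [0..<length gss]"
 let ?n = "sum_list ?S"
 have l: "length \<sigma>s = length gss" "length \<tau>s = length gss"
  using list_all2_lengthD[OF \<sigma>s] list_all2_lengthD[OF \<tau>s] .
 have nth: "\<sigma>s ! i permutes {..<length (gss ! i)}" "\<tau>s ! i permutes {..<length (gss ! i)}" "set (gss ! i) <= ds_mors"
  if "i < length gss" for i
  using \<sigma>s \<tau>s that gss by (simp_all add: list_all2_conv_all_nth)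
 have \<sigma>j: "list_all2 (%\<tau> js. \<tau> permutes {..<length js}) \<sigma>s ?jss"
  using \<sigma>s by (simp add: list_all2_map2)
 have \<sigma>': "\<sigma> permutes {..<length ?jss}" "\<sigma> permutes {..<length ?S}" using \<sigma> by simp_all
 have \<beta>: "perms ?\<beta>s ?S"
  using l nth by (auto simp: list_all2_conv_all_nth intro: block_perm_map_permutes)
 note p = block_perm_permutes[OF \<sigma>'(2)] perm_sums_permutes[OF \<beta>]
 have mo: "set (map2 mu_obj \<tau>s gss) <= ds_mors" using l nth by (auto simp: set_zip intro!: mu_obj_mors)
 have mp: "set (map2 ds_perm ?S ?\<beta>s) <= ds_mors"
  using l nth by (auto simp: set_zip intro!: ds_perm_mors block_perm_map_permutes)
 have st: "map dsrc (map2 mu_obj \<tau>s gss) = ?S" "map dtgt (map2 ds_perm ?S ?\<beta>s) = ?S" "map dsrc ?gs = ?S"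
  using l by (auto intro!: nth_equalityI)
 have "?gs = map2 (\<bullet>) (map2 mu_obj \<tau>s gss) (map2 ds_perm ?S ?\<beta>s)"
  using l by (auto intro!: nth_equalityI simp: mu_snd_def)
 then have "mu_obj \<tau> ?gs = mu_obj \<tau> (map2 mu_obj \<tau>s gss) \<bullet> ds_perm ?n (perm_sums ?S ?\<beta>s)"
  using mu_obj_comp[OF mo mp, of \<tau>] st \<tau> l juxts_perm[OF \<beta>] by simp
 moreover have "mu_obj \<tau> (map2 mu_obj \<tau>s gss) = mu_obj (perm_comp (map length gss) \<tau> \<tau>s) (concat gss)"
  by (rule mu_obj_assoc[OF gss \<tau> \<tau>s, symmetric])
 ultimately have "mu_snd \<sigma> \<tau> ?gs =
  mu_obj (perm_comp (map length gss) \<tau> \<tau>s) (concat gss) \<bullet> ds_perm ?n (perm_sums ?S ?\<beta>s) \<bullet> ds_perm ?n (block_perm \<sigma> ?S)"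
  unfolding mu_snd_def[of \<sigma> \<tau> ?gs] st by (simp only:)
 also have "... = mu_obj (perm_comp (map length gss) \<tau> \<tau>s) (concat gss) \<bullet>
   (ds_perm ?n (perm_sums ?S ?\<beta>s) \<bullet> ds_perm ?n (block_perm \<sigma> ?S))"
 proof (rule ds_comp_assoc)
  have "perms \<tau>s (map length gss)" using \<tau>s by (simp add: list_all2_map2)
  then show "mu_obj (perm_comp (map length gss) \<tau> \<tau>s) (concat gss) \<in> ds_mors"
   using gss perm_comp_permutes[of \<tau> "map length gss" \<tau>s] \<tau>
   by (intro mu_obj_mors) (auto simp: length_concat)
 qed (use p in "simp_all add: ds_perm_mors map_concat sum_list_concat comp_def")
 also have "ds_perm ?n (perm_sums ?S ?\<beta>s) \<bullet> ds_perm ?n (block_perm \<sigma> ?S) = ds_perm ?n (block_perm \<sigma> ?S o perm_sums ?S ?\<beta>s)"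
  by (rule perm_perm[OF p(2,1)])
 also have "block_perm \<sigma> ?S o perm_sums ?S ?\<beta>s = block_perm (perm_comp (map length ?jss) \<sigma> \<sigma>s) (concat ?jss)"
  by (rule block_perm_perm_comp[OF \<sigma>'(1) \<sigma>j, symmetric])
 finally show ?thesis
  unfolding mu_snd_def[of "perm_comp _ _ _"] map_concat by (simp add: sum_list_concat comp_def)
qed

lemma mu_obj_unit: "f \<in> ds_mors ==> mu_obj id [f] = f"
 by (simp add: mu_obj_eq block_perm_id ds_move_id juxt_id0 comp_id_left)

lemma mu_snd_unit: "f \<in> ds_mors ==> mu_snd id id [f] = f"
 unfolding mu_snd_def mu_obj_unit by (simp add: block_perm_id ds_id_def[symmetric] comp_id_right)

lemma mu_snd_ids:
 assumes "\<sigma> permutes {..<length ks}"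
 shows "mu_snd \<sigma> \<sigma> (map ds_id ks) = ds_id (sum_list ks)"
proof -
 note p = block_perm_permutes[OF assms]
 have "mu_obj \<sigma> (map ds_id ks) = ds_move (sum_list ks) (block_perm \<sigma> ks)"
  unfolding mu_obj_eq juxts_ids by (simp add: comp_def comp_id_right ds_move_mors p)
 then show ?thesis unfolding mu_snd_def by (simp add: comp_def perm_move_cancel p)
qed

text \<open>Says that \<open>\<mu>\<close> sends arrows of the under-categories to arrows between
  the images of their ends; the permutation \<open>\<sigma>\<close> in the middle cancels.\<close>

lemma mu_snd_mu_obj:
 assumes gs: "set gs <= ds_mors" and fs: "set fs <= ds_mors" and e: "map dsrc gs = map dtgt fs"
  and \<sigma>: "\<sigma> permutes {..<length gs}" and \<tau>: "\<tau> permutes {..<length gs}"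
 shows "mu_snd \<sigma> \<tau> gs \<bullet> mu_obj \<sigma> fs = mu_obj \<tau> (map2 (\<bullet>) gs fs)"
proof -
 let ?n = "sum_list (map dsrc gs)" and ?\<beta> = "block_perm \<sigma> (map dsrc gs)"
 have l: "length gs = length fs" using e by (rule map_eq_imp_length_eq)
 note p = block_perm_map_permutes[OF \<sigma>, of dsrc]
 note mo = mu_obj_mors[OF gs \<tau>]
 have mf: "mu_obj \<sigma> fs = ds_move ?n ?\<beta> \<bullet> ds_juxts fs" by (simp add: mu_obj_eq e)
 have jf: "ds_juxts fs \<in> ds_mors" "dtgt (ds_juxts fs) = ?n" using ds_juxts_mors[OF fs] e by simp_all
 have mfm: "ds_move ?n ?\<beta> \<bullet> ds_juxts fs \<in> ds_mors" by (rule comp_mors) (simp_all add: jf ds_move_mors p p[unfolded e] e)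
 have "mu_snd \<sigma> \<tau> gs \<bullet> mu_obj \<sigma> fs = mu_obj \<tau> gs \<bullet> (ds_perm ?n ?\<beta> \<bullet> (ds_move ?n ?\<beta> \<bullet> ds_juxts fs))"
  unfolding mu_snd_def mf by (rule ds_comp_assoc) (simp_all add: mo ds_perm_mors p p[unfolded e] mfm mfm[unfolded e] e)
 also have "ds_perm ?n ?\<beta> \<bullet> (ds_move ?n ?\<beta> \<bullet> ds_juxts fs) = ds_perm ?n ?\<beta> \<bullet> ds_move ?n ?\<beta> \<bullet> ds_juxts fs"
  by (rule ds_comp_assoc[symmetric]) (simp_all only: jf ds_perm_mors ds_move_mors p ds_move_simps ds_perm_simps)
 also have "... = ds_juxts fs" unfolding perm_move_cancel(1)[OF p] by (rule comp_id_left[OF jf])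
 also have "mu_obj \<tau> gs \<bullet> ds_juxts fs = mu_obj \<tau> (map2 (\<bullet>) gs fs)"
  by (rule mu_obj_comp[OF gs fs e \<tau>, symmetric])
 finally show ?thesis .
qed

lemma mu_snd_comp:
 assumes hs: "set hs <= ds_mors" and gs: "set gs <= ds_mors" and e: "map dsrc hs = map dtgt gs"
  and \<sigma>: "\<sigma> permutes {..<length gs}" and \<tau>: "\<tau> permutes {..<length gs}" and \<upsilon>: "\<upsilon> permutes {..<length gs}"
 shows "mu_snd \<tau> \<upsilon> hs \<bullet> mu_snd \<sigma> \<tau> gs = mu_snd \<sigma> \<upsilon> (map2 (\<bullet>) hs gs)"
proof -
 have l: "length hs = length gs" using e by (rule map_eq_imp_length_eq)
 have s: "map dsrc (map2 (\<bullet>) hs gs) = map dsrc gs" by (rule nth_equalityI) (use l in simp_all)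
 have "mu_snd \<tau> \<upsilon> hs \<bullet> mu_snd \<sigma> \<tau> gs =
  mu_snd \<tau> \<upsilon> hs \<bullet> mu_obj \<tau> gs \<bullet> ds_perm (sum_list (map dsrc gs)) (block_perm \<sigma> (map dsrc gs))"
  unfolding mu_snd_def[of \<sigma>]
  by (rule ds_comp_assoc[symmetric])
   (use e l \<sigma> \<tau> \<upsilon> in "simp_all add: mu_snd_mors mu_obj_mors hs gs ds_perm_mors block_perm_map_permutes")
 then show ?thesis
  unfolding mu_snd_def[of \<sigma> \<upsilon>] s using mu_snd_mu_obj[OF hs gs e, of \<tau> \<upsilon>] \<tau> \<upsilon> l by simp
qed

section \<open>Multilinear maps of lists\<close>

context cring
begin

lemma multilinear_ext_bimulti:
 assumes "!!x ys. [|x \<in> X; list_all2 (\<in>) ys Ys|] ==> F x ys \<in> Z"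
 shows "bimulti R (free X) (map (free) Ys) (free Z) (mext F)"
 unfolding bimulti_def multilin_def
 using multilinear_ext_closed[OF _ _ assms] multilinear_ext_hom_slot[OF _ _ _ assms]
  multilinear_ext_hom_left[OF _ assms]
 by (intro conjI ballI allI impI) simp_all

lemma slotlinI:
 assumes "!!xs. xs \<in> tuples Ms ==> f xs \<in> tuples Ns"
  and "!!xs i. [|xs \<in> tuples Ms; i < length Ms|] ==> k i < length Ns \<and> g i \<in> mhom (Ms ! i) (Ns ! k i) \<and>
   (\<forall>x\<in>carrier (Ms ! i). f (xs[i := x]) = (f xs)[k i := g i x])"
 shows "slotlin R Ms Ns f"
 unfolding slotlin_def using assms by blast

lemma tuples_append: "[|xs \<in> tuples Ms; ys \<in> tuples Ns|] ==> xs @ ys \<in> tuples (Ms @ Ns)"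
 by (simp add: tuples_def list_all2_appendI)

lemma slotlin_append:
 assumes us: "us \<in> tuples As" and ws: "ws \<in> tuples Bs"
 shows "slotlin R Ms (As @ Ms @ Bs) (%y. us @ y @ ws)"
proof (rule slotlinI[where k="%i. length As + i" and g="%_ x. x"])
 show "us @ xs @ ws \<in> tuples (As @ Ms @ Bs)" if "xs \<in> tuples Ms" for xs
  using us ws that by (intro tuples_append)
 fix xs i assume xs: "xs \<in> tuples Ms" and i: "i < length Ms"
 have l: "length us = length As" "length xs = length Ms" using us xs by (auto simp: tuples_iff)
 show "length As + i < length (As @ Ms @ Bs) \<and>
  (%x. x) \<in> mhom (Ms ! i) ((As @ Ms @ Bs) ! (length As + i)) \<and>
  (\<forall>x\<in>carrier (Ms ! i). us @ xs[i := x] @ ws = (us @ xs @ ws)[length As + i := x])"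
  using l i by (simp add: nth_append list_update_append mod_hom_id)
qed

lemma slotlin_map2:
 assumes l: "length Ms = length hs" "length Ns = length hs"
  and h: "!!i. i < length hs ==> hs ! i \<in> mhom (Ms ! i) (Ns ! i)"
 shows "slotlin R Ms Ns (map2 (%h x. h x) hs)"
proof (rule slotlinI[where k="%i. i" and g="%i. hs ! i"])
 show "map2 (%h x. h x) hs xs \<in> tuples Ns" if "xs \<in> tuples Ms" for xs
  using that l hom_closed[OF h] by (simp add: tuples_iff)
 fix xs i assume xs: "xs \<in> tuples Ms" and i: "i < length Ms"
 have "map2 (%h x. h x) hs (xs[i := x]) = (map2 (%h x. h x) hs xs)[i := (hs ! i) x]" for x
  by (rule nth_equalityI) (use xs l i in "auto simp: tuples_iff nth_list_update")
 then show "i < length Ns \<and> hs ! i \<in> mhom (Ms ! i) (Ns ! i) \<and>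
  (\<forall>x\<in>carrier (Ms ! i). map2 (%h x. h x) hs (xs[i := x]) = (map2 (%h x. h x) hs xs)[i := (hs ! i) x])"
  using l h i by simp
qed

lemma slotlin_map:
 assumes "!!M. M \<in> set Ms ==> h \<in> mhom M (H M)"
 shows "slotlin R Ms (map H Ms) (map h)"
proof (rule slotlinI[where k="%i. i" and g="%_. h"])
 show "map h xs \<in> tuples (map H Ms)" if "xs \<in> tuples Ms" for xs
  using that hom_closed[OF assms] by (simp add: tuples_iff)
 fix xs i assume "xs \<in> tuples Ms" "i < length Ms"
 then show "i < length (map H Ms) \<and> h \<in> mhom (Ms ! i) (map H Ms ! i) \<and>
  (\<forall>x\<in>carrier (Ms ! i). map h (xs[i := x]) = (map h xs)[i := h x])"
  using assms by (simp add: map_update)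
qed

lemma move_update:
 assumes "\<sigma> permutes {..<length xs}" "i < length xs"
 shows "move \<sigma> (xs[i := x]) = (move \<sigma> xs)[\<sigma> i := x]"
proof (rule move_unique)
 fix j assume "j < length (xs[i := x])"
 then show "(move \<sigma> xs)[\<sigma> i := x] ! \<sigma> j = xs[i := x] ! j"
  using assms permutes_in_image[OF assms(1), of j] nth_move[OF assms(1), of j] inj_eq[OF permutes_inj[OF assms(1)], of i j]
  by (auto simp: nth_list_update)
qed (use assms in simp_all)

lemma slotlin_move:
 assumes \<sigma>: "\<sigma> permutes {..<length Ms}"
 shows "slotlin R Ms (move \<sigma> Ms) (move \<sigma>)"
proof (rule slotlinI[where k="\<sigma>" and g="%_ x. x"])
 show "move \<sigma> xs \<in> tuples (move \<sigma> Ms)" if "xs \<in> tuples Ms" for xs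
  using that list_all2_permute_list_iff[of "inv_into UNIV \<sigma>" xs "%x M. x \<in> carrier M" Ms] permutes_inv[OF \<sigma>]
  by (auto simp: tuples_def move_def dest: list_all2_lengthD)
 fix xs i assume "xs \<in> tuples Ms" "i < length Ms"
 then show "\<sigma> i < length (move \<sigma> Ms) \<and> (%x. x) \<in> mhom (Ms ! i) (move \<sigma> Ms ! \<sigma> i) \<and>
  (\<forall>x\<in>carrier (Ms ! i). move \<sigma> (xs[i := x]) = (move \<sigma> xs)[\<sigma> i := x])"
  using \<sigma> permutes_in_image[OF \<sigma>, of i] by (simp add: nth_move mod_hom_id move_update tuples_iff)
qed

lemma tuples_concat:
 "list_tuples xss Mss ==> concat xss \<in> tuples (concat Mss)"
 by (induction rule: list_all2_induct) (auto intro: tuples_append simp: tuples_def[of "[]"])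

lemma slotlin_concat_update:
 assumes xss: "list_tuples xss Mss" and i: "i < length Mss"
 shows "slotlin R (Mss ! i) (concat Mss) (%y. concat (xss[i := y]))"
proof -
 have l: "i < length xss" using list_all2_lengthD[OF xss] i by simp
 have "concat Mss = concat (take i Mss) @ (Mss ! i) @ concat (drop (Suc i) Mss)"
  by (metis append_Cons append_Nil concat.simps(2) concat_append i id_take_nth_drop)
 moreover have "concat (xss[i := y]) = concat (take i xss) @ y @ concat (drop (Suc i) xss)" for y
  using l by (simp add: upd_conv_take_nth_drop)
 moreover have "list_tuples (take i xss) (take i Mss)"
  "list_tuples (drop (Suc i) xss) (drop (Suc i) Mss)"
  using xss by (simp_all add: list_all2_takeI list_all2_dropI)
 ultimately show ?thesis using slotlin_append[OF tuples_concat tuples_concat] by simp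
qed

text \<open>Reduces the associativity of operadic compositions to generators.\<close>

lemma assoc_reduce:
 assumes D: "module R D" and E: "module R E" and P: "module R P"
  and Es: "\<forall>M\<in>set Es. module R M" and Qs: "\<forall>M\<in>set Qs. module R M"
  and Xss: "\<forall>Xs\<in>set Xss. \<forall>X\<in>set Xs. module R X"
  and l: "length Xss = length Es" "length Qs = length Es"
  and C: "bimulti R D Es E C" and \<Psi>: "bimulti R E (concat Xss) P \<Psi>"
  and \<phi>: "!!i. i < length Es ==> bimulti R (Es ! i) (Xss ! i) (Qs ! i) (\<phi> i)"
  and \<Omega>: "bimulti R D Qs P \<Omega>"
  and GD: "generates R D GD" and GE: "!!i. i < length Es ==> generates R (Es ! i) (GE i)"
  and GX: "!!i k. [|i < length Es; k < length (Xss ! i)|] ==> generates R (Xss ! i ! k) (GX i k)"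
  and eq: "!!d es xss. [|d \<in> GD; length es = length Es; \<forall>i<length Es. es ! i \<in> GE i; length xss = length Es;
    \<forall>i<length Es. length (xss ! i) = length (Xss ! i) \<and> (\<forall>k<length (Xss ! i). xss ! i ! k \<in> GX i k)|] ==>
   \<Psi> (C d es) (concat xss) = \<Omega> d (map (%i. \<phi> i (es ! i) (xss ! i)) [0..<length Es])"
  and d: "d \<in> carrier D" and es: "es \<in> tuples Es"
  and xss: "list_tuples xss Xss"
 shows "\<Psi> (C d es) (concat xss) = \<Omega> d (map (%i. \<phi> i (es ! i) (xss ! i)) [0..<length Es])"
proof -
 have Xi: "\<forall>X\<in>set (Xss ! i). module R X" if "i < length Es" for i
  using bspec[OF Xss nth_mem, of i] l that by simp
 have G1: "GD <= carrier D" "!!i. i < length Es ==> GE i <= carrier (Es ! i)"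
  using generates_subset[OF GD] generates_subset[OF GE] by auto
 have G2: "GX i k <= carrier (Xss ! i ! k)" if "i < length Es" "k < length (Xss ! i)" for i k
  using generates_subset[OF GX] that by simp
 \<comment> \<open>With \<open>d\<close> and \<open>es\<close> fixed to generators, the inner lists
   are reduced group by group; inside one group both sides are multilinear in its entries.\<close>
 have inner: "\<Psi> (C d es) (concat xss) = \<Omega> d (map (%i. \<phi> i (es ! i) (xss ! i)) [0..<length Es])"
  if de: "d \<in> GD" "length es = length Es" "\<forall>i<length Es. es ! i \<in> GE i"
   and x: "length xss = length Es" "\<forall>i<length Es. xss ! i \<in> tuples (Xss ! i)" for d es xss
 proof -
  have dD: "d \<in> carrier D" using de G1 by auto
  have eE: "es \<in> tuples Es" using de G1 by (fastforce simp: tuples_iff)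
  have ei: "i < length Es ==> es ! i \<in> carrier (Es ! i)" for i using eE by (simp add: tuples_iff)
  have CE: "C d es \<in> carrier E" by (rule multilin_closed[OF bimultiD(1)[OF C dD] eE])
  show ?thesis using _ _ _ x
  proof (rule slot_induct[where G="%i. {xs. length xs = length (Xss ! i) \<and> (\<forall>k<length (Xss ! i). xs ! k \<in> GX i k)}"])
   show "{xs. length xs = length (Xss ! i) \<and> (\<forall>k<length (Xss ! i). xs ! k \<in> GX i k)} <= tuples (Xss ! i)"
    if "i < length Es" for i
    using G2[OF that] by (fastforce simp: tuples_iff)
  next
   fix xss i
   assume x: "length xss = length Es" "\<forall>j<length Es. xss ! j \<in> tuples (Xss ! j)" and i: "i < length Es"
    and IH: "!!xs. xs \<in> {xs. length xs = length (Xss ! i) \<and> (\<forall>k<length (Xss ! i). xs ! k \<in> GX i k)} ==>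
     \<Psi> (C d es) (concat (xss[i := xs])) =
     \<Omega> d (map (%j. \<phi> j (es ! j) (xss[i := xs] ! j)) [0..<length Es])"
   have xl: "list_tuples xss Xss" using x l by (simp add: list_all2_conv_all_nth)
   let ?m = "map (%j. \<phi> j (es ! j) (xss ! j)) [0..<length Es]"
   have m: "?m \<in> tuples Qs"
    using l x by (auto simp: tuples_iff intro!: multilin_closed[OF bimultiD(1)[OF \<phi> ei]])
   have mu: "map (%j. \<phi> j (es ! j) (xss[i := xs] ! j)) [0..<length Es] = ?m[i := \<phi> i (es ! i) xs]" for xs
    using x i by (intro nth_equalityI) (auto simp: nth_list_update)
   have 1: "multilin R (Xss ! i) P (%y. \<Psi> (C d es) (concat (xss[i := y])))"
    by (rule multilin_slotlin[OF Xi[OF i] bimultiD(1)[OF \<Psi> CE] slotlin_concat_update[OF xl]]) (use i l in simp)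
   have 2: "multilin R (Xss ! i) P (%y. \<Omega> d (?m[i := \<phi> i (es ! i) y]))"
    by (rule multilin_compose[OF bimultiD(1)[OF \<phi>[OF i] ei[OF i]] multilin_slot[OF bimultiD(1)[OF \<Omega> dD] m]])
     (use i l in simp)
   have "\<Psi> (C d es) (concat (xss[i := xss ! i])) = \<Omega> d (?m[i := \<phi> i (es ! i) (xss ! i)])"
    by (rule multilin_eqI[OF Xi[OF i] P GX[OF i] 1 2]) (use IH x i in "simp_all add: mu")
   then show "\<Psi> (C d es) (concat xss) = \<Omega> d ?m" using x i by (simp add: mu[symmetric])
  qed (use eq[OF de] in auto)
 qed
 have x: "length xss = length Es" "\<forall>i<length Es. xss ! i \<in> tuples (Xss ! i)"
  using xss l by (auto simp: list_all2_conv_all_nth)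
 \<comment> \<open>Each operation \<open>es ! i\<close> affects only its own value, so the
   right-hand side is multilinear in \<open>es\<close> for arbitrary fixed
   \<open>xss\<close>.\<close>
 have sl: "slotlin R Es Qs (%es. map (%i. \<phi> i (es ! i) (xss ! i)) [0..<length Es])"
 proof (rule slotlinI[where k="%i. i" and g="%i e. \<phi> i e (xss ! i)"])
  show "map (%i. \<phi> i (es ! i) (xss ! i)) [0..<length Es] \<in> tuples Qs" if "es \<in> tuples Es" for es
   using that l x by (auto simp: tuples_iff intro!: multilin_closed[OF bimultiD(1)[OF \<phi>]])
  fix es i assume es: "es \<in> tuples Es" and i: "i < length Es"
  then have "map (%j. \<phi> j (es[i := e] ! j) (xss ! j)) [0..<length Es] =
    (map (%j. \<phi> j (es ! j) (xss ! j)) [0..<length Es])[i := \<phi> i e (xss ! i)]" for e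
   by (intro nth_equalityI) (auto simp: nth_list_update tuples_iff)
  then show "i < length Qs \<and> (%e. \<phi> i e (xss ! i)) \<in> mhom (Es ! i) (Qs ! i) \<and>
   (\<forall>e\<in>carrier (Es ! i). map (%j. \<phi> j (es[i := e] ! j) (xss ! j)) [0..<length Es] =
    (map (%j. \<phi> j (es ! j) (xss ! j)) [0..<length Es])[i := \<phi> i e (xss ! i)])"
   using i l bimultiD(2)[OF \<phi>[OF i]] x by simp
 qed
 have 1: "bimulti R D Es P (%d es. \<Psi> (C d es) (concat xss))"
  by (rule bimulti_compose[OF C bimultiD(2)[OF \<Psi> tuples_concat[OF xss]]])
 have 2: "bimulti R D Es P (%d es. \<Omega> d (map (%i. \<phi> i (es ! i) (xss ! i)) [0..<length Es]))"
  unfolding bimulti_def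
  using multilin_slotlin[OF Es bimultiD(1)[OF \<Omega>] sl] bimultiD(2)[OF \<Omega>] sl
  by (simp add: slotlin_def)
 show ?thesis by (rule bimulti_eqI[OF D Es P GD GE 1 2 _ d es]) (use inner[OF _ _ _ x] in simp_all)
qed

end

section \<open>Nerves\<close>

lemma arrows_upto_iff: "(i, j) \<in> arrows_upto p \<longleftrightarrow> i <= j \<and> j <= p"
 by (auto simp: arrows_upto_def)

lemma monotone_mapsD:
 assumes "\<theta> \<in> monotone_maps q p"
 shows "i <= q ==> \<theta> i <= p" "[|i <= j; j <= q|] ==> \<theta> i <= \<theta> j"
 using assms by (auto simp: monotone_maps_def monotone_on_def)

lemma arrows_upto_map: "[|\<theta> \<in> monotone_maps q p; (i, j) \<in> arrows_upto q|] ==> (\<theta> i, \<theta> j) \<in> arrows_upto p"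
 using monotone_mapsD[of \<theta> q p] by (auto simp: arrows_upto_iff)

lemma simplex_eqI:
 assumes "s \<in> extensional (arrows_upto p)" "t \<in> extensional (arrows_upto p)"
  and "!!i j. (i, j) \<in> arrows_upto p ==> s (i, j) = t (i, j)"
 shows "s = t"
 by (rule extensionalityI[OF assms(1,2)]) (use assms(3) in auto)

lemma nerve_ext: "s \<in> nerve C p ==> s \<in> extensional (arrows_upto p)"
 by (auto simp: nerve_def)

lemma nerve_op_closed:
 assumes "\<theta> \<in> monotone_maps q p" "s \<in> nerve C p"
 shows "nerve_op q \<theta> s \<in> nerve C q"
proof -
 note \<theta> = monotone_mapsD[OF assms(1)]
 obtain c where c: "\<forall>i\<le>p. c i \<in> Obj C \<and> s (i, i) = Ide C (c i)"
  "\<forall>i j. i <= j \<and> j <= p --> s (i, j) \<in> Hom C (c i) (c j)"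
  "\<forall>i j l. i <= j \<and> j <= l \<and> l <= p --> s (i, l) = Cmp C (s (j, l)) (s (i, j))"
  using assms(2) unfolding nerve_def by blast
 show ?thesis unfolding nerve_def by (intro CollectI conjI exI[of _ "%i. c (\<theta> i)"] allI impI)
   (use c \<theta> in "auto simp: nerve_op_def arrows_upto_iff")
qed

lemma nerve_op_id: "s \<in> nerve C p ==> nerve_op p (restrict id {..p}) s = s"
 by (rule simplex_eqI[of _ p]) (auto simp: nerve_op_def arrows_upto_iff dest: nerve_ext)

lemma nerve_op_comp:
 assumes "\<theta> \<in> monotone_maps q p" "\<eta> \<in> monotone_maps r q"
 shows "nerve_op r (compose {..r} \<theta> \<eta>) s = nerve_op r \<eta> (nerve_op q \<theta> s)"
 by (rule simplex_eqI[of _ r])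
  (use arrows_upto_map[OF assms(2)] in "auto simp: nerve_op_def arrows_upto_iff compose_def")

lemma nerve_map_apply: "(i, j) \<in> arrows_upto p ==> nerve_map p F s (i, j) = F (s (i, j))"
 by (simp add: nerve_map_def)

lemma nerve_map_prod_apply: "(i, j) \<in> arrows_upto p ==>
  nerve_map_prod p F s ts (i, j) = F (s (i, j)) (map (%t. t (i, j)) ts)"
 by (simp add: nerve_map_prod_def)

lemma nerve_op_apply: "(i, j) \<in> arrows_upto q ==> nerve_op q \<theta> s (i, j) = s (\<theta> i, \<theta> j)"
 by (simp add: nerve_op_def)

lemma nerve_map_ext: "nerve_map p F s \<in> extensional (arrows_upto p)"
 "nerve_map_prod p G s ts \<in> extensional (arrows_upto p)"
 "nerve_op p \<theta> s \<in> extensional (arrows_upto p)"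
 by (simp_all add: nerve_map_def nerve_map_prod_def nerve_op_def)

lemma nerve_op_map:
 "\<theta> \<in> monotone_maps q p ==> nerve_op q \<theta> (nerve_map p F s) = nerve_map q F (nerve_op q \<theta> s)"
 by (rule simplex_eqI[OF nerve_map_ext(3,1)])
  (simp add: nerve_op_apply nerve_map_apply arrows_upto_map)

lemma nerve_op_map_prod:
 "\<theta> \<in> monotone_maps q p ==>
  nerve_op q \<theta> (nerve_map_prod p F s ts) = nerve_map_prod q F (nerve_op q \<theta> s) (map (nerve_op q \<theta>) ts)"
 by (rule simplex_eqI[OF nerve_map_ext(3,2)])
  (simp add: nerve_op_apply nerve_map_prod_apply arrows_upto_map comp_def)

context cring
begin

lemma nerve_smod_simps: "lev (nerve_smod R C) p = free (nerve C p)"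
 "sop (nerve_smod R C) q p \<theta> = free_map R (nerve_op q \<theta>)"
 by (simp_all add: nerve_smod_def)

lemma nerve_smod_simplicial: "simplicial_module R (nerve_smod R C)"
proof (intro simplicial_module.intro simplicial_module_axioms.intro, unfold nerve_smod_simps)
 show "cring R" by (rule cring_axioms)
 show "module R (free (nerve C p))" for p by (rule free_mod)
 show op: "free_map R (nerve_op q \<theta>) \<in> mhom (free (nerve C p)) (free (nerve C q))"
  if "\<theta> \<in> monotone_maps q p" for \<theta> q p
  by (rule free_map_hom) (rule nerve_op_closed[OF that])
 have id: "restrict id {..p} \<in> monotone_maps p p" for p by (auto simp: monotone_maps_def monotone_on_def)
 show "free_map R (nerve_op p (restrict id {..p})) x = x" if "x \<in> carrier (free (nerve C p))" for x p
  by (rule mod_hom_eqI[OF free_generates free_mod free_mod op[OF id] mod_hom_id(2) _ that])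
   (auto simp: free_map_basis nerve_op_id)
 fix \<theta> \<eta> q p r x assume \<theta>: "\<theta> \<in> monotone_maps q p" and \<eta>: "\<eta> \<in> monotone_maps r q"
  and x: "x \<in> carrier (free (nerve C p))"
 have c: "compose {..r} \<theta> \<eta> \<in> monotone_maps r p"
  using monotone_mapsD[OF \<theta>] monotone_mapsD[OF \<eta>]
  by (auto simp: monotone_maps_def monotone_on_def compose_def)
 show "free_map R (nerve_op r (compose {..r} \<theta> \<eta>)) x = free_map R (nerve_op r \<eta>) (free_map R (nerve_op q \<theta>) x)"
  by (rule mod_hom_eqI[OF free_generates free_mod free_mod op[OF c]
     hom_compose[OF op[OF \<theta>] op[OF \<eta>]] _ x])
   (auto simp: free_map_basis nerve_op_comp[OF \<theta> \<eta>])
qed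

end


section \<open>The operad\<close>

text \<open>There is exactly one arrow between any two objects, so a simplex is the same as its
  sequence of vertices.\<close>

lemma nerve_ESigma_iff:
 "s \<in> esimps m p \<longleftrightarrow>
  (\<exists>c. (\<forall>i\<le>p. c i permutes {..<m}) \<and> s = restrict (%(i, j). (c i, c j)) (arrows_upto p))"
proof
 assume "s \<in> esimps m p"
 then obtain c where c: "s \<in> extensional (arrows_upto p)" "\<forall>i\<le>p. c i permutes {..<m}"
  "\<forall>i j. i <= j \<and> j <= p --> s (i, j) = (c i, c j)"
  by (auto simp: nerve_def ESigma_def)
 have "s = restrict (%(i, j). (c i, c j)) (arrows_upto p)"
  by (rule simplex_eqI[OF c(1)]) (use c(3) in "auto simp: arrows_upto_iff")
 then show "\<exists>c. (\<forall>i\<le>p. c i permutes {..<m}) \<and> s = restrict (%(i, j). (c i, c j)) (arrows_upto p)"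
  using c(2) by blast
qed (auto simp: nerve_def ESigma_def arrows_upto_iff)

lemma nerve_ESigma_arrow:
 assumes "s \<in> esimps m p" "i <= j" "j <= p"
 shows "s (i, j) = (fst (s (i, i)), fst (s (j, j)))"
 using assms by (auto simp: nerve_ESigma_iff arrows_upto_iff)

lemma nerve_ESigmaI:
 assumes "s \<in> extensional (arrows_upto p)" "!!i. i <= p ==> fst (s (i, i)) permutes {..<m}"
  and "!!i j. [|i <= j; j <= p|] ==> s (i, j) = (fst (s (i, i)), fst (s (j, j)))"
 shows "s \<in> esimps m p"
proof -
 have eq: "s = restrict (%(i, j). (fst (s (i, i)), fst (s (j, j)))) (arrows_upto p)"
 proof (rule simplex_eqI[OF assms(1)])
  fix i j assume "(i, j) \<in> arrows_upto p"
  then show "s (i, j) = restrict (%(i, j). (fst (s (i, i)), fst (s (j, j)))) (arrows_upto p) (i, j)"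
   using assms(3)[of i j] by (simp add: arrows_upto_iff)
 qed simp
 show ?thesis unfolding nerve_ESigma_iff by (intro exI[of _ "%i. fst (s (i, i))"] conjI allI impI assms(2) eq)
qed

lemma nerve_ESigmaD:
 assumes "s \<in> esimps m p" "(i, j) \<in> arrows_upto p"
 shows "fst (s (i, j)) permutes {..<m}" "snd (s (i, j)) permutes {..<m}"
 using assms by (auto simp: nerve_ESigma_iff arrows_upto_iff)

lemma perm_comp_nerve:
 assumes s: "s \<in> esimps (length ks) p" and ts: "list_all2 (\<in>) ts (map (%k. esimps k p) ks)"
 shows "comp_simplex p ks s ts \<in> esimps (sum_list ks) p"
proof (rule nerve_ESigmaI[OF nerve_map_ext(2)])
 have l: "length ts = length ks" using ts by (auto dest: list_all2_lengthD)
 have tn: "ts ! n \<in> esimps (ks ! n) p" if "n < length ks" for n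
  using list_all2_nthD[OF ts, of n] that l by simp
 fix i assume i: "i <= p"
 have a: "(i, i) \<in> arrows_upto p" using i by (simp add: arrows_upto_iff)
 have "perms (map (%t. fst (t (i, i))) ts) ks"
  unfolding list_all2_conv_all_nth using l nerve_ESigmaD(1)[OF tn a] by simp
 then show "fst (comp_simplex p ks s ts (i, i)) permutes {..<sum_list ks}"
  using perm_comp_permutes[OF nerve_ESigmaD(1)[OF s a]] a
  by (simp add: nerve_map_prod_apply perm_comp_arr_def comp_def)
next
 fix i j assume ij: "i <= j" "j <= p"
 have l: "length ts = length ks" using ts by (auto dest: list_all2_lengthD)
 have tn: "ts ! n \<in> esimps (ks ! n) p" if "n < length ks" for n
  using list_all2_nthD[OF ts, of n] that l by simp
 have a': "(i, j) \<in> arrows_upto p" "(j, j) \<in> arrows_upto p" "(i, i) \<in> arrows_upto p"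
  using ij by (simp_all add: arrows_upto_iff)
 have te: "t (i, j) = (fst (t (i, i)), fst (t (j, j)))" if t: "t \<in> set ts" for t
 proof -
  obtain n where "n < length ks" "t = ts ! n" using t l by (auto simp: in_set_conv_nth)
  then show ?thesis using nerve_ESigma_arrow[OF tn ij] by simp
 qed
 have me: "map (%t. fst (t (i, j))) ts = map (%t. fst (t (i, i))) ts"
  "map (%t. snd (t (i, j))) ts = map (%t. fst (t (j, j))) ts"
  by (intro map_cong refl, drule te, simp)+
 show "comp_simplex p ks s ts (i, j) =
   (fst (comp_simplex p ks s ts (i, i)), fst (comp_simplex p ks s ts (j, j)))"
  using nerve_ESigma_arrow[OF s ij] by (simp add: a' nerve_map_prod_apply perm_comp_arr_def comp_def me)
qed

lemma nerve_act_closed: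
 assumes \<rho>: "\<rho> permutes {..<m}" and s: "s \<in> esimps m p"
 shows "nerve_map p (%(\<sigma>, \<tau>). (\<sigma> o \<rho>, \<tau> o \<rho>)) s \<in> esimps m p"
proof (rule nerve_ESigmaI[OF nerve_map_ext(1)])
 fix i assume "i <= p"
 then have a: "(i, i) \<in> arrows_upto p" by (simp add: arrows_upto_iff)
 show "fst (nerve_map p (%(\<sigma>, \<tau>). (\<sigma> o \<rho>, \<tau> o \<rho>)) s (i, i)) permutes {..<m}"
  using permutes_compose[OF \<rho> nerve_ESigmaD(1)[OF s a]] a by (simp add: nerve_map_apply case_prod_unfold)
next
 fix i j assume ij: "i <= j" "j <= p"
 then have a': "(i, j) \<in> arrows_upto p" "(j, j) \<in> arrows_upto p" "(i, i) \<in> arrows_upto p" by (simp_all add: arrows_upto_iff)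
 show "nerve_map p (%(\<sigma>, \<tau>). (\<sigma> o \<rho>, \<tau> o \<rho>)) s (i, j) =
  (fst (nerve_map p (%(\<sigma>, \<tau>). (\<sigma> o \<rho>, \<tau> o \<rho>)) s (i, i)), fst (nerve_map p (%(\<sigma>, \<tau>). (\<sigma> o \<rho>, \<tau> o \<rho>)) s (j, j)))"
  using nerve_ESigma_arrow[OF s ij] by (simp add: a' nerve_map_apply case_prod_unfold)
qed

lemma DMod_simps:
 "arity (DMod R) m = nerve_smod R (ESigma m)"
 "oact (DMod R) m p \<rho> = free_map R (nerve_map p (%(\<sigma>, \<tau>). (\<sigma> o \<rho>, \<tau> o \<rho>)))"
 "ocomp (DMod R) ks p = linear_from R (lev (comp_dom R (arity (DMod R)) ks) p) (lev (arity (DMod R) (sum_list ks)) p)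
   {(d, es). d \<in> carrier (lev (arity (DMod R) (length ks)) p) \<and> es \<in> tuples (map (%k. lev (arity (DMod R) k) p) ks)}
   (%(d, es). comp_pure R (arity (DMod R)) ks p d es)
   (%(d, es). multilinear_ext R (comp_simplex p ks) d es)"
 by (simp_all add: DMod_def Let_def)

context cring
begin

abbreviation "D_lev n p \<equiv> lev (arity (DMod R) n) p"
abbreviation "D_levs ks p \<equiv> map (%k. D_lev k p) ks"
abbreviation "dcomp \<equiv> compose_at R (DMod R)"

lemma DMod_lev: "D_lev m p = free (esimps m p)"
 by (simp add: DMod_simps nerve_smod_simps)

lemma DMod_unit: "ounit (DMod R) p a = a \<odot>\<^bsub>D_lev 1 p\<^esub> bv (id_simplex p)"
 if "a \<in> carrier R"
 using that by (auto simp: DMod_def Let_def nerve_smod_simps free_simps basis_vec_def)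

lemma unit_simplex: "id_simplex p \<in> esimps 1 p"
 unfolding nerve_ESigma_iff by (intro exI[of _ "%_. id"]) (auto intro: permutes_id)

lemma DMod_unit_one: "ounit (DMod R) p \<one> = bv (id_simplex p)"
 by (auto simp: DMod_def Let_def basis_vec_def)

lemma comp_dom_props:
 fixes ks p
 defines "Ms \<equiv> D_levs ks p" and "D \<equiv> D_lev (length ks) p"
 shows "lev (comp_dom R (arity (DMod R)) ks) p = tensor R D (tensors R Ms)"
  and "comp_pure R (arity (DMod R)) ks p d es = pure R D (tensors R Ms) d (pures R Ms es)"
  and "module R D" and "\<forall>M\<in>set Ms. module R M"
  and "Ms = map (free) (map (%k. esimps k p) ks)"
 by (auto simp: Ms_def D_def comp_dom_def stensor_def stensors_def comp_pure_def comp_def DMod_lev free_mod)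

lemma comp_bimulti:
 "bimulti R (D_lev (length ks) p) (D_levs ks p)
  (D_lev (sum_list ks) p) (mext (comp_simplex p ks))"
proof -
 have "bimulti R (free (esimps (length ks) p))
  (map (free) (map (%k. esimps k p) ks)) (free (esimps (sum_list ks) p))
  (mext (comp_simplex p ks))"
  by (rule multilinear_ext_bimulti) (rule perm_comp_nerve)
 then show ?thesis by (simp add: DMod_lev comp_def)
qed

lemma comp_dom_generates:
 "generates R (lev (comp_dom R (arity (DMod R)) ks) p)
  ((%(d, es). comp_pure R (arity (DMod R)) ks p d es) `
   {(d, es). d \<in> carrier (D_lev (length ks) p) \<and> es \<in> tuples (D_levs ks p)})"
proof -
 note cd = comp_dom_props[where ks=ks and p=p]
 have c: "generates R M (carrier M)" for M :: "('a, 'x) module" by (simp add: generates_def)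
 have "(%(d, es). comp_pure R (arity (DMod R)) ks p d es) `
   {(d, es). d \<in> carrier (D_lev (length ks) p) \<and> es \<in> tuples (D_levs ks p)} =
  {pure R (D_lev (length ks) p) (tensors R (D_levs ks p)) d
    (pures R (D_levs ks p) xs) | d xs.
   d \<in> carrier (D_lev (length ks) p) \<and> length xs = length (D_levs ks p) \<and>
   (\<forall>i<length (D_levs ks p). xs ! i \<in> carrier (D_levs ks p ! i))}"
  unfolding cd(2) tuples_iff by auto
 then show ?thesis unfolding cd(1) using tensor_tensors_generates[OF cd(3,4) c c] by simp
qed

text \<open>Makes the definite description of the composition effective: \<open>comp_bimulti\<close>
  yields a linear map with the prescribed values, and pure elements generate the domain.\<close>

lemma ocomp_props:
 shows ocomp_hom: "ocomp (DMod R) ks p \<in> mhom (lev (comp_dom R (arity (DMod R)) ks) p) (D_lev (sum_list ks) p)"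
  and compose_at_eq: "[|d \<in> carrier (D_lev (length ks) p); es \<in> tuples (D_levs ks p)|] ==>
   dcomp ks p d es = mext (comp_simplex p ks) d es"
proof -
 note cd = comp_dom_props[where ks=ks and p=p]
 have P: "module R (D_lev (sum_list ks) p)" unfolding DMod_lev by (rule free_mod)
 obtain h where h: "h \<in> mhom (lev (comp_dom R (arity (DMod R)) ks) p) (D_lev (sum_list ks) p)"
  "!!d es. [|d \<in> carrier (D_lev (length ks) p); es \<in> tuples (D_levs ks p)|] ==>
   h (comp_pure R (arity (DMod R)) ks p d es) = mext (comp_simplex p ks) d es"
  using tensor_tensors_lift[OF cd(3,4) P comp_bimulti] unfolding cd(1,2) by blast
 have M: "module R (lev (comp_dom R (arity (DMod R)) ks) p)"
  unfolding cd(1) by (intro tensor_module tensors_module cd)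
 note lf = linear_from_props[OF M P comp_dom_generates h(1), of "%(d, es). mext (comp_simplex p ks) d es",
   folded DMod_simps(3)]
 show "ocomp (DMod R) ks p \<in> mhom (lev (comp_dom R (arity (DMod R)) ks) p) (D_lev (sum_list ks) p)"
  by (rule lf(1)) (use h(2) in auto)
 show "dcomp ks p d es = mext (comp_simplex p ks) d es"
  if "d \<in> carrier (D_lev (length ks) p)" "es \<in> tuples (D_levs ks p)"
  unfolding compose_at_def using lf(2)[of "(d, es)"] h(2) that by auto
qed

end

section \<open>Operad laws on simplices\<close>

context cring
begin

definition nact :: "nat => (nat => nat) => perm_simplex => perm_simplex"
 where "nact p \<rho> = nerve_map p (%(\<sigma>, \<tau>). (\<sigma> o \<rho>, \<tau> o \<rho>))"

lemma DMod_act: "oact (DMod R) m p \<rho> = free_map R (nact p \<rho>)"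
 by (simp add: DMod_simps nact_def)

lemma nact_closed: "[|\<rho> permutes {..<m}; s \<in> esimps m p|] ==> nact p \<rho> s \<in> esimps m p"
 unfolding nact_def by (rule nerve_act_closed)

lemma nact_apply: "(i, j) \<in> arrows_upto p ==> nact p \<rho> s (i, j) = (fst (s (i, j)) o \<rho>, snd (s (i, j)) o \<rho>)"
 by (simp add: nact_def nerve_map_apply case_prod_unfold)

lemma nact_ext: "nact p \<rho> s \<in> extensional (arrows_upto p)"
 by (simp add: nact_def nerve_map_ext)

lemma DMod_act_hom: "\<rho> permutes {..<m} ==>
  free_map R (nact p \<rho>) \<in> mhom (D_lev m p) (D_lev m p)"
 unfolding DMod_lev by (rule free_map_hom) (rule nact_closed)

lemma D_module: "module R (D_lev m p)"
 unfolding DMod_lev by (rule free_mod)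

lemma DMod_generates: "generates R (D_lev m p) (bv ` esimps m p)"
 unfolding DMod_lev by (rule free_generates)

lemma comp_simplex_fst_snd:
 "(i, j) \<in> arrows_upto p ==> comp_simplex p ks s ts (i, j) =
  (perm_comp ks (fst (s (i, j))) (map (%t. fst (t (i, j))) ts),
  perm_comp ks (snd (s (i, j))) (map (%t. snd (t (i, j))) ts))"
 by (simp add: nerve_map_prod_apply perm_comp_arr_def comp_def)

lemma simplices_permute:
 assumes "esimplices p ts ks" "(i, j) \<in> arrows_upto p"
 shows "perms (map (%t. fst (t (i, j))) ts) ks"
  "perms (map (%t. snd (t (i, j))) ts) ks"
 using assms(1) nerve_ESigmaD[OF _ assms(2)] by (auto simp: list_all2_conv_all_nth)

lemma basis_list:
 assumes "length es = length ks" "\<forall>i<length ks. es ! i \<in> e i ` X i"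
 shows "\<exists>ts. length ts = length ks \<and> (\<forall>i<length ks. ts ! i \<in> X i \<and> es ! i = e i (ts ! i))"
proof -
 have "\<forall>i<length ks. \<exists>t. t \<in> X i \<and> es ! i = e i t" using assms(2) by auto
 then obtain t where t: "!!i. i < length ks ==> t i \<in> X i \<and> es ! i = e i (t i)" by metis
 show ?thesis by (rule exI[of _ "map t [0..<length ks]"]) (use t in simp)
qed

text \<open>Holds at both ends of each arrow, by \<open>block_perm_compose\<close> and the exchange
  law \<open>block_perm_perm_sums\<close>.\<close>

lemma comp_equivariant_outer:
 assumes \<sigma>: "\<sigma> permutes {..<length ks}" and s: "s \<in> esimps (length ks) p"
  and ts: "esimplices p ts ks"
 shows "comp_simplex p ks (nact p \<sigma> s) ts =
  nact p (block_perm \<sigma> ks) (comp_simplex p (move \<sigma> ks) s (move \<sigma> ts))"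
proof (rule simplex_eqI[OF nerve_map_ext(2) nact_ext])
 fix i j assume ij: "(i, j) \<in> arrows_upto p"
 have l: "length ts = length ks" using list_all2_lengthD[OF ts] .
 have "perm_comp ks (\<alpha> o \<sigma>) \<tau>s = perm_comp (move \<sigma> ks) \<alpha> (move \<sigma> \<tau>s) o block_perm \<sigma> ks"
  if "\<alpha> permutes {..<length ks}" "perms \<tau>s ks" for \<alpha> \<tau>s
  unfolding perm_comp_def block_perm_compose[OF that(1) \<sigma>]
  using block_perm_perm_sums[OF \<sigma> that(2)] by (metis comp_assoc)
 moreover have "move \<sigma> (map h ts) = map h (move \<sigma> ts)" for h :: "perm_simplex => nat => nat"
  by (rule move_map) (use \<sigma> l in simp)
 ultimately show "comp_simplex p ks (nact p \<sigma> s) ts (i, j) =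
  nact p (block_perm \<sigma> ks) (comp_simplex p (move \<sigma> ks) s (move \<sigma> ts)) (i, j)"
  using nerve_ESigmaD[OF s ij] simplices_permute[OF ts ij] ij
  by (simp add: comp_simplex_fst_snd nact_apply)
qed

lemma comp_equivariant_inner:
 assumes \<rho>s: "perms \<rho>s ks" and s: "s \<in> esimps (length ks) p"
  and ts: "esimplices p ts ks"
 shows "comp_simplex p ks s (map (%i. nact p (\<rho>s ! i) (ts ! i)) [0..<length ks]) =
  nact p (perm_sums ks \<rho>s) (comp_simplex p ks s ts)"
proof (rule simplex_eqI[OF nerve_map_ext(2) nact_ext])
 fix i j assume ij: "(i, j) \<in> arrows_upto p"
 have l: "length ts = length ks" "length \<rho>s = length ks" using list_all2_lengthD[OF ts] list_all2_lengthD[OF \<rho>s] .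
 have m: "map (%t. fst (t (i, j))) (map (%i. nact p (\<rho>s ! i) (ts ! i)) [0..<length ks]) = map2 (o) (map (%t. fst (t (i, j))) ts) \<rho>s"
  "map (%t. snd (t (i, j))) (map (%i. nact p (\<rho>s ! i) (ts ! i)) [0..<length ks]) = map2 (o) (map (%t. snd (t (i, j))) ts) \<rho>s"
  by (rule nth_equalityI; use l ij in "simp add: nact_apply")+
 show "comp_simplex p ks s (map (%i. nact p (\<rho>s ! i) (ts ! i)) [0..<length ks]) (i, j) =
  nact p (perm_sums ks \<rho>s) (comp_simplex p ks s ts) (i, j)"
  unfolding comp_simplex_fst_snd[OF ij] nact_apply[OF ij] m
  using perm_sums_compose[OF simplices_permute(1)[OF ts ij] \<rho>s] perm_sums_compose[OF simplices_permute(2)[OF ts ij] \<rho>s]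
  by (simp only: perm_comp_def fst_conv snd_conv comp_assoc)
qed

text \<open>\<open>perm_comp_assoc\<close> at both ends of each arrow of the simplex.\<close>

lemma comp_simplex_assoc:
 assumes s: "s \<in> esimps (length jss) p"
  and ts: "list_all2 (%t js. t \<in> esimps (length js) p) ts jss"
  and uss: "list_all2 (%us js. esimplices p us js) uss jss"
 shows "comp_simplex p (concat jss) (comp_simplex p (map length jss) s ts) (concat uss) =
  comp_simplex p (map sum_list jss) s
   (map (%i. comp_simplex p (jss ! i) (ts ! i) (uss ! i)) [0..<length jss])"
proof (rule simplex_eqI[OF nerve_map_ext(2) nerve_map_ext(2)])
 fix i j assume ij: "(i, j) \<in> arrows_upto p"
 have l: "length ts = length jss" "length uss = length jss" using list_all2_lengthD[OF ts] list_all2_lengthD[OF uss] .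
 have t: "esimplices p ts (map length jss)" using ts by (simp add: list_all2_map2)
 have un: "esimplices p (uss ! n) (jss ! n)" if "n < length jss" for n
  using list_all2_nthD[OF uss, of n] that l by simp
 have "list_all2 (%\<rho>s js. perms \<rho>s js) (map (map (%t. fst (t (i, j)))) uss) jss"
  "list_all2 (%\<rho>s js. perms \<rho>s js) (map (map (%t. snd (t (i, j)))) uss) jss"
  unfolding list_all2_conv_all_nth[of _ _ jss] using l simplices_permute[OF un ij] by simp_all
 note pu = this
 have me: "map (%n. perm_comp (jss ! n) (map h ts ! n) (map (map h) uss ! n)) [0..<length jss] =
   map (%n. perm_comp (jss ! n) (h (ts ! n)) (map h (uss ! n))) [0..<length jss]" for h
  by (rule map_cong[OF refl]) (use l in simp)
 note pa = perm_comp_assoc[OF nerve_ESigmaD(1)[OF s ij] _ pu(1)] perm_comp_assoc[OF nerve_ESigmaD(2)[OF s ij] _ pu(2)]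
 show "comp_simplex p (concat jss) (comp_simplex p (map length jss) s ts) (concat uss) (i, j) =
  comp_simplex p (map sum_list jss) s
   (map (%i. comp_simplex p (jss ! i) (ts ! i) (uss ! i)) [0..<length jss]) (i, j)"
  using pa(1)[of "map (%t. fst (t (i, j))) ts"] pa(2)[of "map (%t. snd (t (i, j))) ts"]
   simplices_permute[OF t ij]
  by (simp add: comp_simplex_fst_snd[OF ij] map_concat list_all2_map2 comp_def me del: nth_map)
qed

lemma comp_unit_left: "t \<in> esimps k p ==>
  nerve_map_prod p (perm_comp_arr [k]) (id_simplex p) [t] = t"
proof (rule simplex_eqI[OF nerve_map_ext(2) nerve_ext], assumption)
 fix i j assume t: "t \<in> esimps k p" and ij: "(i, j) \<in> arrows_upto p"
 have "perm_comp [k] id [\<tau>] = \<tau>" if "\<tau> permutes {..<k}" for \<tau>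
  using permutes_not_in[OF that] by (auto simp: perm_comp_def block_perm_id perm_sum_def fun_eq_iff)
 then show "nerve_map_prod p (perm_comp_arr [k]) (id_simplex p) [t] (i, j) = t (i, j)"
  using nerve_ESigmaD[OF t ij] ij by (simp add: comp_simplex_fst_snd)
qed

lemma perm_sums_ids: "perm_sums ks (replicate (length ks) id) = id"
 by (induction ks) (auto simp: perm_sum_def fun_eq_iff)

text \<open>A list cut into blocks of length one is the list of its heads, so permuting blocks is
  permuting entries.\<close>

lemma block_perm_ones: "\<sigma> permutes {..<m} ==> block_perm \<sigma> (replicate m 1) = \<sigma>"
proof (rule perm_eq_by_concat[of _ "replicate m 1"])
 assume \<sigma>: "\<sigma> permutes {..<m}"
 then show "block_perm \<sigma> (replicate m 1) permutes {..<sum_list (replicate m 1)}"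
  by (intro block_perm_permutes) simp
 show "\<sigma> permutes {..<sum_list (replicate m 1)}" using \<sigma> by (simp add: sum_list_replicate)
 fix xss :: "nat list list" assume xss: "map length xss = replicate m 1"
 have l: "length xss = m" using xss by (metis length_map length_replicate)
 have "xss ! i = [hd (xss ! i)]" if "i < m" for i
  using arg_cong[OF xss, of "%l. l ! i"] that l by (cases "xss ! i") auto
 then have e: "xss = map (%x. [x]) (map hd xss)" using l by (intro nth_equalityI) auto
 have "move (block_perm \<sigma> (replicate m 1)) (concat xss) = concat (move \<sigma> xss)"
  using move_block_perm[of \<sigma> xss] \<sigma> l xss by simp
 also have "... = move \<sigma> (map hd xss)"
  by (subst e, subst move_map) (use \<sigma> l concat_singletons in simp_all)
 also have "map hd xss = concat xss" by (subst (2) e) (rule concat_singletons[symmetric])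
 finally show "move (block_perm \<sigma> (replicate m 1)) (concat xss) = move \<sigma> (concat xss)" .
qed

lemma comp_unit_right: "s \<in> esimps m p ==>
  comp_simplex p (replicate m 1) s (replicate m (id_simplex p)) = s"
proof (rule simplex_eqI[OF nerve_map_ext(2) nerve_ext], assumption)
 fix i j assume s: "s \<in> esimps m p" and ij: "(i, j) \<in> arrows_upto p"
 show "comp_simplex p (replicate m 1) s (replicate m (id_simplex p)) (i, j) = s (i, j)"
  using nerve_ESigmaD[OF s ij] ij perm_sums_ids[of "replicate m 1"] block_perm_ones
  by (simp add: comp_simplex_fst_snd perm_comp_def)
qed

section \<open>From simplices to modules\<close>

lemma tuples_DMod_basis: "esimplices p ts ks ==>
  map (bv) ts \<in> tuples (D_levs ks p)"
 by (auto simp: tuples_def list_all2_conv_all_nth DMod_lev basis_vec_closed)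

lemma basis_in_lev: "s \<in> esimps m p ==> bv s \<in> carrier (D_lev m p)"
 by (simp add: DMod_lev basis_vec_closed)

lemma DMod_bimulti_eqI:
 assumes P: "module R P"
  and f: "bimulti R (D_lev (length ks) p) (D_levs ks p) P f"
  and g: "bimulti R (D_lev (length ks) p) (D_levs ks p) P g"
  and eq: "!!s ts. [|s \<in> esimps (length ks) p; esimplices p ts ks|] ==>
   f (bv s) (map (bv) ts) = g (bv s) (map (bv) ts)"
  and d: "d \<in> carrier (D_lev (length ks) p)"
  and es: "es \<in> tuples (D_levs ks p)"
 shows "f d es = g d es"
proof (rule bimulti_eqI[OF D_module _ P DMod_generates _ f g _ d es])
 show "\<forall>M\<in>set (D_levs ks p). module R M" using D_module by auto
 show "generates R (D_levs ks p ! i) (bv ` esimps (ks ! i) p)"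
  if "i < length (D_levs ks p)" for i
  using that DMod_generates by simp
 fix d es assume d: "d \<in> bv ` esimps (length ks) p"
  and es: "length es = length (D_levs ks p)"
  "\<forall>i<length (D_levs ks p). es ! i \<in> bv ` esimps (ks ! i) p"
 obtain ts where ts: "length ts = length ks"
  "\<forall>i<length ks. ts ! i \<in> esimps (ks ! i) p \<and> es ! i = bv (ts ! i)"
  using basis_list[of es ks "%_. bv" "%i. esimps (ks ! i) p"] es by auto
 then have "es = map (bv) ts" using es(1) by (intro nth_equalityI) auto
 then show "f d es = g d es" using d ts eq by (auto simp: list_all2_conv_all_nth)
qed

lemma compose_at_bimulti:
 "bimulti R (D_lev (length ks) p) (D_levs ks p)
  (D_lev (sum_list ks) p) (dcomp ks p)"
proof -
 note cd = comp_dom_props[where ks=ks and p=p]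
 show ?thesis unfolding compose_at_def cd(2)
  using bimulti_compose[OF bimulti_pure[OF cd(3,4)] ocomp_hom[of ks p, unfolded cd(1)]] .
qed

lemma compose_at_basis:
 assumes "s \<in> esimps (length ks) p" "esimplices p ts ks"
 shows "dcomp ks p (bv s) (map (bv) ts) =
  bv (comp_simplex p ks s ts)"
 using compose_at_eq[OF basis_in_lev[OF assms(1)] tuples_DMod_basis[OF assms(2)]]
 by (simp add: multilinear_ext_basis)

lemma comp_simplex_closed:
 assumes "s \<in> esimps (length ks) p" "esimplices p ts ks"
 shows "comp_simplex p ks s ts \<in> esimps (sum_list ks) p"
 by (rule perm_comp_nerve[OF assms(1)]) (use assms(2) in "simp add: list_all2_map2")

lemma bimulti_precompose:
 assumes Ms: "\<forall>M\<in>set Ms. module R M" and f: "bimulti R D Ns P f" and g: "slotlin R Ms Ns g"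
 shows "bimulti R D Ms P (%d xs. f d (g xs))"
 unfolding bimulti_def
 using multilin_slotlin[OF Ms bimultiD(1)[OF f] g] bimultiD(2)[OF f] g by (simp add: slotlin_def)

lemma bimulti_precompose_left:
 assumes f: "bimulti R D Ms P f" and g: "g \<in> mhom D' D"
 shows "bimulti R D' Ms P (%d xs. f (g d) xs)"
 unfolding bimulti_def
 using bimultiD(1)[OF f hom_closed[OF g]] hom_compose[OF g bimultiD(2)[OF f]] by simp

text \<open>On basis vectors each axiom is a law for simplices that is already available. What
  remains is to see that both sides are linear, or linear in the operation and multilinear in the
  inputs.\<close>

lemma DMod_operad: "operad R (DMod R)"
proof (intro operad.intro operad_axioms.intro)
 let ?L = "%m p. D_lev m p"
 show "cring R" by (rule cring_axioms)
 show "simplicial_module R (arity (DMod R) m)" for m unfolding DMod_simps by (rule nerve_smod_simplicial)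
 show "simplicial_map R (arity (DMod R) m) (arity (DMod R) m) (%p. oact (DMod R) m p \<sigma>)"
  if \<sigma>: "\<sigma> permutes {..<m}" for \<sigma> m
  unfolding simplicial_map_def DMod_act
 proof (intro conjI allI ballI DMod_act_hom[OF \<sigma>])
  fix p q \<theta> x assume \<theta>: "\<theta> \<in> monotone_maps q p" and x: "x \<in> carrier (?L m p)"
  have op: "sop (arity (DMod R) m) q p \<theta> \<in> mhom (?L m p) (?L m q)"
   using simplicial_module.sop_hom[OF nerve_smod_simplicial \<theta>] by (simp add: DMod_simps)
  show "free_map R (nact q \<sigma>) (sop (arity (DMod R) m) q p \<theta> x) = sop (arity (DMod R) m) q p \<theta> (free_map R (nact p \<sigma>) x)"
   by (rule mod_hom_eqI[OF DMod_generates D_module D_module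
      hom_compose[OF op DMod_act_hom[OF \<sigma>]] hom_compose[OF DMod_act_hom[OF \<sigma>] op] _ x])
    (auto simp: DMod_simps nerve_smod_simps free_map_basis nact_def nerve_op_map[OF \<theta>])
 qed
 show "oact (DMod R) m p id x = x" if x: "x \<in> carrier (?L m p)" for x m p unfolding DMod_act
 proof (rule mod_hom_eqI[OF DMod_generates D_module D_module DMod_act_hom mod_hom_id(2) _ x])
  fix y assume "y \<in> bv ` esimps m p"
  then obtain s where s: "s \<in> esimps m p" "y = bv s" by auto
  have "nact p id s = s" by (rule simplex_eqI[OF nact_ext nerve_ext[OF s(1)]]) (simp add: nact_apply)
  then show "free_map R (nact p id) y = y" using s by (simp add: free_map_basis)
 qed (rule permutes_id)
 show "oact (DMod R) m p \<tau> (oact (DMod R) m p \<sigma> x) = oact (DMod R) m p (\<sigma> o \<tau>) x"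
  if \<sigma>: "\<sigma> permutes {..<m}" and \<tau>: "\<tau> permutes {..<m}" and x: "x \<in> carrier (?L m p)" for \<sigma> \<tau> x m p
  unfolding DMod_act
 proof (rule mod_hom_eqI[OF DMod_generates D_module D_module
   hom_compose[OF DMod_act_hom[OF \<sigma>] DMod_act_hom[OF \<tau>]] DMod_act_hom[OF permutes_compose[OF \<tau> \<sigma>]] _ x])
  fix y assume "y \<in> bv ` esimps m p"
  then obtain s where s: "s \<in> esimps m p" "y = bv s" by auto
  have "nact p \<tau> (nact p \<sigma> s) = nact p (\<sigma> o \<tau>) s"
   by (rule simplex_eqI[OF nact_ext nact_ext]) (simp add: nact_apply comp_assoc)
  then show "free_map R (nact p \<tau>) (free_map R (nact p \<sigma>) y) = free_map R (nact p (\<sigma> o \<tau>)) y"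
   using s by (simp add: free_map_basis)
 qed
 show "simplicial_map R (comp_dom R (arity (DMod R)) ks) (arity (DMod R) (sum_list ks)) (ocomp (DMod R) ks)" for ks
  unfolding simplicial_map_def
 proof (intro conjI allI ballI ocomp_hom)
  fix p q \<theta> x assume \<theta>: "\<theta> \<in> monotone_maps q p" and x: "x \<in> carrier (lev (comp_dom R (arity (DMod R)) ks) p)"
  have op: "sop (arity (DMod R) m) q p \<theta> \<in> mhom (?L m p) (?L m q)" for m
   using simplicial_module.sop_hom[OF nerve_smod_simplicial \<theta>] by (simp add: DMod_simps)
  note cd = comp_dom_props[where ks=ks and p=p] and cd' = comp_dom_props[where ks=ks and p=q]
  let ?Ms = "%p. map (%k. ?L k p) ks"
  let ?hs = "map (%k. sop (arity (DMod R) k) q p \<theta>) ks"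
  \<comment> \<open>The factors have different arities, so there is one operator per slot and the
    maps form a list of their own.\<close>
  have sl: "slotlin R (?Ms p) (?Ms q) (map2 (%h x. h x) ?hs)" by (rule slotlin_map2) (simp_all add: op)
  have m2: "map2 (%h x. h x) ?hs xs = map2 (%X. sop X q p \<theta>) (map (arity (DMod R)) ks) xs" for xs
   by (rule nth_equalityI) simp_all
  note tm = tensors_map_props[OF cd(4) cd'(4) _ multilin_slotlin[OF cd(4) pures_multilin[OF cd'(4)] sl], unfolded m2]
  have tm1: "!!xs. xs \<in> tuples (?Ms p) ==> map2 (%X. sop X q p \<theta>) (map (arity (DMod R)) ks) xs \<in> tuples (?Ms q)"
   using sl unfolding slotlin_def m2 by blast
  note tp = tensor_map_props[OF cd(3) tensors_module[OF cd(4)] cd'(3) tensors_module[OF cd'(4)] op tm(1)[OF tm1]]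
  have so: "sop (comp_dom R (arity (DMod R)) ks) q p \<theta> = tensor_map R (?L (length ks) q) (tensors R (?Ms q))
   (sop (arity (DMod R) (length ks)) q p \<theta>) (tensors_map R (?Ms q) (map2 (%X. sop X q p \<theta>) (map (arity (DMod R)) ks)))"
   by (simp add: comp_dom_def stensor_def stensors_def comp_def)
  have soh: "sop (comp_dom R (arity (DMod R)) ks) q p \<theta> \<in>
    mhom (lev (comp_dom R (arity (DMod R)) ks) p) (lev (comp_dom R (arity (DMod R)) ks) q)"
   unfolding so cd(1) cd'(1) by (rule tp(1))
  have sp: "sop (comp_dom R (arity (DMod R)) ks) q p \<theta> (comp_pure R (arity (DMod R)) ks p d es) =
    comp_pure R (arity (DMod R)) ks q (sop (arity (DMod R) (length ks)) q p \<theta> d) (map2 (%h x. h x) ?hs es)"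
   if "d \<in> carrier (?L (length ks) p)" "es \<in> tuples (?Ms p)" for d es
   unfolding so cd(2) cd'(2) m2
   using that multilin_closed[OF pures_multilin[OF cd(4)]] tm1 by (simp add: tp(2) tm(2))
  have M: "module R (lev (comp_dom R (arity (DMod R)) ks) p)"
   unfolding cd(1) by (intro tensor_module tensors_module cd)
  have key: "ocomp (DMod R) ks q (sop (comp_dom R (arity (DMod R)) ks) q p \<theta> (comp_pure R (arity (DMod R)) ks p d es)) =
   sop (arity (DMod R) (sum_list ks)) q p \<theta> (ocomp (DMod R) ks p (comp_pure R (arity (DMod R)) ks p d es))"
   if de: "d \<in> carrier (?L (length ks) p)" "es \<in> tuples (?Ms p)" for d es
  proof -
   have "dcomp ks q (sop (arity (DMod R) (length ks)) q p \<theta> d) (map2 (%h x. h x) ?hs es) =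
     sop (arity (DMod R) (sum_list ks)) q p \<theta> (dcomp ks p d es)"
   proof (rule DMod_bimulti_eqI[OF D_module _ _ _ de])
    show "bimulti R (?L (length ks) p) (?Ms p) (?L (sum_list ks) q)
     (%d es. dcomp ks q (sop (arity (DMod R) (length ks)) q p \<theta> d) (map2 (%h x. h x) ?hs es))"
     by (rule bimulti_precompose_left[OF bimulti_precompose[OF cd(4) compose_at_bimulti sl] op])
    show "bimulti R (?L (length ks) p) (?Ms p) (?L (sum_list ks) q)
     (%d es. sop (arity (DMod R) (sum_list ks)) q p \<theta> (dcomp ks p d es))"
     by (rule bimulti_compose[OF compose_at_bimulti op])
    fix s ts assume s: "s \<in> esimps (length ks) p" and ts: "esimplices p ts ks"
    have "map2 (%h x. h x) ?hs (map (bv) ts) = map (bv) (map (nerve_op q \<theta>) ts)"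
     by (rule nth_equalityI)
      (use list_all2_lengthD[OF ts] in "simp_all add: DMod_simps nerve_smod_simps free_map_basis")
    moreover have "sop (arity (DMod R) m) q p \<theta> (bv s) = bv (nerve_op q \<theta> s)" for m s
     by (simp add: DMod_simps nerve_smod_simps free_map_basis)
    moreover have "list_all2 (%t k. t \<in> esimps k q) (map (nerve_op q \<theta>) ts) ks"
     unfolding list_all2_map1 by (rule list_all2_mono[OF ts]) (rule nerve_op_closed[OF \<theta>])
    ultimately show "dcomp ks q (sop (arity (DMod R) (length ks)) q p \<theta> (bv s))
      (map2 (%h x. h x) ?hs (map (bv) ts)) =
     sop (arity (DMod R) (sum_list ks)) q p \<theta> (dcomp ks p (bv s) (map (bv) ts))"
     using s ts nerve_op_closed[OF \<theta> s] by (simp only: compose_at_basis nerve_op_map_prod[OF \<theta>])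
   qed
   then show ?thesis unfolding sp[OF de] compose_at_def .
  qed
  show "ocomp (DMod R) ks q (sop (comp_dom R (arity (DMod R)) ks) q p \<theta> x) =
    sop (arity (DMod R) (sum_list ks)) q p \<theta> (ocomp (DMod R) ks p x)"
   by (rule mod_hom_eqI[OF comp_dom_generates M D_module hom_compose[OF soh ocomp_hom] hom_compose[OF ocomp_hom op] _ x])
    (use key in auto)
 qed
 let ?u = "%p. id_simplex p :: perm_simplex"
 show "simplicial_map R (const_smod R) (arity (DMod R) 1) (ounit (DMod R))" unfolding simplicial_map_def
 proof (intro conjI allI ballI)
  fix p
  interpret L: module R "?L 1 p" by (rule D_module)
  have b: "bv (?u p) \<in> carrier (?L 1 p)" by (rule basis_in_lev[OF unit_simplex])
  show "ounit (DMod R) p \<in> mhom (lev (const_smod R) p) (?L 1 p)" by (rule mod_homI)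
    (use b in "simp_all add: const_smod_def base_module_def DMod_unit L.smult_l_distr L.smult_assoc1 del: One_nat_def")
  fix q \<theta> x assume \<theta>: "\<theta> \<in> monotone_maps q p" and x: "x \<in> carrier (lev (const_smod R) p)"
  have x': "x \<in> carrier R" using x by (simp add: const_smod_def base_module_def)
  have op: "sop (arity (DMod R) 1) q p \<theta> \<in> mhom (?L 1 p) (?L 1 q)"
   using simplicial_module.sop_hom[OF nerve_smod_simplicial \<theta>] by (simp add: DMod_simps)
  have "nerve_op q \<theta> (?u p) = ?u q"
   by (rule simplex_eqI[OF nerve_map_ext(3)]) (simp_all add: nerve_op_apply arrows_upto_map[OF \<theta>])
  then show "ounit (DMod R) q (sop (const_smod R) q p \<theta> x) = sop (arity (DMod R) 1) q p \<theta> (ounit (DMod R) p x)"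
   using mod_hom_smult[OF op x' b] x'
   by (simp add: DMod_unit const_smod_def del: One_nat_def) (simp add: DMod_simps nerve_smod_simps free_map_basis)
 qed
 show "dcomp [k] p (ounit (DMod R) p \<one>) [e] = e" if e: "e \<in> carrier (?L k p)" for e k p
 proof (rule mod_hom_eqI[OF DMod_generates D_module D_module _ mod_hom_id(2) _ e])
  have u: "ounit (DMod R) p \<one> \<in> carrier (?L (length [k]) p)"
   unfolding DMod_unit_one using basis_in_lev[OF unit_simplex] by simp
  have "[e] \<in> tuples (map (%k. ?L k p) [k])" using e by (simp add: tuples_def)
  from multilin_slot[OF bimultiD(1)[OF compose_at_bimulti u] this, of 0]
  show "(%e. dcomp [k] p (ounit (DMod R) p \<one>) [e]) \<in> mhom (?L k p) (?L k p)" by simp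
  fix y assume "y \<in> bv ` esimps k p"
  then obtain t where t: "t \<in> esimps k p" "y = bv t" by auto
  then show "dcomp [k] p (ounit (DMod R) p \<one>) [y] = y"
   unfolding DMod_unit_one using compose_at_basis[of "?u p" "[k]" p "[t]"] comp_unit_left[OF t(1)] unit_simplex
   by simp
 qed
 show "dcomp (replicate m 1) p d (replicate m (ounit (DMod R) p \<one>)) = d"
  if d: "d \<in> carrier (?L m p)" for d m p
 proof (rule mod_hom_eqI[OF DMod_generates D_module D_module _ mod_hom_id(2) _ d])
  have u: "ounit (DMod R) p \<one> \<in> carrier (?L 1 p)"
   unfolding DMod_unit_one by (rule basis_in_lev[OF unit_simplex])
  have "replicate m (ounit (DMod R) p \<one>) \<in> tuples (map (%k. ?L k p) (replicate m 1))"
   using u by (auto simp: tuples_iff)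
  from bimultiD(2)[OF compose_at_bimulti this]
  show "(%d. dcomp (replicate m 1) p d (replicate m (ounit (DMod R) p \<one>))) \<in> mhom (?L m p) (?L m p)"
   by (simp add: sum_list_replicate)
  fix y assume "y \<in> bv ` esimps m p"
  then obtain s where s: "s \<in> esimps m p" "y = bv s" by auto
  have "dcomp (replicate m 1) p (bv s) (map (bv) (replicate m (?u p))) = bv s"
   by (subst compose_at_basis) (use s unit_simplex comp_unit_right in "auto simp: list_all2_conv_all_nth")
  then show "dcomp (replicate m 1) p y (replicate m (ounit (DMod R) p \<one>)) = y"
   unfolding DMod_unit_one using s by simp
 qed
 show "dcomp (concat jss) p (dcomp ks p d es) (concat fss) =
   dcomp (map sum_list jss) p d
    (map (%i. dcomp (jss ! i) p (es ! i) (fss ! i)) [0..<length ks])"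
  if d: "d \<in> carrier (?L (length ks) p)" and es: "es \<in> tuples (map (%k. ?L k p) ks)" and jss: "map length jss = ks"
   and fss: "list_all2 (%js fs. fs \<in> tuples (map (%j. ?L j p) js)) jss fss"
  for d ks p es jss fss
 proof -
  let ?X = "%js. map (%j. ?L j p) js"
  let ?Es = "?X ks"
  have l: "length jss = length ks" using jss by (metis length_map)
  have ks: "ks ! i = length (jss ! i)" if "i < length ks" for i using arg_cong[OF jss, of "%l. l ! i"] that l by simp
  have s: "sum_list ks = length (concat jss)" using jss by (simp add: length_concat)
  have "dcomp (concat jss) p (dcomp ks p d es) (concat fss) =
   dcomp (map sum_list jss) p d
    (map (%i. dcomp (jss ! i) p (es ! i) (fss ! i)) [0..<length ?Es])"
  proof (rule assoc_reduce[where D="?L (length ks) p" and E="?L (sum_list ks) p" and P="?L (sum_list (concat jss)) p" and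
    Es="?Es" and Qs="?X (map sum_list jss)" and Xss="map ?X jss" and C="dcomp ks p"
    and \<Psi>="dcomp (concat jss) p" and \<Omega>="dcomp (map sum_list jss) p"
    and \<phi>="%i. dcomp (jss ! i) p" and GD="bv ` esimps (length ks) p"
    and GE="%i. bv ` esimps (ks ! i) p" and GX="%i k. bv ` esimps (jss ! i ! k) p"])
   show "bimulti R (?L (sum_list ks) p) (concat (map ?X jss)) (?L (sum_list (concat jss)) p) (dcomp (concat jss) p)"
    using compose_at_bimulti[of "concat jss" p] by (simp add: s map_concat)
   show "bimulti R (?Es ! i) (map ?X jss ! i) (?X (map sum_list jss) ! i) (dcomp (jss ! i) p)"
    if "i < length ?Es" for i
    using compose_at_bimulti[of "jss ! i" p] that l ks by simp
   show "bimulti R (?L (length ks) p) (?X (map sum_list jss)) (?L (sum_list (concat jss)) p) (dcomp (map sum_list jss) p)"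
    using compose_at_bimulti[of "map sum_list jss" p] l by (simp add: sum_list_concat)
   show "list_tuples fss (map ?X jss)" using fss by (simp add: list_all2_map2 list_all2_conv_all_nth)
  next
   fix d es xss assume d: "d \<in> bv ` esimps (length ks) p"
    and es: "length es = length ?Es" "\<forall>i<length ?Es. es ! i \<in> bv ` esimps (ks ! i) p"
    and xss: "length xss = length ?Es"
     "\<forall>i<length ?Es. length (xss ! i) = length (map ?X jss ! i) \<and>
      (\<forall>k<length (map ?X jss ! i). xss ! i ! k \<in> bv ` esimps (jss ! i ! k) p)"
   obtain s where s: "s \<in> esimps (length ks) p" "d = bv s" using d by auto
   obtain ts where ts: "length ts = length ks"
    "\<forall>i<length ks. ts ! i \<in> esimps (ks ! i) p \<and> es ! i = bv (ts ! i)"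
    using basis_list[of es ks "%_. bv" "%i. esimps (ks ! i) p"] es by auto
   have et: "es = map (bv) ts" using es(1) ts by (intro nth_equalityI) auto
   have "\<forall>i<length ks. \<exists>us. length us = length (jss ! i) \<and>
     (\<forall>k<length (jss ! i). us ! k \<in> esimps (jss ! i ! k) p \<and> xss ! i ! k = bv (us ! k))"
   proof (intro allI impI)
    fix i assume "i < length ks"
    then show "\<exists>us. length us = length (jss ! i) \<and>
     (\<forall>k<length (jss ! i). us ! k \<in> esimps (jss ! i ! k) p \<and> xss ! i ! k = bv (us ! k))"
     using basis_list[of "xss ! i" "jss ! i" "%_. bv" "%k. esimps (jss ! i ! k) p"] xss l by simp
   qed
   then obtain u where u: "!!i. i < length ks ==> length (u i) = length (jss ! i) \<and>
     (\<forall>k<length (jss ! i). u i ! k \<in> esimps (jss ! i ! k) p \<and> xss ! i ! k = bv (u i ! k))"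
    by metis
   define uss where "uss = map u [0..<length ks]"
   have ul: "length uss = length jss" using l by (simp add: uss_def)
   have un: "esimplices p (uss ! i) (jss ! i)" "xss ! i = map (bv) (uss ! i)"
    if "i < length ks" for i
    using u[OF that] that xss l by (auto simp: uss_def list_all2_conv_all_nth intro!: nth_equalityI)
   have ux: "xss = map (map (bv)) uss" using un(2) ul xss l by (intro nth_equalityI) auto
   have t1: "esimplices p ts ks" using ts by (simp add: list_all2_conv_all_nth)
   have t2: "list_all2 (%t js. t \<in> esimps (length js) p) ts jss" using ts ks l by (simp add: list_all2_conv_all_nth)
   have u2: "list_all2 (%us js. esimplices p us js) uss jss"
    using un(1) ul l by (simp add: list_all2_conv_all_nth[of _ uss])
   have u1: "esimplices p (concat uss) (concat jss)"
    using u2 by (induction rule: list_all2_induct) (auto intro: list_all2_appendI)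
   have cs: "comp_simplex p ks s ts \<in> esimps (length (concat jss)) p"
    using comp_simplex_closed[OF s(1) t1] \<open>sum_list ks = _\<close> by simp
   have mm: "map (%i. dcomp (jss ! i) p (es ! i) (xss ! i)) [0..<length ks] =
    map (bv) (map (%i. comp_simplex p (jss ! i) (ts ! i) (uss ! i)) [0..<length jss])"
    unfolding l map_map comp_def
    by (rule map_cong[OF refl]) (use ts un ks in "auto simp: compose_at_basis")
   have c1: "esimplices p
     (map (%i. comp_simplex p (jss ! i) (ts ! i) (uss ! i)) [0..<length jss]) (map sum_list jss)"
    unfolding list_all2_conv_all_nth[of _ _ "map sum_list jss"]
    using ts un ks l by (auto intro!: comp_simplex_closed)
   have "dcomp (concat jss) p (dcomp ks p d es) (concat xss) =
    bv (comp_simplex p (concat jss) (comp_simplex p ks s ts) (concat uss))"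
    unfolding s(2) et ux map_concat[symmetric] compose_at_basis[OF s(1) t1] by (rule compose_at_basis[OF cs u1])
   also have "... = dcomp (map sum_list jss) p d
    (map (%i. dcomp (jss ! i) p (es ! i) (xss ! i)) [0..<length ks])"
    unfolding mm s(2) using compose_at_basis[OF _ c1, of s] comp_simplex_assoc[OF _ t2 u2, of s] s(1) l jss by simp
   finally show "dcomp (concat jss) p (dcomp ks p d es) (concat xss) =
    dcomp (map sum_list jss) p d
    (map (%i. dcomp (jss ! i) p (es ! i) (xss ! i)) [0..<length ?Es])" by simp
  qed (use D_module DMod_generates compose_at_bimulti d es l in auto)
  then show ?thesis by simp
 qed
 show "dcomp ks p (oact (DMod R) (length ks) p \<sigma> d) es =
   oact (DMod R) (sum_list ks) p (block_perm \<sigma> ks) (dcomp (move \<sigma> ks) p d (move \<sigma> es))"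
  if \<sigma>: "\<sigma> permutes {..<length ks}" and de: "d \<in> carrier (?L (length ks) p)" "es \<in> tuples (map (%k. ?L k p) ks)"
  for \<sigma> ks d p es
  unfolding DMod_act
 proof (rule DMod_bimulti_eqI[OF D_module _ _ _ de])
  let ?Ms = "map (%k. ?L k p) ks"
  have ml: "length (move \<sigma> ks) = length ks" "sum_list (move \<sigma> ks) = sum_list ks" using sum_list_move[OF \<sigma>] by simp_all
  show "bimulti R (?L (length ks) p) ?Ms (?L (sum_list ks) p) (%d es. dcomp ks p (free_map R (nact p \<sigma>) d) es)"
   by (rule bimulti_precompose_left[OF compose_at_bimulti DMod_act_hom[OF \<sigma>]])
  have "slotlin R ?Ms (map (%k. ?L k p) (move \<sigma> ks)) (move \<sigma>)"
   using slotlin_move[of \<sigma> ?Ms] move_map[OF \<sigma>, of "%k. ?L k p"] \<sigma> by simp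
  from bimulti_compose[OF bimulti_precompose[OF _ compose_at_bimulti this, unfolded ml] DMod_act_hom[OF block_perm_permutes[OF \<sigma>]]]
  show "bimulti R (?L (length ks) p) ?Ms (?L (sum_list ks) p)
   (%d es. free_map R (nact p (block_perm \<sigma> ks)) (dcomp (move \<sigma> ks) p d (move \<sigma> es)))"
   using D_module by auto
  fix s ts assume s: "s \<in> esimps (length ks) p" and ts: "esimplices p ts ks"
  have "esimplices p (move \<sigma> ts) (move \<sigma> ks)" unfolding move_def
   by (rule list_all2_permute_list_iff[THEN iffD2]) (use ts permutes_inv[OF \<sigma>] list_all2_lengthD[OF ts] in simp_all)
  moreover have "move \<sigma> (map (bv) ts) = map (bv) (move \<sigma> ts)"
   by (rule move_map) (use \<sigma> list_all2_lengthD[OF ts] in simp)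
  ultimately show "dcomp ks p (free_map R (nact p \<sigma>) (bv s)) (map (bv) ts) =
   free_map R (nact p (block_perm \<sigma> ks)) (dcomp (move \<sigma> ks) p (bv s) (move \<sigma> (map (bv) ts)))"
   using s ts by (simp add: free_map_basis compose_at_basis nact_closed[OF \<sigma> s] comp_equivariant_outer[OF \<sigma> s ts])
 qed
 show "dcomp ks p d (map (%i. oact (DMod R) (ks ! i) p (\<tau>s ! i) (es ! i)) [0..<length ks]) =
   oact (DMod R) (sum_list ks) p (perm_sums ks \<tau>s) (dcomp ks p d es)"
  if \<tau>s: "perms \<tau>s ks"
   and de: "d \<in> carrier (?L (length ks) p)" "es \<in> tuples (map (%k. ?L k p) ks)" for \<tau>s ks d p es
  unfolding DMod_act
 proof (rule DMod_bimulti_eqI[OF D_module _ _ _ de])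
  let ?Ms = "map (%k. ?L k p) ks"
  have t: "\<tau>s ! i permutes {..<ks ! i}" if "i < length ks" for i using list_all2_nthD2[OF \<tau>s that] .
  have sl: "slotlin R ?Ms ?Ms (map2 (%h x. h x) (map (%i. free_map R (nact p (\<tau>s ! i))) [0..<length ks]))"
   by (rule slotlin_map2) (use DMod_act_hom[OF t] in simp_all)
  have "slotlin R ?Ms ?Ms (%es. map (%i. free_map R (nact p (\<tau>s ! i)) (es ! i)) [0..<length ks])"
   unfolding slotlin_def
  proof (intro ballI)
   fix xs assume xs: "xs \<in> tuples ?Ms"
   \<comment> \<open>The axiom applies the permutations by index, whereas
     \<open>slotlin_map2\<close> wants a list of maps; for lists of the right length the two
     agree.\<close>
   have e: "map2 (%h x. h x) (map (%i. free_map R (nact p (\<tau>s ! i))) [0..<length ks]) ys =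
     map (%i. free_map R (nact p (\<tau>s ! i)) (ys ! i)) [0..<length ks]" if "length ys = length ks" for ys
    by (rule nth_equalityI) (use that in simp_all)
   show "map (%i. free_map R (nact p (\<tau>s ! i)) (xs ! i)) [0..<length ks] \<in> tuples ?Ms \<and>
    (\<forall>i<length ?Ms. \<exists>k<length ?Ms. \<exists>g\<in>mhom (?Ms ! i) (?Ms ! k). \<forall>x\<in>carrier (?Ms ! i).
     map (%j. free_map R (nact p (\<tau>s ! j)) (xs[i := x] ! j)) [0..<length ks] =
     (map (%i. free_map R (nact p (\<tau>s ! i)) (xs ! i)) [0..<length ks])[k := g x])"
    using bspec[OF sl[unfolded slotlin_def] xs] xs by (simp add: e tuples_iff del: upt_Suc)
  qed
  from bimulti_precompose[OF _ compose_at_bimulti this]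
  show "bimulti R (?L (length ks) p) ?Ms (?L (sum_list ks) p)
   (%d es. dcomp ks p d (map (%i. free_map R (nact p (\<tau>s ! i)) (es ! i)) [0..<length ks]))"
   using D_module by auto
  show "bimulti R (?L (length ks) p) ?Ms (?L (sum_list ks) p)
   (%d es. free_map R (nact p (perm_sums ks \<tau>s)) (dcomp ks p d es))"
   by (rule bimulti_compose[OF compose_at_bimulti DMod_act_hom[OF perm_sums_permutes[OF \<tau>s]]])
  fix s ts assume s: "s \<in> esimps (length ks) p" and ts: "esimplices p ts ks"
  have tn: "ts ! i \<in> esimps (ks ! i) p" if "i < length ks" for i using list_all2_nthD2[OF ts that] .
  have "map (%i. free_map R (nact p (\<tau>s ! i)) (map (bv) ts ! i)) [0..<length ks] =
   map (bv) (map (%i. nact p (\<tau>s ! i) (ts ! i)) [0..<length ks])"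
   using list_all2_lengthD[OF ts] by (simp add: free_map_basis)
  moreover have "esimplices p (map (%i. nact p (\<tau>s ! i) (ts ! i)) [0..<length ks]) ks"
   unfolding list_all2_conv_all_nth using nact_closed[OF t tn] by simp
  ultimately show "dcomp ks p (bv s) (map (%i. free_map R (nact p (\<tau>s ! i)) (map (bv) ts ! i)) [0..<length ks]) =
   free_map R (nact p (perm_sums ks \<tau>s)) (dcomp ks p (bv s) (map (bv) ts))"
   using s ts comp_equivariant_inner[OF \<tau>s s ts] by (simp only: compose_at_basis free_map_basis)
 qed
qed

end

section \<open>The operad is an E-infinity operad\<close>

context cring
begin

lemma base_module_module: "module R (base_module R)"
proof (rule moduleI)
 show "abelian_group (base_module R)"
  by (rule abelian_groupI) (auto simp: base_module_def a_ac intro!: bexI[of _ "\<ominus> _"] l_neg)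
qed (auto simp: base_module_def cring_axioms l_distr r_distr m_assoc)

text \<open>Each simplex is in a unique way a translate of one whose first vertex is the identity,
  and these simplices are the free generators. The inverse map \<open>\<kappa>\<close> records the
  first vertex and translates it away.\<close>

lemma DMod_free_action: "free_action R (DMod R) m"
 unfolding free_action_def
proof
 fix p
 let ?L = "D_lev m p" and ?N = "esimps m p"
 define B where "B = {s \<in> ?N. fst (s (0, 0)) = id}"
 define S where "S = bv ` B"
 let ?\<Sigma> = "{\<sigma>::nat => nat. \<sigma> permutes {..<m}}"
 let ?F = "free (S \<times> ?\<Sigma>)"
 let ?T = "%c. finsum ?L (%(s, \<sigma>). c (s, \<sigma>) \<odot>\<^bsub>?L\<^esub> oact (DMod R) m p \<sigma> s) {z. c z ~= \<zero>}"
 have S: "S <= carrier ?L" unfolding S_def B_def using basis_in_lev by auto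
 define \<phi> where "\<phi> = (%(s, \<sigma>). oact (DMod R) m p \<sigma> s)"
 have \<phi>: "\<phi> z \<in> carrier ?L" if "z \<in> S \<times> ?\<Sigma>" for z
  using that S hom_closed[OF DMod_act_hom] unfolding \<phi>_def DMod_act by (auto simp: subset_iff)
 have Teq: "?T c = finsum ?L (%z. c z \<odot>\<^bsub>?L\<^esub> \<phi> z) {z. c z ~= \<zero>}" for c
  by (simp add: \<phi>_def case_prod_unfold)
 have T: "?T \<in> mhom ?F ?L" unfolding Teq by (rule free_sum_hom[OF D_module \<phi>])
 have Tb: "?T (bv (bv s, \<sigma>)) = bv (nact p \<sigma> s)"
  if "s \<in> B" "\<sigma> permutes {..<m}" for s \<sigma>
 proof -
  have z: "(bv s, \<sigma>) \<in> S \<times> ?\<Sigma>" using that by (auto simp: S_def)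
  have "?T (bv (bv s, \<sigma>)) = \<phi> (bv s, \<sigma>)"
   unfolding Teq by (rule free_sum_basis[OF D_module \<phi> z])
  then show ?thesis by (simp add: \<phi>_def DMod_act free_map_basis)
 qed
 have a0: "(0, 0) \<in> arrows_upto p" by (simp add: arrows_upto_iff)
 let ?\<rho> = "%t :: perm_simplex. fst (t (0, 0))"
 define \<kappa> where "\<kappa> t = (bv (nact p (inv_into UNIV (?\<rho> t)) t), ?\<rho> t)" for t
 have \<rho>: "?\<rho> t permutes {..<m}" if "t \<in> ?N" for t using nerve_ESigmaD(1)[OF that a0] .
 have base: "nact p (inv_into UNIV (?\<rho> t)) t \<in> B" if t: "t \<in> ?N" for t
  unfolding B_def using nact_closed[OF permutes_inv[OF \<rho>[OF t]] t] permutes_inv_o(1)[OF \<rho>[OF t]]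
  by (simp add: nact_apply[OF a0])
 have nn: "nact p \<tau> (nact p \<sigma> s) = nact p (\<sigma> o \<tau>) s" for \<sigma> \<tau> s
  by (rule simplex_eqI[OF nact_ext nact_ext]) (simp add: nact_apply comp_assoc)
 have nid: "nact p id s = s" if "s \<in> ?N" for s
  by (rule simplex_eqI[OF nact_ext nerve_ext[OF that]]) (simp add: nact_apply)
 have K: "free_map R \<kappa> \<in> mhom ?L ?F"
  unfolding DMod_lev by (rule free_map_hom) (use base \<rho> in \<open>auto simp: \<kappa>_def S_def\<close>)
 have TK: "?T (free_map R \<kappa> x) = x" if x: "x \<in> carrier ?L" for x
 proof (rule mod_hom_eqI[OF DMod_generates D_module D_module hom_compose[OF K T] mod_hom_id(2) _ x])
  fix y assume "y \<in> bv ` ?N"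
  then obtain t where t: "t \<in> ?N" "y = bv t" by auto
  have "nact p (?\<rho> t) (nact p (inv_into UNIV (?\<rho> t)) t) = t"
   unfolding nn permutes_inv_o(2)[OF \<rho>[OF t(1)]] by (rule nid[OF t(1)])
  then show "?T (free_map R \<kappa> y) = y"
   using Tb[OF base[OF t(1)] \<rho>[OF t(1)]] unfolding t(2) free_map_basis \<kappa>_def by (simp only:)
 qed
 have KT: "free_map R \<kappa> (?T x) = x" if x: "x \<in> carrier ?F" for x
 proof (rule mod_hom_eqI[OF free_generates free_mod free_mod hom_compose[OF T K] mod_hom_id(2) _ x])
  fix y assume "y \<in> bv ` (S \<times> ?\<Sigma>)"
  then obtain s \<sigma> where s: "s \<in> B" "\<sigma> permutes {..<m}" "y = bv (bv s, \<sigma>)"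
   by (auto simp: S_def)
  have sN: "s \<in> ?N" and s0: "fst (s (0, 0)) = id" using s(1) by (auto simp: B_def)
  have r: "?\<rho> (nact p \<sigma> s) = \<sigma>" using s0 by (simp add: nact_apply[OF a0])
  have "nact p (inv_into UNIV \<sigma>) (nact p \<sigma> s) = s"
   unfolding nn permutes_inv_o(1)[OF s(2)] by (rule nid[OF sN])
  then show "free_map R \<kappa> (?T y) = y"
   unfolding s(3) Tb[OF s(1,2)] free_map_basis \<kappa>_def r by (simp only:)
 qed
 have "bij_betw ?T (carrier ?F) (carrier ?L)" by (rule bij_betwI[where g="free_map R \<kappa>"])
   (use hom_closed[OF T] hom_closed[OF K] TK KT in auto)
 with S show "\<exists>S \<subseteq> carrier ?L. bij_betw
   (%c. finsum ?L (%(s, \<sigma>). c (s, \<sigma>) \<odot>\<^bsub>?L\<^esub> oact (DMod R) m p \<sigma> s) {z. c z ~= \<zero>})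
   (carrier (free (S \<times> ?\<Sigma>))) (carrier ?L)" by blast
qed

section \<open>Homotopy groups and weak equivalences\<close>

definition coface :: "nat => nat => nat => nat"
 where "coface n i = restrict (%j. if j < i then j else Suc j) {..n}"

lemma coface_monotone: "coface n i \<in> monotone_maps n (Suc n)"
 by (auto simp: coface_def monotone_maps_def monotone_on_def)

lemma face_eq: "face X n i = sop X n (Suc n) (coface n i)"
 by (simp add: face_def coface_def)

lemma face_hom: "simplicial_module R X ==> face X n i \<in> mhom (lev X (Suc n)) (lev X n)"
 unfolding face_eq by (rule simplicial_module.sop_hom[OF _ coface_monotone])

lemma spheres_submodule:
 assumes X: "simplicial_module R X"
 shows "submodule (spheres X n) R (lev X n)"
proof -
 note M = simplicial_module.lev_module[OF X]
 interpret M: module R "lev X n" by (rule M)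
 have z: "\<zero>\<^bsub>lev X k\<^esub> \<oplus>\<^bsub>lev X k\<^esub> \<zero>\<^bsub>lev X k\<^esub> = \<zero>\<^bsub>lev X k\<^esub>" "a \<in> carrier R ==> a \<odot>\<^bsub>lev X k\<^esub> \<zero>\<^bsub>lev X k\<^esub> = \<zero>\<^bsub>lev X k\<^esub>" for k a
 proof -
  interpret K: module R "lev X k" by (rule M)
  show "\<zero>\<^bsub>lev X k\<^esub> \<oplus>\<^bsub>lev X k\<^esub> \<zero>\<^bsub>lev X k\<^esub> = \<zero>\<^bsub>lev X k\<^esub>" by simp
  show "a \<in> carrier R ==> a \<odot>\<^bsub>lev X k\<^esub> \<zero>\<^bsub>lev X k\<^esub> = \<zero>\<^bsub>lev X k\<^esub>" by simp
 qed
 show ?thesis by (rule submoduleI'[OF M])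
   (auto simp: spheres_def mod_hom_zero[OF M M face_hom[OF X]] mod_hom_add[OF face_hom[OF X]]
    mod_hom_smult[OF face_hom[OF X]] z)
qed

lemma boundaries_submodule:
 assumes X: "simplicial_module R X"
 shows "submodule (boundaries X n) R (lev X n)"
proof -
 note M = simplicial_module.lev_module[OF X] and f = face_hom[OF X]
 interpret M: module R "lev X n" by (rule M)
 interpret M': module R "lev X (Suc n)" by (rule M)
 let ?Z = "{y \<in> carrier (lev X (Suc n)). \<forall>i\<le>n. face X n i y = \<zero>\<^bsub>lev X n\<^esub>}"
 have b: "boundaries X n = face X n (Suc n) ` ?Z" by (auto simp: boundaries_def)
 have Z: "\<zero>\<^bsub>lev X (Suc n)\<^esub> \<in> ?Z" "!!x y. [|x \<in> ?Z; y \<in> ?Z|] ==> x \<oplus>\<^bsub>lev X (Suc n)\<^esub> y \<in> ?Z"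
  "!!a x. [|a \<in> carrier R; x \<in> ?Z|] ==> a \<odot>\<^bsub>lev X (Suc n)\<^esub> x \<in> ?Z"
  by (auto simp: mod_hom_zero[OF M M f] mod_hom_add[OF f] mod_hom_smult[OF f])
 show ?thesis
 proof (rule submoduleI'[OF M])
  show "boundaries X n <= carrier (lev X n)" by (auto simp: b hom_closed[OF f])
  show "\<zero>\<^bsub>lev X n\<^esub> \<in> boundaries X n"
   using imageI[OF Z(1), of "face X n (Suc n)"] unfolding b mod_hom_zero[OF M M f] .
  fix x y assume "x \<in> boundaries X n" "y \<in> boundaries X n"
  then obtain u v where uv: "u \<in> ?Z" "v \<in> ?Z" "x = face X n (Suc n) u" "y = face X n (Suc n) v" unfolding b by blast
  show "x \<oplus>\<^bsub>lev X n\<^esub> y \<in> boundaries X n"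
   unfolding b by (rule image_eqI[OF _ Z(2)[OF uv(1,2)]]) (use uv mod_hom_add[OF f] in auto)
 next
  fix a x assume a: "a \<in> carrier R" and "x \<in> boundaries X n"
  then obtain u where u: "u \<in> ?Z" "x = face X n (Suc n) u" unfolding b by blast
  show "a \<odot>\<^bsub>lev X n\<^esub> x \<in> boundaries X n"
   unfolding b by (rule image_eqI[OF _ Z(3)[OF a u(1)]]) (use u a mod_hom_smult[OF f] in auto)
 qed
qed

text \<open>Cosets are replaced by representatives. Differences of spheres are spheres, so
  injectivity on homotopy groups needs to be tested only against the class of zero.\<close>

lemma weak_equivalenceI:
 assumes X: "simplicial_module R X" and Y: "simplicial_module R Y" and g: "simplicial_map R X Y g"
  and inj: "!!n x. [|x \<in> spheres X n; g n x \<in> boundaries Y n|] ==> x \<in> boundaries X n"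
  and surj: "!!n y. y \<in> spheres Y n ==> \<exists>x\<in>spheres X n. y \<ominus>\<^bsub>lev Y n\<^esub> g n x \<in> boundaries Y n"
 shows "weak_equivalence R X Y g"
 unfolding weak_equivalence_def
proof (intro conjI allI g)
 fix n
 note MX = simplicial_module.lev_module[OF X] and MY = simplicial_module.lev_module[OF Y]
 note BX = boundaries_submodule[OF X] and BY = boundaries_submodule[OF Y]
 have h: "g p \<in> mhom (lev X p) (lev Y p)" for p using g by (simp add: simplicial_map_def)
 have fg: "g n (face X n i y) = face Y n i (g (Suc n) y)" if "y \<in> carrier (lev X (Suc n))" for n i y
  using g that coface_monotone[of n i] unfolding simplicial_map_def face_eq by blast
 have bd: "g n ` boundaries X n <= boundaries Y n"
 proof
  fix z assume "z \<in> g n ` boundaries X n"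
  then obtain y where y: "y \<in> carrier (lev X (Suc n))" "\<forall>i\<le>n. face X n i y = \<zero>\<^bsub>lev X n\<^esub>" "z = g n (face X n (Suc n) y)"
   by (auto simp: boundaries_def)
  then have "\<forall>i\<le>n. face Y n i (g (Suc n) y) = \<zero>\<^bsub>lev Y n\<^esub>"
   using fg[OF y(1)] mod_hom_zero[OF MX MY h] by metis
  then show "z \<in> boundaries Y n"
   unfolding boundaries_def using y fg[OF y(1)] hom_closed[OF h y(1)] by auto
 qed
 have q: "quot_map (lev Y n) (boundaries Y n) (g n) (boundaries X n +>\<^bsub>lev X n\<^esub> x) = boundaries Y n +>\<^bsub>lev Y n\<^esub> g n x"
  if "x \<in> carrier (lev X n)" for x
  by (rule quot_map_coset[OF MX BX MY BY h bd that])
 have sX: "x \<in> spheres X n ==> x \<in> carrier (lev X n)" and sY: "y \<in> spheres Y n ==> y \<in> carrier (lev Y n)" for x y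
  by (auto simp: spheres_def)
 have gs: "g n x \<in> spheres Y n" if "x \<in> spheres X n" for x
  using that hom_closed[OF h] fg mod_hom_zero[OF MX MY h] by (auto simp: spheres_def) (metis order_refl)
 interpret MX: module R "lev X n" by (rule MX)
 show "bij_betw (quot_map (lev Y n) (boundaries Y n) (g n)) (homotopy_group X n) (homotopy_group Y n)"
  unfolding bij_betw_def homotopy_group_def
 proof (rule conjI[OF inj_onI])
  fix C C' assume "C \<in> (%x. boundaries X n +>\<^bsub>lev X n\<^esub> x) ` spheres X n" "C' \<in> (%x. boundaries X n +>\<^bsub>lev X n\<^esub> x) ` spheres X n"
   and eq: "quot_map (lev Y n) (boundaries Y n) (g n) C = quot_map (lev Y n) (boundaries Y n) (g n) C'"
  then obtain x x' where x: "x \<in> spheres X n" "x' \<in> spheres X n" "C = boundaries X n +>\<^bsub>lev X n\<^esub> x" "C' = boundaries X n +>\<^bsub>lev X n\<^esub> x'"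
   by auto
  note xc = sX[OF x(1)] sX[OF x(2)]
  have "g n x \<ominus>\<^bsub>lev Y n\<^esub> g n x' \<in> boundaries Y n"
   using eq coset_eq_iff[OF MY BY hom_closed[OF h xc(1)] hom_closed[OF h xc(2)]] unfolding x(3,4) q[OF xc(1)] q[OF xc(2)] by blast
  then have 1: "g n (x \<ominus>\<^bsub>lev X n\<^esub> x') \<in> boundaries Y n" unfolding mod_hom_minus[OF MX MY h xc] .
  have "x \<ominus>\<^bsub>lev X n\<^esub> x' \<in> spheres X n"
   unfolding a_minus_def module_minus_eq[OF MX xc(2)]
   by (intro submoduleD(3)[OF MX spheres_submodule[OF X]] submoduleD(4)[OF MX spheres_submodule[OF X]] x) simp
  from inj[OF this 1] show "C = C'" unfolding x(3,4) using coset_eq_iff[OF MX BX xc] by blast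
 next
  show "quot_map (lev Y n) (boundaries Y n) (g n) ` (%x. boundaries X n +>\<^bsub>lev X n\<^esub> x) ` spheres X n =
   (%x. boundaries Y n +>\<^bsub>lev Y n\<^esub> x) ` spheres Y n"
  proof (intro equalityI subsetI)
  fix C assume "C \<in> quot_map (lev Y n) (boundaries Y n) (g n) ` (%x. boundaries X n +>\<^bsub>lev X n\<^esub> x) ` spheres X n"
  then obtain x where "x \<in> spheres X n" "C = quot_map (lev Y n) (boundaries Y n) (g n) (boundaries X n +>\<^bsub>lev X n\<^esub> x)" by auto
  then show "C \<in> (%x. boundaries Y n +>\<^bsub>lev Y n\<^esub> x) ` spheres Y n" using q[OF sX] gs by auto
 next
  fix C assume "C \<in> (%x. boundaries Y n +>\<^bsub>lev Y n\<^esub> x) ` spheres Y n"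
  then obtain y where y: "y \<in> spheres Y n" "C = boundaries Y n +>\<^bsub>lev Y n\<^esub> y" by auto
  from surj[OF y(1)] obtain x where x: "x \<in> spheres X n" "y \<ominus>\<^bsub>lev Y n\<^esub> g n x \<in> boundaries Y n" by auto
  then have "C = quot_map (lev Y n) (boundaries Y n) (g n) (boundaries X n +>\<^bsub>lev X n\<^esub> x)"
   unfolding y(2) q[OF sX[OF x(1)]] using coset_eq_iff[OF MY BY sY[OF y(1)] hom_closed[OF h sX[OF x(1)]]] by blast
  then show "C \<in> quot_map (lev Y n) (boundaries Y n) (g n) ` (%x. boundaries X n +>\<^bsub>lev X n\<^esub> x) ` spheres X n"
   using x(1) by blast
  qed
 qed
qed

text \<open>The contraction of the nerve of \<open>E\<Sigma>\<^sub>m\<close> appends the identity as a last vertex.\<close>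

definition cone :: "nat => perm_simplex => perm_simplex"
 where "cone n s = (let c = (%i. if i <= n then fst (s (i, i)) else id) in
  restrict (%(i, j). (c i, c j)) (arrows_upto (Suc n)))"

lemma cone_closed: "s \<in> esimps m n ==> cone n s \<in> esimps m (Suc n)"
 by (subst nerve_ESigma_iff, unfold cone_def Let_def, rule exI[of _ "%i. if i <= n then fst (s (i, i)) else id"])
  (auto intro: permutes_id nerve_ESigmaD(1) simp: arrows_upto_iff)

lemma cone_last: "s \<in> esimps m n ==> nerve_op n (coface n (Suc n)) (cone n s) = s"
proof (rule simplex_eqI[OF nerve_map_ext(3) nerve_ext], assumption)
 fix i j assume s: "s \<in> esimps m n" and ij: "(i, j) \<in> arrows_upto n"
 then have "i <= j" "j <= n" by (auto simp: arrows_upto_iff)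
 then show "nerve_op n (coface n (Suc n)) (cone n s) (i, j) = s (i, j)"
  using nerve_ESigma_arrow[OF s, of i j] ij by (simp add: nerve_op_apply coface_def cone_def Let_def arrows_upto_iff)
qed

text \<open>Dropping an old vertex commutes with appending the new one; the bound on
  \<open>i\<close> keeps the appended vertex.\<close>

lemma cone_face:
 assumes "i <= Suc k"
 shows "nerve_op (Suc k) (coface (Suc k) i) (cone (Suc k) s) = cone k (nerve_op k (coface k i) s)"
proof (rule simplex_eqI[OF nerve_map_ext(3)])
 show "cone k (nerve_op k (coface k i) s) \<in> extensional (arrows_upto (Suc k))" by (simp add: cone_def Let_def)
 fix a b assume ab: "(a, b) \<in> arrows_upto (Suc k)"
 have *: "(if coface (Suc k) i c <= Suc k then fst (s (coface (Suc k) i c, coface (Suc k) i c)) else id) =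
  (if c <= k then fst (nerve_op k (coface k i) s (c, c)) else id)" if "c <= Suc k" for c
  using that assms by (auto simp: coface_def nerve_op_apply arrows_upto_iff)
 have "(coface (Suc k) i a, coface (Suc k) i b) \<in> arrows_upto (Suc (Suc k))"
  using arrows_upto_map[OF coface_monotone ab] .
 then show "nerve_op (Suc k) (coface (Suc k) i) (cone (Suc k) s) (a, b) = cone k (nerve_op k (coface k i) s) (a, b)"
  using ab *[of a] *[of b] unfolding nerve_op_apply[OF ab] by (simp add: cone_def Let_def arrows_upto_iff)
qed

text \<open>In degree 0 nothing is left to cone: dropping the only old vertex leaves the appended
  one. This exceptional face is what brings in the augmentation.\<close>

lemma cone_first: "s \<in> esimps m 0 ==> nerve_op 0 (coface 0 0) (cone 0 s) = restrict (%_. (id, id)) (arrows_upto 0)"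
 by (rule simplex_eqI[OF nerve_map_ext(3)]) (auto simp: nerve_op_apply arrows_upto_iff coface_def cone_def Let_def)

section \<open>Comparison with the constant simplicial module\<close>

lemma const_smod_simplicial: "simplicial_module R (const_smod R)"
 by (intro simplicial_module.intro simplicial_module_axioms.intro cring_axioms)
  (simp_all add: const_smod_def base_module_module mod_hom_id)

text \<open>All faces are the identity, so a simplex with one vanishing face is zero.\<close>

lemma const_boundaries: "boundaries (const_smod R) n = {\<zero>}"
 by (auto simp: boundaries_def face_def const_smod_def base_module_def intro!: exI[of _ \<zero>])

lemma const_spheres: "spheres (const_smod R) n = (if n = 0 then carrier R else {\<zero>})"
 by (cases n) (auto simp: spheres_def face_def const_smod_def base_module_def)

text \<open>The apex of the span is the operad component itself, with the identity as one leg and,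
  as the other, the augmentation that sends every simplex to one. A sphere killed by the
  augmentation is the last face of its own cone, whose other faces vanish.\<close>

lemma DMod_contractible: "weakly_equivalent R (arity (DMod R) m) (const_smod R)"
proof -
 let ?X = "arity (DMod R) m" and ?Y = "const_smod R"
 let ?N = "%p. esimps m p"
 have X: "simplicial_module R ?X" unfolding DMod_simps by (rule nerve_smod_simplicial)
 note Y = const_smod_simplicial and LM = D_module[of m]
 have YM: "lev ?Y p = base_module R" for p by (simp add: const_smod_def)
 have bs: "carrier (base_module R) = carrier R" "\<zero>\<^bsub>base_module R\<^esub> = \<zero>" "smult (base_module R) = (\<otimes>)"
  "add (base_module R) = (\<oplus>)"
  by (simp_all add: base_module_def)
 have op: "sop ?X q p \<theta> \<in> mhom (lev ?X p) (lev ?X q)" if "\<theta> \<in> monotone_maps q p" for p q \<theta>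
  by (rule simplicial_module.sop_hom[OF X that])
 have opb: "sop ?X q p \<theta> (bv s) = bv (nerve_op q \<theta> s)" for q p \<theta> s
  by (simp add: DMod_simps nerve_smod_simps free_map_basis)
 have "\<exists>h\<in>mhom (lev ?X p) (base_module R). \<forall>s\<in>?N p. h (bv s) = \<one>" for p
  unfolding DMod_lev by (rule free_lift[OF base_module_module]) (simp add: bs)
 then obtain g where g: "!!p. g p \<in> mhom (lev ?X p) (base_module R)"
  "!!p s. s \<in> ?N p ==> g p (bv s) = \<one>" by metis
 have id: "weak_equivalence R ?X ?X (%p x. x)"
 proof (rule weak_equivalenceI[OF X X])
  show "simplicial_map R ?X ?X (%p x. x)" by (simp add: simplicial_map_def mod_hom_id)
  fix n y assume y: "y \<in> spheres ?X n"
  then have "y \<in> carrier (lev ?X n)" by (simp add: spheres_def)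
  then have "y \<ominus>\<^bsub>lev ?X n\<^esub> y = \<zero>\<^bsub>lev ?X n\<^esub>" using module_minus_eq_zero[OF LM] by blast
  then show "\<exists>x\<in>spheres ?X n. y \<ominus>\<^bsub>lev ?X n\<^esub> x \<in> boundaries ?X n"
   using y submoduleD(2)[OF LM boundaries_submodule[OF X]] by (intro bexI[of _ y]) simp_all
 qed
 have gs: "simplicial_map R ?X ?Y g" unfolding simplicial_map_def YM
 proof (intro conjI allI ballI g)
  fix p q \<theta> x assume \<theta>: "\<theta> \<in> monotone_maps q p" and x: "x \<in> carrier (lev ?X p)"
  have "g q (sop ?X q p \<theta> x) = g p x"
   by (rule mod_hom_eqI[OF DMod_generates LM base_module_module hom_compose[OF op[OF \<theta>] g(1)] g(1) _ x])
    (auto simp: opb g(2) nerve_op_closed[OF \<theta>])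
  then show "g q (sop ?X q p \<theta> x) = sop ?Y q p \<theta> (g p x)" by (simp add: const_smod_def)
 qed
 have coneh: "free_map R (cone n) \<in> mhom (lev ?X n) (lev ?X (Suc n))" for n
  unfolding DMod_lev by (rule free_map_hom) (rule cone_closed)
 have fh: "face ?X n i \<in> mhom (lev ?X (Suc n)) (lev ?X n)" for n i by (rule face_hom[OF X])
 have fb: "face ?X n i (bv s) = bv (nerve_op n (coface n i) s)" for n i s unfolding face_eq opb ..
 let ?v = "restrict (%_. (id, id)) (arrows_upto 0) :: perm_simplex"
 have vN: "?v \<in> ?N 0" unfolding nerve_ESigma_iff by (intro exI[of _ "%_. id"]) (auto intro: permutes_id)
 have vL: "bv ?v \<in> carrier (lev ?X 0)" by (rule basis_in_lev[OF vN])
 have "weak_equivalence R ?X ?Y g"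
 proof (rule weak_equivalenceI[OF X Y gs])
  fix n x assume x: "x \<in> spheres ?X n" and gx: "g n x \<in> boundaries ?Y n"
  have xc: "x \<in> carrier (lev ?X n)" using x by (simp add: spheres_def)
  have g0: "g n x = \<zero>" using gx by (simp add: const_boundaries)
  let ?y = "free_map R (cone n) x"
  have "face ?X n (Suc n) ?y = x"
   by (rule mod_hom_eqI[OF DMod_generates LM LM hom_compose[OF coneh fh] mod_hom_id(2) _ xc])
    (auto simp: free_map_basis fb cone_last)
  moreover have "face ?X n i ?y = \<zero>\<^bsub>lev ?X n\<^esub>" if i: "i <= n" for i
  proof (cases n)
   \<comment> \<open>Here the remaining face of the cone is the augmentation times the vertex
     \<open>?v\<close>; this is where the vanishing of \<open>g n x\<close> enters.\<close>
   case 0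
   interpret L0: module R "lev ?X 0" by (rule LM)
   have sc: "(%a. a \<odot>\<^bsub>lev ?X 0\<^esub> bv ?v) \<in> mhom (base_module R) (lev ?X 0)"
    by (rule mod_homI) (use vL in "simp_all add: bs L0.smult_l_distr L0.smult_assoc1")
   have "face ?X 0 0 (free_map R (cone 0) x) = g 0 x \<odot>\<^bsub>lev ?X 0\<^esub> bv ?v"
    by (rule mod_hom_eqI[OF DMod_generates LM LM hom_compose[OF coneh fh] hom_compose[OF g(1) sc] _ xc[unfolded 0]])
     (use vL in "auto simp: free_map_basis fb cone_first g(2)")
   then show ?thesis using 0 i g0 vL by simp
  next
   case (Suc k)
   have "face ?X (Suc k) i (free_map R (cone (Suc k)) x) = free_map R (cone k) (face ?X k i x)"
    by (rule mod_hom_eqI[OF DMod_generates LM LM hom_compose[OF coneh fh] hom_compose[OF fh coneh] _ xc[unfolded Suc]])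
     (use i Suc in "auto simp: free_map_basis fb cone_face")
   also have "face ?X k i x = \<zero>\<^bsub>lev ?X k\<^esub>" using x i Suc by (simp add: spheres_def)
   also have "free_map R (cone k) ... = \<zero>\<^bsub>lev ?X (Suc k)\<^esub>" by (rule mod_hom_zero[OF LM LM coneh])
   finally show ?thesis using Suc by simp
  qed
  ultimately show "x \<in> boundaries ?X n"
   unfolding boundaries_def using hom_closed[OF coneh xc] by (intro CollectI exI[of _ ?y]) auto
 next
  fix n y assume y: "y \<in> spheres ?Y n"
  interpret B: module R "base_module R" by (rule base_module_module)
  show "\<exists>x\<in>spheres ?X n. y \<ominus>\<^bsub>lev ?Y n\<^esub> g n x \<in> boundaries ?Y n"
  proof (cases n)
   case 0
   interpret L0: module R "lev ?X 0" by (rule LM)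
   have yR: "y \<in> carrier R" using y 0 by (simp add: const_spheres)
   let ?x = "y \<odot>\<^bsub>lev ?X 0\<^esub> bv ?v"
   have "g 0 ?x = y" using mod_hom_smult[OF g(1) yR vL] g(2)[OF vN] yR by (simp add: bs)
   moreover have "y \<ominus>\<^bsub>base_module R\<^esub> y = \<zero>"
    using module_minus_eq_zero[OF base_module_module, of y y] yR by (simp add: bs)
   moreover have "?x \<in> spheres ?X 0" using yR vL by (simp add: spheres_def)
   ultimately show ?thesis using 0 by (intro bexI[of _ ?x]) (simp_all add: YM const_boundaries)
  next
   \<comment> \<open>In positive degrees the constant module has only the zero sphere.\<close>
   case (Suc k)
   have z: "\<zero>\<^bsub>lev ?X n\<^esub> \<in> spheres ?X n" by (rule submoduleD(2)[OF LM spheres_submodule[OF X]])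
   have "g n \<zero>\<^bsub>lev ?X n\<^esub> = \<zero>" using mod_hom_zero[OF LM base_module_module g(1)] by (simp add: bs)
   moreover have "\<zero> \<ominus>\<^bsub>base_module R\<^esub> \<zero> = \<zero>"
    using module_minus_eq_zero[OF base_module_module, of \<zero> \<zero>] by (simp add: bs)
   ultimately show ?thesis using y z Suc by (intro bexI[OF _ z]) (simp add: YM const_boundaries const_spheres)
  qed
 qed
 with id X show ?thesis unfolding weakly_equivalent_def by blast
qed

lemma DMod_E_infinity: "E_infinity_operad R (DMod R)"
 unfolding E_infinity_operad_def using DMod_operad DMod_free_action DMod_contractible by blast

end

section \<open>Coends over \<open>\<Delta>S\<^sub>+\<close>\<close>

lemma nerve_underD:
 assumes s: "s \<in> usimps m p"
 shows "i <= p ==> fst (s (i, i)) \<in> ds_mors" "i <= p ==> dsrc (fst (s (i, i))) = m"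
  "i <= p ==> snd (s (i, i)) = ds_id (dtgt (fst (s (i, i))))"
  "[|i <= j; j <= p|] ==> fst (s (i, j)) = fst (s (i, i))"
  "[|i <= j; j <= p|] ==> snd (s (i, j)) \<in> ds_mors"
  "[|i <= j; j <= p|] ==> dsrc (snd (s (i, j))) = dtgt (fst (s (i, i)))"
  "[|i <= j; j <= p|] ==> dtgt (snd (s (i, j))) = dtgt (fst (s (j, j)))"
  "[|i <= j; j <= p|] ==> snd (s (i, j)) \<bullet> fst (s (i, i)) = fst (s (j, j))"
  "[|i <= j; j <= l; l <= p|] ==> snd (s (i, l)) = snd (s (j, l)) \<bullet> snd (s (i, j))"
proof -
 obtain c where c: "\<forall>i\<le>p. c i \<in> Obj (under m) \<and> s (i, i) = Ide (under m) (c i)"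
  "\<forall>i j. i <= j \<and> j <= p --> s (i, j) \<in> Hom (under m) (c i) (c j)"
  "\<forall>i j l. i <= j \<and> j <= l \<and> l <= p --> s (i, l) = Cmp (under m) (s (j, l)) (s (i, j))"
  using s unfolding nerve_def by blast
 have 1: "c i \<in> ds_mors" "dsrc (c i) = m" "s (i, i) = (c i, ds_id (dtgt (c i)))" if "i <= p" for i
  using c(1)[rule_format, OF that] by (auto simp: under_def ds_hom_iff)
 have 2: "fst (s (i, j)) = c i" "snd (s (i, j)) \<in> ds_mors" "dsrc (snd (s (i, j))) = dtgt (c i)"
   "dtgt (snd (s (i, j))) = dtgt (c j)" "snd (s (i, j)) \<bullet> c i = c j" if "i <= j" "j <= p" for i j
  using c(2)[rule_format, OF conjI[OF that]] by (auto simp: under_def ds_hom_iff)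
 have fc: "fst (s (i, i)) = c i" if "i <= p" for i using 1(3)[OF that] by simp
 show "i <= p ==> fst (s (i, i)) \<in> ds_mors" "i <= p ==> dsrc (fst (s (i, i))) = m"
  "i <= p ==> snd (s (i, i)) = ds_id (dtgt (fst (s (i, i))))" using 1[of i] by simp_all
 show "fst (s (i, j)) = fst (s (i, i))" "snd (s (i, j)) \<in> ds_mors" "dsrc (snd (s (i, j))) = dtgt (fst (s (i, i)))"
  "dtgt (snd (s (i, j))) = dtgt (fst (s (j, j)))" "snd (s (i, j)) \<bullet> fst (s (i, i)) = fst (s (j, j))"
  if ij: "i <= j" "j <= p"
  using 2[OF ij] unfolding fc[OF order_trans[OF ij]] fc[OF ij(2)] by simp_all
 show "snd (s (i, l)) = snd (s (j, l)) \<bullet> snd (s (i, j))" if "i <= j" "j <= l" "l <= p"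
  using arg_cong[OF c(3)[rule_format, of i j l], of snd] that by (simp add: under_def)
qed

lemma nerve_underI:
 assumes e: "s \<in> extensional (arrows_upto p)"
  and c: "!!i. i <= p ==> fst (s (i, i)) \<in> ds_mors" "!!i. i <= p ==> dsrc (fst (s (i, i))) = m"
  "!!i. i <= p ==> snd (s (i, i)) = ds_id (dtgt (fst (s (i, i))))"
  and g: "!!i j. [|i <= j; j <= p|] ==> fst (s (i, j)) = fst (s (i, i))"
  "!!i j. [|i <= j; j <= p|] ==> snd (s (i, j)) \<in> ds_mors"
  "!!i j. [|i <= j; j <= p|] ==> dsrc (snd (s (i, j))) = dtgt (fst (s (i, i)))"
  "!!i j. [|i <= j; j <= p|] ==> dtgt (snd (s (i, j))) = dtgt (fst (s (j, j)))"
  "!!i j. [|i <= j; j <= p|] ==> snd (s (i, j)) \<bullet> fst (s (i, i)) = fst (s (j, j))"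
  "!!i j l. [|i <= j; j <= l; l <= p|] ==> snd (s (i, l)) = snd (s (j, l)) \<bullet> snd (s (i, j))"
 shows "s \<in> usimps m p"
 unfolding nerve_def
proof (intro CollectI conjI exI[of _ "%i. fst (s (i, i))"] allI impI e)
 fix i assume i: "i <= p"
 show "fst (s (i, i)) \<in> Obj (under m)" using c(1,2)[OF i] by (auto simp: under_def ds_hom_iff)
 show "s (i, i) = Ide (under m) (fst (s (i, i)))" by (rule prod_eqI) (simp_all add: under_def c(3)[OF i])
next
 fix i j assume ij: "i <= j \<and> j <= p"
 note g' = g(1-5)[OF conjunct1[OF ij] conjunct2[OF ij]]
 have "s (i, j) = (fst (s (i, i)), snd (s (i, j)))" by (rule prod_eqI) (simp_all only: g' fst_conv snd_conv)
 moreover have "snd (s (i, j)) \<in> ds_hom (dtgt (fst (s (i, i)))) (dtgt (fst (s (j, j))))"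
  using g'(2-4) by (simp add: ds_hom_iff)
 ultimately have "s (i, j) \<in> {(fst (s (i, i)), g) | g.
   g \<in> ds_hom (dtgt (fst (s (i, i)))) (dtgt (fst (s (j, j)))) \<and> g \<bullet> fst (s (i, i)) = fst (s (j, j))}"
  using g'(5) by blast
 then show "s (i, j) \<in> Hom (under m) (fst (s (i, i))) (fst (s (j, j)))" by (simp add: under_def)
next
 fix i j l assume ijl: "i <= j \<and> j <= l \<and> l <= p"
 then have ij: "i <= j" "j <= p" and il: "i <= l" "l <= p" by auto
 show "s (i, l) = Cmp (under m) (s (j, l)) (s (i, j))"
  by (rule prod_eqI) (use ijl g(6)[of i j l] g(1)[OF ij] g(1)[OF il] in "simp_all add: under_def")
qed

definition precomp_simplex :: "nat => ds_mor => under_simplex => under_simplex"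
 where "precomp_simplex p f = nerve_map p (map_prod (%h. h \<bullet> f) id)"

lemma precomp_eq: "precomp R p f = free_map R (precomp_simplex p f)"
 by (simp add: precomp_def precomp_simplex_def)

lemma precomp_simplex_apply: "(i, j) \<in> arrows_upto p ==>
  precomp_simplex p f s (i, j) = (fst (s (i, j)) \<bullet> f, snd (s (i, j)))"
 by (simp add: precomp_simplex_def nerve_map_apply map_prod_def case_prod_unfold)

lemma precomp_simplex_ext: "precomp_simplex p f s \<in> extensional (arrows_upto p)"
 by (simp add: precomp_simplex_def nerve_map_ext)

text \<open>Precomposition alters the vertices and keeps the connecting morphisms, which still carry
  one new vertex to the next by associativity.\<close>

lemma precomp_simplex_closed:
 assumes f: "f \<in> ds_mors" and s: "s \<in> usimps (dtgt f) p"
 shows "precomp_simplex p f s \<in> usimps (dsrc f) p"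
proof -
 have a: "i <= j ==> j <= p ==> precomp_simplex p f s (i, j) = (fst (s (i, j)) \<bullet> f, snd (s (i, j)))" for i j
  by (rule precomp_simplex_apply) (simp add: arrows_upto_iff)
 note D = nerve_underD[OF s]
 show ?thesis
 proof (rule nerve_underI[OF precomp_simplex_ext])
  fix i assume i: "i <= p"
  show "fst (precomp_simplex p f s (i, i)) \<in> ds_mors"
   unfolding a[OF order_refl i] fst_conv by (rule comp_mors[OF D(1)[OF i] f D(2)[OF i]])
  show "dsrc (fst (precomp_simplex p f s (i, i))) = dsrc f"
   "snd (precomp_simplex p f s (i, i)) = ds_id (dtgt (fst (precomp_simplex p f s (i, i))))"
   unfolding a[OF order_refl i] using D(3)[OF i] by simp_all
 next
  fix i j assume ij: "i <= j" "j <= p"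
  then have i: "i <= p" by simp
  note aa = a[OF ij] a[OF order_refl i] a[OF order_refl ij(2)]
  show "fst (precomp_simplex p f s (i, j)) = fst (precomp_simplex p f s (i, i))"
   "snd (precomp_simplex p f s (i, j)) \<in> ds_mors"
   "dsrc (snd (precomp_simplex p f s (i, j))) = dtgt (fst (precomp_simplex p f s (i, i)))"
   "dtgt (snd (precomp_simplex p f s (i, j))) = dtgt (fst (precomp_simplex p f s (j, j)))"
   unfolding aa fst_conv snd_conv D(4)[OF ij] using D(5-7)[OF ij] by simp_all
  show "snd (precomp_simplex p f s (i, j)) \<bullet> fst (precomp_simplex p f s (i, i)) = fst (precomp_simplex p f s (j, j))"
   unfolding aa fst_conv snd_conv D(8)[OF ij, symmetric]
   by (rule ds_comp_assoc[symmetric]) (use D(1,2)[OF i] D(5,6)[OF ij] f in simp_all)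
 next
  fix i j l assume ijl: "i <= j" "j <= l" "l <= p"
  then have il: "i <= l" "j <= p" by auto
  show "snd (precomp_simplex p f s (i, l)) = snd (precomp_simplex p f s (j, l)) \<bullet> snd (precomp_simplex p f s (i, j))"
   unfolding a[OF il(1) ijl(3)] a[OF ijl(2,3)] a[OF ijl(1) il(2)] snd_conv by (rule D(9)[OF ijl])
 qed
qed

lemma precomp_simplex_op:
 "\<theta> \<in> monotone_maps q p ==> nerve_op q \<theta> (precomp_simplex p f s) = precomp_simplex q f (nerve_op q \<theta> s)"
 unfolding precomp_simplex_def by (rule nerve_op_map)

section \<open>Classes and relations of a coend\<close>

definition coend_class ::
 "('k, 'r) ring_scheme => ('k, 'a) module => ds_mor set => nat => nat => (under_simplex => 'k) =>
  ('a list => 'k) set => (nat => ('k, 'a) summand) set"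
 where "coend_class R A S p n x V =
  coend_rel R A S p +>\<^bsub>dsum (coend_summand R A p)\<^esub> coend_pre R A p n x V"

definition class_pures ::
 "('k, 'r) ring_scheme => ('k, 'a) module => ds_mor set => nat => nat => (under_simplex => 'k) =>
  'a list => (nat => ('k, 'a) summand) set"
 where "class_pures R A S p n x vs = coend_class R A S p n x (pures R (replicate n A) vs)"

definition coend_gens :: "('k, 'r) ring_scheme => ('k, 'a) module => ds_mor set => nat =>
  (nat => ('k, 'a) summand) set"
 where "coend_gens R A S p =
   {coend_pre R A p (dsrc f) (precomp R p f x) V
     \<ominus>\<^bsub>dsum (coend_summand R A p)\<^esub> coend_pre R A p (dtgt f) x (bar_map R A f V) | f x V.
    f \<in> S \<and> x \<in> carrier (lev (Ftilde R (dtgt f)) p) \<and> V \<in> carrier (bar R A (dsrc f))}"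

lemma coend_rel_span: "coend_rel R A S p = span R (dsum (coend_summand R A p)) (coend_gens R A S p)"
 by (simp add: coend_rel_def coend_gens_def)

text \<open>Instantiated with all morphisms and with the automorphisms.\<close>

locale coend_over = cring R for R (structure) +
 fixes A :: "('a, 'v) module" and S :: "ds_mor set"
 assumes algebra: "assoc_algebra R A"
  and S_mors: "S <= ds_mors"
  and S_perm: "\<gamma> permutes {..<n} ==> ds_perm n \<gamma> \<in> S"
  and S_juxts: "set fs <= S ==> ds_juxts fs \<in> S"
begin

abbreviation "F_lev n p \<equiv> lev (Ftilde R n) p"
abbreviation "sums p \<equiv> dsum (coend_summand R A p)"
abbreviation "rel p \<equiv> coend_rel R A S p"
abbreviation "coend_lev p \<equiv> lev (coend R A S) p"
abbreviation "cpures \<equiv> class_pures R A S"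

sublocale A: assoc_algebra R A by (rule algebra)

lemma A_module: "module R A" by (rule A.module_axioms)

lemma replicate_module: "\<forall>M\<in>set (replicate n A). module R M"
 using A_module by simp

section \<open>The bar construction on lists\<close>

definition lprod :: "'v list => 'v"
 where "lprod l = foldr (\<otimes>\<^bsub>A\<^esub>) l \<one>\<^bsub>A\<^esub>"

lemma lprod_simps [simp]: "lprod [] = \<one>\<^bsub>A\<^esub>" "lprod (x # l) = x \<otimes>\<^bsub>A\<^esub> lprod l"
 by (simp_all add: lprod_def)

lemma lprod_closed: "set l <= carrier A ==> lprod l \<in> carrier A"
 by (induction l) auto

lemma lprod_append: "[|set l <= carrier A; set l' <= carrier A|] ==> lprod (l @ l') = lprod l \<otimes>\<^bsub>A\<^esub> lprod l'"
 by (induction l) (auto simp: lprod_closed A.m_assoc)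

text \<open>The bar construction multiplies out the groups formed by \<open>act\<close>, so its
  behaviour on identities, permutations and juxtapositions is inherited from there.\<close>

lemma bar_list_act:
 assumes f: "f \<in> ds_mors" and l: "length as = dsrc f"
 shows "bar_list A f as = map lprod (act f as)"
 using l by (auto simp: bar_list_def act_def Let_def lprod_def fibre_def permute_list_def
   intro!: arg_cong[of _ _ "%l. foldr _ l _"])

lemma set_act:
 assumes f: "f \<in> ds_mors" and xs: "length xs = dsrc f" and l: "l \<in> set (act f xs)"
 shows "set l <= set xs"
proof -
 note f' = ds_homD(4)[OF f[unfolded ds_mors_iff]]
 obtain i where l': "l = map (%j. xs ! dperm f j) (fibre (dmap f) (dsrc f) i)"
  using l unfolding act_def set_map by blast
 show ?thesis
 proof
  fix x assume "x \<in> set l"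
  then obtain j where j: "j \<in> set (fibre (dmap f) (dsrc f) i)" "x = xs ! dperm f j"
   unfolding l' set_map by blast
  have "dperm f j \<in> {..<dsrc f}" unfolding permutes_in_image[OF f'] using j(1) by (simp add: set_fibre)
  then show "x \<in> set xs" unfolding j(2) using xs by simp
 qed
qed

lemma bar_list_closed:
 assumes f: "f \<in> ds_mors" and as: "as \<in> tuples (replicate (dsrc f) A)"
 shows "bar_list A f as \<in> tuples (replicate (dtgt f) A)"
 using as set_act[OF f, of as] unfolding tuples_replicate
 by (auto simp: bar_list_act[OF f] intro!: lprod_closed)

text \<open>Entry \<open>i\<close> occurs exactly once, in a single group. The product of this group
  has the entry between two fixed factors and is linear in it by the algebra axioms; the other
  groups do not see it.\<close>

lemma bar_list_slotlin:
 assumes f: "f \<in> ds_mors"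
 shows "slotlin R (replicate (dsrc f) A) (replicate (dtgt f) A) (bar_list A f)"
 unfolding slotlin_def
proof (intro ballI conjI allI impI bar_list_closed[OF f])
 fix as i assume as: "as \<in> tuples (replicate (dsrc f) A)" and i: "i < length (replicate (dsrc f) A)"
 note fD = ds_homD[OF f[unfolded ds_mors_iff]]
 have la: "length as = dsrc f" "set as <= carrier A" using as by (auto simp: tuples_replicate)
 define j where "j = inv_into UNIV (dperm f) i"
 have j: "j < dsrc f" "dperm f j = i"
  using i permutes_in_image[OF permutes_inv[OF fD(4)], of i] permutes_inverses(1)[OF fD(4)] by (auto simp: j_def)
 have jeq: "j' = j" if "dperm f j' = i" for j'
  using that permutes_inverses(2)[OF fD(4), of j'] by (simp add: j_def)
 define k where "k = dmap f j"
 have k: "k < dtgt f" using ds_mapsD(1)[OF fD(3) j(1)] by (simp add: k_def)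
 have "j \<in> set (fibre (dmap f) (dsrc f) k)" using j(1) by (simp add: set_fibre k_def)
 \<comment> \<open>Splits the fibre that receives entry \<open>i\<close> around its unique
   occurrence.\<close>
 then obtain us ws where sp: "fibre (dmap f) (dsrc f) k = us @ j # ws" by (auto simp: in_set_conv_decomp)
 have d: "j \<notin> set us" "j \<notin> set ws"
 proof -
  have "distinct (us @ j # ws)" unfolding sp[symmetric] by (simp add: fibre_def)
  then show "j \<notin> set us" "j \<notin> set ws" by auto
 qed
 let ?v = "%l. map (%j. as ! dperm f j) l"
 have uw: "set (?v us) <= carrier A" "set (?v ws) <= carrier A"
 proof -
  have "set us \<union> set ws <= {..<dsrc f}" using arg_cong[OF sp, of set] by (auto simp: set_fibre)
  then show "set (?v us) <= carrier A" "set (?v ws) <= carrier A"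
   using la permutes_in_image[OF fD(4)] by (auto intro!: subsetD[OF la(2)] nth_mem)
 qed
 define g where "g x = lprod (?v us) \<otimes>\<^bsub>A\<^esub> (x \<otimes>\<^bsub>A\<^esub> lprod (?v ws))" for x
 note cl = lprod_closed[OF uw(1)] lprod_closed[OF uw(2)]
 have gm: "g \<in> mhom A A" unfolding g_def
  by (rule mod_homI) (use cl in "simp_all add: A.l_distr A.r_distr A.smult_mult_left A.smult_mult_right")
 have "bar_list A f (as[i := x]) = (bar_list A f as)[k := g x]" if x: "x \<in> carrier A" for x
 proof (rule nth_equalityI)
  fix l assume "l < length (bar_list A f (as[i := x]))"
  then have l: "l < dtgt f" using la by (simp add: bar_list_act[OF f])
  have un: "map (%j. as[i := x] ! dperm f j) l' = ?v l'" if "j \<notin> set l'" for l'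
  proof (rule map_cong[OF refl])
   fix j' assume "j' \<in> set l'"
   then have "dperm f j' ~= i" using that jeq by auto
   then show "as[i := x] ! dperm f j' = as ! dperm f j'" by simp
  qed
  show "bar_list A f (as[i := x]) ! l = (bar_list A f as)[k := g x] ! l"
  proof (cases "l = k")
   case True
   have e: "map (%j. as[i := x] ! dperm f j) (us @ j # ws) = ?v us @ x # ?v ws"
    using un[OF d(1)] un[OF d(2)] j i la by simp
   have "bar_list A f (as[i := x]) ! l = lprod (?v us @ x # ?v ws)"
    unfolding e[symmetric] sp[symmetric] using True k la by (simp add: bar_list_act[OF f] act_def)
   also have "... = g x" using uw x by (simp add: lprod_append g_def)
   also have "... = (bar_list A f as)[k := g x] ! l" using True k la by (simp add: bar_list_act[OF f] act_def)
   finally show ?thesis .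
  next
   case False
   then have "j \<notin> set (fibre (dmap f) (dsrc f) l)" by (auto simp: set_fibre k_def)
   from un[OF this] show ?thesis using False l la by (simp add: bar_list_act[OF f] act_def del: map_eq_conv)
  qed
 qed (use la in "simp add: bar_list_act[OF f]")
 then show "\<exists>k<length (replicate (dtgt f) A). \<exists>g\<in>mhom (replicate (dsrc f) A ! i) (replicate (dtgt f) A ! k).
   \<forall>x\<in>carrier (replicate (dsrc f) A ! i). bar_list A f (as[i := x]) = (bar_list A f as)[k := g x]"
  using k gm i by (intro exI[of _ k] conjI bexI[of _ g]) simp_all
qed

lemma bar_list_id:
 assumes "vs \<in> tuples (replicate n A)"
 shows "bar_list A (ds_id n) vs = vs"
proof -
 have vs: "length vs = n" "set vs <= carrier A" using assms by (auto simp: tuples_replicate)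
 have "map lprod (map (%x. [x]) vs) = vs"  unfolding map_map by (rule map_idI) (use vs in auto)
 then show ?thesis using vs by (simp add: bar_list_act ds_id_mors act_id)
qed

lemma bar_list_move:
 assumes \<pi>: "\<pi> permutes {..<n}" and vs: "vs \<in> tuples (replicate n A)"
 shows "bar_list A (ds_move n \<pi>) vs = move \<pi> vs"
proof -
 have l: "length vs = n" using vs by (simp add: tuples_replicate)
 have "set (move \<pi> vs) <= carrier A" using vs set_move[of \<pi> vs] \<pi> by (simp add: tuples_replicate)
 then have "map lprod (map (%x. [x]) (move \<pi> vs)) = move \<pi> vs"
  unfolding map_map by (intro map_idI) auto
 then show ?thesis using l by (simp add: bar_list_act ds_move_mors[OF \<pi>] act_move)
qed

lemma bar_list_juxts:
 assumes fs: "set fs <= ds_mors" and vss: "map length vss = map dsrc fs"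
 shows "bar_list A (ds_juxts fs) (concat vss) = concat (map2 (bar_list A) fs vss)"
proof -
 have l: "length vss = length fs" using vss by (rule map_eq_imp_length_eq)
 have "map2 (bar_list A) fs vss = map (map lprod) (map2 act fs vss)"
 proof (rule nth_equalityI)
  fix i assume "i < length (map2 (bar_list A) fs vss)"
  then have i: "i < length fs" by simp
  then have "length (vss ! i) = dsrc (fs ! i)" using arg_cong[OF vss, of "%l. l ! i"] l by simp
  then show "map2 (bar_list A) fs vss ! i = map (map lprod) (map2 act fs vss) ! i"
   using i l bar_list_act[of "fs ! i" "vss ! i"] fs by (auto simp: subset_iff)
 qed (use l in simp)
 then have "concat (map2 (bar_list A) fs vss) = map lprod (concat (map2 act fs vss))"
  by (simp only: map_concat)
 also have "... = bar_list A (ds_juxts fs) (concat vss)" by (subst bar_list_act[OF ds_juxts_mors[OF fs]])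
   (use vss in "simp_all add: act_juxts[OF fs vss] length_concat ds_juxts_src_tgt")
 finally show ?thesis ..
qed

lemma bar_module: "module R (bar R A n)"
 unfolding bar_def by (rule tensors_module[OF replicate_module])

lemma bar_map_props:
 assumes f: "f \<in> ds_mors"
 shows bar_map_hom: "bar_map R A f \<in> mhom (bar R A (dsrc f)) (bar R A (dtgt f))"
  and bar_map_pures: "vs \<in> tuples (replicate (dsrc f) A) ==>
   bar_map R A f (pures R (replicate (dsrc f) A) vs) = pures R (replicate (dtgt f) A) (bar_list A f vs)"
 unfolding bar_map_def bar_def
 using tensors_map_props[OF replicate_module replicate_module bar_list_closed[OF f]
   multilin_slotlin[OF replicate_module pures_multilin[OF replicate_module] bar_list_slotlin[OF f]]]
 by simp_all

section \<open>The coend as a quotient of a direct sum\<close>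

lemma Ftilde_lev: "F_lev n p = free (usimps n p)"
 by (simp add: Ftilde_def nerve_smod_simps)

lemma Ftilde_sop: "sop (Ftilde R n) q p \<theta> = free_map R (nerve_op q \<theta>)"
 by (simp add: Ftilde_def nerve_smod_simps)

lemma Ftilde_module: "module R (F_lev n p)"
 unfolding Ftilde_lev by (rule free_mod)

lemma Ftilde_generates: "generates R (F_lev n p) (bv ` usimps n p)"
 unfolding Ftilde_lev by (rule free_generates)

lemma Ftilde_sop_hom: "\<theta> \<in> monotone_maps q p ==> sop (Ftilde R n) q p \<theta> \<in> mhom (F_lev n p) (F_lev n q)"
 unfolding Ftilde_sop Ftilde_lev by (rule free_map_hom) (rule nerve_op_closed)

lemma precomp_hom: "f \<in> ds_mors ==> precomp R p f \<in> mhom (F_lev (dtgt f) p) (F_lev (dsrc f) p)"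
 unfolding Ftilde_lev precomp_eq by (rule free_map_hom) (rule precomp_simplex_closed)

lemma summand_module: "module R (coend_summand R A p n)"
 unfolding coend_summand_def by (rule tensor_module[OF Ftilde_module bar_module])

lemma pre_module: "module R (sums p)"
 by (rule dsum_module[OF summand_module])

lemma coend_pre_bilin: "bilin R (F_lev n p) (bar R A n) (sums p) (coend_pre R A p n)"
proof -
 note b = pure_bilin[OF Ftilde_module[of n p] bar_module[of n], unfolded bilin_def, folded coend_summand_def]
 note inj = dsum_inj_hom[of "coend_summand R A p" n, OF summand_module]
 show ?thesis unfolding bilin_def coend_pre_def[abs_def]
  by (intro conjI ballI hom_compose[OF _ inj] b[THEN conjunct1, rule_format] b[THEN conjunct2, rule_format])
qed

lemma coend_pre_closed: "[|x \<in> carrier (F_lev n p); V \<in> carrier (bar R A n)|] ==>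
  coend_pre R A p n x V \<in> carrier (sums p)"
 using coend_pre_bilin unfolding bilin_def by (blast intro: hom_closed)

lemma coend_gens_subset: "coend_gens R A S p <= carrier (sums p)"
proof -
 interpret D: module R "sums p" by (rule pre_module)
 show ?thesis unfolding coend_gens_def using S_mors hom_closed[OF precomp_hom] hom_closed[OF bar_map_hom]
  by (auto intro!: D.M.minus_closed coend_pre_closed)
qed

lemma coend_rel_submodule: "submodule (rel p) R (sums p)"
 unfolding coend_rel_span by (rule span_submodule[OF pre_module coend_gens_subset])

lemma coend_lev: "coend_lev p = quot_module (sums p) (rel p)"
 by (simp add: coend_def)

lemma coend_module: "module R (coend_lev p)"
 unfolding coend_lev by (rule quot_module_module[OF pre_module coend_rel_submodule])

lemma coend_proj_hom: "(%z. rel p +>\<^bsub>sums p\<^esub> z) \<in>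
  mhom (sums p) (coend_lev p)"
 unfolding coend_lev by (rule quot_proj_hom[OF pre_module coend_rel_submodule])

lemma coend_class_bilin: "bilin R (F_lev n p) (bar R A n) (coend_lev p) (coend_class R A S p n)"
 using coend_pre_bilin[of n p] unfolding bilin_def coend_class_def[abs_def]
 by (intro conjI ballI hom_compose[OF _ coend_proj_hom]) simp_all

lemma coend_class_rel:
 assumes f: "f \<in> S" and x: "x \<in> carrier (F_lev (dtgt f) p)" and V: "V \<in> carrier (bar R A (dsrc f))"
 shows "coend_class R A S p (dsrc f) (precomp R p f x) V = coend_class R A S p (dtgt f) x (bar_map R A f V)"
proof -
 have f': "f \<in> ds_mors" using f S_mors by auto
 let ?a = "coend_pre R A p (dsrc f) (precomp R p f x) V" and ?b = "coend_pre R A p (dtgt f) x (bar_map R A f V)"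
 have c: "?a \<in> carrier (sums p)" "?b \<in> carrier (sums p)"
  using hom_closed[OF precomp_hom[OF f'] x] hom_closed[OF bar_map_hom[OF f'] V] x V
  by (auto intro!: coend_pre_closed)
 have "?a \<ominus>\<^bsub>sums p\<^esub> ?b \<in> coend_gens R A S p"
  unfolding coend_gens_def by (rule CollectI, intro exI conjI, rule refl) (use f x V in auto)
 then have "?a \<ominus>\<^bsub>sums p\<^esub> ?b \<in> rel p"
  unfolding coend_rel_span by (rule subsetD[OF span_superset])
 then show ?thesis unfolding coend_class_def by (simp only: coset_eq_iff[OF pre_module coend_rel_submodule c])
qed

lemma class_pures_bimulti:
 "bimulti R (F_lev n p) (replicate n A) (coend_lev p) (cpures p n)"
proof -
 note b = coend_class_bilin[of n p, unfolded bilin_def, THEN conjunct1, rule_format]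
  coend_class_bilin[of n p, unfolded bilin_def, THEN conjunct2, rule_format]
 note m = pures_multilin[OF replicate_module, of n, folded bar_def]
 show ?thesis unfolding bimulti_def class_pures_def[abs_def]
  by (intro conjI ballI multilin_compose[OF m] b multilin_closed[OF m])
qed

text \<open>The coend relation for a basis simplex and a pure tensor; every later appeal to the
  relations has this form.\<close>

lemma class_pures_rel:
 assumes f: "f \<in> S" and s: "s \<in> usimps (dtgt f) p" and vs: "vs \<in> tuples (replicate (dsrc f) A)"
 shows "cpures p (dsrc f) (bv (precomp_simplex p f s)) vs =
  cpures p (dtgt f) (bv s) (bar_list A f vs)"
proof -
 have f': "f \<in> ds_mors" using f S_mors by auto
 have V: "pures R (replicate (dsrc f) A) vs \<in> carrier (bar R A (dsrc f))"
  unfolding bar_def by (rule multilin_closed[OF pures_multilin[OF replicate_module] vs])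
 have x: "bv s \<in> carrier (F_lev (dtgt f) p)" unfolding Ftilde_lev by (rule basis_vec_closed[OF s])
 show ?thesis
  using coend_class_rel[OF f x V] unfolding class_pures_def bar_map_pures[OF f' vs] precomp_eq free_map_basis .
qed

text \<open>Indices of generators: arity, simplex and list of algebra elements. The lists run over
  all elements of \<open>A\<close>, not over a basis, so the generators satisfy relations and
  functions of cells extend linearly only under conditions.\<close>

definition cells :: "nat => (nat \<times> under_simplex \<times> 'v list) set"
 where "cells p = {(n, s, vs). s \<in> usimps n p \<and> vs \<in> tuples (replicate n A)}"

definition cell :: "nat => nat \<times> under_simplex \<times> 'v list => (nat => ('a, 'v) summand) set"
 where "cell p = (%(n, s, vs). cpures p n (bv s) vs)"

lemma coend_generates: "generates R (coend_lev p) (cell p ` cells p)"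
proof -
 have c: "generates R M (carrier M)" for M :: "('a, 'x) module" by (simp add: generates_def)
 let ?G = "%n. {pure R (F_lev n p) (tensors R (replicate n A)) d (pures R (replicate n A) xs) | d xs.
   d \<in> bv ` usimps n p \<and> length xs = length (replicate n A) \<and>
   (\<forall>i<length (replicate n A). xs ! i \<in> carrier (replicate n A ! i))}"
 have G: "generates R (coend_summand R A p n) (?G n)" for n unfolding coend_summand_def bar_def
  by (rule tensor_tensors_generates[OF Ftilde_module replicate_module Ftilde_generates c])
 have "(%z. rel p +>\<^bsub>sums p\<^esub> z) `
   (\<Union>n. dsum_inj (coend_summand R A p) n ` ?G n) = cell p ` cells p"
 proof (intro equalityI subsetI)
  fix z assume "z \<in> (%z. rel p +>\<^bsub>sums p\<^esub> z) `
   (\<Union>n. dsum_inj (coend_summand R A p) n ` ?G n)"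
  then obtain n g where z: "z = rel p +>\<^bsub>sums p\<^esub> dsum_inj (coend_summand R A p) n g"
   and g: "g \<in> ?G n" by (elim imageE UN_E) simp
  from g obtain s vs where "s \<in> usimps n p" "vs \<in> tuples (replicate n A)"
   "g = pure R (F_lev n p) (tensors R (replicate n A)) (bv s) (pures R (replicate n A) vs)"
   unfolding tuples_iff by blast
  then have "(n, s, vs) \<in> cells p" "z = cell p (n, s, vs)"
   unfolding z by (simp_all add: cell_def cells_def class_pures_def coend_class_def coend_pre_def bar_def)
  then show "z \<in> cell p ` cells p" by simp
 next
  fix z assume "z \<in> cell p ` cells p"
  then obtain n s vs where c: "s \<in> usimps n p" "vs \<in> tuples (replicate n A)" and z: "z = cell p (n, s, vs)"
   by (auto simp: cells_def)
  have mem: "pure R (F_lev n p) (tensors R (replicate n A)) (bv s) (pures R (replicate n A) vs) \<in> ?G n"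
   using c unfolding tuples_iff by blast
  have ze: "z = rel p +>\<^bsub>sums p\<^esub> dsum_inj (coend_summand R A p) n
    (pure R (F_lev n p) (tensors R (replicate n A)) (bv s) (pures R (replicate n A) vs))"
   unfolding z by (simp add: cell_def class_pures_def coend_class_def coend_pre_def bar_def)
  show "z \<in> (%z. rel p +>\<^bsub>sums p\<^esub> z) `
   (\<Union>n. dsum_inj (coend_summand R A p) n ` ?G n)"
   unfolding ze by (rule imageI, rule UN_I[OF UNIV_I], rule imageI[OF mem])
 qed
 then show ?thesis
  using quot_generates[OF pre_module coend_rel_submodule dsum_generates[of "coend_summand R A p" ?G, OF summand_module G]]
  unfolding coend_lev by simp
qed

text \<open>The universal property of the coend on generators. The function passes successively
  through the summands, their direct sum and the quotient; multilinearity in the list handles the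
  first stage and \<open>rel\<close> the last one.\<close>

lemma coend_lift:
 assumes P: "module R P"
  and \<phi>: "!!n s. s \<in> usimps n p ==> multilin R (replicate n A) P (\<phi> n s)"
  and rel: "!!f s vs. [|f \<in> S; s \<in> usimps (dtgt f) p; vs \<in> tuples (replicate (dsrc f) A)|] ==>
   \<phi> (dsrc f) (precomp_simplex p f s) vs = \<phi> (dtgt f) s (bar_list A f vs)"
 shows "extends_to R (coend_lev p) P (cells p) (cell p) (%(n, s, vs). \<phi> n s vs)"
proof -
 have "\<exists>h. h \<in> mhom (coend_summand R A p n) P \<and>
  (\<forall>s\<in>usimps n p. \<forall>vs\<in>tuples (replicate n A).
   h (pure R (F_lev n p) (bar R A n) (bv s) (pures R (replicate n A) vs)) = \<phi> n s vs)" for n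
 proof -
  have "extends_to R (F_lev n p) P (usimps n p) (bv) (%s. \<phi> n s vs)"
   if "vs \<in> tuples (replicate n A)" for vs
   unfolding extends_to_def Ftilde_lev
   by (rule free_lift[OF P]) (rule multilin_closed[OF \<phi> that])
  from bimulti_extend[OF Ftilde_module P replicate_module Ftilde_generates \<phi> this]
  obtain \<Phi> where \<Phi>: "bimulti R (F_lev n p) (replicate n A) P \<Phi>"
   "!!s vs. [|s \<in> usimps n p; vs \<in> tuples (replicate n A)|] ==> \<Phi> (bv s) vs = \<phi> n s vs"
   by blast
  obtain h where h: "h \<in> mhom (coend_summand R A p n) P"
   "!!d vs. [|d \<in> carrier (F_lev n p); vs \<in> tuples (replicate n A)|] ==>
    h (pure R (F_lev n p) (bar R A n) d (pures R (replicate n A) vs)) = \<Phi> d vs"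
   using tensor_tensors_lift[OF Ftilde_module replicate_module P \<Phi>(1)] unfolding coend_summand_def bar_def by blast
  show ?thesis
  proof (intro exI[of _ h] conjI ballI h(1))
   fix s vs assume s: "s \<in> usimps n p" and vs: "vs \<in> tuples (replicate n A)"
   have "bv s \<in> carrier (F_lev n p)" unfolding Ftilde_lev by (rule basis_vec_closed[OF s])
   then show "h (pure R (F_lev n p) (bar R A n) (bv s) (pures R (replicate n A) vs)) = \<phi> n s vs"
    using h(2)[OF _ vs] \<Phi>(2)[OF s vs] by simp
  qed
 qed
 then obtain h where h: "!!n. h n \<in> mhom (coend_summand R A p n) P"
  "!!n s vs. [|s \<in> usimps n p; vs \<in> tuples (replicate n A)|] ==>
   h n (pure R (F_lev n p) (bar R A n) (bv s) (pures R (replicate n A) vs)) = \<phi> n s vs"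
  by metis
 obtain H where H: "H \<in> mhom (sums p) P"
  "!!n x. x \<in> carrier (coend_summand R A p n) ==> H (dsum_inj (coend_summand R A p) n x) = h n x"
  using dsum_lift[of "coend_summand R A p", OF summand_module P h(1)] by blast
 have pc: "pure R (F_lev n p) (bar R A n) x V \<in> carrier (coend_summand R A p n)"
  if "x \<in> carrier (F_lev n p)" "V \<in> carrier (bar R A n)" for n x V
  using pure_bilin[OF Ftilde_module[of n p] bar_module[of n]] that unfolding bilin_def coend_summand_def
  by (blast intro: hom_closed)
 have vc: "pures R (replicate n A) vs \<in> carrier (bar R A n)" if "vs \<in> tuples (replicate n A)" for n vs
  unfolding bar_def by (rule multilin_closed[OF pures_multilin[OF replicate_module] that])
 have Hs: "H (coend_pre R A p n (bv s) (pures R (replicate n A) vs)) = \<phi> n s vs"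
  if "s \<in> usimps n p" "vs \<in> tuples (replicate n A)" for n s vs
  unfolding coend_pre_def using H(2)[OF pc] vc h(2) that by (simp add: Ftilde_lev basis_vec_closed)
 have Hb: "(%V. H (coend_pre R A p n x V)) \<in> mhom (bar R A n) P" if "x \<in> carrier (F_lev n p)" for n x
  using hom_compose[OF _ H(1)] coend_pre_bilin[of n p] that unfolding bilin_def by blast
 have Hx: "(%x. H (coend_pre R A p n x V)) \<in> mhom (F_lev n p) P" if "V \<in> carrier (bar R A n)" for n V
  using hom_compose[OF _ H(1)] coend_pre_bilin[of n p] that unfolding bilin_def by blast
 have gens_bar: "generates R (bar R A n) (pures R (replicate n A) ` tuples (replicate n A))" for n
  unfolding bar_def by (rule tensors_generates_pures[OF replicate_module])
 \<comment> \<open>The relations involve arbitrary chains \<open>x\<close> and tensors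
   \<open>V\<close>; linearity in each brings them down to basis simplices and pure tensors, where
   \<open>rel\<close> applies.\<close>
 have kill: "H z = \<zero>\<^bsub>P\<^esub>" if z: "z \<in> coend_gens R A S p" for z
 proof -
  obtain f x V where f: "f \<in> S" and x: "x \<in> carrier (F_lev (dtgt f) p)" and V: "V \<in> carrier (bar R A (dsrc f))"
   and ze: "z = coend_pre R A p (dsrc f) (precomp R p f x) V
    \<ominus>\<^bsub>sums p\<^esub> coend_pre R A p (dtgt f) x (bar_map R A f V)"
   using z unfolding coend_gens_def by blast
  have f': "f \<in> ds_mors" using f S_mors by auto
  note pch = precomp_hom[OF f', of p] and bmh = bar_map_hom[OF f']
  have "H (coend_pre R A p (dsrc f) (precomp R p f x) V) = H (coend_pre R A p (dtgt f) x (bar_map R A f V))"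
  proof (rule mod_hom_eqI[OF gens_bar bar_module P Hb[OF hom_closed[OF pch x]] hom_compose[OF bmh Hb[OF x]] _ V])
   fix W assume "W \<in> pures R (replicate (dsrc f) A) ` tuples (replicate (dsrc f) A)"
   then obtain vs where vs: "vs \<in> tuples (replicate (dsrc f) A)" "W = pures R (replicate (dsrc f) A) vs" by auto
   show "H (coend_pre R A p (dsrc f) (precomp R p f x) W) = H (coend_pre R A p (dtgt f) x (bar_map R A f W))"
   proof (rule mod_hom_eqI[OF Ftilde_generates Ftilde_module P hom_compose[OF pch Hx] Hx _ x])
    show "W \<in> carrier (bar R A (dsrc f))" "bar_map R A f W \<in> carrier (bar R A (dtgt f))"
     using vc[OF vs(1)] vs(2) hom_closed[OF bmh] by auto
    fix y assume "y \<in> bv ` usimps (dtgt f) p"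
    then obtain s where s: "s \<in> usimps (dtgt f) p" "y = bv s" by auto
    show "H (coend_pre R A p (dsrc f) (precomp R p f y) W) = H (coend_pre R A p (dtgt f) y (bar_map R A f W))"
     unfolding s(2) vs(2) precomp_eq free_map_basis bar_map_pures[OF f' vs(1)]
     using Hs[OF precomp_simplex_closed[OF f' s(1)] vs(1)] Hs[OF s(1) bar_list_closed[OF f' vs(1)]] rel[OF f s(1) vs(1)]
     by simp
   qed
  qed
  then show ?thesis unfolding ze
   using mod_hom_minus[OF pre_module P H(1) coend_pre_closed[OF hom_closed[OF pch x] V]
     coend_pre_closed[OF x hom_closed[OF bmh V]]]
    module_minus_eq_zero[OF P] hom_closed[OF H(1) coend_pre_closed[OF x hom_closed[OF bmh V]]] by simp
 qed
 have "H z = \<zero>\<^bsub>P\<^esub>" if "z \<in> rel p" for z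
  by (rule span_kernel[OF pre_module P H(1) coend_gens_subset kill that[unfolded coend_rel_span]])
 from quot_lift[OF pre_module coend_rel_submodule P H(1) this]
 obtain K where K: "K \<in> mhom (coend_lev p) P"
  "!!z. z \<in> carrier (sums p) ==> K (rel p +>\<^bsub>sums p\<^esub> z) = H z"
  unfolding coend_lev by blast
 have "K (cell p (n, s, vs)) = \<phi> n s vs" if "(n, s, vs) \<in> cells p" for n s vs
  using that Hs[of s n vs] K(2)[OF coend_pre_closed] vc
  by (simp add: cell_def cells_def class_pures_def coend_class_def Ftilde_lev basis_vec_closed)
 then show ?thesis unfolding extends_to_def by (intro bexI[OF _ K(1)]) auto
qed

section \<open>The simplicial structure of the coend\<close>

lemma coend_sop_props:
 assumes \<theta>: "\<theta> \<in> monotone_maps q p"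
 shows coend_sop_hom: "sop (coend R A S) q p \<theta> \<in> mhom (coend_lev p) (coend_lev q)"
  and coend_sop_class: "[|x \<in> carrier (F_lev n p); V \<in> carrier (bar R A n)|] ==>
   sop (coend R A S) q p \<theta> (coend_class R A S p n x V) = coend_class R A S q n (sop (Ftilde R n) q p \<theta> x) V"
proof -
 let ?M = "coend_summand R A p" and ?M' = "coend_summand R A q"
 let ?t = "%n. tensor_map R (F_lev n q) (bar R A n) (sop (Ftilde R n) q p \<theta>) id"
 let ?f = "%z n. ?t n (z n)"
 have t: "?t n \<in> mhom (?M n) (?M' n)" for n unfolding coend_summand_def
  by (rule tensor_map_hom[OF Ftilde_module bar_module Ftilde_module bar_module Ftilde_sop_hom[OF \<theta>] mod_hom_id(1)])
 have tz: "?t n \<zero>\<^bsub>?M n\<^esub> = \<zero>\<^bsub>?M' n\<^esub>" for n by (rule mod_hom_zero[OF summand_module summand_module t])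
 have f: "?f \<in> mhom (dsum ?M) (dsum ?M')"
 proof (rule mod_homI)
  show "?f z \<in> carrier (dsum ?M')" if z: "z \<in> carrier (dsum ?M)" for z
  proof -
   have "{n. ?t n (z n) ~= \<zero>\<^bsub>?M' n\<^esub>} <= {n. z n ~= \<zero>\<^bsub>?M n\<^esub>}" using tz by auto
   then show ?thesis using z hom_closed[OF t] by (auto simp: dsum_simps intro: finite_subset)
  qed
 qed (auto simp: dsum_simps mod_hom_add[OF t] mod_hom_smult[OF t])
 have fp: "?f (coend_pre R A p n x V) = coend_pre R A q n (sop (Ftilde R n) q p \<theta> x) V"
  if "x \<in> carrier (F_lev n p)" "V \<in> carrier (bar R A n)" for n x V
 proof (rule ext)
  note tm = tensor_map_pure[OF Ftilde_module bar_module Ftilde_module bar_module Ftilde_sop_hom[OF \<theta>] mod_hom_id(1) that]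
  show "?f (coend_pre R A p n x V) m = coend_pre R A q n (sop (Ftilde R n) q p \<theta> x) V m" for m
   by (cases "m = n") (simp_all add: coend_pre_def dsum_inj_def tm tz)
 qed
 \<comment> \<open>Simplicial operators commute with precomposition, so a defining relation in
   degree \<open>p\<close> goes to a defining relation in degree \<open>q\<close>.\<close>
 have k: "?f z \<in> rel q" if z: "z \<in> coend_gens R A S p" for z
 proof -
  obtain f x V where f0: "f \<in> S" and x: "x \<in> carrier (F_lev (dtgt f) p)" and V: "V \<in> carrier (bar R A (dsrc f))"
   and ze: "z = coend_pre R A p (dsrc f) (precomp R p f x) V
    \<ominus>\<^bsub>dsum ?M\<^esub> coend_pre R A p (dtgt f) x (bar_map R A f V)"
   using z unfolding coend_gens_def by blast
  have f': "f \<in> ds_mors" using f0 S_mors by auto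
  note px = hom_closed[OF precomp_hom[OF f'] x] and bV = hom_closed[OF bar_map_hom[OF f'] V]
  let ?x = "sop (Ftilde R (dtgt f)) q p \<theta> x"
  have x': "?x \<in> carrier (F_lev (dtgt f) q)" by (rule hom_closed[OF Ftilde_sop_hom[OF \<theta>] x])
  have "sop (Ftilde R (dsrc f)) q p \<theta> (precomp R p f x) = precomp R q f ?x"
   by (rule mod_hom_eqI[OF Ftilde_generates Ftilde_module Ftilde_module hom_compose[OF precomp_hom[OF f'] Ftilde_sop_hom[OF \<theta>]]
      hom_compose[OF Ftilde_sop_hom[OF \<theta>] precomp_hom[OF f']] _ x])
    (auto simp: Ftilde_sop precomp_eq free_map_basis precomp_simplex_op[OF \<theta>])
  then have "?f z = coend_pre R A q (dsrc f) (precomp R q f ?x) V \<ominus>\<^bsub>dsum ?M'\<^esub> coend_pre R A q (dtgt f) ?x (bar_map R A f V)"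
   unfolding ze mod_hom_minus[OF pre_module pre_module f coend_pre_closed[OF px V] coend_pre_closed[OF x bV]]
    fp[OF px V] fp[OF x bV] by simp
  also have "... \<in> coend_gens R A S q"
   unfolding coend_gens_def by (rule CollectI, intro exI conjI, rule refl) (use f0 x' V in auto)
  finally show ?thesis unfolding coend_rel_span by (rule subsetD[OF span_superset])
 qed
 have sop: "sop (coend R A S) q p \<theta> = quot_map (dsum ?M') (rel q) ?f" by (simp add: coend_def)
 note q = quot_map_span_hom[OF pre_module coend_gens_subset pre_module coend_rel_submodule f]
 show "sop (coend R A S) q p \<theta> \<in> mhom (coend_lev p) (coend_lev q)"
  unfolding sop coend_lev coend_rel_span[of R A S p] by (rule q(1)[OF k])
 show "sop (coend R A S) q p \<theta> (coend_class R A S p n x V) = coend_class R A S q n (sop (Ftilde R n) q p \<theta> x) V"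
  if "x \<in> carrier (F_lev n p)" "V \<in> carrier (bar R A n)"
  unfolding sop coend_class_def coend_rel_span[of R A S p] fp[OF that, symmetric]
  by (rule q(2)[OF k coend_pre_closed[OF that]])
qed

lemma pures_closed: "vs \<in> tuples (replicate n A) ==> pures R (replicate n A) vs \<in> carrier (bar R A n)"
 unfolding bar_def by (rule multilin_closed[OF pures_multilin[OF replicate_module]])

lemma coend_sop_cell:
 assumes \<theta>: "\<theta> \<in> monotone_maps q p" and c: "(n, s, vs) \<in> cells p"
 shows "sop (coend R A S) q p \<theta> (cell p (n, s, vs)) = cell q (n, nerve_op q \<theta> s, vs)"
 using coend_sop_class[OF \<theta>, of "bv s" n "pures R (replicate n A) vs"] c
 by (simp add: cells_def cell_def class_pures_def Ftilde_lev Ftilde_sop free_map_basis basis_vec_closed pures_closed)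

lemma cells_op: "[|\<theta> \<in> monotone_maps q p; (n, s, vs) \<in> cells p|] ==> (n, nerve_op q \<theta> s, vs) \<in> cells q"
 by (auto simp: cells_def nerve_op_closed)

lemma coend_simplicial: "simplicial_module R (coend R A S)"
proof (intro simplicial_module.intro simplicial_module_axioms.intro)
 show "cring R" by (rule cring_axioms)
 show "module R (coend_lev p)" for p by (rule coend_module)
 show "sop (coend R A S) q p \<theta> \<in> mhom (coend_lev p) (coend_lev q)"
  if "\<theta> \<in> monotone_maps q p" for \<theta> q p by (rule coend_sop_hom[OF that])
 have id: "restrict id {..p} \<in> monotone_maps p p" for p by (auto simp: monotone_maps_def monotone_on_def)
 show "sop (coend R A S) p p (restrict id {..p}) x = x" if x: "x \<in> carrier (coend_lev p)" for x p
 proof (rule mod_hom_eqI[OF coend_generates coend_module coend_module coend_sop_hom[OF id] mod_hom_id(2) _ x])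
  fix y assume "y \<in> cell p ` cells p"
  then obtain n s vs where c: "(n, s, vs) \<in> cells p" "y = cell p (n, s, vs)" by auto
  then have "nerve_op p (restrict id {..p}) s = s" by (intro nerve_op_id) (auto simp: cells_def)
  then show "sop (coend R A S) p p (restrict id {..p}) y = y" using coend_sop_cell[OF id c(1)] c(2) by simp
 qed
 fix \<theta> \<eta> q p r x assume \<theta>: "\<theta> \<in> monotone_maps q p" and \<eta>: "\<eta> \<in> monotone_maps r q"
  and x: "x \<in> carrier (coend_lev p)"
 have c: "compose {..r} \<theta> \<eta> \<in> monotone_maps r p"
  using monotone_mapsD[OF \<theta>] monotone_mapsD[OF \<eta>]
  by (auto simp: monotone_maps_def monotone_on_def compose_def)
 show "sop (coend R A S) r p (compose {..r} \<theta> \<eta>) x = sop (coend R A S) r q \<eta> (sop (coend R A S) q p \<theta> x)"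
 proof (rule mod_hom_eqI[OF coend_generates coend_module coend_module coend_sop_hom[OF c]
    hom_compose[OF coend_sop_hom[OF \<theta>] coend_sop_hom[OF \<eta>]] _ x])
  fix y assume "y \<in> cell p ` cells p"
  then obtain n s vs where cl: "(n, s, vs) \<in> cells p" "y = cell p (n, s, vs)" by auto
  show "sop (coend R A S) r p (compose {..r} \<theta> \<eta>) y = sop (coend R A S) r q \<eta> (sop (coend R A S) q p \<theta> y)"
   unfolding cl(2) coend_sop_cell[OF c cl(1)] coend_sop_cell[OF \<theta> cl(1)] coend_sop_cell[OF \<eta> cells_op[OF \<theta> cl(1)]]
    nerve_op_comp[OF \<theta> \<eta>] ..
 qed
qed

end

subsection \<open>The functors \<open>\<mu>\<close> on simplices\<close>

lemma mu_simplex_apply: "(i, j) \<in> arrows_upto p ==> mu_simplex p s ts (i, j) =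
  (mu_obj (fst (s (i, j))) (map (%t. fst (t (i, j))) ts),
  mu_snd (fst (s (i, j))) (snd (s (i, j))) (map (%t. snd (t (i, j))) ts))"
 by (simp add: nerve_map_prod_apply mu_arr_eq comp_def)

text \<open>Gathers the data of a list of simplices into one list of morphisms per arrow, the form
  in which the facts about \<open>mu_obj\<close> and \<open>mu_snd\<close> take their
  arguments.\<close>

lemma under_list:
 assumes ts: "usimplices p ts js" and ij: "i <= j" "j <= p"
 defines "f \<equiv> %i j. map (%t. fst (t (i, j))) ts" and "g \<equiv> %i j. map (%t. snd (t (i, j))) ts"
 shows "set (f i j) <= ds_mors" "map dsrc (f i j) = js" "f i j = f i i" "set (g i j) <= ds_mors"
  "map dsrc (g i j) = map dtgt (f i i)" "map dtgt (g i j) = map dtgt (f j j)"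
  "map2 (\<bullet>) (g i j) (f i i) = f j j" "g i i = map ds_id (map dtgt (f i i))"
  "[|j <= l; l <= p|] ==> g i l = map2 (\<bullet>) (g j l) (g i j)"
proof -
 have l: "length ts = length js" by (rule list_all2_lengthD[OF ts])
 have tn: "ts ! n \<in> usimps (js ! n) p" if "n < length ts" for n by (rule list_all2_nthD[OF ts that])
 have ex: "\<exists>n<length ts. t = ts ! n" if "t \<in> set ts" for t using that by (auto simp: in_set_conv_nth)
 have i: "i <= p" using ij by simp
 show fe: "f i j = f i i" unfolding f_def using nerve_underD(4)[OF tn ij] ex by (intro map_cong refl) auto
 show "set (f i j) <= ds_mors" unfolding fe unfolding f_def using nerve_underD(1)[OF tn i] ex by auto
 show "map dsrc (f i j) = js"
  unfolding fe by (rule nth_equalityI) (use nerve_underD(2)[OF tn i] l in "simp_all add: f_def")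
 show "set (g i j) <= ds_mors" unfolding g_def using nerve_underD(5)[OF tn ij] ex by auto
 show "map dsrc (g i j) = map dtgt (f i i)"
  by (rule nth_equalityI) (use nerve_underD(6)[OF tn ij] in "simp_all add: f_def g_def")
 show "map dtgt (g i j) = map dtgt (f j j)"
  by (rule nth_equalityI) (use nerve_underD(7)[OF tn ij] in "simp_all add: f_def g_def")
 show "map2 (\<bullet>) (g i j) (f i i) = f j j"
  by (rule nth_equalityI) (use nerve_underD(8)[OF tn ij] in "simp_all add: f_def g_def")
 show "g i i = map ds_id (map dtgt (f i i))"
  by (rule nth_equalityI) (use nerve_underD(3)[OF tn i] in "simp_all add: f_def g_def")
 show "g i l = map2 (\<bullet>) (g j l) (g i j)" if "j <= l" "l <= p"
  by (rule nth_equalityI) (use nerve_underD(9)[OF tn ij(1) that] in "simp_all add: g_def")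
qed

text \<open>Functoriality of \<open>\<mu>\<close> in terms of simplices: identities, composites and
  compatibility with the vertices come from \<open>mu_snd_ids\<close>, \<open>mu_snd_comp\<close>
  and \<open>mu_snd_mu_obj\<close>.\<close>

lemma mu_simplex_closed:
 assumes s: "s \<in> esimps n p" and ts: "usimplices p ts js" and n: "length js = n"
 shows "mu_simplex p s ts \<in> usimps (sum_list js) p"
proof -
 let ?f = "%i. map (%t. fst (t (i, i))) ts" and ?g = "%i j. map (%t. snd (t (i, j))) ts" and ?c = "%i. fst (s (i, i))"
 have l: "length ts = n" using list_all2_lengthD[OF ts] n by simp
 have a: "mu_simplex p s ts (i, j) = (mu_obj (?c i) (?f i), mu_snd (?c i) (?c j) (?g i j))"
  if ij: "i <= j" "j <= p" for i j
 proof -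
  have e: "fst (s (i, j)) = ?c i" "snd (s (i, j)) = ?c j"
   using arg_cong[OF nerve_ESigma_arrow[OF s ij], of fst] arg_cong[OF nerve_ESigma_arrow[OF s ij], of snd] by simp_all
  have "(i, j) \<in> arrows_upto p" using ij by (simp add: arrows_upto_iff)
  from mu_simplex_apply[OF this, of s ts] show ?thesis unfolding e under_list(3)[OF ts ij] .
 qed
 have c: "?c i permutes {..<n}" if "i <= p" for i
  by (rule nerve_ESigmaD(1)[OF s]) (use that in "simp add: arrows_upto_iff")
 show ?thesis
 proof (rule nerve_underI[OF nerve_map_ext(2)])
  fix i assume i: "i <= p"
  note u = under_list[OF ts order_refl i]
  show "fst (mu_simplex p s ts (i, i)) \<in> ds_mors"
   unfolding a[OF order_refl i] fst_conv by (rule mu_obj_mors[OF u(1)]) (use c[OF i] l in simp)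
  show "dsrc (fst (mu_simplex p s ts (i, i))) = sum_list js"
   unfolding a[OF order_refl i] fst_conv mu_obj_simps u(2) ..
  show "snd (mu_simplex p s ts (i, i)) = ds_id (dtgt (fst (mu_simplex p s ts (i, i))))"
   unfolding a[OF order_refl i] fst_conv snd_conv mu_obj_simps u(8)
   by (rule mu_snd_ids) (use c[OF i] l in simp)
 next
  fix i j assume ij: "i <= j" "j <= p"
  then have i: "i <= p" by simp
  note u = under_list[OF ts ij] and ui = under_list(1)[OF ts order_refl i] and
   aa = a[OF ij] a[OF order_refl i] a[OF order_refl ij(2)]
  have lg: "length (?g i j) = n" using l by simp
  show "fst (mu_simplex p s ts (i, j)) = fst (mu_simplex p s ts (i, i))" unfolding aa fst_conv ..
  show "snd (mu_simplex p s ts (i, j)) \<in> ds_mors"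
   unfolding aa snd_conv by (rule mu_snd_mors[OF u(4)]) (use c[OF i] c[OF ij(2)] l in simp_all)
  show "dsrc (snd (mu_simplex p s ts (i, j))) = dtgt (fst (mu_simplex p s ts (i, i)))"
   "dtgt (snd (mu_simplex p s ts (i, j))) = dtgt (fst (mu_simplex p s ts (j, j)))"
   unfolding aa fst_conv snd_conv mu_obj_simps mu_snd_simps u(5,6) by (rule refl)+
  show "snd (mu_simplex p s ts (i, j)) \<bullet> fst (mu_simplex p s ts (i, i)) =
    fst (mu_simplex p s ts (j, j))"
   unfolding aa fst_conv snd_conv u(7)[symmetric]
   by (rule mu_snd_mu_obj[OF u(4) ui u(5)]) (use c[OF i] c[OF ij(2)] l in simp_all)
 next
  fix i j k assume ijk: "i <= j" "j <= k" "k <= p"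
  then have o: "i <= k" "j <= p" "i <= p" by auto
  note u = under_list[OF ts ijk(1) o(2)] and u' = under_list[OF ts ijk(2,3)]
  show "snd (mu_simplex p s ts (i, k)) =
    snd (mu_simplex p s ts (j, k)) \<bullet> snd (mu_simplex p s ts (i, j))"
   unfolding a[OF o(1) ijk(3)] a[OF ijk(2,3)] a[OF ijk(1) o(2)] snd_conv u(9)[OF ijk(2,3)]
   by (rule mu_snd_comp[OF u'(4) u(4), symmetric])
    (use u(6) u'(5) c[OF o(3)] c[OF o(2)] c[OF ijk(3)] l in simp_all)
 qed
qed

text \<open>Lets an untouched slot count as precomposed with an identity, so that a change in one
  slot can be treated as a change in all of them.\<close>

lemma precomp_simplex_id:
 assumes t: "t \<in> usimps j p"
 shows "precomp_simplex p (ds_id j) t = t"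
proof (rule simplex_eqI[OF precomp_simplex_ext nerve_ext[OF t]])
 fix i k assume ik: "(i, k) \<in> arrows_upto p"
 then have o: "i <= k" "k <= p" "i <= p" by (auto simp: arrows_upto_iff)
 have "fst (t (i, k)) \<bullet> ds_id j = fst (t (i, k))" unfolding nerve_underD(4)[OF t o(1,2)]
  by (rule comp_id_right[OF nerve_underD(1)[OF t o(3)] nerve_underD(2)[OF t o(3)]])
 then show "precomp_simplex p (ds_id j) t (i, k) = t (i, k)" by (simp add: precomp_simplex_apply[OF ik])
qed

text \<open>Precomposition leaves connecting morphisms unchanged, so only the vertices have to be
  compared, by \<open>mu_obj_comp\<close>.\<close>

lemma mu_simplex_precomp:
 assumes s: "s \<in> esimps (length ts) p" and ts: "usimplices p ts (map dtgt fs)"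
  and fs: "set fs <= ds_mors"
 shows "mu_simplex p s (map2 (precomp_simplex p) fs ts) =
  precomp_simplex p (ds_juxts fs) (mu_simplex p s ts)"
proof (rule simplex_eqI[OF nerve_map_ext(2) precomp_simplex_ext])
 fix i j assume a: "(i, j) \<in> arrows_upto p"
 then have ij: "i <= j" "j <= p" by (auto simp: arrows_upto_iff)
 note u = under_list[OF ts ij]
 have l: "length ts = length fs" using list_all2_lengthD[OF ts] by simp
 have e: "map (%t. fst (t (i, j))) (map2 (precomp_simplex p) fs ts) = map2 (\<bullet>) (map (%t. fst (t (i, j))) ts) fs"
  "map (%t. snd (t (i, j))) (map2 (precomp_simplex p) fs ts) = map (%t. snd (t (i, j))) ts"
  by (rule nth_equalityI; use l in "simp add: precomp_simplex_apply[OF a]")+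
 show "mu_simplex p s (map2 (precomp_simplex p) fs ts) (i, j) =
  precomp_simplex p (ds_juxts fs) (mu_simplex p s ts) (i, j)"
  unfolding mu_simplex_apply[OF a] precomp_simplex_apply[OF a] e fst_conv snd_conv
  by (subst mu_obj_comp[OF u(1) fs u(2)]) (use nerve_ESigmaD(1)[OF s a] in simp_all)
qed

context cring
begin

text \<open>The correction at the source found for objects becomes one precomposition of the whole
  simplex, because arrows need none.\<close>

lemma mu_simplex_equivariant:
 assumes s: "s \<in> esimps (length js) p" and ts: "usimplices p ts js"
  and \<rho>: "\<rho> permutes {..<length js}"
 shows "mu_simplex p (nact p \<rho> s) ts =
  precomp_simplex p (ds_move (sum_list js) (block_perm \<rho> js)) (mu_simplex p s (move \<rho> ts))"
proof (rule simplex_eqI[OF nerve_map_ext(2) precomp_simplex_ext])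
 fix i j assume a: "(i, j) \<in> arrows_upto p"
 then have ij: "i <= j" "j <= p" by (auto simp: arrows_upto_iff)
 note u = under_list[OF ts ij]
 have l: "length ts = length js" by (rule list_all2_lengthD[OF ts])
 note \<rho>' = \<rho>[folded l]
 note \<sigma> = nerve_ESigmaD[OF s a, folded l]
 have m: "map h (move \<rho> ts) = move \<rho> (map h ts)" for h :: "under_simplex => ds_mor" by (rule move_map[OF \<rho>', symmetric])
 show "mu_simplex p (nact p \<rho> s) ts (i, j) =
  precomp_simplex p (ds_move (sum_list js) (block_perm \<rho> js)) (mu_simplex p s (move \<rho> ts)) (i, j)"
  unfolding mu_simplex_apply[OF a] precomp_simplex_apply[OF a] nact_apply[OF a] fst_conv snd_conv m
  using mu_obj_equivariant[OF u(1), of "fst (s (i, j))" \<rho>] mu_snd_equivariant[OF u(4), of "fst (s (i, j))" "snd (s (i, j))" \<rho>]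
   \<sigma> \<rho>' u(2) by simp
qed

lemma mu_simplex_assoc:
 assumes s: "s \<in> esimps (length tss) p"
  and ss: "list_all2 (%s ts. s \<in> esimps (length ts) p) ss tss"
  and tss: "list_all2 (usimplices p) tss jss"
 shows "mu_simplex p (comp_simplex p (map length tss) s ss) (concat tss) =
  mu_simplex p s (map (%i. mu_simplex p (ss ! i) (tss ! i)) [0..<length tss])"
proof (rule simplex_eqI[OF nerve_map_ext(2) nerve_map_ext(2)])
 fix i j assume a: "(i, j) \<in> arrows_upto p"
 then have ij: "i <= j" "j <= p" by (auto simp: arrows_upto_iff)
 have l: "length ss = length tss" by (rule list_all2_lengthD[OF ss])
 let ?f = "%ts. map (%t. fst (t (i, j))) ts" and ?g = "%ts. map (%t. snd (t (i, j))) ts"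
 note \<sigma> = nerve_ESigmaD[OF s a]
 have \<sigma>s: "list_all2 (%\<tau> ts. \<tau> permutes {..<length ts}) (map (%s. fst (s (i, j))) ss) tss"
  "list_all2 (%\<tau> ts. \<tau> permutes {..<length ts}) (map (%s. snd (s (i, j))) ss) tss"
  using ss nerve_ESigmaD[OF _ a] by (simp_all add: list_all2_conv_all_nth)
 have us: "set (?f ts) <= ds_mors" "set (?g ts) <= ds_mors" if ts: "ts \<in> set tss" for ts
 proof -
  obtain n where "n < length tss" "ts = tss ! n" using ts by (auto simp: in_set_conv_nth)
  then have "usimplices p ts (jss ! n)" using list_all2_nthD[OF tss] by simp
  from under_list(1,4)[OF this ij] show "set (?f ts) <= ds_mors" "set (?g ts) <= ds_mors" by simp_all
 qed
 have uf: "set fs <= ds_mors" if h: "fs \<in> set (map ?f tss)" for fs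
 proof -
  obtain ts where "ts \<in> set tss" "fs = ?f ts" using h by auto
  then show ?thesis using us(1) by simp
 qed
 have ug: "set fs <= ds_mors" if h: "fs \<in> set (map ?g tss)" for fs
 proof -
  obtain ts where "ts \<in> set tss" "fs = ?g ts" using h by auto
  then show ?thesis using us(2) by simp
 qed
 have 1: "mu_obj (perm_comp (map length (map ?f tss)) (fst (s (i, j))) (map (%s. fst (s (i, j))) ss)) (concat (map ?f tss)) =
   mu_obj (fst (s (i, j))) (map2 mu_obj (map (%s. fst (s (i, j))) ss) (map ?f tss))"
  by (rule mu_obj_assoc) (use uf \<sigma>(1) \<sigma>s(1) in "simp_all add: list_all2_map2 del: set_map")
 have 2: "mu_snd (perm_comp (map length (map ?g tss)) (fst (s (i, j))) (map (%s. fst (s (i, j))) ss))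
   (perm_comp (map length (map ?g tss)) (snd (s (i, j))) (map (%s. snd (s (i, j))) ss)) (concat (map ?g tss)) =
  mu_snd (fst (s (i, j))) (snd (s (i, j))) (map (%k. mu_snd (map (%s. fst (s (i, j))) ss ! k)
   (map (%s. snd (s (i, j))) ss ! k) (map ?g tss ! k)) [0..<length (map ?g tss)])"
  by (rule mu_snd_assoc) (use ug \<sigma> \<sigma>s in "simp_all add: list_all2_map2 del: set_map")
 have 3: "map2 mu_obj (map (%s. fst (s (i, j))) ss) (map ?f tss) =
   map (%t. fst (t (i, j))) (map (%k. mu_simplex p (ss ! k) (tss ! k)) [0..<length tss])"
  by (rule nth_equalityI) (use l in "simp_all add: mu_simplex_apply[OF a]")
 have 4: "map (%k. mu_snd (map (%s. fst (s (i, j))) ss ! k)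
   (map (%s. snd (s (i, j))) ss ! k) (map ?g tss ! k)) [0..<length (map ?g tss)] =
   map (%t. snd (t (i, j))) (map (%k. mu_simplex p (ss ! k) (tss ! k)) [0..<length tss])"
  by (rule nth_equalityI) (use l in "simp_all add: mu_simplex_apply[OF a]")
 have len: "map length (map ?f tss) = map length tss" "map length (map ?g tss) = map length tss" by simp_all
 show "mu_simplex p (comp_simplex p (map length tss) s ss) (concat tss) (i, j) =
  mu_simplex p s (map (%i. mu_simplex p (ss ! i) (tss ! i)) [0..<length tss]) (i, j)"
  unfolding mu_simplex_apply[OF a, of s] mu_simplex_apply[OF a, of "comp_simplex p (map length tss) s ss"]
   comp_simplex_fst_snd[OF a] fst_conv snd_conv map_concat 1[unfolded len 3] 2[unfolded len 4] ..
qed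

lemma mu_simplex_unit:
 assumes t: "t \<in> usimps j p"
 shows "mu_simplex p (id_simplex p) [t] = t"
proof (rule simplex_eqI[OF nerve_map_ext(2) nerve_ext[OF t]])
 fix i k assume a: "(i, k) \<in> arrows_upto p"
 then have o: "i <= k" "k <= p" by (auto simp: arrows_upto_iff)
 have "set [fst (t (i, k))] <= ds_mors" "set [snd (t (i, k))] <= ds_mors"
  using under_list(1,4)[of p "[t]" "[j]", OF _ o] t by simp_all
 then show "mu_simplex p (id_simplex p) [t] (i, k) = t (i, k)"
  by (simp add: mu_simplex_apply[OF a] a mu_obj_unit mu_snd_unit)
qed

end

section \<open>The domain of the structure maps\<close>

lemma move_replicate:
 assumes "\<sigma> permutes {..<n}"
 shows "move \<sigma> (replicate n x) = replicate n x"
 by (rule replicate_eqI) (use set_move[of \<sigma> "replicate n x"] assms in "auto split: if_splits")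

context cring
begin

lemma slotlin_cong:
 assumes "!!xs. length xs = length Ms ==> g xs = f xs" and f: "slotlin R Ms Ns f"
 shows "slotlin R Ms Ns g"
 using f assms(1) unfolding slotlin_def by (simp add: tuples_iff)

lemma tensors_map_slotlin:
 assumes Ms: "\<forall>M\<in>set Ms. module R M" and Ns: "\<forall>N\<in>set Ns. module R N" and f: "slotlin R Ms Ns f"
 shows "tensors_map R Ns f \<in> mhom (tensors R Ms) (tensors R Ns)"
  and "xs \<in> tuples Ms ==> tensors_map R Ns f (pures R Ms xs) = pures R Ns (f xs)"
proof -
 have t: "f xs \<in> tuples Ns" if "xs \<in> tuples Ms" for xs using f that by (simp add: slotlin_def)
 note b = multilin_slotlin[OF Ms pures_multilin[OF Ns] f]
 show "tensors_map R Ns f \<in> mhom (tensors R Ms) (tensors R Ns)" by (rule tensors_map_hom[OF Ms Ns t b])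
 show "xs \<in> tuples Ms ==> tensors_map R Ns f (pures R Ms xs) = pures R Ns (f xs)"
  by (rule tensors_map_pures[OF Ms Ns t b])
qed

end

context operad
begin

lemma arity_module: "module R (lev (arity P n) p)"
 by (rule simplicial_module.lev_module[OF arity_smod])

lemma oact_hom: "\<sigma> permutes {..<n} ==> oact P n p \<sigma> \<in> mhom (lev (arity P n) p) (lev (arity P n) p)"
 using act_map unfolding simplicial_map_def by blast

definition sym_gens :: "nat => ('k, 'y) smod => nat => ('x \<times> ('y list => 'k) set => 'k) set set"
 where "sym_gens n X p =
  (let D = lev (arity P n) p; Ms = replicate n (lev X p);
    T = tensor R D (tensors R Ms); t = pure R D (tensors R Ms) in
  {t (oact P n p \<sigma> d) w \<ominus>\<^bsub>T\<^esub> t d (tensors_map R Ms (move \<sigma>) w) | \<sigma> d w.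
   \<sigma> permutes {..<n} \<and> d \<in> carrier D \<and> w \<in> carrier (tensors R Ms)})"

lemma sym_rel_span: "sym_rel R P n X p =
  span R (tensor R (lev (arity P n) p) (tensors R (replicate n (lev X p)))) (sym_gens n X p)"
 by (simp add: sym_rel_def sym_gens_def Let_def)

lemma alg_dom_lev: "lev (alg_dom R P n X) p =
  quot_module (tensor R (lev (arity P n) p) (tensors R (replicate n (lev X p)))) (sym_rel R P n X p)"
 by (simp add: alg_dom_def Let_def stensor_def stensors_def)

end

text \<open>An operad with a simplicial module on which it does not yet act: the coinvariants of the
  tensor powers have to be understood before a structure map exists.\<close>

locale operad_smod = operad R P + X: simplicial_module R X
 for R (structure) and P :: "('k, 'd) operad" and X :: "('k, 'x) smod"
begin

abbreviation "arity_lev n p \<equiv> lev (arity P n) p"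
abbreviation "power_lev n p \<equiv> replicate n (lev X p)"
abbreviation "dom_tensor n p \<equiv> tensor R (arity_lev n p) (tensors R (power_lev n p))"
abbreviation "dom_pure n p \<equiv> pure R (arity_lev n p) (tensors R (power_lev n p))"

lemma power_module: "\<forall>M\<in>set (power_lev n p). module R M"
 using X.lev_module by simp

lemma power_tensors_module: "module R (tensors R (power_lev n p))"
 by (rule tensors_module[OF power_module])

lemma dom_tensor_module: "module R (dom_tensor n p)"
 by (rule tensor_module[OF arity_module power_tensors_module])

lemma dom_pure_closed: "[|d \<in> carrier (arity_lev n p); w \<in> carrier (tensors R (power_lev n p))|] ==>
  dom_pure n p d w \<in> carrier (dom_tensor n p)"
 using pure_bilin[OF arity_module power_tensors_module, of n p n p] unfolding bilin_def
 by (blast intro: hom_closed)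

lemma move_slotlin: "\<sigma> permutes {..<n} ==> slotlin R (power_lev n p) (power_lev n p) (move \<sigma>)"
 using slotlin_move[of \<sigma> "power_lev n p"] by (simp add: move_replicate)

lemma move_tensors_hom: "\<sigma> permutes {..<n} ==> tensors_map R (power_lev n p) (move \<sigma>) \<in>
  mhom (tensors R (power_lev n p)) (tensors R (power_lev n p))"
 by (rule tensors_map_slotlin(1)[OF power_module power_module move_slotlin])

lemma move_tensors_pures: "[|\<sigma> permutes {..<n}; xs \<in> tuples (power_lev n p)|] ==>
  tensors_map R (power_lev n p) (move \<sigma>) (pures R (power_lev n p) xs) = pures R (power_lev n p) (move \<sigma> xs)"
 by (rule tensors_map_slotlin(2)[OF power_module power_module move_slotlin])

lemma sym_gensE:
 assumes "z \<in> sym_gens n X p"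
 obtains \<sigma> d w where "\<sigma> permutes {..<n}" "d \<in> carrier (arity_lev n p)" "w \<in> carrier (tensors R (power_lev n p))"
  "z = dom_pure n p (oact P n p \<sigma> d) w \<ominus>\<^bsub>dom_tensor n p\<^esub> dom_pure n p d (tensors_map R (power_lev n p) (move \<sigma>) w)"
 using assms unfolding sym_gens_def Let_def by blast

lemma sym_gensI:
 "[|\<sigma> permutes {..<n}; d \<in> carrier (arity_lev n p); w \<in> carrier (tensors R (power_lev n p))|] ==>
  dom_pure n p (oact P n p \<sigma> d) w \<ominus>\<^bsub>dom_tensor n p\<^esub> dom_pure n p d (tensors_map R (power_lev n p) (move \<sigma>) w) \<in>
  sym_gens n X p"
 unfolding sym_gens_def Let_def by blast

lemma sym_gens_subset: "sym_gens n X p <= carrier (dom_tensor n p)"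
proof
 interpret T: module R "dom_tensor n p" by (rule dom_tensor_module)
 fix z assume "z \<in> sym_gens n X p"
 then show "z \<in> carrier (dom_tensor n p)"
 proof (rule sym_gensE)
  fix \<sigma> d w assume *: "\<sigma> permutes {..<n}" "d \<in> carrier (arity_lev n p)" "w \<in> carrier (tensors R (power_lev n p))"
   and z: "z = dom_pure n p (oact P n p \<sigma> d) w \<ominus>\<^bsub>dom_tensor n p\<^esub>
    dom_pure n p d (tensors_map R (power_lev n p) (move \<sigma>) w)"
  show ?thesis unfolding z by (intro T.M.minus_closed dom_pure_closed hom_closed[OF oact_hom[OF *(1)]]
     hom_closed[OF move_tensors_hom[OF *(1)]] *(2,3))
 qed
qed

lemma sym_rel_submodule: "submodule (sym_rel R P n X p) R (dom_tensor n p)"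
 unfolding sym_rel_span by (rule span_submodule[OF dom_tensor_module sym_gens_subset])

lemma alg_dom_module: "module R (lev (alg_dom R P n X) p)"
 unfolding alg_dom_lev by (rule quot_module_module[OF dom_tensor_module sym_rel_submodule])

lemma alg_pure_eq: "alg_pure R P n X p d xs =
  sym_rel R P n X p +>\<^bsub>dom_tensor n p\<^esub> dom_pure n p d (pures R (power_lev n p) xs)"
 by (simp add: alg_pure_def Let_def)

lemma alg_pure_bimulti: "bimulti R (arity_lev n p) (power_lev n p) (lev (alg_dom R P n X) p) (alg_pure R P n X p)"
 unfolding alg_dom_lev alg_pure_eq[abs_def]
 by (rule bimulti_compose[OF bimulti_pure[OF arity_module power_module] quot_proj_hom[OF dom_tensor_module sym_rel_submodule]])

lemma alg_pure_generates:
 assumes G: "generates R (arity_lev n p) G" and H: "generates R (lev X p) H"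
 shows "generates R (lev (alg_dom R P n X) p) {alg_pure R P n X p d xs | d xs. d \<in> G \<and> length xs = n \<and> set xs <= H}"
proof -
 have H': "generates R (power_lev n p ! i) H" if "i < length (power_lev n p)" for i using H that by simp
 have c: "(length xs = n \<and> (\<forall>i<n. xs ! i \<in> H)) = (length xs = n \<and> set xs <= H)" for xs
  by (auto simp: subset_code(1) all_set_conv_all_nth)
 have im: "f ` {g d xs | d xs. Q d xs} = {f (g d xs) | d xs. Q d xs}" for f g Q by auto
 show ?thesis
  using quot_generates[OF dom_tensor_module sym_rel_submodule tensor_tensors_generates[OF arity_module power_module G H']]
  unfolding alg_dom_lev im length_replicate alg_pure_eq[symmetric] c .
qed

text \<open>The relations that define the coinvariants range over all tensors \<open>w\<close>, but
  pure tensors generate, so the symmetry of \<open>\<Phi>\<close> on lists is enough.\<close>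

lemma alg_lift:
 assumes Q: "module R Q" and \<Phi>: "bimulti R (arity_lev n p) (power_lev n p) Q \<Phi>"
  and sym: "!!\<sigma> d xs. [|\<sigma> permutes {..<n}; d \<in> carrier (arity_lev n p); xs \<in> tuples (power_lev n p)|] ==>
   \<Phi> (oact P n p \<sigma> d) xs = \<Phi> d (move \<sigma> xs)"
 shows "\<exists>h \<in> mhom (lev (alg_dom R P n X) p) Q. \<forall>d\<in>carrier (arity_lev n p). \<forall>xs\<in>tuples (power_lev n p).
  h (alg_pure R P n X p d xs) = \<Phi> d xs"
proof -
 obtain h where h: "h \<in> mhom (dom_tensor n p) Q"
  and hv: "\<forall>d\<in>carrier (arity_lev n p). \<forall>xs\<in>tuples (power_lev n p). h (dom_pure n p d (pures R (power_lev n p) xs)) = \<Phi> d xs"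
  using tensor_tensors_lift[OF arity_module power_module Q \<Phi>] by blast
 note b = pure_bilin[OF arity_module power_tensors_module, of n p n p, unfolded bilin_def, THEN conjunct1, rule_format]
 have mc: "move \<sigma> xs \<in> tuples (power_lev n p)" if "\<sigma> permutes {..<n}" "xs \<in> tuples (power_lev n p)" for \<sigma> xs
  using move_slotlin[OF that(1), of p] that(2) by (simp add: slotlin_def)
 have kill: "h z = \<zero>\<^bsub>Q\<^esub>" if z: "z \<in> sym_gens n X p" for z using z
 proof (rule sym_gensE)
  fix \<sigma> d w assume \<sigma>: "\<sigma> permutes {..<n}" and d: "d \<in> carrier (arity_lev n p)"
   and w: "w \<in> carrier (tensors R (power_lev n p))"
   and ze: "z = dom_pure n p (oact P n p \<sigma> d) w \<ominus>\<^bsub>dom_tensor n p\<^esub>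
    dom_pure n p d (tensors_map R (power_lev n p) (move \<sigma>) w)"
  note ad = hom_closed[OF oact_hom[OF \<sigma>] d] and mw = hom_closed[OF move_tensors_hom[OF \<sigma>] w]
  have "h (dom_pure n p (oact P n p \<sigma> d) w) = h (dom_pure n p d (tensors_map R (power_lev n p) (move \<sigma>) w))"
  proof (rule mod_hom_eqI[OF tensors_generates_pures[OF power_module] power_tensors_module Q
     hom_compose[OF b[OF ad] h] hom_compose[OF move_tensors_hom[OF \<sigma>] hom_compose[OF b[OF d] h]] _ w])
   fix y assume "y \<in> pures R (power_lev n p) ` tuples (power_lev n p)"
   then obtain xs where xs: "xs \<in> tuples (power_lev n p)" "y = pures R (power_lev n p) xs" by blast
   show "h (dom_pure n p (oact P n p \<sigma> d) y) = h (dom_pure n p d (tensors_map R (power_lev n p) (move \<sigma>) y))"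
    unfolding xs(2) move_tensors_pures[OF \<sigma> xs(1)]
    using hv ad d xs(1) mc[OF \<sigma> xs(1)] sym[OF \<sigma> d xs(1)] by simp
  qed
  then show "h z = \<zero>\<^bsub>Q\<^esub>"
   unfolding ze mod_hom_minus[OF dom_tensor_module Q h dom_pure_closed[OF ad w] dom_pure_closed[OF d mw]]
   using module_minus_eq_zero[OF Q hom_closed[OF h dom_pure_closed[OF ad w]] hom_closed[OF h dom_pure_closed[OF d mw]]]
   by simp
 qed
 have "h z = \<zero>\<^bsub>Q\<^esub>" if "z \<in> sym_rel R P n X p" for z
  by (rule span_kernel[OF dom_tensor_module Q h sym_gens_subset kill that[unfolded sym_rel_span]])
 from quot_lift[OF dom_tensor_module sym_rel_submodule Q h this]
 obtain k where k: "k \<in> mhom (lev (alg_dom R P n X) p) Q"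
  "\<forall>z\<in>carrier (dom_tensor n p). k (sym_rel R P n X p +>\<^bsub>dom_tensor n p\<^esub> z) = h z"
  unfolding alg_dom_lev by blast
 have "k (alg_pure R P n X p d xs) = \<Phi> d xs" if "d \<in> carrier (arity_lev n p)" "xs \<in> tuples (power_lev n p)" for d xs
  using k(2) hv that dom_pure_closed[OF that(1) multilin_closed[OF pures_multilin[OF power_module] that(2)]]
  by (simp add: alg_pure_eq)
 then show ?thesis using k(1) by blast
qed

end

section \<open>Functoriality of the coinvariants\<close>

context operad
begin

text \<open>A common form of two constructions: \<open>alg_dom_map\<close>, which fixes the operad
  and the degree, and the simplicial operators, which change both. The list map \<open>G\<close> is
  kept general because one definition uses \<open>map\<close> and the other
  \<open>map2\<close>.\<close>

lemma alg_map_props: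
 assumes X: "simplicial_module R X" and Y: "simplicial_module R Y"
  and f: "f \<in> mhom (lev (arity P n) p) (lev (arity P n) q)"
  and comm: "!!\<sigma> d. [|\<sigma> permutes {..<n}; d \<in> carrier (lev (arity P n) p)|] ==>
   f (oact P n p \<sigma> d) = oact P n q \<sigma> (f d)"
  and g: "g \<in> mhom (lev X p) (lev Y q)" and G: "!!xs. length xs = n ==> G xs = map g xs"
 defines "h \<equiv> quot_map (tensor R (lev (arity P n) q) (tensors R (replicate n (lev Y q)))) (sym_rel R P n Y q)
   (tensor_map R (lev (arity P n) q) (tensors R (replicate n (lev Y q))) f (tensors_map R (replicate n (lev Y q)) G))"
 shows "h \<in> mhom (lev (alg_dom R P n X) p) (lev (alg_dom R P n Y) q)"
  and "[|d \<in> carrier (lev (arity P n) p); xs \<in> tuples (replicate n (lev X p))|] ==>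
   h (alg_pure R P n X p d xs) = alg_pure R P n Y q (f d) (map g xs)"
proof -
 interpret X: operad_smod R P X by (intro operad_smod.intro operad_axioms X) 
 interpret Y: operad_smod R P Y by (intro operad_smod.intro operad_axioms Y) 
 let ?Ms = "replicate n (lev X p)" and ?Ns = "replicate n (lev Y q)"
 let ?w = "tensors_map R ?Ns G"
 let ?m = "tensor_map R (lev (arity P n) q) (tensors R ?Ns) f ?w"
 have sl: "slotlin R ?Ms ?Ns G"
  by (rule slotlin_cong[OF _ slotlin_map[of ?Ms g "%_. lev Y q", simplified]]) (use g G in auto)
 note wh = tensors_map_slotlin[OF X.power_module Y.power_module sl]
 note mh = tensor_map_props[OF arity_module X.power_tensors_module arity_module Y.power_tensors_module f wh(1)]
 have k: "?m z \<in> sym_rel R P n Y q" if z: "z \<in> sym_gens n X p" for z using z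
 proof (rule X.sym_gensE)
  fix \<sigma> d w assume \<sigma>: "\<sigma> permutes {..<n}" and d: "d \<in> carrier (lev (arity P n) p)" and w: "w \<in> carrier (tensors R ?Ms)"
   and ze: "z = X.dom_pure n p (oact P n p \<sigma> d) w \<ominus>\<^bsub>X.dom_tensor n p\<^esub>
    X.dom_pure n p d (tensors_map R ?Ms (move \<sigma>) w)"
  note ad = hom_closed[OF oact_hom[OF \<sigma>] d] and mw = hom_closed[OF X.move_tensors_hom[OF \<sigma>] w]
  \<comment> \<open>Reordering the tensor factors commutes with applying \<open>g\<close> in each of
    them; pure tensors suffice for the test.\<close>
  have c: "?w (tensors_map R ?Ms (move \<sigma>) w) = tensors_map R ?Ns (move \<sigma>) (?w w)"
  proof (rule mod_hom_eqI[OF tensors_generates_pures[OF X.power_module] X.power_tensors_module Y.power_tensors_module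
     hom_compose[OF X.move_tensors_hom[OF \<sigma>] wh(1)] hom_compose[OF wh(1) Y.move_tensors_hom[OF \<sigma>]] _ w])
   fix y assume "y \<in> pures R ?Ms ` tuples ?Ms"
   then obtain xs where xs: "xs \<in> tuples ?Ms" "y = pures R ?Ms xs" by blast
   have l: "length xs = n" using xs(1) by (simp add: tuples_iff)
   have mx: "move \<sigma> xs \<in> tuples ?Ms" using X.move_slotlin[OF \<sigma>, of p] xs(1) by (simp add: slotlin_def)
   have gx: "G xs \<in> tuples ?Ns" using sl xs(1) by (simp add: slotlin_def)
   have "G (move \<sigma> xs) = move \<sigma> (G xs)" using move_map[of \<sigma> xs g] \<sigma> l by (simp add: G)
   then show "?w (tensors_map R ?Ms (move \<sigma>) y) = tensors_map R ?Ns (move \<sigma>) (?w y)"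
    unfolding xs(2) X.move_tensors_pures[OF \<sigma> xs(1)] wh(2)[OF mx] wh(2)[OF xs(1)] Y.move_tensors_pures[OF \<sigma> gx]
    by simp
  qed
  have "?m z = Y.dom_pure n q (oact P n q \<sigma> (f d)) (?w w) \<ominus>\<^bsub>Y.dom_tensor n q\<^esub>
    Y.dom_pure n q (f d) (tensors_map R ?Ns (move \<sigma>) (?w w))"
   unfolding ze mod_hom_minus[OF X.dom_tensor_module Y.dom_tensor_module mh(1) X.dom_pure_closed[OF ad w]
     X.dom_pure_closed[OF d mw]] mh(2)[OF ad w] mh(2)[OF d mw] c comm[OF \<sigma> d] ..
  also have "... \<in> sym_gens n Y q"
   by (rule Y.sym_gensI[OF \<sigma> hom_closed[OF f d] hom_closed[OF wh(1) w]])
  finally show "?m z \<in> sym_rel R P n Y q" unfolding sym_rel_span by (rule subsetD[OF span_superset])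
 qed
 note q = quot_map_span_hom[OF X.dom_tensor_module X.sym_gens_subset Y.dom_tensor_module Y.sym_rel_submodule mh(1)]
 show "h \<in> mhom (lev (alg_dom R P n X) p) (lev (alg_dom R P n Y) q)"
  unfolding h_def alg_dom_lev sym_rel_span[of n X] by (rule q(1)[OF k])
 show "h (alg_pure R P n X p d xs) = alg_pure R P n Y q (f d) (map g xs)"
  if d: "d \<in> carrier (lev (arity P n) p)" and xs: "xs \<in> tuples ?Ms"
 proof -
  have l: "length xs = n" using xs by (simp add: tuples_iff)
  have w: "pures R ?Ms xs \<in> carrier (tensors R ?Ms)" by (rule multilin_closed[OF pures_multilin[OF X.power_module] xs])
  have "h (alg_pure R P n X p d xs) = sym_rel R P n Y q +>\<^bsub>Y.dom_tensor n q\<^esub> ?m (X.dom_pure n p d (pures R ?Ms xs))"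
   unfolding h_def X.alg_pure_eq sym_rel_span[of n X] by (rule q(2)[OF k X.dom_pure_closed[OF d w]])
  then show ?thesis unfolding mh(2)[OF d w] wh(2)[OF xs] Y.alg_pure_eq G[OF l] .
 qed
qed

lemma alg_dom_map_props:
 assumes X: "simplicial_module R X" and Y: "simplicial_module R Y" and g: "g \<in> mhom (lev X p) (lev Y p)"
 shows "alg_dom_map R P n Y p g \<in> mhom (lev (alg_dom R P n X) p) (lev (alg_dom R P n Y) p)"
  and "[|d \<in> carrier (lev (arity P n) p); xs \<in> tuples (replicate n (lev X p))|] ==>
   alg_dom_map R P n Y p g (alg_pure R P n X p d xs) = alg_pure R P n Y p d (map g xs)"
 using alg_map_props[OF X Y mod_hom_id(1) _ g refl, of n] by (simp_all add: alg_dom_map_def Let_def)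

lemma alg_dom_sop_props:
 assumes X: "simplicial_module R X" and \<theta>: "\<theta> \<in> monotone_maps q p"
 shows "sop (alg_dom R P n X) q p \<theta> \<in> mhom (lev (alg_dom R P n X) p) (lev (alg_dom R P n X) q)"
  and "[|d \<in> carrier (lev (arity P n) p); xs \<in> tuples (replicate n (lev X p))|] ==>
   sop (alg_dom R P n X) q p \<theta> (alg_pure R P n X p d xs) =
   alg_pure R P n X q (sop (arity P n) q p \<theta> d) (map (sop X q p \<theta>) xs)"
proof -
 have e: "sop (alg_dom R P n X) q p \<theta> =
  quot_map (tensor R (lev (arity P n) q) (tensors R (replicate n (lev X q)))) (sym_rel R P n X q)
   (tensor_map R (lev (arity P n) q) (tensors R (replicate n (lev X q))) (sop (arity P n) q p \<theta>)
    (tensors_map R (replicate n (lev X q)) (map2 (%X. sop X q p \<theta>) (replicate n X))))"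
  by (simp add: alg_dom_def Let_def stensor_def stensors_def)
 have comm: "sop (arity P n) q p \<theta> (oact P n p \<sigma> d) = oact P n q \<sigma> (sop (arity P n) q p \<theta> d)"
  if "\<sigma> permutes {..<n}" "d \<in> carrier (lev (arity P n) p)" for \<sigma> d
  using act_map[OF that(1)] \<theta> that(2) unfolding simplicial_map_def by simp
 have G: "map2 (%X. sop X q p \<theta>) (replicate n X) xs = map (sop X q p \<theta>) xs" if "length xs = n" for xs
  by (rule nth_equalityI) (use that in simp_all)
 note a = alg_map_props[OF X X simplicial_module.sop_hom[OF arity_smod \<theta>] comm simplicial_module.sop_hom[OF X \<theta>] G, folded e]
 show "sop (alg_dom R P n X) q p \<theta> \<in> mhom (lev (alg_dom R P n X) p) (lev (alg_dom R P n X) q)" by (rule a(1))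
 show "[|d \<in> carrier (lev (arity P n) p); xs \<in> tuples (replicate n (lev X p))|] ==>
   sop (alg_dom R P n X) q p \<theta> (alg_pure R P n X p d xs) =
   alg_pure R P n X q (sop (arity P n) q p \<theta> d) (map (sop X q p \<theta>) xs)" by (rule a(2))
qed

end

section \<open>The algebra structure on coends\<close>

lemma list_image:
 assumes "set xs <= f ` X"
 shows "\<exists>ys. xs = map f ys \<and> set ys <= X"
 using assms
proof (induction xs)
 case (Cons x xs)
 then obtain ys y where "xs = map f ys" "set ys <= X" "x = f y" "y \<in> X" by auto
 then show ?case by (intro exI[of _ "y # ys"]) simp
qed simp

lemma concat_replicates: "concat (map (%j. replicate j x) js) = replicate (sum_list js) x"
 by (induction js) (simp_all add: replicate_add)

context cring
begin

lemma generates_mono: "[|generates R M G; G <= G'; G' <= carrier M|] ==> generates R M G'"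
 by (auto simp: generates_def)

end

text \<open>The value of the structure map on indices, before classes are taken. Multiplication in
  \<open>A\<close> does not occur: the lists are concatenated.\<close>

definition mu_cell :: "nat => perm_simplex => (nat \<times> under_simplex \<times> 'v list) list => nat \<times> under_simplex \<times> 'v list"
 where "mu_cell p s ys = (sum_list (map fst ys),
  mu_simplex p s (map (fst o snd) ys), concat (map (snd o snd) ys))"

section \<open>Products of cells\<close>

context coend_over
begin


abbreviation "dom_lev n p \<equiv> lev (alg_dom R (DMod R) n (coend R A S)) p"
abbreviation "dom_pure n p \<equiv> alg_pure R (DMod R) n (coend R A S) p"

sublocale O: operad_smod R "DMod R" "coend R A S"
 by (intro operad_smod.intro DMod_operad coend_simplicial)

lemma cellD: "c \<in> cells p ==> fst (snd c) \<in> usimps (fst c) p \<and> snd (snd c) \<in> tuples (replicate (fst c) A)"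
 by (auto simp: cells_def)

lemma cellsD:
 assumes "set ys <= cells p"
 shows "usimplices p (map (fst o snd) ys) (map fst ys)"
  and "list_tuples (map (snd o snd) ys) (map (%j. replicate j A) (map fst ys))"
 unfolding list_all2_conv_all_nth using cellD[OF subsetD[OF assms nth_mem]] by simp_all

lemma cell_closed: "c \<in> cells p ==> cell p c \<in> carrier (coend_lev p)"
 using generates_subset[OF coend_generates] by auto

lemma mu_cell_closed:
 assumes s: "s \<in> esimps (length ys) p" and ys: "set ys <= cells p"
 shows "mu_cell p s ys \<in> cells p"
 using mu_simplex_closed[OF s cellsD(1)[OF ys]] tuples_concat[OF cellsD(2)[OF ys], unfolded concat_replicates]
 by (simp add: mu_cell_def cells_def)

text \<open>Associativity holds for the indices themselves, in contrast to the symmetry, which holds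
  only for their classes.\<close>

lemma mu_cell_assoc:
 assumes s: "s \<in> esimps (length yss) p" and ss: "list_all2 (%s ys. s \<in> esimps (length ys) p) ss yss"
  and yss: "!!ys. ys \<in> set yss ==> set ys <= cells p"
 shows "mu_cell p (comp_simplex p (map length yss) s ss) (concat yss) =
  mu_cell p s (map (%i. mu_cell p (ss ! i) (yss ! i)) [0..<length yss])"
proof -
 let ?tss = "map (map (fst o snd)) yss"
 have l: "map length ?tss = map length yss" by simp
 have 1: "mu_simplex p (comp_simplex p (map length ?tss) s ss) (concat ?tss) =
  mu_simplex p s (map (%i. mu_simplex p (ss ! i) (?tss ! i)) [0..<length ?tss])"
 proof (rule mu_simplex_assoc[where jss="map (map fst) yss"])
  show "list_all2 (usimplices p) ?tss (map (map fst) yss)"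
   unfolding list_all2_conv_all_nth[of "list_all2 _"] using cellsD(1)[OF yss] by simp
 qed (use s ss in "simp_all add: list_all2_map2")
 have 2: "map fst (map (%i. mu_cell p (ss ! i) (yss ! i)) [0..<length yss]) = map (%ys. sum_list (map fst ys)) yss"
  by (rule nth_equalityI) (simp_all add: mu_cell_def)
 have 3: "map (fst o snd) (map (%i. mu_cell p (ss ! i) (yss ! i)) [0..<length yss]) =
   map (%i. mu_simplex p (ss ! i) (?tss ! i)) [0..<length ?tss]"
  by (rule nth_equalityI) (simp_all add: mu_cell_def)
 have 4: "map (snd o snd) (map (%i. mu_cell p (ss ! i) (yss ! i)) [0..<length yss]) =
   map (%ys. concat (map (snd o snd) ys)) yss"
  by (rule nth_equalityI) (simp_all add: mu_cell_def)
 have 5: "sum_list (map fst (concat yss)) = sum_list (map (%ys. sum_list (map fst ys)) yss)"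
  by (induction yss) simp_all
 have 6: "concat (map (snd o snd) (concat yss)) = concat (map (%ys. concat (map (snd o snd) ys)) yss)"
  by (induction yss) simp_all
 show ?thesis
  unfolding mu_cell_def[of _ _ "concat yss"] mu_cell_def[of p s] 2 3 4 5 6 map_concat[of "fst o snd" yss]
  unfolding l[symmetric] 1 ..
qed

lemma mu_cell_unit:
 assumes "y \<in> cells p"
 shows "mu_cell p (id_simplex p) [y] = y"
 using assms by (auto simp: mu_cell_def cells_def mu_simplex_unit)

lemma mu_cell_op:
 assumes "\<theta> \<in> monotone_maps q p"
 shows "mu_cell q (nerve_op q \<theta> s) (map (%(n, t, vs). (n, nerve_op q \<theta> t, vs)) ys) =
  (%(n, t, vs). (n, nerve_op q \<theta> t, vs)) (mu_cell p s ys)"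
 unfolding mu_cell_def by (simp add: nerve_op_map_prod[OF assms] comp_def case_prod_unfold)

lemma id_S: "ds_id n \<in> S"
 unfolding ds_id_def by (rule S_perm[OF permutes_id])

lemma move_S: "\<pi> permutes {..<n} ==> ds_move n \<pi> \<in> S"
 unfolding ds_move_def by (rule S_perm[OF permutes_inv])

text \<open>Reordering the factors changes the simplex by precomposition with a block permutation.
  The coend relation for this permutation carries it over to the concatenated list, where it
  reorders the blocks; here the permutations in \<open>S\<close> are used.\<close>

lemma cell_mu_sym:
 assumes s: "s \<in> esimps (length ys) p" and ys: "set ys <= cells p" and \<rho>: "\<rho> permutes {..<length ys}"
 shows "cell p (mu_cell p (nact p \<rho> s) ys) = cell p (mu_cell p s (move \<rho> ys))"
proof -
 let ?J = "map fst ys" and ?T = "map (fst o snd) ys" and ?V = "map (snd o snd) ys"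
 let ?f = "ds_move (sum_list ?J) (block_perm \<rho> ?J)"
 have \<pi>: "block_perm \<rho> ?J permutes {..<sum_list ?J}" by (rule block_perm_permutes) (use \<rho> in simp)
 have sy: "set (move \<rho> ys) <= cells p" using set_move[OF \<rho>] ys by simp
 have J: "map fst (move \<rho> ys) = move \<rho> ?J" "map (snd o snd) (move \<rho> ys) = move \<rho> ?V"
  "map (fst o snd) (move \<rho> ys) = move \<rho> ?T" by (rule move_map[OF \<rho>, symmetric])+
 have sJ: "sum_list (map fst (move \<rho> ys)) = sum_list ?J" unfolding J by (rule sum_list_move) (use \<rho> in simp)
 have lV: "map length ?V = ?J"
  by (rule nth_equalityI) (use cellD[OF subsetD[OF ys nth_mem]] in "simp_all add: tuples_replicate")
 have V: "concat ?V \<in> tuples (replicate (sum_list ?J) A)"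
  using tuples_concat[OF cellsD(2)[OF ys]] unfolding concat_replicates .
 have t: "mu_simplex p s (map (fst o snd) (move \<rho> ys)) \<in> usimps (dtgt ?f) p"
  using mu_simplex_closed[OF _ cellsD(1)[OF sy], of s] s sJ by simp
 have "cell p (mu_cell p (nact p \<rho> s) ys) = cpures p (dsrc ?f)
   (bv (precomp_simplex p ?f (mu_simplex p s (map (fst o snd) (move \<rho> ys))))) (concat ?V)"
  using mu_simplex_equivariant[OF _ cellsD(1)[OF ys], of s \<rho>] s \<rho> unfolding J by (simp add: cell_def mu_cell_def)
 also have "... = cpures p (dtgt ?f)
   (bv (mu_simplex p s (map (fst o snd) (move \<rho> ys)))) (bar_list A ?f (concat ?V))"
  by (rule class_pures_rel[OF move_S[OF \<pi>] t]) (use V in simp)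
 also have "bar_list A ?f (concat ?V) = concat (move \<rho> ?V)"
  using bar_list_move[OF \<pi> V] move_block_perm[of \<rho> ?V] \<rho> unfolding lV by simp
 finally show ?thesis using sJ unfolding cell_def mu_cell_def J by simp
qed

text \<open>The product respects the relations in slot \<open>i\<close>: such a relation by
  \<open>f\<close> is the relation by a juxtaposition that has \<open>f\<close> in this slot and
  identities elsewhere. All other entries are fixed cells.\<close>

lemma cell_mu_slot:
 assumes s: "s \<in> esimps n p" and n: "length ys = n" and i: "i < n"
  and ys: "\<forall>j<n. j ~= i --> ys ! j \<in> cells p"
 shows "extends_to R (coend_lev p) (coend_lev p) (cells p) (cell p) (%x. cell p (mu_cell p s (ys[i := x])))"
proof -
 define J T V where "J = map fst ys" and "T = map (fst o snd) ys" and "V = map (snd o snd) ys"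
 have l: "length J = n" "length T = n" "length V = n" using n by (simp_all add: J_def T_def V_def)
 have other: "T ! k \<in> usimps (J ! k) p" "V ! k \<in> tuples (replicate (J ! k) A)" if "k < n" "k ~= i" for k
  using cellD[of "ys ! k" p] ys that n by (simp_all add: J_def T_def V_def)
 have Tc: "usimplices p (T[i := t]) (J[i := m])" if "t \<in> usimps m p" for t m
  unfolding list_all2_conv_all_nth using other that l i by (simp add: nth_list_update)
 have Vc: "list_tuples (V[i := vs]) (map (%j. replicate j A) (J[i := m]))"
  if "vs \<in> tuples (replicate m A)" for vs m
  unfolding list_all2_conv_all_nth using other that l i by (simp add: nth_list_update)
 have muc: "mu_simplex p s (T[i := t]) \<in> usimps (sum_list (J[i := m])) p" if "t \<in> usimps m p" for t m
  by (rule mu_simplex_closed[OF s Tc[OF that]]) (simp add: l)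
 define \<phi> where "\<phi> m t vs = cpures p (sum_list (J[i := m]))
   (bv (mu_simplex p s (T[i := t]))) (concat (V[i := vs]))" for m t vs
 have e: "cell p (mu_cell p s (ys[i := x])) = (%(m, t, vs). \<phi> m t vs) x" for x
  by (cases x) (simp add: cell_def mu_cell_def \<phi>_def map_update J_def T_def V_def)
 show ?thesis unfolding e
 proof (rule coend_lift[OF coend_module])
  show "multilin R (replicate m A) (coend_lev p) (\<phi> m t)" if t: "t \<in> usimps m p" for m t
  proof -
   \<comment> \<open>Slot \<open>i\<close> needs some list of the right length for the shape of the
     concatenation to be stated; it is overwritten afterwards.\<close>
   have z: "replicate m \<zero>\<^bsub>A\<^esub> \<in> tuples (replicate m A)" by (auto simp: tuples_replicate)
   have sl: "slotlin R (replicate m A) (replicate (sum_list (J[i := m])) A) (%vs. concat (V[i := vs]))"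
    using slotlin_concat_update[OF Vc[OF z], of i] i l by (simp add: concat_replicates)
   have b: "bv (mu_simplex p s (T[i := t])) \<in> carrier (F_lev (sum_list (J[i := m])) p)"
    unfolding Ftilde_lev by (rule basis_vec_closed[OF muc[OF t]])
   show ?thesis unfolding \<phi>_def[abs_def]
    by (rule multilin_slotlin[OF replicate_module bimultiD(1)[OF class_pures_bimulti b] sl])
  qed
 next
  fix f t vs assume f: "f \<in> S" and t: "t \<in> usimps (dtgt f) p" and vs: "vs \<in> tuples (replicate (dsrc f) A)"
  \<comment> \<open>This juxtaposition lies in \<open>S\<close>; its identities fix the simplices
    and lists in the slots other than \<open>i\<close>.\<close>
  define F where "F = (map ds_id J)[i := f]"
  have FS: "set F <= S" using set_update_subset_insert[of "map ds_id J" i f] id_S f by (auto simp: F_def)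
  then have Fm: "set F <= ds_mors" using S_mors by auto
  have F: "map dsrc F = J[i := dsrc f]" "map dtgt F = J[i := dtgt f]" "length F = n"
   by (simp_all add: F_def map_update comp_def l)
  have TF: "T[i := precomp_simplex p f t] = map2 (precomp_simplex p) F (T[i := t])"
   by (rule nth_equalityI) (use other(1) i l in "auto simp: F_def nth_list_update precomp_simplex_id")
  have VF: "V[i := bar_list A f vs] = map2 (bar_list A) F (V[i := vs])"
   by (rule nth_equalityI) (use other(2) i l in "auto simp: F_def nth_list_update bar_list_id")
  have lV: "map length (V[i := vs]) = map dsrc F"
  proof (rule nth_equalityI)
   fix k assume "k < length (map length (V[i := vs]))"
   then have "k < n" using l by simp
   then show "map length (V[i := vs]) ! k = map dsrc F ! k"
    unfolding F(1) using other(2)[of k] vs l i by (simp add: nth_list_update tuples_replicate)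
  qed (simp add: F l)
  have V: "concat (V[i := vs]) \<in> tuples (replicate (dsrc (ds_juxts F)) A)"
   using tuples_concat[OF Vc[OF vs]] by (simp add: concat_replicates F)
  have "\<phi> (dsrc f) (precomp_simplex p f t) vs = cpures p (dsrc (ds_juxts F))
    (bv (precomp_simplex p (ds_juxts F) (mu_simplex p s (T[i := t])))) (concat (V[i := vs]))"
   unfolding \<phi>_def TF
   by (subst mu_simplex_precomp[OF _ _ Fm]) (use s Tc[OF t] l in "simp_all add: F")
  also have "... = cpures p (dtgt (ds_juxts F)) (bv (mu_simplex p s (T[i := t])))
    (bar_list A (ds_juxts F) (concat (V[i := vs])))"
   by (rule class_pures_rel[OF S_juxts[OF FS] _ V]) (use muc[OF t] in "simp add: F")
  also have "... = \<phi> (dtgt f) t (bar_list A f vs)"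
   unfolding \<phi>_def VF bar_list_juxts[OF Fm lV] by (simp add: F)
  finally show "\<phi> (dsrc f) (precomp_simplex p f t) vs = \<phi> (dtgt f) t (bar_list A f vs)" .
 qed
qed

text \<open>For a fixed simplex the product extends over the cells by
  \<open>multilin_extend\<close>. The extension in the operad variable meets no condition, since
  that module is free on simplices.\<close>

lemma mu_extend:
 "\<exists>\<Phi>. bimulti R (D_lev n p) (replicate n (coend_lev p)) (coend_lev p) \<Phi> \<and>
  (\<forall>s\<in>esimps n p. \<forall>ys. length ys = n --> set ys <= cells p -->
   \<Phi> (bv s) (map (cell p) ys) = cell p (mu_cell p s ys))"
proof -
 have "\<forall>s\<in>esimps n p. \<exists>F. multilin R (replicate n (coend_lev p)) (coend_lev p) F \<and>
  (\<forall>ys. length ys = n --> set ys <= cells p --> F (map (cell p) ys) = cell p (mu_cell p s ys))"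
 proof
  fix s assume s: "s \<in> esimps n p"
  show "\<exists>F. multilin R (replicate n (coend_lev p)) (coend_lev p) F \<and>
   (\<forall>ys. length ys = n --> set ys <= cells p --> F (map (cell p) ys) = cell p (mu_cell p s ys))"
  proof (rule multilin_extend[OF coend_module coend_module coend_generates])
   show "cell p (mu_cell p s ys) \<in> carrier (coend_lev p)" if "length ys = n" "set ys <= cells p" for ys
    using cell_closed[OF mu_cell_closed] s that by simp
  qed (rule cell_mu_slot[OF s])
 qed
 then obtain F where F: "!!s. s \<in> esimps n p ==> multilin R (replicate n (coend_lev p)) (coend_lev p) (F s)"
  "!!s ys. [|s \<in> esimps n p; length ys = n; set ys <= cells p|] ==> F s (map (cell p) ys) = cell p (mu_cell p s ys)"
  by metis
 have "extends_to R (D_lev n p) (coend_lev p) (esimps n p) (bv) (%s. F s cs)"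
  if "cs \<in> tuples (replicate n (coend_lev p))" for cs
  unfolding extends_to_def DMod_lev by (rule free_lift[OF coend_module]) (rule multilin_closed[OF F(1) that])
 from bimulti_extend[OF D_module coend_module O.power_module DMod_generates F(1) this]
 obtain \<Phi> where \<Phi>: "bimulti R (D_lev n p) (replicate n (coend_lev p)) (coend_lev p) \<Phi>"
  "\<forall>s\<in>esimps n p. \<forall>cs\<in>tuples (replicate n (coend_lev p)). \<Phi> (bv s) cs = F s cs"
  by blast
 show ?thesis
 proof (intro exI[of _ \<Phi>] conjI \<Phi>(1) ballI allI impI)
  fix s and ys :: "(nat \<times> under_simplex \<times> 'v list) list"
  assume s: "s \<in> esimps n p" and ys: "length ys = n" "set ys <= cells p"
  have "map (cell p) ys \<in> tuples (replicate n (coend_lev p))"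
   using ys cell_closed by (auto simp: tuples_replicate)
  then show "\<Phi> (bv s) (map (cell p) ys) = cell p (mu_cell p s ys)"
   using \<Phi>(2) s F(2)[OF s ys] by simp
 qed
qed

text \<open>A choice among the extensions; on the carriers there is only one, because cells and
  basis simplices generate. The multilinear map replaces \<open>struct\<close> in proofs, so that
  the coinvariants can be left aside.\<close>

definition mu_mod :: "nat => nat => (perm_simplex => 'a) => (nat => ('a, 'v) summand) set list => (nat => ('a, 'v) summand) set"
 where "mu_mod n p = (SOME \<Phi>. bimulti R (D_lev n p) (replicate n (coend_lev p)) (coend_lev p) \<Phi> \<and>
  (\<forall>s\<in>esimps n p. \<forall>ys. length ys = n --> set ys <= cells p -->
   \<Phi> (bv s) (map (cell p) ys) = cell p (mu_cell p s ys)))"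

lemma mu_mod_bimulti: "bimulti R (D_lev n p) (replicate n (coend_lev p)) (coend_lev p) (mu_mod n p)"
 unfolding mu_mod_def by (rule conjunct1[OF someI_ex[OF mu_extend]])

lemma mu_mod_cells: "[|s \<in> esimps n p; length ys = n; set ys <= cells p|] ==>
  mu_mod n p (bv s) (map (cell p) ys) = cell p (mu_cell p s ys)"
 using conjunct2[OF someI_ex[OF mu_extend[of n p]]] unfolding mu_mod_def by simp

lemma mu_mod_eqI:
 assumes P: "module R P" and f: "bimulti R (D_lev n p) (replicate n (coend_lev p)) P f"
  and g: "bimulti R (D_lev n p) (replicate n (coend_lev p)) P g"
  and eq: "!!s ys. [|s \<in> esimps n p; length ys = n; set ys <= cells p|] ==>
   f (bv s) (map (cell p) ys) = g (bv s) (map (cell p) ys)"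
  and d: "d \<in> carrier (D_lev n p)" and cs: "cs \<in> tuples (replicate n (coend_lev p))"
 shows "f d cs = g d cs"
proof (rule bimulti_eqI[OF D_module O.power_module P DMod_generates _ f g _ d cs])
 show "generates R (replicate n (coend_lev p) ! i) (cell p ` cells p)" if "i < length (replicate n (coend_lev p))" for i
  using that coend_generates by simp
 fix d xs assume d: "d \<in> bv ` esimps n p" and xs: "length xs = length (replicate n (coend_lev p))"
  "\<forall>i<length (replicate n (coend_lev p)). xs ! i \<in> cell p ` cells p"
 then have "set xs <= cell p ` cells p" by (simp add: subset_code(1) all_set_conv_all_nth)
 from list_image[OF this] obtain ys where ys: "xs = map (cell p) ys" "set ys <= cells p" by (elim exE conjE)
 obtain s where s: "d = bv s" "s \<in> esimps n p" using d by (rule imageE)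
 show "f d xs = g d xs" unfolding s(1) ys(1) by (rule eq[OF s(2) _ ys(2)]) (use xs(1) ys(1) in simp)
qed

text \<open>What is needed to descend to the coinvariants; on generators it is
  \<open>cell_mu_sym\<close>.\<close>

lemma mu_mod_sym:
 assumes \<rho>: "\<rho> permutes {..<n}" and d: "d \<in> carrier (D_lev n p)" and cs: "cs \<in> tuples (replicate n (coend_lev p))"
 shows "mu_mod n p (oact (DMod R) n p \<rho> d) cs = mu_mod n p d (move \<rho> cs)"
proof (rule mu_mod_eqI[OF coend_module _ _ _ d cs])
 show "bimulti R (D_lev n p) (replicate n (coend_lev p)) (coend_lev p) (%d. mu_mod n p (oact (DMod R) n p \<rho> d))"
  by (rule bimulti_precompose_left[OF mu_mod_bimulti O.oact_hom[OF \<rho>]])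
 show "bimulti R (D_lev n p) (replicate n (coend_lev p)) (coend_lev p) (%d cs. mu_mod n p d (move \<rho> cs))"
  by (rule bimulti_precompose[OF O.power_module mu_mod_bimulti O.move_slotlin[OF \<rho>]])
 fix s and ys :: "(nat \<times> under_simplex \<times> 'v list) list"
 assume s: "s \<in> esimps n p" and ys: "length ys = n" "set ys <= cells p"
 have \<rho>': "\<rho> permutes {..<length ys}" using \<rho> ys by simp
 have m: "set (move \<rho> ys) <= cells p" "length (move \<rho> ys) = n" using set_move[OF \<rho>'] ys by simp_all
 show "mu_mod n p (oact (DMod R) n p \<rho> (bv s)) (map (cell p) ys) = mu_mod n p (bv s) (move \<rho> (map (cell p) ys))"
  unfolding DMod_act free_map_basis move_map[OF \<rho>'] mu_mod_cells[OF nact_closed[OF \<rho> s] ys] mu_mod_cells[OF s m(2,1)]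
  by (rule cell_mu_sym[OF _ ys(2) \<rho>']) (use s ys in simp)
qed

lemma mu_star_bimulti:
 "bimulti R (D_lev (length js) p) (map (%j. F_lev j p) js) (F_lev (sum_list js) p) (mu_star R p)"
proof -
 have "bimulti R (free (esimps (length js) p)) (map (free) (map (%j. usimps j p) js))
  (free (usimps (sum_list js) p)) (mext (mu_simplex p))"
  by (rule multilinear_ext_bimulti) (rule mu_simplex_closed, assumption, simp_all add: list_all2_map2)
 then show ?thesis unfolding mu_star_def by (simp add: DMod_lev Ftilde_lev comp_def)
qed

text \<open>Passes from basis simplices to arbitrary chains, as in the formula for
  \<open>\<nu>\<close>. The lists \<open>vss\<close> stay fixed, and both sides are linear in
  \<open>d\<close> and multilinear in \<open>xs\<close>.\<close>

lemma mu_mod_class: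
 assumes d: "d \<in> carrier (D_lev (length js) p)" and xs: "xs \<in> tuples (map (%j. F_lev j p) js)"
  and vss: "list_all2 (%vs j. vs \<in> tuples (replicate j A)) vss js"
 shows "mu_mod (length js) p d (map (%i. cpures p (js ! i) (xs ! i) (vss ! i)) [0..<length js]) =
  cpures p (sum_list js) (mu_star R p d xs) (concat vss)"
proof -
 let ?Ms = "map (%j. F_lev j p) js"
 let ?c = "%xs. map (%i. cpures p (js ! i) (xs ! i) (vss ! i)) [0..<length js]"
 have l: "length vss = length js" by (rule list_all2_lengthD[OF vss])
 have vi: "vss ! i \<in> tuples (replicate (js ! i) A)" if "i < length js" for i using list_all2_nthD2[OF vss that] .
 have V: "concat vss \<in> tuples (replicate (sum_list js) A)"
  using tuples_concat[of vss "map (%j. replicate j A) js"] vss by (simp add: list_all2_map2 concat_replicates)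
 have Ms: "\<forall>M\<in>set ?Ms. module R M" using Ftilde_module by auto
 have sl0: "slotlin R ?Ms (replicate (length js) (coend_lev p))
   (map2 (%h x. h x) (map (%i x. cpures p (js ! i) x (vss ! i)) [0..<length js]))"
  by (rule slotlin_map2) (use bimultiD(2)[OF class_pures_bimulti vi] in simp_all)
 have sl: "slotlin R ?Ms (replicate (length js) (coend_lev p)) ?c"
  by (rule slotlin_cong[OF _ sl0], rule nth_equalityI) simp_all
 show ?thesis
 proof (rule bimulti_eqI[OF D_module Ms coend_module DMod_generates _ _ _ _ d xs])
  show "bimulti R (D_lev (length js) p) ?Ms (coend_lev p) (%d xs. mu_mod (length js) p d (?c xs))"
   by (rule bimulti_precompose[OF Ms mu_mod_bimulti sl])
  show "bimulti R (D_lev (length js) p) ?Ms (coend_lev p)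
    (%d xs. cpures p (sum_list js) (mu_star R p d xs) (concat vss))"
   by (rule bimulti_compose[OF mu_star_bimulti bimultiD(2)[OF class_pures_bimulti V]])
  show "generates R (?Ms ! i) (bv ` usimps (js ! i) p)" if "i < length ?Ms" for i
   using that Ftilde_generates by simp
  fix d xs assume d: "d \<in> bv ` esimps (length js) p" and xs: "length xs = length ?Ms"
   "\<forall>i<length ?Ms. xs ! i \<in> bv ` usimps (js ! i) p"
  obtain s where s: "s \<in> esimps (length js) p" "d = bv s" using d by auto
  obtain ts where ts: "length ts = length js"
   "\<forall>i<length js. ts ! i \<in> usimps (js ! i) p \<and> xs ! i = bv (ts ! i)"
   using basis_list[of xs js "%_. bv" "%i. usimps (js ! i) p"] xs by auto
  define ys where "ys = map (%i. (js ! i, ts ! i, vss ! i)) [0..<length js]"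
  have ys: "length ys = length js" "set ys <= cells p" using ts vi by (auto simp: ys_def cells_def)
  have y3: "map fst ys = js" "map (fst o snd) ys = ts" "map (snd o snd) ys = vss"
   by (rule nth_equalityI; simp add: ys_def ts l)+
  have c: "?c xs = map (cell p) ys" by (rule nth_equalityI) (use ts in "simp_all add: ys_def cell_def")
  have x: "xs = map (bv) ts" by (rule nth_equalityI) (use xs ts in simp_all)
  show "mu_mod (length js) p d (?c xs) = cpures p (sum_list js) (mu_star R p d xs) (concat vss)"
   unfolding c s(2) mu_mod_cells[OF s(1) ys] unfolding x mu_star_def multilinear_ext_basis mu_cell_def y3 cell_def
   by simp
 qed
qed

end

section \<open>The structure map of the coend\<close>

definition coend_gen ::
 "('k, 'r) ring_scheme => ('k, 'a) module => ds_mor set => nat => nat =>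
  (perm_simplex => 'k) \<times> (nat \<times> (under_simplex => 'k) \<times> 'a list) list =>
  ((perm_simplex => 'k) \<times> ((nat => ('k, 'a) summand) set list => 'k) set => 'k) set set"
 where "coend_gen R A S n p = (%(d, ys). alg_pure R (DMod R) n (coend R A S) p d
  (map (%(j, x, vs). class_pures R A S p j x vs) ys))"

definition coend_value ::
 "('k, 'r) ring_scheme => ('k, 'a) module => ds_mor set => nat =>
  (perm_simplex => 'k) \<times> (nat \<times> (under_simplex => 'k) \<times> 'a list) list =>
  (nat => ('k, 'a) summand) set"
 where "coend_value R A S p = (%(d, ys). class_pures R A S p (sum_list (map fst ys))
  (mu_star R p d (map (fst o snd) ys)) (concat (map (snd o snd) ys)))"

text \<open>The definition of \<open>nu\<close> with the class of morphisms as a parameter: the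
  automorphisms give back \<open>nu\<close>, and all morphisms give the structure on CA.\<close>

definition coend_struct ::
 "('k, 'r) ring_scheme => ('k, 'a) module => ds_mor set => nat => nat =>
  ((perm_simplex => 'k) \<times> ((nat => ('k, 'a) summand) set list => 'k) set => 'k) set set =>
  (nat => ('k, 'a) summand) set"
 where "coend_struct R A S n p = linear_from R (lev (alg_dom R (DMod R) n (coend R A S)) p) (lev (coend R A S) p)
  (nu_index R A n p) (coend_gen R A S n p) (coend_value R A S p)"

lemma nu_gen_eq: "nu_gen R A n p = coend_gen R A ds_auts n p"
 by (simp add: nu_gen_def coend_gen_def FA_def FA_class_def class_pures_def coend_class_def)

lemma nu_value_eq: "nu_value R A p = coend_value R A ds_auts p"
 by (simp add: nu_value_def coend_value_def FA_class_def class_pures_def coend_class_def Let_def)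

lemma nu_eq: "nu R A = coend_struct R A ds_auts"
 by (intro ext) (simp add: nu_def coend_struct_def nu_gen_eq nu_value_eq FA_def)

context coend_over
begin

abbreviation "struct \<equiv> coend_struct R A S"

lemma class_pures_closed: "[|x \<in> carrier (F_lev j p); vs \<in> tuples (replicate j A)|] ==>
  cpures p j x vs \<in> carrier (coend_lev p)"
 by (rule multilin_closed[OF bimultiD(1)[OF class_pures_bimulti]])

lemma index_props:
 assumes "(d, ys) \<in> nu_index R A n p"
 shows "d \<in> carrier (D_lev n p)"
  and "map (%(j, x, vs). cpures p j x vs) ys \<in> tuples (replicate n (coend_lev p))"
  and "mu_mod n p d (map (%(j, x, vs). cpures p j x vs) ys) = coend_value R A S p (d, ys)"
proof -
 show d: "d \<in> carrier (D_lev n p)" using assms by (simp add: nu_index_def)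
 have n: "length ys = n" using assms by (simp add: nu_index_def)
 have y: "fst (snd y) \<in> carrier (F_lev (fst y) p)" "snd (snd y) \<in> tuples (replicate (fst y) A)" if "y \<in> set ys" for y
  using assms that by (auto simp: nu_index_def)
 note yn = y[OF nth_mem]
 show "map (%(j, x, vs). cpures p j x vs) ys \<in> tuples (replicate n (coend_lev p))"
  using class_pures_closed[OF y] n by (auto simp: tuples_replicate)
 let ?js = "map fst ys" and ?xs = "map (fst o snd) ys" and ?vss = "map (snd o snd) ys"
 have m: "map (%i. cpures p (?js ! i) (?xs ! i) (?vss ! i)) [0..<length ?js] =
   map (%(j, x, vs). cpures p j x vs) ys"
  by (rule nth_equalityI) (simp_all add: case_prod_unfold)
 have "?xs \<in> tuples (map (%j. F_lev j p) ?js)" using yn(1) by (simp add: tuples_iff)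
 moreover have "list_all2 (%vs j. vs \<in> tuples (replicate j A)) ?vss ?js" using yn(2) by (simp add: list_all2_conv_all_nth)
 ultimately show "mu_mod n p d (map (%(j, x, vs). cpures p j x vs) ys) = coend_value R A S p (d, ys)"
  using mu_mod_class[of d ?js p ?xs ?vss] d n unfolding m by (simp add: coend_value_def)
qed

text \<open>Indices with basis simplices in place of general chains already yield generators, so a
  linear map with the prescribed values is unique.\<close>

lemma index_generates: "generates R (dom_lev n p) (coend_gen R A S n p ` nu_index R A n p)"
proof (rule generates_mono[OF O.alg_pure_generates[OF DMod_generates coend_generates]])
 show "{dom_pure n p d xs | d xs. d \<in> bv ` esimps n p \<and> length xs = n \<and>
   set xs <= cell p ` cells p} <= coend_gen R A S n p ` nu_index R A n p"
 proof
  fix z assume "z \<in> {dom_pure n p d xs | d xs. d \<in> bv ` esimps n p \<and> length xs = n \<and>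
   set xs <= cell p ` cells p}"
  then obtain s xs where s: "s \<in> esimps n p" and xs: "length xs = n" "set xs <= cell p ` cells p"
   and z: "z = dom_pure n p (bv s) xs" by blast
  from list_image[OF xs(2)] obtain ys where ys: "xs = map (cell p) ys" "set ys <= cells p" by (elim exE conjE)
  let ?ys = "map (%(j, t, vs). (j, bv t, vs)) ys"
  have "(bv s, ?ys) \<in> nu_index R A n p"
   using s xs(1) ys by (auto simp: nu_index_def basis_in_lev cells_def Ftilde_lev basis_vec_closed)
  moreover have "map (%(j, x, vs). cpures p j x vs) ?ys = xs"
   unfolding ys(1) map_map by (rule map_cong[OF refl]) (simp add: cell_def case_prod_unfold)
  then have "z = coend_gen R A S n p (bv s, ?ys)" unfolding z coend_gen_def by simp
  ultimately show "z \<in> coend_gen R A S n p ` nu_index R A n p" by (rule rev_image_eqI)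
 qed
 show "coend_gen R A S n p ` nu_index R A n p <= carrier (dom_lev n p)"
 proof
  fix z assume "z \<in> coend_gen R A S n p ` nu_index R A n p"
  then obtain d ys where i: "(d, ys) \<in> nu_index R A n p" "z = coend_gen R A S n p (d, ys)" by auto
  show "z \<in> carrier (dom_lev n p)" unfolding i(2) coend_gen_def prod.case
   by (rule multilin_closed[OF bimultiD(1)[OF O.alg_pure_bimulti index_props(1)[OF i(1)]] index_props(2)[OF i(1)]])
 qed
qed

text \<open>The lift of \<open>mu_mod\<close> to the coinvariants has the values that
  \<open>linear_from\<close> prescribes, so it is the map described; on pure elements the structure
  map can then be computed by \<open>mu_mod\<close>.\<close>

lemma coend_struct_props:
 shows coend_struct_hom: "struct n p \<in> mhom (dom_lev n p) (coend_lev p)"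
  and coend_struct_gen: "i \<in> nu_index R A n p ==> struct n p (coend_gen R A S n p i) = coend_value R A S p i"
  and coend_struct_pure: "[|d \<in> carrier (D_lev n p); cs \<in> tuples (replicate n (coend_lev p))|] ==>
   struct n p (dom_pure n p d cs) = mu_mod n p d cs"
proof -
 have "\<exists>h \<in> mhom (dom_lev n p) (coend_lev p).
  \<forall>d\<in>carrier (D_lev n p). \<forall>cs\<in>tuples (replicate n (coend_lev p)).
   h (dom_pure n p d cs) = mu_mod n p d cs"
  by (rule O.alg_lift[OF coend_module mu_mod_bimulti mu_mod_sym])
 then obtain h where h: "h \<in> mhom (dom_lev n p) (coend_lev p)"
  "\<forall>d\<in>carrier (D_lev n p). \<forall>cs\<in>tuples (replicate n (coend_lev p)).
   h (dom_pure n p d cs) = mu_mod n p d cs"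
  by (rule bexE)
 have v: "h (coend_gen R A S n p i) = coend_value R A S p i" if i: "i \<in> nu_index R A n p" for i
 proof -
  obtain d ys where dy: "i = (d, ys)" by (cases i)
  note ip = index_props[OF i[unfolded dy]]
  show ?thesis unfolding dy coend_gen_def prod.case h(2)[rule_format, OF ip(1,2)] by (rule ip(3))
 qed
 note lf = linear_from_props[OF O.alg_dom_module coend_module index_generates h(1) v, folded coend_struct_def]
 show "struct n p \<in> mhom (dom_lev n p) (coend_lev p)" by (rule lf(1))
 show "i \<in> nu_index R A n p ==> struct n p (coend_gen R A S n p i) = coend_value R A S p i" by (rule lf(2))
 show "struct n p (dom_pure n p d cs) = mu_mod n p d cs"
  if dc: "d \<in> carrier (D_lev n p)" "cs \<in> tuples (replicate n (coend_lev p))"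
  using lf(3)[OF _ multilin_closed[OF bimultiD(1)[OF O.alg_pure_bimulti dc(1)] dc(2)]] h(2)[rule_format, OF dc] by simp
qed

lemma cells_tuples: "[|length ys = n; set ys <= cells p|] ==> map (cell p) ys \<in> tuples (replicate n (coend_lev p))"
 using cell_closed by (auto simp: tuples_replicate)

lemma coend_struct_cells: "[|s \<in> esimps n p; length ys = n; set ys <= cells p|] ==>
  struct n p (dom_pure n p (bv s) (map (cell p) ys)) = cell p (mu_cell p s ys)"
 by (simp add: coend_struct_pure basis_in_lev cells_tuples mu_mod_cells)

text \<open>The target \<open>Q\<close> is arbitrary, so this serves the naturality in the
  simplicial degree as well as the comparison of the two coends.\<close>

lemma alg_dom_eqI:
 assumes Q: "module R Q" and f: "f \<in> mhom (dom_lev n p) Q"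
  and g: "g \<in> mhom (dom_lev n p) Q"
  and eq: "!!s ys. [|s \<in> esimps n p; length ys = n; set ys <= cells p|] ==>
   f (dom_pure n p (bv s) (map (cell p) ys)) =
   g (dom_pure n p (bv s) (map (cell p) ys))"
  and z: "z \<in> carrier (dom_lev n p)"
 shows "f z = g z"
proof (rule mod_hom_eqI[OF O.alg_pure_generates[OF DMod_generates coend_generates] O.alg_dom_module Q f g _ z])
 fix y assume "y \<in> {dom_pure n p d xs | d xs. d \<in> bv ` esimps n p \<and>
   length xs = n \<and> set xs <= cell p ` cells p}"
 then obtain s xs where s: "s \<in> esimps n p" and xs: "length xs = n" "set xs <= cell p ` cells p"
  and y: "y = dom_pure n p (bv s) xs" by blast
 from list_image[OF xs(2)] obtain ys where ys: "xs = map (cell p) ys" "set ys <= cells p" by (elim exE conjE)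
 show "f y = g y" unfolding y ys(1) by (rule eq[OF s _ ys(2)]) (use xs(1) ys(1) in simp)
qed

section \<open>The laws of the algebra\<close>

lemma coend_struct_natural: "simplicial_map R (alg_dom R (DMod R) n (coend R A S)) (coend R A S) (struct n)"
 unfolding simplicial_map_def
proof (intro conjI allI ballI coend_struct_hom)
 fix p q \<theta> z assume \<theta>: "\<theta> \<in> monotone_maps q p" and z: "z \<in> carrier (dom_lev n p)"
 note sp = O.alg_dom_sop_props[OF coend_simplicial \<theta>, where n=n]
 show "struct n q (sop (alg_dom R (DMod R) n (coend R A S)) q p \<theta> z) =
   sop (coend R A S) q p \<theta> (struct n p z)"
 proof (rule alg_dom_eqI[OF coend_module hom_compose[OF sp(1) coend_struct_hom]
    hom_compose[OF coend_struct_hom coend_sop_hom[OF \<theta>]] _ z])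
  fix s and ys :: "(nat \<times> under_simplex \<times> 'v list) list"
  assume s: "s \<in> esimps n p" and ys: "length ys = n" "set ys <= cells p"
  let ?o = "%(n, t, vs). (n, nerve_op q \<theta> t, vs)"
  have o: "sop (coend R A S) q p \<theta> (cell p y) = cell q (?o y)" "?o y \<in> cells q" if "y \<in> cells p" for y
   by (cases y; use coend_sop_cell[OF \<theta>] cells_op[OF \<theta>] that in simp)+
  have m: "map (sop (coend R A S) q p \<theta>) (map (cell p) ys) = map (cell q) (map ?o ys)"
   unfolding map_map by (rule map_cong[OF refl]) (use o(1) ys(2) in auto)
  have s': "nerve_op q \<theta> s \<in> esimps n q" by (rule nerve_op_closed[OF \<theta> s])
  have sb: "sop (arity (DMod R) n) q p \<theta> (bv s) = bv (nerve_op q \<theta> s)"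
   by (simp add: DMod_simps nerve_smod_simps free_map_basis)
  have "sop (coend R A S) q p \<theta> (cell p (mu_cell p s ys)) = cell q (mu_cell q (nerve_op q \<theta> s) (map ?o ys))"
   using o(1)[OF mu_cell_closed] s ys by (simp add: mu_cell_op[OF \<theta>])
  moreover have "set (map ?o ys) <= cells q" using o(2) ys(2) by auto
  ultimately show "struct n q (sop (alg_dom R (DMod R) n (coend R A S)) q p \<theta>
     (dom_pure n p (bv s) (map (cell p) ys))) =
    sop (coend R A S) q p \<theta> (struct n p
     (dom_pure n p (bv s) (map (cell p) ys)))"
   unfolding sp(2)[OF basis_in_lev[OF s] cells_tuples[OF ys]] sb m coend_struct_cells[OF s ys]
   by (subst coend_struct_cells[OF s']) (use ys in simp_all)
 qed
qed

text \<open>\<open>assoc_reduce\<close> leaves basis simplices and cells, and there the claim is the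
  associativity of the indices.\<close>

lemma mu_mod_assoc:
 assumes d: "d \<in> carrier (D_lev (length ks) p)" and es: "es \<in> tuples (D_levs ks p)"
  and xss: "list_all2 (%k xs. xs \<in> tuples (replicate k (coend_lev p))) ks xss"
 shows "mu_mod (sum_list ks) p (dcomp ks p d es) (concat xss) =
  mu_mod (length ks) p d (map (%i. mu_mod (ks ! i) p (es ! i) (xss ! i)) [0..<length ks])"
proof -
 let ?Es = "D_levs ks p" and ?X = "%k. replicate k (coend_lev p)"
 have "mu_mod (sum_list ks) p (dcomp ks p d es) (concat xss) =
  mu_mod (length ks) p d (map (%i. mu_mod (ks ! i) p (es ! i) (xss ! i)) [0..<length ?Es])"
 proof (rule assoc_reduce[where D="D_lev (length ks) p" and E="D_lev (sum_list ks) p" and P="coend_lev p" and Es="?Es"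
    and Qs="?X (length ks)" and Xss="map ?X ks" and C="dcomp ks p" and \<Psi>="mu_mod (sum_list ks) p"
    and \<Omega>="mu_mod (length ks) p" and \<phi>="%i. mu_mod (ks ! i) p" and GD="bv ` esimps (length ks) p"
    and GE="%i. bv ` esimps (ks ! i) p" and GX="%_ _. cell p ` cells p"])
  show "bimulti R (D_lev (sum_list ks) p) (concat (map ?X ks)) (coend_lev p) (mu_mod (sum_list ks) p)"
   unfolding concat_replicates by (rule mu_mod_bimulti)
  show "bimulti R (?Es ! i) (map ?X ks ! i) (?X (length ks) ! i) (mu_mod (ks ! i) p)" if "i < length ?Es" for i
   using mu_mod_bimulti[of "ks ! i" p] that by simp
  show "list_tuples xss (map ?X ks)" using xss by (simp add: list_all2_map2 list_all2_conv_all_nth)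
 next
  fix d es xss assume d: "d \<in> bv ` esimps (length ks) p"
   and es: "length es = length ?Es" "\<forall>i<length ?Es. es ! i \<in> bv ` esimps (ks ! i) p"
   and xss: "length xss = length ?Es"
    "\<forall>i<length ?Es. length (xss ! i) = length (map ?X ks ! i) \<and>
     (\<forall>k<length (map ?X ks ! i). xss ! i ! k \<in> cell p ` cells p)"
  obtain s where s: "d = bv s" "s \<in> esimps (length ks) p" using d by (rule imageE)
  obtain ts where ts: "length ts = length ks"
   "\<forall>i<length ks. ts ! i \<in> esimps (ks ! i) p \<and> es ! i = bv (ts ! i)"
   using basis_list[of es ks "%_. bv" "%i. esimps (ks ! i) p"] es by auto
  have et: "es = map (bv) ts" by (rule nth_equalityI) (use es(1) ts in simp_all)
  have x: "length (xss ! i) = ks ! i" "set (xss ! i) <= cell p ` cells p" if "i < length ks" for i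
   using xss that by (simp_all add: subset_code(1) all_set_conv_all_nth)
  have "\<forall>i<length ks. \<exists>ys. xss ! i = map (cell p) ys \<and> set ys <= cells p" using list_image[OF x(2)] by simp
  then obtain y where y: "!!i. i < length ks ==> xss ! i = map (cell p) (y i) \<and> set (y i) <= cells p" by metis
  define yss where "yss = map y [0..<length ks]"
  have yl: "length yss = length ks" by (simp add: yss_def)
  have yc: "set (yss ! i) <= cells p" "length (yss ! i) = ks ! i" if "i < length ks" for i
   using y[OF that] x(1)[OF that] that by (simp_all add: yss_def)
  have ks: "map length yss = ks" by (rule nth_equalityI) (use yl yc in simp_all)
  have xy: "xss = map (map (cell p)) yss"
   by (rule nth_equalityI) (use xss(1) yl in simp, use y xss(1) in "simp add: yss_def")
  have t1: "esimplices p ts ks" using ts by (simp add: list_all2_conv_all_nth)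
  have ycs: "set ys <= cells p" if "ys \<in> set yss" for ys using that yc(1) yl by (auto simp: in_set_conv_nth)
  have "mu_mod (sum_list ks) p (dcomp ks p d es) (concat xss) =
    cell p (mu_cell p (comp_simplex p ks s ts) (concat yss))"
   unfolding s(1) et xy compose_at_basis[OF s(2) t1] map_concat[symmetric]
  proof (rule mu_mod_cells[OF comp_simplex_closed[OF s(2) t1]])
   show "length (concat yss) = sum_list ks" using ks by (simp add: length_concat)
   show "set (concat yss) <= cells p" using ycs by auto
  qed
  also have "... = cell p (mu_cell p s (map (%i. mu_cell p (ts ! i) (yss ! i)) [0..<length yss]))"
   using mu_cell_assoc[of s yss p ts] s(2) ts yl yc(2) ycs unfolding ks by (simp add: list_all2_conv_all_nth)
  also have "... = mu_mod (length ks) p d (map (cell p) (map (%i. mu_cell p (ts ! i) (yss ! i)) [0..<length yss]))"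
   unfolding s(1)
  proof (rule mu_mod_cells[symmetric, OF s(2)])
   show "set (map (%i. mu_cell p (ts ! i) (yss ! i)) [0..<length yss]) <= cells p"
   proof -
    have "mu_cell p (ts ! i) (yss ! i) \<in> cells p" if "i < length ks" for i
     using mu_cell_closed[of "ts ! i" "yss ! i" p] ts(2) yc[OF that] that by simp
    then show ?thesis using yl by auto
   qed
  qed (simp add: yl)
  also have "map (cell p) (map (%i. mu_cell p (ts ! i) (yss ! i)) [0..<length yss]) =
    map (%i. mu_mod (ks ! i) p (es ! i) (xss ! i)) [0..<length ks]"
   unfolding map_map comp_def yl
  proof (rule map_cong[OF refl])
   fix i assume "i \<in> set [0..<length ks]"
   then have i: "i < length ks" by simp
   show "cell p (mu_cell p (ts ! i) (yss ! i)) = mu_mod (ks ! i) p (es ! i) (xss ! i)"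
    using mu_mod_cells[of "ts ! i" "ks ! i" p "yss ! i"] ts(2) yc[OF i] i yl unfolding xy by simp
  qed
  finally show "mu_mod (sum_list ks) p (dcomp ks p d es) (concat xss) =
    mu_mod (length ks) p d (map (%i. mu_mod (ks ! i) p (es ! i) (xss ! i)) [0..<length ?Es])" by simp
 qed (use D_module DMod_generates compose_at_bimulti mu_mod_bimulti coend_module coend_generates d es in auto)
 then show ?thesis by simp
qed

lemma coend_algebra: "operad_algebra R (DMod R) (coend R A S) (struct)"
proof (rule operad_algebra.intro[OF DMod_operad coend_simplicial], rule operad_algebra_axioms.intro)
 show "simplicial_map R (alg_dom R (DMod R) n (coend R A S)) (coend R A S) (struct n)" for n
  by (rule coend_struct_natural)
 show "struct 1 p (dom_pure 1 p (ounit (DMod R) p \<one>) [x]) = x"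
  if x: "x \<in> carrier (coend_lev p)" for x p
 proof -
  let ?u = "id_simplex p"
  have u: "bv ?u \<in> carrier (D_lev 1 p)" by (rule basis_in_lev[OF unit_simplex])
  have t: "[x] \<in> tuples (replicate 1 (coend_lev p))" if "x \<in> carrier (coend_lev p)" for x
   unfolding tuples_replicate using that by simp
  have h: "(%x. mu_mod 1 p (bv ?u) [x]) \<in> mhom (coend_lev p) (coend_lev p)"
   using multilin_slot[OF bimultiD(1)[OF mu_mod_bimulti u] t[OF x], of 0] by simp
  have "mu_mod 1 p (bv ?u) [x] = x"
  proof (rule mod_hom_eqI[OF coend_generates coend_module coend_module h mod_hom_id(2) _ x])
   fix y assume "y \<in> cell p ` cells p"
   then obtain c where c: "y = cell p c" "c \<in> cells p" by (rule imageE)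
   show "mu_mod 1 p (bv ?u) [y] = y"
    using mu_mod_cells[OF unit_simplex, of "[c]" p] c mu_cell_unit[OF c(2)] by simp
  qed
  then show ?thesis unfolding DMod_unit_one coend_struct_pure[OF u t[OF x]] .
 qed
 show "struct (sum_list ks) p
    (dom_pure (sum_list ks) p (dcomp ks p d es) (concat xss)) =
   struct (length ks) p (dom_pure (length ks) p d
    (map (%i. struct (ks ! i) p
     (dom_pure (ks ! i) p (es ! i) (xss ! i))) [0..<length ks]))"
  if d: "d \<in> carrier (D_lev (length ks) p)" and es: "es \<in> tuples (D_levs ks p)"
   and xss: "list_all2 (%k xs. xs \<in> tuples (replicate k (coend_lev p))) ks xss" for d ks p es xss
 proof -
  have c: "dcomp ks p d es \<in> carrier (D_lev (sum_list ks) p)"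
   by (rule multilin_closed[OF bimultiD(1)[OF compose_at_bimulti d] es])
  have x: "concat xss \<in> tuples (replicate (sum_list ks) (coend_lev p))"
   using tuples_concat[of xss "map (%k. replicate k (coend_lev p)) ks"] xss
   unfolding concat_replicates by (simp add: list_all2_map2 list_all2_conv_all_nth)
  have i: "es ! i \<in> carrier (D_lev (ks ! i) p)" "xss ! i \<in> tuples (replicate (ks ! i) (coend_lev p))" if "i < length ks" for i
   using es list_all2_nthD[OF xss that] that by (simp_all add: tuples_iff)
  have m: "map (%i. struct (ks ! i) p
     (dom_pure (ks ! i) p (es ! i) (xss ! i))) [0..<length ks] =
    map (%i. mu_mod (ks ! i) p (es ! i) (xss ! i)) [0..<length ks]"
   by (rule map_cong[OF refl]) (simp add: coend_struct_pure[OF i])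
  have mt: "map (%i. mu_mod (ks ! i) p (es ! i) (xss ! i)) [0..<length ks] \<in> tuples (replicate (length ks) (coend_lev p))"
   using multilin_closed[OF bimultiD(1)[OF mu_mod_bimulti i(1)] i(2)] by (auto simp: tuples_replicate)
  show ?thesis
   unfolding m coend_struct_pure[OF c x] coend_struct_pure[OF d mt] by (rule mu_mod_assoc[OF d es xss])
 qed
qed

end


section \<open>The two coends\<close>

lemma ds_auts_iff: "f \<in> ds_auts \<longleftrightarrow> f \<in> ds_mors \<and> dtgt f = dsrc f \<and> (\<exists>g\<in>ds_mors. dsrc g = dsrc f \<and>
  dtgt g = dsrc f \<and> g \<bullet> f = ds_id (dsrc f) \<and> f \<bullet> g = ds_id (dsrc f))"
 by (auto simp: ds_auts_def ds_hom_iff)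

lemma perm_auts:
 assumes "\<gamma> permutes {..<n}"
 shows "ds_perm n \<gamma> \<in> ds_auts"
 unfolding ds_auts_iff
 by (intro conjI bexI[of _ "ds_perm n (inv_into UNIV \<gamma>)"])
  (use assms permutes_inv[OF assms] permutes_inv_o[OF assms] in "simp_all add: ds_perm_mors perm_perm ds_id_def")

text \<open>Chosen inverses of the factors juxtapose to an inverse, by the interchange law and
  \<open>juxts_ids\<close>.\<close>

lemma juxts_auts:
 assumes fs: "set fs <= ds_auts"
 shows "ds_juxts fs \<in> ds_auts"
proof -
 have "\<forall>f\<in>set fs. \<exists>g. g \<in> ds_mors \<and> dsrc g = dsrc f \<and> dtgt g = dsrc f \<and> g \<bullet> f = ds_id (dsrc f) \<and> f \<bullet> g = ds_id (dsrc f)"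
  using fs unfolding ds_auts_iff[abs_def] subset_iff by blast
 then obtain h where h: "!!f. f \<in> set fs ==> h f \<in> ds_mors \<and> dsrc (h f) = dsrc f \<and> dtgt (h f) = dsrc f \<and>
   h f \<bullet> f = ds_id (dsrc f) \<and> f \<bullet> h f = ds_id (dsrc f)" by metis
 have f: "set fs <= ds_mors" "!!f. f \<in> set fs ==> dtgt f = dsrc f" using fs by (auto simp: ds_auts_iff)
 let ?gs = "map h fs"
 have g: "set ?gs <= ds_mors" "map dsrc ?gs = map dsrc fs" "map dtgt ?gs = map dsrc fs" "map dtgt fs = map dsrc fs"
  using h f(2) by auto
 have m: "map2 (\<bullet>) ?gs fs = map ds_id (map dsrc fs)" "map2 (\<bullet>) fs ?gs = map ds_id (map dsrc fs)"
  by (rule nth_equalityI; use h in simp)+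
 have e: "ds_juxts ?gs \<bullet> ds_juxts fs = ds_id (sum_list (map dsrc fs))"
  "ds_juxts fs \<bullet> ds_juxts ?gs = ds_id (sum_list (map dsrc fs))"
  unfolding juxts_comp[OF g(1) f(1) trans[OF g(2) g(4)[symmetric]]]
   juxts_comp[OF f(1) g(1) g(3)[symmetric]] m juxts_ids by (rule refl)+
 show ?thesis unfolding ds_auts_iff
 proof (intro conjI bexI[of _ "ds_juxts ?gs"])
  show "dtgt (ds_juxts fs) = dsrc (ds_juxts fs)" "dsrc (ds_juxts ?gs) = dsrc (ds_juxts fs)"
   "dtgt (ds_juxts ?gs) = dsrc (ds_juxts fs)"
   unfolding ds_juxts_src_tgt g(2-4) by (rule refl)+
  show "ds_juxts ?gs \<bullet> ds_juxts fs = ds_id (dsrc (ds_juxts fs))" "ds_juxts fs \<bullet> ds_juxts ?gs = ds_id (dsrc (ds_juxts fs))"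
   unfolding ds_juxts_src_tgt by (rule e)+
 qed (rule ds_juxts_mors[OF f(1)] ds_juxts_mors[OF g(1)])+
qed

lemma coend_over_auts:
 assumes "cring R" "assoc_algebra R A"
 shows "coend_over R A ds_auts"
proof (intro coend_over.intro coend_over_axioms.intro assms)
 show "ds_auts <= ds_mors" by (auto simp: ds_auts_iff)
qed (rule perm_auts juxts_auts, assumption)+

lemma coend_over_mors:
 assumes "cring R" "assoc_algebra R A"
 shows "coend_over R A ds_mors"
 by (intro coend_over.intro coend_over_axioms.intro assms) (rule subset_refl ds_perm_mors ds_juxts_mors; assumption?)+

text \<open>The relations by automorphisms are among all relations, so the identity of the direct
  sum induces a map of quotients, and each cell goes to the cell with the same index.\<close>

lemma Q_map_props:
 assumes "cring R" "assoc_algebra R A"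
 shows "Q_map R A p \<in> mod_hom R (lev (FA R A) p) (lev (CA R A) p)"
  and "c \<in> coend_over.cells A p ==>
   Q_map R A p (coend_over.cell R A ds_auts p c) = coend_over.cell R A ds_mors p c"
proof -
 interpret F: coend_over R A ds_auts by (rule coend_over_auts[OF assms])
 interpret C: coend_over R A ds_mors by (rule coend_over_mors[OF assms])
 have "coend_gens R A ds_auts p <= coend_gens R A ds_mors p" unfolding coend_gens_def using F.S_mors by blast
 then have i: "id x \<in> coend_rel R A ds_mors p" if "x \<in> coend_gens R A ds_auts p" for x
  using that F.span_superset[of "coend_gens R A ds_mors p"] unfolding coend_rel_span by auto
 note q = F.quot_map_span_hom[OF F.pre_module F.coend_gens_subset C.pre_module C.coend_rel_submodule F.mod_hom_id(1)]
 show "Q_map R A p \<in> mod_hom R (lev (FA R A) p) (lev (CA R A) p)"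
  unfolding Q_map_def FA_def CA_def F.coend_lev C.coend_lev coend_rel_span[of R A ds_auts] by (rule q(1)[OF i])
 show "Q_map R A p (F.cell p c) = C.cell p c" if c: "c \<in> F.cells p"
 proof -
  obtain n s vs where n: "c = (n, s, vs)" by (cases c)
  have "coend_pre R A p n (basis_vec R s) (pures R (replicate n A) vs) \<in> carrier (dsum (coend_summand R A p))"
   using c by (intro F.coend_pre_closed) (simp_all add: n F.cells_def F.Ftilde_lev F.basis_vec_closed F.pures_closed)
  from q(2)[OF i this] show ?thesis
   unfolding n F.cell_def C.cell_def prod.case class_pures_def coend_class_def Q_map_def coend_rel_span[of R A ds_auts] by simp
 qed
qed

theorem lemma18:
  fixes R :: "('k, 'r) ring_scheme" and A :: "('k, 'a) module"
  assumes "cring R" and "assoc_algebra R A"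
  shows
    "operad_algebra R (DMod R) (FA R A) (nu R A) \<and>
     (\<forall>n p. \<forall>i \<in> nu_index R A n p. nu R A n p (nu_gen R A n p i) = nu_value R A p i) \<and>
     (\<exists>\<nu>. operad_algebra R (DMod R) (CA R A) \<nu> \<and>
       (\<forall>n p. \<forall>z \<in> carrier (lev (alg_dom R (DMod R) n (FA R A)) p).
         \<nu> n p (alg_dom_map R (DMod R) n (CA R A) p (Q_map R A p) z) = Q_map R A p (nu R A n p z))) \<and>
     E_infinity_algebra TYPE(perm_simplex \<Rightarrow> 'k) R (CA R A)"
proof -
 interpret F: coend_over R A ds_auts by (rule coend_over_auts[OF assms])
 interpret C: coend_over R A ds_mors by (rule coend_over_mors[OF assms])
 have FA: "operad_algebra R (DMod R) (FA R A) (nu R A)" unfolding FA_def nu_eq by (rule F.coend_algebra)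
 \<comment> \<open>Records that the definite description behind \<open>nu\<close> is met by a linear
   map with the prescribed values.\<close>
 have val: "nu R A n p (nu_gen R A n p i) = nu_value R A p i" if "i \<in> nu_index R A n p" for n p i
  unfolding nu_eq nu_gen_eq nu_value_eq by (rule F.coend_struct_gen[OF that])
 have CA: "operad_algebra R (DMod R) (CA R A) (coend_struct R A ds_mors)"
  unfolding CA_def by (rule C.coend_algebra)
 have compat: "coend_struct R A ds_mors n p (alg_dom_map R (DMod R) n (CA R A) p (Q_map R A p) z) = Q_map R A p (nu R A n p z)"
  if z: "z \<in> carrier (lev (alg_dom R (DMod R) n (FA R A)) p)" for n p z
 proof -
  note Q = Q_map_props[OF assms, where p=p, unfolded FA_def CA_def]
  note am = F.O.alg_dom_map_props[OF F.coend_simplicial C.coend_simplicial Q(1), where n=n]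
  \<comment> \<open>Both coends have the same indices of cells. On generators each side is therefore
    the class in CA of the single index \<open>mu_cell p s ys\<close>.\<close>
  have "coend_struct R A ds_mors n p (alg_dom_map R (DMod R) n (coend R A ds_mors) p (Q_map R A p) z) =
    Q_map R A p (coend_struct R A ds_auts n p z)"
  proof (rule F.alg_dom_eqI[OF C.coend_module F.hom_compose[OF am(1) C.coend_struct_hom]
     F.hom_compose[OF F.coend_struct_hom Q(1)] _ z[unfolded FA_def]])
   fix s and ys :: "(nat \<times> under_simplex \<times> 'a list) list"
   assume s: "s \<in> esimps n p" and ys: "length ys = n" "set ys <= F.cells p"
   have m: "map (Q_map R A p) (map (F.cell p) ys) = map (C.cell p) ys"
    unfolding map_map by (rule map_cong[OF refl]) (use Q(2) ys(2) in auto)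
   show "coend_struct R A ds_mors n p (alg_dom_map R (DMod R) n (coend R A ds_mors) p (Q_map R A p)
      (alg_pure R (DMod R) n (coend R A ds_auts) p (basis_vec R s) (map (F.cell p) ys))) =
     Q_map R A p (coend_struct R A ds_auts n p
      (alg_pure R (DMod R) n (coend R A ds_auts) p (basis_vec R s) (map (F.cell p) ys)))"
    unfolding am(2)[OF F.basis_in_lev[OF s] F.cells_tuples[OF ys]] m F.coend_struct_cells[OF s ys] C.coend_struct_cells[OF s ys]
    using Q(2)[OF F.mu_cell_closed] s ys by simp
  qed
  then show ?thesis unfolding CA_def nu_eq .
 qed
 have "E_infinity_algebra TYPE(perm_simplex => 'k) R (CA R A)"
  unfolding E_infinity_algebra_def using F.DMod_E_infinity CA by blast
 then show ?thesis using FA val CA compat by blast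
qed

end
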